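(* (1) Let $\Gamma=(V,E)$ be a directed graph (that is, $V$ is a finite set and $E\subseteq V\times V$) and define $s(v,w):=\{v\}$, $r(v,w):=\{w\}$ for all $(v,w)\in E$. Then $\Gamma$ is a hypergraph with $\mathrm{Aut}^+(\Gamma)=\mathrm{Aut}^+_{\mathrm{Bic}}(\Gamma)$. (2) Let $\Gamma=(V,E)$ be a simple graph (that is, $V$ is a finite set and $E\subseteq\mathcal P(V)$ with $|e|=2$ for all $e\in E$) and define $s(\{v,w\}):=\{v,w\}$, $r(\{v,w\}):=\{v,w\}$ for all $\{v,w\}\in E$. Then $\Gamma$ is a hypergraph with $\mathrm{Aut}^+(\Gamma)=\mathrm{Aut}^+_{\mathrm{Bic}}(\Gamma)$. (3) Let $\Gamma=(V,E)$ be a multigraph without isolated vertices with source map $s':E\to V$ and range map $r':E\to V$ ($V,E$ finite sets). Define $s(e):=\{s'(e)\}$, $r(e):=\{r'(e)\}$ for all $e\in E$. Then $\Gamma$ is a hypergraph with $\mathrm{Aut}^+(\Gamma)=\mathrm{Aut}^+_{\mathrm{GH},\mathrm{Bic}}(\Gamma)$.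
   Context: A (directed) hypergraph $\Gamma=(V,E)$ consists of a finite vertex set $V$, a finite edge set $E$ and maps $s,r:E\to\mathcal P(V)$ (power set). Its incidence matrices $A_s,A_r\in\mathbb C^{V\times E}$ are given by $(A_s)_{ve}=1$ if $v\in s(e)$ and $0$ otherwise, and $(A_r)_{ve}=1$ if $v\in r(e)$ and $0$ otherwise. For a finite set $X$ and a unital $C^*$-algebra $\mathcal A$, a matrix $u=(u_{ij})\in\mathcal A\otimes\mathbb C^{X\times X}$ is a magic unitary if $u_{ij}^2=u_{ij}^*=u_{ij}$ for all $i,j\in X$ and $\sum_{j\in X}u_{ij}=\sum_{j\in X}u_{ji}=1$ for all $i\in X$. A compact matrix quantum group $G=(\mathcal A,u)$ consists of a unital $C^*$-algebra $\mathcal A=:C(G)$ and a matrix $u=(u_{ij})_{i,j\in I}$ over $\mathcal A$ ($I$ a finite set) such that $\mathcal A$ is generated by the $u_{ij}$, $u$ is unitary and $(u_{ij}^* )_{i,j}$ is invertible, and there is a unital $*$-homomorphism $\Delta:\mathcal A\to\mathcal A\otimes\mathcal A$ (minimal tensor product) with $\Delta(u_{ij})=\sum_{k\in I} u_{ik}\otimes u_{kj}$. For compact matrix quantum groups $G,H$ (possibly with fundamental representations of different sizes), $G=H$ means that there is a bijective unital $*$-homomorphism $\varphi:C(G)\to C(H)$ with $(\varphi\otimes\varphi)\circ\Delta_G=\Delta_H\circ\varphi$. Quantum automorphism group of a hypergraph: $\mathrm{Aut}^+(\Gamma)=(\mathcal A,u_V\oplus u_E)$, where $\mathcal A$ is the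 universal unital $C^*$-algebra with generators $u_{vw}$ ($v,w\in V$) and $u_{ef}$ ($e,f\in E$) subject to: $u_V=(u_{vw})_{v,w\in V}$ and $u_E=(u_{ef})_{e,f\in E}$ are magic unitaries, $A_su_E=u_VA_s$ and $A_ru_E=u_VA_r$. Bichon's quantum automorphism group: for a simple (resp. directed) graph write $v\sim w$ if $\{v,w\}\in E$ (resp. $(v,w)\in E$), and let $A_\Gamma\in\mathbb C^{V\times V}$ be the adjacency matrix, $(A_\Gamma)_{vw}=1$ if $v\sim w$ and $0$ otherwise. $\mathrm{Aut}^+_{\mathrm{Bic}}(\Gamma)=(\mathcal A,u)$, where $\mathcal A$ is the universal unital $C^*$-algebra with generators $u_{vw}$ ($v,w\in V$) such that $u=(u_{vw})$ is a magic unitary, $A_\Gamma u=uA_\Gamma$, and $u_{ik}u_{j\ell}=u_{j\ell}u_{ik}$ whenever $i\sim j$ and $k\sim\ell$. Multigraphs: in a multigraph with source and range maps $s',r':E\to V$, a vertex $v$ is a source if $v\ne r'(e)$ for all $e\in E$, a sink if $v\neq s'(e)$ for all $e\in E$, and isolated if it is both a source and a sink. Goswami–Hossain quantum automorphism group in Bichon's sense, for a multigraph without isolated vertices: $\mathrm{Aut}^+_{\mathrm{GH},\mathrm{Bic}}(\Gamma)=(\mathcal A,u)$, where $\mathcal A$ is the universal unital $C^*$-algebra with generators $u_{ef}$ ($e,f\in E$) and relations: (i) $u=(u_{ef})_{e,f\in E}$ is a magic unitary; (ii) for all $v\in V$ and $e_1,e_2\in E$: $\sum_{f:\,s'(f)=v}u_{e_1f}=\sum_{f:\,s'(f)=v}u_{e_2f}$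 if $s'(e_1)=s'(e_2)$, and $\sum_{f:\,r'(f)=v}u_{e_1f}=\sum_{f:\,r'(f)=v}u_{e_2f}$ if $r'(e_1)=r'(e_2)$; (iii) for $e,f\in E$: $u_{ef}=0$ if $s'(e)$ is neither a source nor a sink and $s'(f)$ is a source, and also $u_{ef}=0$ if $r'(e)$ is neither a source nor a sink and $r'(f)$ is a sink; (iv) if $v\in V$ is neither a source nor a sink and $e_1,e_2\in E$ are such that $s'(e_1)=r'(e_2)$ is neither a source nor a sink, then $\sum_{f:\,s'(f)=v}u_{e_1f}=\sum_{f:\,r'(f)=v}u_{e_2f}$. *)

theory Defs
  imports Complex_Main "HOL-Library.Poly_Mapping" "HOL-Algebra.Module"
begin

section \<open>Unital C*-algebras\<close>

definition complex_ring :: "complex ring" where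
  "complex_ring = \<lparr>carrier = UNIV, monoid.mult = (*), one = 1, ring.zero = 0, add = (+)\<rparr>"

record 'a star_algebra = "(complex, 'a) module" +
  star :: "'a \<Rightarrow> 'a"

record 'a cstar_algebra = "'a star_algebra" +
  nrm :: "'a \<Rightarrow> real"

locale star_algebra = ring A + Module.module complex_ring A
  for A :: "('a, 'm) star_algebra_scheme" (structure) +
  assumes smult_mult_left:
      "\<lbrakk>x \<in> carrier A; y \<in> carrier A\<rbrakk> \<Longrightarrow> (c \<odot> x) \<otimes> y = c \<odot> (x \<otimes> y)"
    and smult_mult_right:
      "\<lbrakk>x \<in> carrier A; y \<in> carrier A\<rbrakk> \<Longrightarrow> x \<otimes> (c \<odot> y) = c \<odot> (x \<otimes> y)"
    and star_closed: "x \<in> carrier A \<Longrightarrow> star A x \<in> carrier A"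
    and star_star: "x \<in> carrier A \<Longrightarrow> star A (star A x) = x"
    and star_add:
      "\<lbrakk>x \<in> carrier A; y \<in> carrier A\<rbrakk> \<Longrightarrow> star A (x \<oplus> y) = star A x \<oplus> star A y"
    and star_smult: "x \<in> carrier A \<Longrightarrow> star A (c \<odot> x) = cnj c \<odot> star A x"
    and star_mult:
      "\<lbrakk>x \<in> carrier A; y \<in> carrier A\<rbrakk> \<Longrightarrow> star A (x \<otimes> y) = star A y \<otimes> star A x"

definition cstar_seminorm :: "('a, 'm) star_algebra_scheme \<Rightarrow> ('a \<Rightarrow> real) \<Rightarrow> bool" where
  "cstar_seminorm A p \<longleftrightarrow>
    (\<forall>x \<in> carrier A. 0 \<le> p x) \<and>
    (\<forall>x \<in> carrier A. \<forall>y \<in> carrier A. p (x \<oplus>\<^bsub>A\<^esub> y) \<le> p x + p y) \<and>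
    (\<forall>c. \<forall>x \<in> carrier A. p (c \<odot>\<^bsub>A\<^esub> x) = cmod c * p x) \<and>
    (\<forall>x \<in> carrier A. \<forall>y \<in> carrier A. p (x \<otimes>\<^bsub>A\<^esub> y) \<le> p x * p y) \<and>
    (\<forall>x \<in> carrier A. p (star A x \<otimes>\<^bsub>A\<^esub> x) = (p x)\<^sup>2)"

definition cauchy_seqs :: "('a, 'm) star_algebra_scheme \<Rightarrow> ('a \<Rightarrow> real) \<Rightarrow> (nat \<Rightarrow> 'a) set" where
  "cauchy_seqs A p = {X. (\<forall>n. X n \<in> carrier A) \<and>
    (\<forall>\<epsilon>>0. \<exists>N. \<forall>m\<ge>N. \<forall>n\<ge>N. p (X m \<ominus>\<^bsub>A\<^esub> X n) < \<epsilon>)}"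

definition tends_to ::
    "('a, 'm) star_algebra_scheme \<Rightarrow> ('a \<Rightarrow> real) \<Rightarrow> (nat \<Rightarrow> 'a) \<Rightarrow> 'a \<Rightarrow> bool" where
  "tends_to A p X x \<longleftrightarrow> (\<lambda>n. p (X n \<ominus>\<^bsub>A\<^esub> x)) \<longlonglongrightarrow> 0"

locale unital_cstar_algebra = star_algebra A
  for A :: "('a, 'm) cstar_algebra_scheme" (structure) +
  assumes cstar_norm: "cstar_seminorm A (nrm A)"
    and nrm_eq_0: "\<lbrakk>x \<in> carrier A; nrm A x = 0\<rbrakk> \<Longrightarrow> x = \<zero>"
    and complete: "X \<in> cauchy_seqs A (nrm A) \<Longrightarrow> \<exists>x \<in> carrier A. tends_to A (nrm A) X x"

definition star_hom ::
    "('a, 'm) star_algebra_scheme \<Rightarrow> ('b, 'n) star_algebra_scheme \<Rightarrow> ('a \<Rightarrow> 'b) \<Rightarrow> bool" where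
  "star_hom A B \<phi> \<longleftrightarrow> \<phi> \<in> ring_hom A B \<and>
    (\<forall>c. \<forall>x \<in> carrier A. \<phi> (c \<odot>\<^bsub>A\<^esub> x) = c \<odot>\<^bsub>B\<^esub> \<phi> x) \<and>
    (\<forall>x \<in> carrier A. \<phi> (star A x) = star B (\<phi> x))"

definition cstar_subalgebra :: "'a set \<Rightarrow> ('a, 'm) cstar_algebra_scheme \<Rightarrow> bool" where
  "cstar_subalgebra S A \<longleftrightarrow> S \<subseteq> carrier A \<and> \<one>\<^bsub>A\<^esub> \<in> S \<and>
    (\<forall>x \<in> S. \<forall>y \<in> S. x \<oplus>\<^bsub>A\<^esub> y \<in> S) \<and>
    (\<forall>x \<in> S. \<forall>y \<in> S. x \<otimes>\<^bsub>A\<^esub> y \<in> S) \<and>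
    (\<forall>c. \<forall>x \<in> S. c \<odot>\<^bsub>A\<^esub> x \<in> S) \<and>
    (\<forall>x \<in> S. star A x \<in> S) \<and>
    (\<forall>X. \<forall>x \<in> carrier A. (\<forall>n. X n \<in> S) \<longrightarrow> tends_to A (nrm A) X x \<longrightarrow> x \<in> S)"


section \<open>Hausdorff completion with respect to a C*-seminorm\<close>

text \<open>Elements are the classes of Cauchy sequences modulo null sequences. The operations are
  unions over representatives; each union is over equal sets when the operation is well defined
  on classes.\<close>

definition cauchy_class ::
    "('a, 'm) star_algebra_scheme \<Rightarrow> ('a \<Rightarrow> real) \<Rightarrow> (nat \<Rightarrow> 'a) \<Rightarrow> (nat \<Rightarrow> 'a) set" where
  "cauchy_class A p X = {Y \<in> cauchy_seqs A p. (\<lambda>n. p (X n \<ominus>\<^bsub>A\<^esub> Y n)) \<longlonglongrightarrow> 0}"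

definition completion ::
    "('a, 'm) star_algebra_scheme \<Rightarrow> ('a \<Rightarrow> real) \<Rightarrow> (nat \<Rightarrow> 'a) set cstar_algebra" where
  "completion A p =
    \<lparr>carrier = cauchy_class A p ` cauchy_seqs A p,
     monoid.mult = (\<lambda>P Q. \<Union>X \<in> P. \<Union>Y \<in> Q. cauchy_class A p (\<lambda>n. X n \<otimes>\<^bsub>A\<^esub> Y n)),
     one = cauchy_class A p (\<lambda>n. \<one>\<^bsub>A\<^esub>),
     ring.zero = cauchy_class A p (\<lambda>n. \<zero>\<^bsub>A\<^esub>),
     add = (\<lambda>P Q. \<Union>X \<in> P. \<Union>Y \<in> Q. cauchy_class A p (\<lambda>n. X n \<oplus>\<^bsub>A\<^esub> Y n)),
     smult = (\<lambda>c P. \<Union>X \<in> P. cauchy_class A p (\<lambda>n. c \<odot>\<^bsub>A\<^esub> X n)),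
     star = (\<lambda>P. \<Union>X \<in> P. cauchy_class A p (\<lambda>n. star A (X n))),
     nrm = (\<lambda>P. THE l. \<forall>X \<in> P. (\<lambda>n. p (X n)) \<longlonglongrightarrow> l)\<rparr>"

definition embed ::
    "('a, 'm) star_algebra_scheme \<Rightarrow> ('a \<Rightarrow> real) \<Rightarrow> 'a \<Rightarrow> (nat \<Rightarrow> 'a) set" where
  "embed A p a = cauchy_class A p (\<lambda>n. a)"


section \<open>Universal unital C*-algebras\<close>

text \<open>The free unital *-algebra on a set of generators is the monoid algebra of the free monoid
  on the letters \<open>x\<close>, \<open>x*\<close>. The monoid is written additively because the convolution product on
  \<^typ>\<open>'a \<Rightarrow>\<^sub>0 complex\<close> expects an additive (not necessarily commutative) monoid of exponents.\<close>

datatype 'x letter = Gen 'x | Adj 'x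

datatype 'x gen_word = Word (letters: "'x letter list")

instantiation gen_word :: (type) monoid_add
begin

definition "0 = Word []"

definition "v + w = Word (letters v @ letters w)"

instance
  by standard (auto simp: zero_gen_word_def plus_gen_word_def)

end

type_synonym 'x free_algebra = "'x gen_word \<Rightarrow>\<^sub>0 complex"

fun letter_star :: "'x letter \<Rightarrow> 'x letter" where
  "letter_star (Gen x) = Adj x"
| "letter_star (Adj x) = Gen x"

definition word_star :: "'x gen_word \<Rightarrow> 'x gen_word" where
  "word_star w = Word (rev (map letter_star (letters w)))"

definition conj_linear_ext :: "('m \<Rightarrow> 'm) \<Rightarrow> ('m \<Rightarrow>\<^sub>0 complex) \<Rightarrow> ('m \<Rightarrow>\<^sub>0 complex)" where
  "conj_linear_ext \<sigma> f =
    (\<Sum>w \<in> Poly_Mapping.keys f. Poly_Mapping.single (\<sigma> w) (cnj (Poly_Mapping.lookup f w)))"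

abbreviation scale :: "complex \<Rightarrow> ('m \<Rightarrow>\<^sub>0 complex) \<Rightarrow> ('m \<Rightarrow>\<^sub>0 complex)" where
  "scale c \<equiv> Poly_Mapping.map ((*) c)"

abbreviation free_star :: "'x free_algebra \<Rightarrow> 'x free_algebra" where
  "free_star \<equiv> conj_linear_ext word_star"

definition gen :: "'x \<Rightarrow> 'x free_algebra" where
  "gen x = Poly_Mapping.single (Word [Gen x]) 1"

definition free_star_algebra :: "'x set \<Rightarrow> 'x free_algebra star_algebra" where
  "free_star_algebra X =
    \<lparr>carrier = {f. \<forall>w \<in> Poly_Mapping.keys f. set_gen_word w \<subseteq> X},
     monoid.mult = (*), one = 1, ring.zero = 0, add = (+), smult = scale, star = free_star\<rparr>"

text \<open>A relation is an element of the free algebra that is required to vanish. The universal norm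
  is the supremum over all C*-seminorms (equivalently, over all representations in unital
  C*-algebras) in which the relations hold; it is finite as soon as the relations bound every
  generator, e.g. when they force the generators to be projections.\<close>

definition universal_norm :: "'x set \<Rightarrow> 'x free_algebra set \<Rightarrow> 'x free_algebra \<Rightarrow> real" where
  "universal_norm X R f =
    Sup {p f | p. cstar_seminorm (free_star_algebra X) p \<and> (\<forall>r \<in> R. p r = 0)}"

definition universal_cstar ::
    "'x set \<Rightarrow> 'x free_algebra set \<Rightarrow> (nat \<Rightarrow> 'x free_algebra) set cstar_algebra" where
  "universal_cstar X R = completion (free_star_algebra X) (universal_norm X R)"


section \<open>The minimal tensor product\<close>

text \<open>Formal sums of pairs \<open>(a, b)\<close>, with \<open>(a, b) (a', b') = (a a', b b')\<close> and
  \<open>(a, b)* = (a*, b*)\<close>. The bilinearity relations are null vectors of the spatial seminorm below,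
  so the algebraic tensor product is obtained when passing to the Hausdorff completion.\<close>

definition formal_tensors ::
    "('a, 'm) star_algebra_scheme \<Rightarrow> ('b, 'n) star_algebra_scheme \<Rightarrow>
      ('a \<times> 'b \<Rightarrow>\<^sub>0 complex) star_algebra" where
  "formal_tensors A B =
    \<lparr>carrier = {f. Poly_Mapping.keys f \<subseteq> carrier A \<times> carrier B},
     monoid.mult = (\<lambda>f g. \<Sum>(a, b) \<in> Poly_Mapping.keys f. \<Sum>(a', b') \<in> Poly_Mapping.keys g.
       Poly_Mapping.single (a \<otimes>\<^bsub>A\<^esub> a', b \<otimes>\<^bsub>B\<^esub> b')
         (Poly_Mapping.lookup f (a, b) * Poly_Mapping.lookup g (a', b'))),
     one = Poly_Mapping.single (\<one>\<^bsub>A\<^esub>, \<one>\<^bsub>B\<^esub>) 1, ring.zero = 0, add = (+), smult = scale,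
     star = conj_linear_ext (\<lambda>(a, b). (star A a, star B b))\<rparr>"

text \<open>States: positive linear functionals of norm one (on a unital algebra the norm is attained
  at the unit).\<close>

definition state :: "('a, 'm) cstar_algebra_scheme \<Rightarrow> ('a \<Rightarrow> complex) \<Rightarrow> bool" where
  "state A \<phi> \<longleftrightarrow>
    (\<forall>x \<in> carrier A. \<forall>y \<in> carrier A. \<phi> (x \<oplus>\<^bsub>A\<^esub> y) = \<phi> x + \<phi> y) \<and>
    (\<forall>c. \<forall>x \<in> carrier A. \<phi> (c \<odot>\<^bsub>A\<^esub> x) = c * \<phi> x) \<and>
    (\<forall>x \<in> carrier A. \<phi> (star A x \<otimes>\<^bsub>A\<^esub> x) \<in> \<real> \<and> 0 \<le> Re (\<phi> (star A x \<otimes>\<^bsub>A\<^esub> x))) \<and>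
    (\<forall>x \<in> carrier A. cmod (\<phi> x) \<le> nrm A x) \<and>
    \<phi> \<one>\<^bsub>A\<^esub> = 1"

definition product_functional ::
    "('a \<Rightarrow> complex) \<Rightarrow> ('b \<Rightarrow> complex) \<Rightarrow> ('a \<times> 'b \<Rightarrow>\<^sub>0 complex) \<Rightarrow> complex" where
  "product_functional \<phi> \<psi> f =
    (\<Sum>(a, b) \<in> Poly_Mapping.keys f. Poly_Mapping.lookup f (a, b) * \<phi> a * \<psi> b)"

text \<open>The inner product \<open>\<langle>(\<pi>\<^sub>\<phi> \<otimes> \<pi>\<^sub>\<psi>)(y) \<xi>, (\<pi>\<^sub>\<phi> \<otimes> \<pi>\<^sub>\<psi>)(z) \<xi>\<rangle>\<close> (linear in the first argument), where
  \<open>\<pi>\<^sub>\<phi>\<close>, \<open>\<pi>\<^sub>\<psi>\<close> are the GNS representations of the states \<open>\<phi>\<close>, \<open>\<psi>\<close> and \<open>\<xi> = \<xi>\<^sub>\<phi> \<otimes> \<xi>\<^sub>\<psi>\<close> is the tensor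
  product of their cyclic vectors.\<close>

definition gns_inner ::
    "('a, 'm) cstar_algebra_scheme \<Rightarrow> ('b, 'n) cstar_algebra_scheme \<Rightarrow>
      ('a \<Rightarrow> complex) \<Rightarrow> ('b \<Rightarrow> complex) \<Rightarrow>
      ('a \<times> 'b \<Rightarrow>\<^sub>0 complex) \<Rightarrow> ('a \<times> 'b \<Rightarrow>\<^sub>0 complex) \<Rightarrow> complex" where
  "gns_inner A B \<phi> \<psi> y z = product_functional \<phi> \<psi>
    (star (formal_tensors A B) z \<otimes>\<^bsub>formal_tensors A B\<^esub> y)"

text \<open>The spatial norm \<open>\<parallel>(\<pi>\<^sub>A \<otimes> \<pi>\<^sub>B)(x)\<parallel>\<close> for the universal representations \<open>\<pi>\<^sub>A\<close>, \<open>\<pi>\<^sub>B\<close>, which are the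
  direct sums of the GNS representations over all states. It is thus the supremum over all pairs of
  states of the operator norms of \<open>(\<pi>\<^sub>\<phi> \<otimes> \<pi>\<^sub>\<psi>)(x)\<close>, and the vectors \<open>(\<pi>\<^sub>\<phi> \<otimes> \<pi>\<^sub>\<psi>)(y) \<xi>\<close> are dense. The
  inserted \<open>0\<close> only matters when one of the algebras is zero and hence has no states.\<close>

definition spatial_norm ::
    "('a, 'm) cstar_algebra_scheme \<Rightarrow> ('b, 'n) cstar_algebra_scheme \<Rightarrow>
      ('a \<times> 'b \<Rightarrow>\<^sub>0 complex) \<Rightarrow> real" where
  "spatial_norm A B x = Sup (insert 0
    {sqrt (Re (gns_inner A B \<phi> \<psi> (x \<otimes>\<^bsub>formal_tensors A B\<^esub> y) (x \<otimes>\<^bsub>formal_tensors A B\<^esub> y))) | \<phi> \<psi> y.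
      state A \<phi> \<and> state B \<psi> \<and> y \<in> carrier (formal_tensors A B) \<and> gns_inner A B \<phi> \<psi> y y = 1})"

definition min_tensor ::
    "('a, 'm) cstar_algebra_scheme \<Rightarrow> ('b, 'n) cstar_algebra_scheme \<Rightarrow>
      (nat \<Rightarrow> ('a \<times> 'b \<Rightarrow>\<^sub>0 complex)) set cstar_algebra" where
  "min_tensor A B = completion (formal_tensors A B) (spatial_norm A B)"

definition elem_tensor ::
    "('a, 'm) cstar_algebra_scheme \<Rightarrow> ('b, 'n) cstar_algebra_scheme \<Rightarrow> 'a \<Rightarrow> 'b \<Rightarrow>
      (nat \<Rightarrow> ('a \<times> 'b \<Rightarrow>\<^sub>0 complex)) set" where
  "elem_tensor A B a b =
    embed (formal_tensors A B) (spatial_norm A B) (Poly_Mapping.single (a, b) 1)"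


section \<open>Compact matrix quantum groups\<close>

record ('i, 'a) matrix_quantum_group =
  algebra :: "'a cstar_algebra"
  index :: "'i set"
  fund :: "'i \<Rightarrow> 'i \<Rightarrow> 'a"

definition delta :: "('a, 'm) ring_scheme \<Rightarrow> 'i \<Rightarrow> 'i \<Rightarrow> 'a" where
  "delta A i j = (if i = j then \<one>\<^bsub>A\<^esub> else \<zero>\<^bsub>A\<^esub>)"

definition inverse_matrices ::
    "('a, 'm) ring_scheme \<Rightarrow> 'i set \<Rightarrow> ('i \<Rightarrow> 'i \<Rightarrow> 'a) \<Rightarrow> ('i \<Rightarrow> 'i \<Rightarrow> 'a) \<Rightarrow> bool" where
  "inverse_matrices A I u w \<longleftrightarrow>
    (\<forall>i \<in> I. \<forall>j \<in> I. (\<Oplus>\<^bsub>A\<^esub>k\<in>I. u i k \<otimes>\<^bsub>A\<^esub> w k j) = delta A i j \<and>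
                   (\<Oplus>\<^bsub>A\<^esub>k\<in>I. w i k \<otimes>\<^bsub>A\<^esub> u k j) = delta A i j)"

definition comultiplication ::
    "('i, 'a) matrix_quantum_group \<Rightarrow> ('a \<Rightarrow> (nat \<Rightarrow> ('a \<times> 'a \<Rightarrow>\<^sub>0 complex)) set) \<Rightarrow> bool" where
  "comultiplication G \<Delta> \<longleftrightarrow>
    star_hom (algebra G) (min_tensor (algebra G) (algebra G)) \<Delta> \<and>
    (\<forall>i \<in> index G. \<forall>j \<in> index G.
      \<Delta> (fund G i j) = (\<Oplus>\<^bsub>min_tensor (algebra G) (algebra G)\<^esub>k\<in>index G.
        elem_tensor (algebra G) (algebra G) (fund G i k) (fund G k j)))"

definition compact_matrix_quantum_group :: "('i, 'a) matrix_quantum_group \<Rightarrow> bool" where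
  "compact_matrix_quantum_group G \<longleftrightarrow>
    unital_cstar_algebra (algebra G) \<and> finite (index G) \<and>
    (\<forall>i \<in> index G. \<forall>j \<in> index G. fund G i j \<in> carrier (algebra G)) \<and>
    (\<forall>S. cstar_subalgebra S (algebra G) \<and> (\<forall>i \<in> index G. \<forall>j \<in> index G. fund G i j \<in> S)
      \<longrightarrow> S = carrier (algebra G)) \<and>
    inverse_matrices (algebra G) (index G) (fund G) (\<lambda>i j. star (algebra G) (fund G j i)) \<and>
    (\<exists>w. (\<forall>i \<in> index G. \<forall>j \<in> index G. w i j \<in> carrier (algebra G)) \<and>
      inverse_matrices (algebra G) (index G) (\<lambda>i j. star (algebra G) (fund G i j)) w) \<and>
    (\<exists>\<Delta>. comultiplication G \<Delta>)"

definition tensor_hom ::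
    "('a, 'm) cstar_algebra_scheme \<Rightarrow> ('b, 'n) cstar_algebra_scheme \<Rightarrow> ('a \<Rightarrow> 'b) \<Rightarrow>
      ((nat \<Rightarrow> ('a \<times> 'a \<Rightarrow>\<^sub>0 complex)) set \<Rightarrow> (nat \<Rightarrow> ('b \<times> 'b \<Rightarrow>\<^sub>0 complex)) set) \<Rightarrow> bool" where
  "tensor_hom A B \<phi> \<theta> \<longleftrightarrow> star_hom (min_tensor A A) (min_tensor B B) \<theta> \<and>
    (\<forall>a \<in> carrier A. \<forall>b \<in> carrier A.
      \<theta> (elem_tensor A A a b) = elem_tensor B B (\<phi> a) (\<phi> b))"

text \<open>Comultiplications are unique on the carrier because the matrix entries generate the algebra,
  and \<open>\<theta> = \<phi> \<otimes> \<phi>\<close> is unique on the carrier because *-homomorphisms of C*-algebras are continuous.\<close>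

definition quantum_group_eq ::
    "('i, 'a) matrix_quantum_group \<Rightarrow> ('j, 'b) matrix_quantum_group \<Rightarrow> bool" where
  "quantum_group_eq G H \<longleftrightarrow>
    compact_matrix_quantum_group G \<and> compact_matrix_quantum_group H \<and>
    (\<exists>\<Delta>\<^sub>G \<Delta>\<^sub>H \<phi> \<theta>. comultiplication G \<Delta>\<^sub>G \<and> comultiplication H \<Delta>\<^sub>H \<and>
      star_hom (algebra G) (algebra H) \<phi> \<and>
      bij_betw \<phi> (carrier (algebra G)) (carrier (algebra H)) \<and>
      tensor_hom (algebra G) (algebra H) \<phi> \<theta> \<and>
      (\<forall>a \<in> carrier (algebra G). \<theta> (\<Delta>\<^sub>G a) = \<Delta>\<^sub>H (\<phi> a)))"

definition universal_quantum_group ::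
    "'x set \<Rightarrow> 'x free_algebra set \<Rightarrow> 'i set \<Rightarrow> ('i \<Rightarrow> 'i \<Rightarrow> 'x free_algebra) \<Rightarrow>
      ('i, (nat \<Rightarrow> 'x free_algebra) set) matrix_quantum_group" where
  "universal_quantum_group X R I u =
    \<lparr>algebra = universal_cstar X R, index = I,
     fund = (\<lambda>i j. embed (free_star_algebra X) (universal_norm X R) (u i j))\<rparr>"


section \<open>Relations\<close>

definition magic_unitary_relations ::
    "'i set \<Rightarrow> ('i \<Rightarrow> 'i \<Rightarrow> 'x free_algebra) \<Rightarrow> 'x free_algebra set" where
  "magic_unitary_relations I u =
    {u i j * u i j - u i j | i j. i \<in> I \<and> j \<in> I} \<union>
    {free_star (u i j) - u i j | i j. i \<in> I \<and> j \<in> I} \<union>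
    {(\<Sum>j\<in>I. u i j) - 1 | i. i \<in> I} \<union>
    {(\<Sum>j\<in>I. u j i) - 1 | i. i \<in> I}"

text \<open>The entries of \<open>M w - u M\<close> for a scalar matrix \<open>M\<close> with rows \<open>I\<close> and columns \<open>J\<close>.\<close>

definition intertwiner_relations ::
    "'i set \<Rightarrow> 'j set \<Rightarrow> ('i \<Rightarrow> 'j \<Rightarrow> complex) \<Rightarrow> ('i \<Rightarrow> 'i \<Rightarrow> 'x free_algebra) \<Rightarrow>
      ('j \<Rightarrow> 'j \<Rightarrow> 'x free_algebra) \<Rightarrow> 'x free_algebra set" where
  "intertwiner_relations I J M u w =
    {(\<Sum>k\<in>J. scale (M i k) (w k j)) - (\<Sum>k\<in>I. scale (M k j) (u i k)) | i j. i \<in> I \<and> j \<in> J}"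

definition block_sum ::
    "('i \<Rightarrow> 'i \<Rightarrow> 'x free_algebra) \<Rightarrow> ('j \<Rightarrow> 'j \<Rightarrow> 'x free_algebra) \<Rightarrow>
      'i + 'j \<Rightarrow> 'i + 'j \<Rightarrow> 'x free_algebra" where
  "block_sum u w p q = (case (p, q) of
      (Inl i, Inl k) \<Rightarrow> u i k
    | (Inr j, Inr l) \<Rightarrow> w j l
    | _ \<Rightarrow> 0)"


section \<open>Quantum automorphism groups\<close>

definition hypergraph :: "'v set \<Rightarrow> 'e set \<Rightarrow> ('e \<Rightarrow> 'v set) \<Rightarrow> ('e \<Rightarrow> 'v set) \<Rightarrow> bool" where
  "hypergraph V E s r \<longleftrightarrow> finite V \<and> finite E \<and> s \<in> E \<rightarrow> Pow V \<and> r \<in> E \<rightarrow> Pow V"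

definition incidence :: "('e \<Rightarrow> 'v set) \<Rightarrow> 'v \<Rightarrow> 'e \<Rightarrow> complex" where
  "incidence s v e = (if v \<in> s e then 1 else 0)"

definition vertex_gen :: "'v \<Rightarrow> 'v \<Rightarrow> ('v \<times> 'v + 'e \<times> 'e) free_algebra" where
  "vertex_gen v w = gen (Inl (v, w))"

definition edge_gen :: "'e \<Rightarrow> 'e \<Rightarrow> ('v \<times> 'v + 'e \<times> 'e) free_algebra" where
  "edge_gen e f = gen (Inr (e, f))"

definition qaut ::
    "'v set \<Rightarrow> 'e set \<Rightarrow> ('e \<Rightarrow> 'v set) \<Rightarrow> ('e \<Rightarrow> 'v set) \<Rightarrow>
      ('v + 'e, (nat \<Rightarrow> ('v \<times> 'v + 'e \<times> 'e) free_algebra) set) matrix_quantum_group" where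
  "qaut V E s r = universal_quantum_group (V \<times> V <+> E \<times> E)
    (magic_unitary_relations V vertex_gen \<union> magic_unitary_relations E edge_gen \<union>
     intertwiner_relations V E (incidence s) vertex_gen edge_gen \<union>
     intertwiner_relations V E (incidence r) vertex_gen edge_gen)
    (V <+> E) (block_sum vertex_gen edge_gen)"

definition directed_graph :: "'v set \<Rightarrow> ('v \<times> 'v) set \<Rightarrow> bool" where
  "directed_graph V E \<longleftrightarrow> finite V \<and> E \<subseteq> V \<times> V"

definition simple_graph :: "'v set \<Rightarrow> 'v set set \<Rightarrow> bool" where
  "simple_graph V E \<longleftrightarrow> finite V \<and> E \<subseteq> Pow V \<and> (\<forall>e \<in> E. card e = 2)"

definition adjacency :: "('v \<Rightarrow> 'v \<Rightarrow> bool) \<Rightarrow> 'v \<Rightarrow> 'v \<Rightarrow> complex" where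
  "adjacency adj v w = (if adj v w then 1 else 0)"

definition pair_gen :: "'y \<Rightarrow> 'y \<Rightarrow> ('y \<times> 'y) free_algebra" where
  "pair_gen x y = gen (x, y)"

definition qaut_bic ::
    "'v set \<Rightarrow> ('v \<Rightarrow> 'v \<Rightarrow> bool) \<Rightarrow>
      ('v, (nat \<Rightarrow> ('v \<times> 'v) free_algebra) set) matrix_quantum_group" where
  "qaut_bic V adj = universal_quantum_group (V \<times> V)
    (magic_unitary_relations V pair_gen \<union>
     intertwiner_relations V V (adjacency adj) pair_gen pair_gen \<union>
     {pair_gen i k * pair_gen j l - pair_gen j l * pair_gen i k | i j k l.
       i \<in> V \<and> j \<in> V \<and> k \<in> V \<and> l \<in> V \<and> adj i j \<and> adj k l})
    V pair_gen"

definition multigraph :: "'v set \<Rightarrow> 'e set \<Rightarrow> ('e \<Rightarrow> 'v) \<Rightarrow> ('e \<Rightarrow> 'v) \<Rightarrow> bool" where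
  "multigraph V E s r \<longleftrightarrow> finite V \<and> finite E \<and> s \<in> E \<rightarrow> V \<and> r \<in> E \<rightarrow> V"

definition is_source :: "'e set \<Rightarrow> ('e \<Rightarrow> 'v) \<Rightarrow> 'v \<Rightarrow> bool" where
  "is_source E r v \<longleftrightarrow> (\<forall>e \<in> E. v \<noteq> r e)"

definition is_sink :: "'e set \<Rightarrow> ('e \<Rightarrow> 'v) \<Rightarrow> 'v \<Rightarrow> bool" where
  "is_sink E s v \<longleftrightarrow> (\<forall>e \<in> E. v \<noteq> s e)"

definition isolated :: "'e set \<Rightarrow> ('e \<Rightarrow> 'v) \<Rightarrow> ('e \<Rightarrow> 'v) \<Rightarrow> 'v \<Rightarrow> bool" where
  "isolated E s r v \<longleftrightarrow> is_source E r v \<and> is_sink E s v"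

definition inner_vertex :: "'e set \<Rightarrow> ('e \<Rightarrow> 'v) \<Rightarrow> ('e \<Rightarrow> 'v) \<Rightarrow> 'v \<Rightarrow> bool" where
  "inner_vertex E s r v \<longleftrightarrow> \<not> is_source E r v \<and> \<not> is_sink E s v"

text \<open>The sum of \<open>u\<^sub>e\<^sub>f\<close> over all edges \<open>f\<close> whose endpoint \<open>t f\<close> (source or range) is \<open>v\<close>.\<close>

definition endpoint_sum :: "'e set \<Rightarrow> ('e \<Rightarrow> 'v) \<Rightarrow> 'v \<Rightarrow> 'e \<Rightarrow> ('e \<times> 'e) free_algebra" where
  "endpoint_sum E t v e = (\<Sum>f | f \<in> E \<and> t f = v. pair_gen e f)"

definition qaut_gh_bic ::
    "'v set \<Rightarrow> 'e set \<Rightarrow> ('e \<Rightarrow> 'v) \<Rightarrow> ('e \<Rightarrow> 'v) \<Rightarrow>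
      ('e, (nat \<Rightarrow> ('e \<times> 'e) free_algebra) set) matrix_quantum_group" where
  "qaut_gh_bic V E s r = universal_quantum_group (E \<times> E)
    (magic_unitary_relations E pair_gen \<union>
     {endpoint_sum E s v e\<^sub>1 - endpoint_sum E s v e\<^sub>2 | v e\<^sub>1 e\<^sub>2.
       v \<in> V \<and> e\<^sub>1 \<in> E \<and> e\<^sub>2 \<in> E \<and> s e\<^sub>1 = s e\<^sub>2} \<union>
     {endpoint_sum E r v e\<^sub>1 - endpoint_sum E r v e\<^sub>2 | v e\<^sub>1 e\<^sub>2.
       v \<in> V \<and> e\<^sub>1 \<in> E \<and> e\<^sub>2 \<in> E \<and> r e\<^sub>1 = r e\<^sub>2} \<union>
     {pair_gen e f | e f. e \<in> E \<and> f \<in> E \<and> inner_vertex E s r (s e) \<and> is_source E r (s f)} \<union>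
     {pair_gen e f | e f. e \<in> E \<and> f \<in> E \<and> inner_vertex E s r (r e) \<and> is_sink E s (r f)} \<union>
     {endpoint_sum E s v e\<^sub>1 - endpoint_sum E r v e\<^sub>2 | v e\<^sub>1 e\<^sub>2.
       v \<in> V \<and> inner_vertex E s r v \<and> e\<^sub>1 \<in> E \<and> e\<^sub>2 \<in> E \<and>
       s e\<^sub>1 = r e\<^sub>2 \<and> inner_vertex E s r (s e\<^sub>1)})
    E pair_gen"

end

theory Submission
  imports Defs
begin

text \<open>All three isomorphisms are given by explicit formulas on generators. For a directed graph
  \<open>u\<^sub>e\<^sub>f = u\<^sub>v\<^sub>k u\<^sub>w\<^sub>l\<close> for \<open>e = (v, w)\<close>, \<open>f = (k, l)\<close>; for a simple graph
  \<open>u\<^sub>e\<^sub>f = u\<^sub>v\<^sub>k u\<^sub>w\<^sub>l + u\<^sub>v\<^sub>l u\<^sub>w\<^sub>k\<close> for \<open>e = {v, w}\<close>, \<open>f = {k, l}\<close>; for a multigraph \<open>u\<^sub>v\<^sub>w\<close> is the sum of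
  the \<open>u\<^sub>e\<^sub>f\<close> over all \<open>f\<close> starting (or ending) in \<open>w\<close>, for any fixed \<open>e\<close> starting (or ending) in \<open>v\<close>.
  Checking the relations needs one fact about C*-seminorms beyond algebra: projections that sum to
  \<open>1\<close> are pairwise orthogonal. It follows from the extremality of the unit of a corner in its
  unit ball.

  The comultiplication of \<open>Aut\<^sup>+(\<Gamma>)\<close> comes from the universal property, because the matrices
  \<open>\<Sum>\<^sub>k u\<^sub>i\<^sub>k \<otimes> u\<^sub>k\<^sub>j\<close> satisfy the defining relations in the minimal tensor product. The spatial norm is
  a C*-seminorm because products of states are positive (Schur product theorem) and the operators of
  the GNS representations are bounded (iterated Cauchy-Schwarz). The comultiplication of the other
  quantum group is transported along the isomorphism.\<close>

text \<open>The universal algebras come from suprema of C*-seminorms on free *-algebras, with no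
  Hilbert space and no order structure in sight. So relations are treated as congruences modulo a
  seminorm, and orthogonality of projections has to be a pure norm estimate: for two members
  \<open>p\<close>, \<open>r\<close> of a partition of unity, the corner \<open>h = p r p\<close>
  makes both \<open>p + t h\<close> and \<open>p - t h\<close> contractions for a small
  \<open>t > 0\<close>, and extremality kills \<open>h\<close>. Norms also replace automatic
  continuity: the comparison maps are mutually inverse contractions, hence isometric, so states and
  with them the spatial norm can be pulled back. The comultiplication is built on the hypergraph
  side because magic unitaries and intertwiners of scalar matrices are visibly stable under
  convolution of two commuting copies; this is less clear for the relations of the other quantum
  groups. For multigraphs the obstacle is that the relations compare partial row sums only. Column
  sums are recovered by comparing totals, since a null sum of projections has null terms.\<close>

section \<open>Calculus in *-algebras\<close>

lemma complex_ring_simps [simp]: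
  "carrier complex_ring = UNIV" "one complex_ring = 1" "ring.zero complex_ring = 0"
  "add complex_ring = (+)" "monoid.mult complex_ring = (*)"
  by (simp_all add: complex_ring_def)

lemma complex_ring_cring: "cring complex_ring"
proof (rule cringI)
  show "abelian_group complex_ring"
  proof (rule abelian_groupI)
    fix x :: complex
    show "\<exists>y\<in>carrier complex_ring. y \<oplus>\<^bsub>complex_ring\<^esub> x = \<zero>\<^bsub>complex_ring\<^esub>"
      by (intro bexI[of _ "- x"]) auto
  qed (auto simp: add.assoc add.commute)
  show "comm_monoid complex_ring"
    by (rule comm_monoidI) (auto simp: mult.assoc mult.commute)
qed (simp add: distrib_right)

context star_algebra
begin

lemma is_ring: "ring A" ..

lemma is_group: "abelian_group A" ..

(* The complex_ring instance of the module locale shadows the ring facts of A. *)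
lemmas minus_eq = abelian_group.minus_eq[OF is_group]
lemmas minus_add = abelian_group.minus_add[OF is_group]
lemmas minus_equality = abelian_group.minus_equality[OF is_group]
lemmas a_ac = abelian_monoid.a_ac[OF abelian_group.axioms(1)[OF is_group]]
lemmas a_assoc = abelian_monoid.a_assoc[OF abelian_group.axioms(1)[OF is_group]]
lemmas a_comm = abelian_monoid.a_comm[OF abelian_group.axioms(1)[OF is_group]]
lemmas r_neg = abelian_group.r_neg[OF is_group]
lemmas l_neg = abelian_group.l_neg[OF is_group]
lemmas l_distr = ring.ring_simprules(13)[OF is_ring]
lemmas r_distr = ring.ring_simprules(23)[OF is_ring]
lemmas l_minus = ring.l_minus[OF is_ring]
lemmas r_minus = ring.r_minus[OF is_ring]
lemmas m_assoc = ring.ring_simprules(11)[OF is_ring]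

lemma smult_in [simp, intro]: "x \<in> carrier A \<Longrightarrow> c \<odot> x \<in> carrier A"
  by (simp add: smult_closed)

lemma star_in [simp, intro]: "x \<in> carrier A \<Longrightarrow> star A x \<in> carrier A"
  by (rule star_closed)

lemma smult_add_left: "x \<in> carrier A \<Longrightarrow> (a + b) \<odot> x = a \<odot> x \<oplus> b \<odot> x"
  using smult_l_distr[of a b x] by simp

lemma smult_add_right: "x \<in> carrier A \<Longrightarrow> y \<in> carrier A \<Longrightarrow> a \<odot> (x \<oplus> y) = a \<odot> x \<oplus> a \<odot> y"
  using smult_r_distr[of a x y] by simp

lemma smult_smult: "x \<in> carrier A \<Longrightarrow> a \<odot> (b \<odot> x) = (a * b) \<odot> x"
  using smult_assoc1[of a b x] by simp

lemma smult_1 [simp]: "x \<in> carrier A \<Longrightarrow> 1 \<odot> x = x"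
  using smult_one by simp

lemma smult_0 [simp]: "x \<in> carrier A \<Longrightarrow> 0 \<odot> x = \<zero>"
  using smult_l_null by simp

lemma smult_zero [simp]: "c \<odot> \<zero> = \<zero>"
  using smult_r_null by simp

text \<open>Negation as a scalar multiple: whatever respects sums and scalars then respects
  differences. The star, homomorphisms and the completion are all handled in this way.\<close>

lemma smult_minus_1: "x \<in> carrier A \<Longrightarrow> (- 1) \<odot> x = \<ominus> x"
proof -
  assume x: "x \<in> carrier A"
  have "(-1) \<odot> x \<oplus> x = \<zero>"
    using smult_add_left[OF x, of "-1" 1] x by simp
  then show ?thesis using x by (metis minus_equality smult_in)
qed

lemma smult_minus: "x \<in> carrier A \<Longrightarrow> c \<odot> (\<ominus> x) = \<ominus> (c \<odot> x)"
  by (simp add: smult_minus_1[symmetric] smult_smult mult.commute)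

lemma minus_smult: "x \<in> carrier A \<Longrightarrow> y \<in> carrier A \<Longrightarrow> c \<odot> (x \<ominus> y) = c \<odot> x \<ominus> c \<odot> y"
  by (simp add: minus_eq smult_add_right smult_minus)

lemma star_zero [simp]: "star A \<zero> = \<zero>"
  using star_smult[of \<zero> 0] by simp

lemma star_minus: "x \<in> carrier A \<Longrightarrow> y \<in> carrier A \<Longrightarrow> star A (x \<ominus> y) = star A x \<ominus> star A y"
  by (simp add: minus_eq star_add smult_minus_1[symmetric] star_smult)

text \<open>The star of 1 equals \<open>star 1\<close> times 1, a self-adjoint product, so it is its
  own star, which is 1.\<close>

lemma star_one [simp]: "star A \<one> = \<one>"
proof -
  have "star A \<one> = star A \<one> \<otimes> \<one>" by simp
  also have "\<dots> = star A (star A \<one> \<otimes> \<one>)" by (subst star_mult) (auto simp: star_star)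
  also have "\<dots> = \<one>" by (simp add: star_star)
  finally show ?thesis .
qed

lemma minus_mult_left: "\<lbrakk>x \<in> carrier A; y \<in> carrier A; z \<in> carrier A\<rbrakk> \<Longrightarrow> (x \<ominus> y) \<otimes> z = x \<otimes> z \<ominus> y \<otimes> z"
  by (simp add: minus_eq l_distr l_minus)

lemma minus_mult_right: "\<lbrakk>x \<in> carrier A; y \<in> carrier A; z \<in> carrier A\<rbrakk> \<Longrightarrow> z \<otimes> (x \<ominus> y) = z \<otimes> x \<ominus> z \<otimes> y"
  by (simp add: minus_eq r_distr r_minus)

lemma minus_swap: "x \<in> carrier A \<Longrightarrow> y \<in> carrier A \<Longrightarrow> x \<ominus> y = (- 1) \<odot> (y \<ominus> x)"
  by (simp add: minus_eq smult_add_right smult_smult smult_minus_1[symmetric] a_comm)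

lemma minus_split: "\<lbrakk>x \<in> carrier A; y \<in> carrier A; z \<in> carrier A\<rbrakk> \<Longrightarrow> x \<ominus> z = (x \<ominus> y) \<oplus> (y \<ominus> z)"
  by (simp add: minus_eq a_assoc) (simp add: a_assoc[symmetric] l_neg)

lemma add_minus_add: "\<lbrakk>x \<in> carrier A; y \<in> carrier A; x' \<in> carrier A; y' \<in> carrier A\<rbrakk>
  \<Longrightarrow> (x \<oplus> y) \<ominus> (x' \<oplus> y') = (x \<ominus> x') \<oplus> (y \<ominus> y')"
  by (simp add: minus_eq minus_add a_ac)

lemma mult_minus_mult: "\<lbrakk>x \<in> carrier A; y \<in> carrier A; x' \<in> carrier A; y' \<in> carrier A\<rbrakk>
  \<Longrightarrow> (x \<otimes> y) \<ominus> (x' \<otimes> y') = x \<otimes> (y \<ominus> y') \<oplus> (x \<ominus> x') \<otimes> y'"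
  using minus_split[of "x \<otimes> y" "x \<otimes> y'" "x' \<otimes> y'"] by (simp add: minus_mult_left minus_mult_right)

lemma minus_self [simp]: "x \<in> carrier A \<Longrightarrow> x \<ominus> x = \<zero>"
  by (simp add: minus_eq r_neg)

lemma minus_zero_right [simp]: "x \<in> carrier A \<Longrightarrow> x \<ominus> \<zero> = x"
  by (simp add: minus_eq)

end

lemma star_algebraI:
  fixes A (structure)
  assumes "ring A"
    and "\<And>c x. x \<in> carrier A \<Longrightarrow> c \<odot> x \<in> carrier A"
    and "\<And>a b x. x \<in> carrier A \<Longrightarrow> (a + b) \<odot> x = a \<odot> x \<oplus> b \<odot> x"
    and "\<And>a x y. \<lbrakk>x \<in> carrier A; y \<in> carrier A\<rbrakk> \<Longrightarrow> a \<odot> (x \<oplus> y) = a \<odot> x \<oplus> a \<odot> y"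
    and "\<And>a b x. x \<in> carrier A \<Longrightarrow> (a * b) \<odot> x = a \<odot> (b \<odot> x)"
    and "\<And>x. x \<in> carrier A \<Longrightarrow> 1 \<odot> x = x"
    and "\<And>c x y. \<lbrakk>x \<in> carrier A; y \<in> carrier A\<rbrakk> \<Longrightarrow> (c \<odot> x) \<otimes> y = c \<odot> (x \<otimes> y)"
    and "\<And>c x y. \<lbrakk>x \<in> carrier A; y \<in> carrier A\<rbrakk> \<Longrightarrow> x \<otimes> (c \<odot> y) = c \<odot> (x \<otimes> y)"
    and "\<And>x. x \<in> carrier A \<Longrightarrow> star A x \<in> carrier A"
    and "\<And>x. x \<in> carrier A \<Longrightarrow> star A (star A x) = x"
    and "\<And>x y. \<lbrakk>x \<in> carrier A; y \<in> carrier A\<rbrakk> \<Longrightarrow> star A (x \<oplus> y) = star A x \<oplus> star A y"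
    and "\<And>c x. x \<in> carrier A \<Longrightarrow> star A (c \<odot> x) = cnj c \<odot> star A x"
    and "\<And>x y. \<lbrakk>x \<in> carrier A; y \<in> carrier A\<rbrakk> \<Longrightarrow> star A (x \<otimes> y) = star A y \<otimes> star A x"
  shows "star_algebra A"
  by (intro star_algebra.intro star_algebra_axioms.intro moduleI assms(1) complex_ring_cring
      ring.is_abelian_group) (use assms in auto)

section \<open>C*-seminorms on *-algebras\<close>

text \<open>One setting for three uses: free algebras with the universal norm, formal tensors with
  the spatial norm, and honest C*-algebras with \<open>nrm\<close>.\<close>

locale cstar_seminormed_algebra = star_algebra A
  for A :: "('a, 'm) star_algebra_scheme" (structure) +
  fixes p :: "'a \<Rightarrow> real"
  assumes seminorm: "cstar_seminorm A p"
begin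

lemma p_nonneg [simp]: "x \<in> carrier A \<Longrightarrow> 0 \<le> p x"
  and p_add: "x \<in> carrier A \<Longrightarrow> y \<in> carrier A \<Longrightarrow> p (x \<oplus> y) \<le> p x + p y"
  and p_smult: "x \<in> carrier A \<Longrightarrow> p (c \<odot> x) = cmod c * p x"
  and p_mult: "x \<in> carrier A \<Longrightarrow> y \<in> carrier A \<Longrightarrow> p (x \<otimes> y) \<le> p x * p y"
  and p_cstar: "x \<in> carrier A \<Longrightarrow> p (star A x \<otimes> x) = (p x)\<^sup>2"
  using seminorm unfolding cstar_seminorm_def by blast+

lemma p_zero [simp]: "p \<zero> = 0"
  using p_smult[of \<zero> 0] by simp

text \<open>The C*-identity and submultiplicativity give
  \<open>p y * p y \<le> p (star A y) * p y\<close>; cancelling and applying this to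
  \<open>x\<close> and to its star yields both inequalities.\<close>

lemma p_star [simp]: assumes x: "x \<in> carrier A" shows "p (star A x) = p x"
proof -
  have le: "p y \<le> p (star A y)" if y: "y \<in> carrier A" for y
  proof (cases "p y = 0")
    case False
    have "p y * p y \<le> p (star A y) * p y"
      using p_cstar[OF y] p_mult[of "star A y" y] y by (simp add: power2_eq_square)
    with False p_nonneg[OF y] show ?thesis by (simp add: order_less_le)
  qed (use y in simp)
  show ?thesis using le[OF x] le[of "star A x"] x by (simp add: star_star)
qed

lemma p_minus_commute: "x \<in> carrier A \<Longrightarrow> y \<in> carrier A \<Longrightarrow> p (x \<ominus> y) = p (y \<ominus> x)"
  by (subst minus_swap) (auto simp: p_smult)

lemma p_triangle: "\<lbrakk>x \<in> carrier A; y \<in> carrier A; z \<in> carrier A\<rbrakk> \<Longrightarrow> p (x \<ominus> z) \<le> p (x \<ominus> y) + p (y \<ominus> z)"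
  by (subst minus_split[of x y z]) (auto intro: p_add)

lemma p_abs_diff: assumes "x \<in> carrier A" "y \<in> carrier A" shows "\<bar>p x - p y\<bar> \<le> p (x \<ominus> y)"
  using p_triangle[of x y \<zero>] p_triangle[of y x \<zero>] p_minus_commute[of x y] assms
  by auto

lemma p_mult_diff:
  assumes "x \<in> carrier A" "y \<in> carrier A" "x' \<in> carrier A" "y' \<in> carrier A"
  shows "p ((x \<otimes> y) \<ominus> (x' \<otimes> y')) \<le> p x * p (y \<ominus> y') + p (x \<ominus> x') * p y'"
  unfolding mult_minus_mult[OF assms]
  using assms by (intro order_trans[OF p_add] add_mono p_mult) auto

lemma p_add_diff:
  assumes "x \<in> carrier A" "y \<in> carrier A" "x' \<in> carrier A" "y' \<in> carrier A"
  shows "p ((x \<oplus> y) \<ominus> (x' \<oplus> y')) \<le> p (x \<ominus> x') + p (y \<ominus> y')"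
  unfolding add_minus_add[OF assms] using assms by (intro p_add) auto

end

section \<open>The Hausdorff completion is a unital C*-algebra\<close>

context cstar_seminormed_algebra
begin

abbreviation "cs \<equiv> cauchy_seqs A p"
abbreviation "cls \<equiv> cauchy_class A p"

definition null_eq :: "(nat \<Rightarrow> 'a) \<Rightarrow> (nat \<Rightarrow> 'a) \<Rightarrow> bool" where
  "null_eq X Y \<longleftrightarrow> (\<lambda>n. p (X n \<ominus> Y n)) \<longlonglongrightarrow> 0"

lemma cs_in [simp]: "X \<in> cs \<Longrightarrow> X n \<in> carrier A"
  by (simp add: cauchy_seqs_def)

lemma csD: "X \<in> cs \<Longrightarrow> \<epsilon> > 0 \<Longrightarrow> \<exists>N. \<forall>m\<ge>N. \<forall>n\<ge>N. p (X m \<ominus> X n) < \<epsilon>"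
  unfolding cauchy_seqs_def by blast

lemma cs_const: "a \<in> carrier A \<Longrightarrow> (\<lambda>n. a) \<in> cs"
  by (simp add: cauchy_seqs_def del: cs_in)

lemma cs_bounded: assumes "X \<in> cs" obtains B where "B > 0" "\<And>n. p (X n) \<le> B"
proof -
  obtain N where N: "\<forall>m\<ge>N. \<forall>n\<ge>N. p (X m \<ominus> X n) < 1" using csD[OF assms, of 1] by auto
  define B where "B = Max ((\<lambda>n. p (X n)) ` {..N}) + 1"
  have le: "p (X n) \<le> B - 1" if "n \<le> N" for n
    unfolding B_def using that by auto
  have "p (X n) \<le> B" for n
  proof (cases "n \<le> N")
    case False
    then have "p (X n \<ominus> X N) < 1" using N by auto
    then show ?thesis using p_abs_diff[of "X n" "X N"] le[of N] assms by simp
  qed (use le in force)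
  moreover have "B > 0" using order_trans[OF p_nonneg[of "X 0"] le[of 0]] assms by simp
  ultimately show ?thesis using that by blast
qed

text \<open>The common Lipschitz form of all closure properties of Cauchy sequences; for products
  the constants are bounds of the two factors.\<close>

lemma cs_dominated:
  assumes X: "X \<in> cs" and Y: "Y \<in> cs" and Z: "\<And>n. Z n \<in> carrier A"
    and le: "\<And>m n. p (Z m \<ominus> Z n) \<le> a * p (X m \<ominus> X n) + b * p (Y m \<ominus> Y n)" and ab: "a \<ge> 0" "b \<ge> 0"
  shows "Z \<in> cs"
  unfolding cauchy_seqs_def
proof (intro CollectI conjI allI impI Z)
  fix \<epsilon> :: real assume e: "\<epsilon> > 0"
  \<comment> \<open>The summand 1 keeps the denominator positive when \<open>a = b = 0\<close> and
    makes the final inequality strict.\<close>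
  define \<delta> where "\<delta> = \<epsilon> / (a + b + 1)"
  have d: "\<delta> > 0" using e ab by (simp add: \<delta>_def)
  obtain N1 where N1: "\<forall>m\<ge>N1. \<forall>n\<ge>N1. p (X m \<ominus> X n) < \<delta>" using csD[OF X d] by auto
  obtain N2 where N2: "\<forall>m\<ge>N2. \<forall>n\<ge>N2. p (Y m \<ominus> Y n) < \<delta>" using csD[OF Y d] by auto
  have "p (Z m \<ominus> Z n) < \<epsilon>" if "m \<ge> max N1 N2" "n \<ge> max N1 N2" for m n
  proof -
    have "p (Z m \<ominus> Z n) \<le> a * p (X m \<ominus> X n) + b * p (Y m \<ominus> Y n)" by (rule le)
    also have "\<dots> \<le> a * \<delta> + b * \<delta>"
      using N1 N2 that ab by (intro add_mono mult_left_mono) (auto intro: less_imp_le)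
    also have "\<dots> = (a + b) * \<delta>" by (simp add: algebra_simps)
    also have "\<dots> < \<epsilon>" using ab e by (simp add: \<delta>_def field_simps)
    finally show ?thesis .
  qed
  then show "\<exists>N. \<forall>m\<ge>N. \<forall>n\<ge>N. p (Z m \<ominus> Z n) < \<epsilon>" by blast
qed

lemma cs_add [simp]: assumes "X \<in> cs" "Y \<in> cs" shows "(\<lambda>n. X n \<oplus> Y n) \<in> cs"
  by (rule cs_dominated[OF assms, where a=1 and b=1]) (use assms p_add_diff in auto)

lemma cs_mult [simp]: assumes X: "X \<in> cs" and Y: "Y \<in> cs" shows "(\<lambda>n. X n \<otimes> Y n) \<in> cs"
proof -
  obtain B where B: "B > 0" "\<And>n. p (X n) \<le> B" using cs_bounded[OF X] by blast
  obtain B' where B': "B' > 0" "\<And>n. p (Y n) \<le> B'" using cs_bounded[OF Y] by blast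
  show ?thesis
  proof (rule cs_dominated[OF X Y, where a=B' and b=B])
    fix m n
    have "p (X m \<otimes> Y m \<ominus> X n \<otimes> Y n) \<le> p (X m) * p (Y m \<ominus> Y n) + p (X m \<ominus> X n) * p (Y n)"
      using X Y by (intro p_mult_diff) auto
    also have "\<dots> \<le> B * p (Y m \<ominus> Y n) + p (X m \<ominus> X n) * B'"
      using X Y B B' by (intro add_mono mult_left_mono mult_right_mono) auto
    finally show "p (X m \<otimes> Y m \<ominus> X n \<otimes> Y n) \<le> B' * p (X m \<ominus> X n) + B * p (Y m \<ominus> Y n)"
      by (simp add: mult.commute)
  qed (use X Y B B' in auto)
qed

lemma cs_smult [simp]: assumes "X \<in> cs" shows "(\<lambda>n. c \<odot> X n) \<in> cs"
  by (rule cs_dominated[OF assms assms, where a="cmod c" and b=0])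
    (use assms in \<open>auto simp: minus_smult[symmetric] p_smult\<close>)

lemma cs_star [simp]: assumes "X \<in> cs" shows "(\<lambda>n. star A (X n)) \<in> cs"
  by (rule cs_dominated[OF assms assms, where a=1 and b=0])
    (use assms in \<open>auto simp: star_minus[symmetric]\<close>)

lemma cs_minus: assumes "X \<in> cs" "Y \<in> cs" shows "(\<lambda>n. X n \<ominus> Y n) \<in> cs"
proof -
  have "(\<lambda>n. X n \<oplus> (-1) \<odot> Y n) \<in> cs" using assms by simp
  then show ?thesis using assms by (simp add: smult_minus_1 minus_eq)
qed

lemma null_eq_dominated:
  assumes "null_eq X X'" "null_eq Y Y'" "\<And>n. Z n \<in> carrier A" "\<And>n. Z' n \<in> carrier A"
    and le: "\<And>n. p (Z n \<ominus> Z' n) \<le> a * p (X n \<ominus> X' n) + b * p (Y n \<ominus> Y' n)"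
  shows "null_eq Z Z'"
  unfolding null_eq_def
proof (rule tendsto_sandwich[OF _ _ tendsto_const])
  show "(\<lambda>n. a * p (X n \<ominus> X' n) + b * p (Y n \<ominus> Y' n)) \<longlonglongrightarrow> 0"
    using assms(1,2) unfolding null_eq_def by (auto intro!: tendsto_eq_intros)
qed (use assms in auto)

lemma null_eq_refl: "X \<in> cs \<Longrightarrow> null_eq X X"
  by (simp add: null_eq_def)

lemma null_eq_sym: "X \<in> cs \<Longrightarrow> Y \<in> cs \<Longrightarrow> null_eq X Y \<Longrightarrow> null_eq Y X"
  by (simp add: null_eq_def p_minus_commute)

lemma null_eq_trans:
  "\<lbrakk>X \<in> cs; Y \<in> cs; Z \<in> cs; null_eq X Y; null_eq Y Z\<rbrakk> \<Longrightarrow> null_eq X Z"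
  by (rule null_eq_dominated[of X Y Y Z _ _ 1 1]) (auto intro: p_triangle)

lemma null_eq_add:
  "\<lbrakk>X \<in> cs; Y \<in> cs; X' \<in> cs; Y' \<in> cs; null_eq X X'; null_eq Y Y'\<rbrakk>
    \<Longrightarrow> null_eq (\<lambda>n. X n \<oplus> Y n) (\<lambda>n. X' n \<oplus> Y' n)"
  by (erule (1) null_eq_dominated[where a=1 and b=1]) (auto intro: p_add_diff)

lemma null_eq_mult:
  assumes "X \<in> cs" "Y \<in> cs" "X' \<in> cs" "Y' \<in> cs" "null_eq X X'" "null_eq Y Y'"
  shows "null_eq (\<lambda>n. X n \<otimes> Y n) (\<lambda>n. X' n \<otimes> Y' n)"
proof -
  obtain B where B: "B > 0" "\<And>n. p (X n) \<le> B" using cs_bounded[OF assms(1)] by blast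
  obtain B' where B': "B' > 0" "\<And>n. p (Y' n) \<le> B'" using cs_bounded[OF assms(4)] by blast
  show ?thesis
  proof (rule null_eq_dominated[OF assms(5,6), where a=B' and b=B])
    fix n
    have "p (X n \<otimes> Y n \<ominus> X' n \<otimes> Y' n) \<le> p (X n) * p (Y n \<ominus> Y' n) + p (X n \<ominus> X' n) * p (Y' n)"
      using assms by (intro p_mult_diff) auto
    also have "\<dots> \<le> B * p (Y n \<ominus> Y' n) + p (X n \<ominus> X' n) * B'"
      using assms B B' by (intro add_mono mult_left_mono mult_right_mono) auto
    finally show "p (X n \<otimes> Y n \<ominus> X' n \<otimes> Y' n) \<le> B' * p (X n \<ominus> X' n) + B * p (Y n \<ominus> Y' n)"
      by (simp add: mult.commute)
  qed (use assms in auto)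
qed

lemma null_eq_smult: "\<lbrakk>X \<in> cs; X' \<in> cs; null_eq X X'\<rbrakk> \<Longrightarrow> null_eq (\<lambda>n. c \<odot> X n) (\<lambda>n. c \<odot> X' n)"
  by (erule null_eq_dominated[where a="cmod c" and b=0, OF _ null_eq_refl[of X]])
    (auto simp: minus_smult[symmetric] p_smult)

lemma null_eq_star: "\<lbrakk>X \<in> cs; X' \<in> cs; null_eq X X'\<rbrakk> \<Longrightarrow> null_eq (\<lambda>n. star A (X n)) (\<lambda>n. star A (X' n))"
  by (erule null_eq_dominated[where a=1 and b=0, OF _ null_eq_refl[of X]])
    (auto simp: star_minus[symmetric])

lemma mem_cls: "Y \<in> cls X \<longleftrightarrow> Y \<in> cs \<and> null_eq X Y"
  by (simp add: cauchy_class_def null_eq_def)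

lemma cls_eq_iff: assumes "X \<in> cs" "Y \<in> cs" shows "cls X = cls Y \<longleftrightarrow> null_eq X Y"
proof
  assume "cls X = cls Y"
  then have "Y \<in> cls X" using assms by (simp add: mem_cls null_eq_refl)
  then show "null_eq X Y" by (simp add: mem_cls)
next
  assume XY: "null_eq X Y"
  have "null_eq X Z \<longleftrightarrow> null_eq Y Z" if "Z \<in> cs" for Z
    using null_eq_trans[of X Y Z] null_eq_trans[of Y X Z] XY null_eq_sym[OF assms] assms that by blast
  then show "cls X = cls Y" by (auto simp: mem_cls)
qed

lemma cls_nonempty: "X \<in> cs \<Longrightarrow> cls X \<noteq> {}"
  using mem_cls null_eq_refl by blast

text \<open>Turns the unions over representatives in \<open>completion\<close> into a computation on
  one representative: all members of the union agree, and the class is nonempty.\<close>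

lemma UN_cls:
  assumes "X \<in> cs" "\<And>X'. X' \<in> cs \<Longrightarrow> null_eq X' X \<Longrightarrow> F X' = G"
  shows "(\<Union>X' \<in> cls X. F X') = G"
  using cls_nonempty[OF assms(1)] assms by (intro SUP_eq_const) (auto simp: mem_cls null_eq_sym)

abbreviation "C \<equiv> completion A p"

lemma carrier_C: "carrier C = cls ` cs"
  by (simp add: completion_def)

lemma cls_in_C [simp]: "X \<in> cs \<Longrightarrow> cls X \<in> carrier C"
  by (simp add: carrier_C)

lemma CE: assumes "P \<in> carrier C" obtains X where "X \<in> cs" "P = cls X"
  using assms by (auto simp: carrier_C)

lemma cls_mult: assumes "X \<in> cs" "Y \<in> cs" shows "cls X \<otimes>\<^bsub>C\<^esub> cls Y = cls (\<lambda>n. X n \<otimes> Y n)"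
proof -
  have "(\<Union>X' \<in> cls X. \<Union>Y' \<in> cls Y. cls (\<lambda>n. X' n \<otimes> Y' n)) = cls (\<lambda>n. X n \<otimes> Y n)"
    using assms by (intro UN_cls) (auto simp: cls_eq_iff null_eq_mult)
  then show ?thesis by (simp add: completion_def)
qed

lemma cls_add: assumes "X \<in> cs" "Y \<in> cs" shows "cls X \<oplus>\<^bsub>C\<^esub> cls Y = cls (\<lambda>n. X n \<oplus> Y n)"
proof -
  have "(\<Union>X' \<in> cls X. \<Union>Y' \<in> cls Y. cls (\<lambda>n. X' n \<oplus> Y' n)) = cls (\<lambda>n. X n \<oplus> Y n)"
    using assms by (intro UN_cls) (auto simp: cls_eq_iff null_eq_add)
  then show ?thesis by (simp add: completion_def)
qed

lemma cls_smult: assumes "X \<in> cs" shows "c \<odot>\<^bsub>C\<^esub> cls X = cls (\<lambda>n. c \<odot> X n)"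
proof -
  have "(\<Union>X' \<in> cls X. cls (\<lambda>n. c \<odot> X' n)) = cls (\<lambda>n. c \<odot> X n)"
    using assms by (intro UN_cls) (auto simp: cls_eq_iff null_eq_smult)
  then show ?thesis by (simp add: completion_def)
qed

lemma cls_star: assumes "X \<in> cs" shows "star C (cls X) = cls (\<lambda>n. star A (X n))"
proof -
  have "(\<Union>X' \<in> cls X. cls (\<lambda>n. star A (X' n))) = cls (\<lambda>n. star A (X n))"
    using assms by (intro UN_cls) (auto simp: cls_eq_iff null_eq_star)
  then show ?thesis by (simp add: completion_def)
qed

lemma one_C: "\<one>\<^bsub>C\<^esub> = cls (\<lambda>n. \<one>)" and zero_C: "\<zero>\<^bsub>C\<^esub> = cls (\<lambda>n. \<zero>)"
  by (simp_all add: completion_def)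

lemma p_convergent: assumes "X \<in> cs" shows "convergent (\<lambda>n. p (X n))"
proof -
  have "Cauchy (\<lambda>n. p (X n))"
    unfolding Cauchy_def dist_real_def
  proof (intro allI impI)
    fix e :: real assume "e > 0"
    then obtain N where "\<forall>m\<ge>N. \<forall>n\<ge>N. p (X m \<ominus> X n) < e" using csD[OF assms] by blast
    then show "\<exists>M. \<forall>m\<ge>M. \<forall>n\<ge>M. \<bar>p (X m) - p (X n)\<bar> < e"
      using p_abs_diff assms by (meson cs_in order_le_less_trans)
  qed
  then show ?thesis by (rule real_Cauchy_convergent)
qed

lemma null_eq_tendsto:
  assumes "X \<in> cs" "Y \<in> cs" "null_eq X Y" "(\<lambda>n. p (X n)) \<longlonglongrightarrow> l" shows "(\<lambda>n. p (Y n)) \<longlonglongrightarrow> l"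
proof -
  have "(\<lambda>n. p (X n) - p (Y n)) \<longlonglongrightarrow> 0"
    by (rule tendsto_0_le[where K=1, OF assms(3)[unfolded null_eq_def]])
      (use assms p_abs_diff in \<open>auto intro!: always_eventually\<close>)
  then show ?thesis using tendsto_diff[OF assms(4)] by fastforce
qed

lemma nrm_cls: assumes "X \<in> cs" shows "(\<lambda>n. p (X n)) \<longlonglongrightarrow> nrm C (cls X)"
proof -
  obtain l where l: "(\<lambda>n. p (X n)) \<longlonglongrightarrow> l" using p_convergent[OF assms] by (auto simp: convergent_def)
  have "nrm C (cls X) = (THE l. \<forall>Y \<in> cls X. (\<lambda>n. p (Y n)) \<longlonglongrightarrow> l)" by (simp add: completion_def)
  also have "\<dots> = l"
  proof (rule the_equality)
    show "\<forall>Y \<in> cls X. (\<lambda>n. p (Y n)) \<longlonglongrightarrow> l" using null_eq_tendsto assms l by (auto simp: mem_cls)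
    fix l' assume "\<forall>Y \<in> cls X. (\<lambda>n. p (Y n)) \<longlonglongrightarrow> l'"
    then have "(\<lambda>n. p (X n)) \<longlonglongrightarrow> l'" using assms by (simp add: mem_cls null_eq_refl)
    then show "l' = l" using l LIMSEQ_unique by blast
  qed
  finally show ?thesis using l by simp
qed

lemma nrm_cls_eqI: "X \<in> cs \<Longrightarrow> (\<lambda>n. p (X n)) \<longlonglongrightarrow> l \<Longrightarrow> nrm C (cls X) = l"
  using nrm_cls LIMSEQ_unique by blast

lemma nrm_embed: "a \<in> carrier A \<Longrightarrow> nrm C (embed A p a) = p a"
  unfolding embed_def by (rule nrm_cls_eqI) (auto intro: cs_const)

lemma ring_completion: "ring C"
proof (rule ringI)
  show "abelian_group C"
  proof (rule abelian_groupI)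
    fix P assume "P \<in> carrier C"
    then obtain X where X: "X \<in> cs" "P = cls X" by (rule CE)
    show "\<exists>Q\<in>carrier C. Q \<oplus>\<^bsub>C\<^esub> P = \<zero>\<^bsub>C\<^esub>"
    proof (intro bexI)
      have "cls (\<lambda>n. (-1) \<odot> X n) \<oplus>\<^bsub>C\<^esub> P = cls (\<lambda>n. (-1) \<odot> X n \<oplus> X n)"
        using X by (simp add: cls_add)
      also have "\<dots> = \<zero>\<^bsub>C\<^esub>" using X by (simp add: zero_C smult_minus_1 l_neg)
      finally show "cls (\<lambda>n. (-1) \<odot> X n) \<oplus>\<^bsub>C\<^esub> P = \<zero>\<^bsub>C\<^esub>" .
    qed (use X in simp)
  qed (auto elim!: CE simp: cls_add zero_C a_ac cs_const)
  show "monoid C"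
    by (rule monoidI) (auto elim!: CE simp: cls_mult one_C m_assoc cs_const)
qed (auto elim!: CE simp: cls_mult cls_add l_distr r_distr)

lemma star_algebra_completion: "star_algebra C"
  by (rule star_algebraI[OF ring_completion])
    (auto elim!: CE simp: cls_mult cls_add cls_smult cls_star smult_add_left smult_add_right
      smult_smult smult_mult_left smult_mult_right star_star star_add star_smult star_mult)

interpretation C: star_algebra C by (rule star_algebra_completion)

lemma cls_minus: assumes "X \<in> cs" "Y \<in> cs" shows "cls X \<ominus>\<^bsub>C\<^esub> cls Y = cls (\<lambda>n. X n \<ominus> Y n)"
proof -
  have "cls X \<ominus>\<^bsub>C\<^esub> cls Y = cls X \<oplus>\<^bsub>C\<^esub> (-1) \<odot>\<^bsub>C\<^esub> cls Y"
    using assms by (simp add: C.smult_minus_1 C.minus_eq)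
  also have "\<dots> = cls (\<lambda>n. X n \<oplus> (-1) \<odot> Y n)"
    using assms by (simp only: cls_add cls_smult cs_smult)
  finally show ?thesis using assms by (simp add: smult_minus_1 minus_eq)
qed

lemma seminorm_completion: "cstar_seminorm C (nrm C)"
  unfolding cstar_seminorm_def
proof (intro conjI ballI allI)
  fix P assume "P \<in> carrier C"
  then obtain X where X: "X \<in> cs" "P = cls X" by (rule CE)
  note lX = nrm_cls[OF X(1)]
  show "0 \<le> nrm C P" using X LIMSEQ_le_const[OF lX] by auto
  show "nrm C (c \<odot>\<^bsub>C\<^esub> P) = cmod c * nrm C P" for c
    using X by (auto simp: cls_smult p_smult intro!: nrm_cls_eqI tendsto_intros lX)
  show "nrm C (star C P \<otimes>\<^bsub>C\<^esub> P) = (nrm C P)\<^sup>2"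
    using X by (auto simp: cls_mult cls_star p_cstar intro!: nrm_cls_eqI tendsto_intros lX)
  fix Q assume "Q \<in> carrier C"
  then obtain Y where Y: "Y \<in> cs" "Q = cls Y" by (rule CE)
  note lY = nrm_cls[OF Y(1)]
  show "nrm C (P \<oplus>\<^bsub>C\<^esub> Q) \<le> nrm C P + nrm C Q"
    unfolding X Y cls_add[OF X(1) Y(1)]
    using X Y by (intro LIMSEQ_le[OF nrm_cls tendsto_add[OF lX lY]]) (auto simp: p_add)
  show "nrm C (P \<otimes>\<^bsub>C\<^esub> Q) \<le> nrm C P * nrm C Q"
    unfolding X Y cls_mult[OF X(1) Y(1)]
    using X Y by (intro LIMSEQ_le[OF nrm_cls tendsto_mult[OF lX lY]]) (auto simp: p_mult)
qed

lemma nrm_completion_eq_0: assumes "P \<in> carrier C" "nrm C P = 0" shows "P = \<zero>\<^bsub>C\<^esub>"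
proof -
  obtain X where X: "X \<in> cs" "P = cls X" using assms(1) by (rule CE)
  then show ?thesis using assms(2) nrm_cls[OF X(1)] by (simp add: zero_C cls_eq_iff null_eq_def cs_const)
qed

lemma embed_in [simp]: "a \<in> carrier A \<Longrightarrow> embed A p a \<in> carrier C"
  by (simp add: embed_def cs_const)

text \<open>Density of the image of \<open>A\<close>: the distance from the class of
  \<open>X\<close> to the constant class of \<open>X m\<close> is the limit over \<open>n\<close> of
  \<open>p (X m \<ominus> X n)\<close>.\<close>

lemma tendsto_embed:
  assumes X: "X \<in> cs" shows "tends_to C (nrm C) (\<lambda>n. embed A p (X n)) (cls X)"
  unfolding tends_to_def
proof (rule LIMSEQ_I)
  fix e :: real assume e: "e > 0"
  obtain N where N: "\<forall>m\<ge>N. \<forall>n\<ge>N. p (X m \<ominus> X n) < e / 2" using csD[OF X, of "e/2"] e by auto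
  have "norm (nrm C (embed A p (X m) \<ominus>\<^bsub>C\<^esub> cls X) - 0) < e" if "m \<ge> N" for m
  proof -
    have *: "(\<lambda>n. X m \<ominus> X n) \<in> cs" using X by (intro cs_minus cs_const) auto
    have "nrm C (cls (\<lambda>n. X m \<ominus> X n)) \<le> e / 2"
      using N that by (intro LIMSEQ_le_const2[OF nrm_cls[OF *]]) (auto intro!: exI[of _ N] less_imp_le)
    moreover have "embed A p (X m) \<ominus>\<^bsub>C\<^esub> cls X = cls (\<lambda>n. X m \<ominus> X n)"
      using X by (simp add: embed_def cls_minus cs_const)
    moreover have "0 \<le> nrm C (cls (\<lambda>n. X m \<ominus> X n))"
      using seminorm_completion * by (simp add: cstar_seminorm_def)
    ultimately show ?thesis using e by simp
  qed
  then show "\<exists>N. \<forall>n\<ge>N. norm (nrm C (embed A p (X n) \<ominus>\<^bsub>C\<^esub> cls X) - 0) < e" by blast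
qed

lemma star_hom_embed: "star_hom A C (embed A p)"
  unfolding star_hom_def
  by (auto intro!: ring_hom_memI simp: embed_def cls_mult cls_add cls_smult cls_star one_C cs_const)

lemma cstar_subalgebra_completion:
  assumes S: "cstar_subalgebra S C" and emb: "\<And>a. a \<in> carrier A \<Longrightarrow> embed A p a \<in> S"
  shows "S = carrier C"
proof
  show "carrier C \<subseteq> S"
  proof
    fix P assume "P \<in> carrier C"
    then obtain X where X: "X \<in> cs" "P = cls X" by (rule CE)
    have "\<And>n. embed A p (X n) \<in> S" using X emb by simp
    with S tendsto_embed[OF X(1)] X show "P \<in> S"
      unfolding cstar_subalgebra_def by (metis cls_in_C)
  qed
qed (use S in \<open>simp add: cstar_subalgebra_def\<close>)

theorem unital_cstar_completion: "unital_cstar_algebra C"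
proof (intro unital_cstar_algebra.intro unital_cstar_algebra_axioms.intro star_algebra_completion
    seminorm_completion nrm_completion_eq_0)
  interpret N: cstar_seminormed_algebra C "nrm C"
    by (intro cstar_seminormed_algebra.intro star_algebra_completion
        cstar_seminormed_algebra_axioms.intro seminorm_completion)
  fix P assume P: "P \<in> cauchy_seqs C (nrm C)"
  \<comment> \<open>By density each \<open>P n\<close> is within \<open>1 / (n + 1)\<close> of a
    constant class. These approximants form a Cauchy sequence in \<open>A\<close> itself, and its
    class is the limit of \<open>P\<close>.\<close>
  have "\<exists>a \<in> carrier A. nrm C (P n \<ominus>\<^bsub>C\<^esub> embed A p a) < inverse (real (Suc n))" for n
  proof -
    obtain X where X: "X \<in> cs" "P n = cls X" using P by (meson CE N.cs_in)
    have "\<forall>\<^sub>F k in sequentially. nrm C (embed A p (X k) \<ominus>\<^bsub>C\<^esub> cls X) < inverse (real (Suc n))"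
      using tendsto_embed[OF X(1)] unfolding tends_to_def by (rule order_tendstoD) simp
    then obtain k where "nrm C (embed A p (X k) \<ominus>\<^bsub>C\<^esub> cls X) < inverse (real (Suc n))"
      by (auto simp: eventually_sequentially)
    then show ?thesis using X by (intro bexI[of _ "X k"]) (auto simp: N.p_minus_commute)
  qed
  then obtain Z where Z: "\<And>n. Z n \<in> carrier A"
      "\<And>n. nrm C (P n \<ominus>\<^bsub>C\<^esub> embed A p (Z n)) < inverse (real (Suc n))"
    by metis
  have lim: "(\<lambda>n. nrm C (P n \<ominus>\<^bsub>C\<^esub> embed A p (Z n))) \<longlonglongrightarrow> 0"
    by (rule tendsto_sandwich[OF _ _ tendsto_const LIMSEQ_inverse_real_of_nat])
      (use P Z in \<open>auto intro!: always_eventually less_imp_le\<close>)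
  have pZ: "p (Z m \<ominus> Z n) = nrm C (embed A p (Z m) \<ominus>\<^bsub>C\<^esub> embed A p (Z n))" for m n
    using Z by (simp add: embed_def cls_minus cs_const flip: nrm_embed)
  have Zcs: "Z \<in> cs"
    unfolding cauchy_seqs_def
  proof (intro CollectI conjI allI impI Z)
    fix \<epsilon> :: real assume e: "\<epsilon> > 0"
    obtain N1 where N1: "\<forall>m\<ge>N1. \<forall>n\<ge>N1. nrm C (P m \<ominus>\<^bsub>C\<^esub> P n) < \<epsilon> / 3" using N.csD[OF P, of "\<epsilon>/3"] e by auto
    have "\<forall>\<^sub>F n in sequentially. nrm C (P n \<ominus>\<^bsub>C\<^esub> embed A p (Z n)) < \<epsilon> / 3"
      using lim by (rule order_tendstoD) (use e in simp)
    then obtain N2 where N2: "\<And>n. n \<ge> N2 \<Longrightarrow> nrm C (P n \<ominus>\<^bsub>C\<^esub> embed A p (Z n)) < \<epsilon> / 3"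
      by (auto simp: eventually_sequentially)
    have "p (Z m \<ominus> Z n) < \<epsilon>" if "m \<ge> max N1 N2" "n \<ge> max N1 N2" for m n
    proof -
      let ?e = "\<lambda>n. embed A p (Z n)"
      have c: "?e k \<in> carrier C" "P k \<in> carrier C" for k using Z P by auto
      have "nrm C (?e m \<ominus>\<^bsub>C\<^esub> ?e n) \<le> nrm C (?e m \<ominus>\<^bsub>C\<^esub> P m) + (nrm C (P m \<ominus>\<^bsub>C\<^esub> P n) + nrm C (P n \<ominus>\<^bsub>C\<^esub> ?e n))"
        using N.p_triangle[OF c(1)[of m] c(2)[of m] c(1)[of n]] N.p_triangle[OF c(2)[of m] c(2)[of n] c(1)[of n]]
        by linarith
      also have "\<dots> < \<epsilon> / 3 + (\<epsilon> / 3 + \<epsilon> / 3)"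
        using N1 N2[of m] N2[of n] that N.p_minus_commute[OF c(1)[of m] c(2)[of m]]
        by (intro add_strict_mono) auto
      finally show ?thesis by (simp add: pZ)
    qed
    then show "\<exists>N. \<forall>m\<ge>N. \<forall>n\<ge>N. p (Z m \<ominus> Z n) < \<epsilon>" by blast
  qed
  have "tends_to C (nrm C) P (cls Z)"
    unfolding tends_to_def
  proof (rule tendsto_sandwich[OF _ _ tendsto_const])
    show "(\<lambda>n. nrm C (P n \<ominus>\<^bsub>C\<^esub> embed A p (Z n)) + nrm C (embed A p (Z n) \<ominus>\<^bsub>C\<^esub> cls Z)) \<longlonglongrightarrow> 0"
      using tendsto_add[OF lim tendsto_embed[OF Zcs, unfolded tends_to_def]] by simp
  qed (use P Z Zcs N.p_triangle in \<open>auto intro!: always_eventually\<close>)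
  then show "\<exists>x\<in>carrier C. tends_to C (nrm C) P x" using Zcs by auto
qed

end

section \<open>Maps between completions\<close>

definition contraction ::
    "('a, 'm) star_algebra_scheme \<Rightarrow> ('a \<Rightarrow> real) \<Rightarrow> ('b, 'n) star_algebra_scheme \<Rightarrow> ('b \<Rightarrow> real) \<Rightarrow> ('a \<Rightarrow> 'b) \<Rightarrow> bool" where
  "contraction A p B q g \<longleftrightarrow> star_hom A B g \<and> (\<forall>a \<in> carrier A. q (g a) \<le> p a)"

definition completion_map ::
    "('b, 'n) star_algebra_scheme \<Rightarrow> ('b \<Rightarrow> real) \<Rightarrow> ('a \<Rightarrow> 'b) \<Rightarrow> (nat \<Rightarrow> 'a) set \<Rightarrow> (nat \<Rightarrow> 'b) set" where
  "completion_map B q g P = (\<Union>X \<in> P. cauchy_class B q (\<lambda>n. g (X n)))"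

lemma star_homD:
  assumes "star_hom A B g"
  shows "x \<in> carrier A \<Longrightarrow> g x \<in> carrier B"
    and "x \<in> carrier A \<Longrightarrow> y \<in> carrier A \<Longrightarrow> g (x \<oplus>\<^bsub>A\<^esub> y) = g x \<oplus>\<^bsub>B\<^esub> g y"
    and "x \<in> carrier A \<Longrightarrow> y \<in> carrier A \<Longrightarrow> g (x \<otimes>\<^bsub>A\<^esub> y) = g x \<otimes>\<^bsub>B\<^esub> g y"
    and "g \<one>\<^bsub>A\<^esub> = \<one>\<^bsub>B\<^esub>"
    and "x \<in> carrier A \<Longrightarrow> g (c \<odot>\<^bsub>A\<^esub> x) = c \<odot>\<^bsub>B\<^esub> g x"
    and "x \<in> carrier A \<Longrightarrow> g (star A x) = star B (g x)"
  using assms by (auto simp: star_hom_def ring_hom_def)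

lemma star_homI:
  assumes "\<And>x. x \<in> carrier A \<Longrightarrow> g x \<in> carrier B"
    and "\<And>x y. x \<in> carrier A \<Longrightarrow> y \<in> carrier A \<Longrightarrow> g (x \<oplus>\<^bsub>A\<^esub> y) = g x \<oplus>\<^bsub>B\<^esub> g y"
    and "\<And>x y. x \<in> carrier A \<Longrightarrow> y \<in> carrier A \<Longrightarrow> g (x \<otimes>\<^bsub>A\<^esub> y) = g x \<otimes>\<^bsub>B\<^esub> g y"
    and "g \<one>\<^bsub>A\<^esub> = \<one>\<^bsub>B\<^esub>"
    and "\<And>c x. x \<in> carrier A \<Longrightarrow> g (c \<odot>\<^bsub>A\<^esub> x) = c \<odot>\<^bsub>B\<^esub> g x"
    and "\<And>x. x \<in> carrier A \<Longrightarrow> g (star A x) = star B (g x)"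
  shows "star_hom A B g"
  using assms by (simp add: star_hom_def ring_hom_memI)

lemma star_hom_comp:
  assumes "star_hom A B g" "star_hom B C h" shows "star_hom A C (h \<circ> g)"
  by (rule star_homI) (simp_all add: star_homD[OF assms(1)] star_homD[OF assms(2)])

lemma star_hom_minus:
  assumes "star_algebra A" "star_algebra B" and g: "star_hom A B g" and "x \<in> carrier A" "y \<in> carrier A"
  shows "g (x \<ominus>\<^bsub>A\<^esub> y) = g x \<ominus>\<^bsub>B\<^esub> g y"
proof -
  interpret A: star_algebra A by fact
  interpret B: star_algebra B by fact
  show ?thesis using assms
    by (simp add: A.minus_eq B.minus_eq star_homD[OF g] flip: A.smult_minus_1 B.smult_minus_1)
qed

lemma star_hom_zero:
  assumes "star_algebra A" "star_algebra B" and g: "star_hom A B g"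
  shows "g \<zero>\<^bsub>A\<^esub> = \<zero>\<^bsub>B\<^esub>"
  using star_homD(5)[OF g, of "\<one>\<^bsub>A\<^esub>" 0] star_homD(1,4)[OF g]
    star_algebra.smult_0[OF assms(1), of "\<one>\<^bsub>A\<^esub>"] star_algebra.smult_0[OF assms(2), of "\<one>\<^bsub>B\<^esub>"]
    ring.ring_simprules(6)[OF star_algebra.is_ring[OF assms(1)]] by metis

lemma star_hom_finsum:
  assumes "star_algebra A" "star_algebra B" and g: "star_hom A B g"
    and "finite I" "\<And>i. i \<in> I \<Longrightarrow> f i \<in> carrier A"
  shows "g (finsum A f I) = finsum B (\<lambda>i. g (f i)) I"
proof -
  interpret A: abelian_group A by (rule star_algebra.is_group[OF assms(1)])
  interpret B: abelian_group B by (rule star_algebra.is_group[OF assms(2)])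
  show ?thesis using assms(4,5)
    by (induction I) (auto simp: star_hom_zero[OF assms(1-3)] star_homD[OF g] Pi_def)
qed

locale contraction_pair = A: cstar_seminormed_algebra A p + B: cstar_seminormed_algebra B q
  for A :: "('a, 'm) star_algebra_scheme" and p and B :: "('b, 'n) star_algebra_scheme" and q +
  fixes g
  assumes contr: "contraction A p B q g"
begin

lemma hom: "star_hom A B g" and le: "a \<in> carrier A \<Longrightarrow> q (g a) \<le> p a"
  using contr by (auto simp: contraction_def)

lemma diff: "x \<in> carrier A \<Longrightarrow> y \<in> carrier A \<Longrightarrow> q (g x \<ominus>\<^bsub>B\<^esub> g y) \<le> p (x \<ominus>\<^bsub>A\<^esub> y)"
  using le[of "x \<ominus>\<^bsub>A\<^esub> y"] star_hom_minus[OF A.star_algebra_axioms B.star_algebra_axioms hom, of x y] by simp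

lemma cs_map: assumes X: "X \<in> A.cs" shows "(\<lambda>n. g (X n)) \<in> B.cs"
  unfolding cauchy_seqs_def
proof (intro CollectI conjI allI impI)
  fix \<epsilon> :: real assume "\<epsilon> > 0"
  then obtain N where "\<forall>m\<ge>N. \<forall>n\<ge>N. p (X m \<ominus>\<^bsub>A\<^esub> X n) < \<epsilon>" using A.csD[OF X] by blast
  then show "\<exists>N. \<forall>m\<ge>N. \<forall>n\<ge>N. q (g (X m) \<ominus>\<^bsub>B\<^esub> g (X n)) < \<epsilon>"
    using diff X by (meson A.cs_in order_le_less_trans)
qed (use X in \<open>simp add: star_homD[OF hom]\<close>)

lemma null_map: "X \<in> A.cs \<Longrightarrow> Y \<in> A.cs \<Longrightarrow> A.null_eq X Y \<Longrightarrow> B.null_eq (\<lambda>n. g (X n)) (\<lambda>n. g (Y n))"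
  unfolding A.null_eq_def B.null_eq_def
  by (rule tendsto_sandwich[OF _ _ tendsto_const, of _ _ _ "\<lambda>n. p (X n \<ominus>\<^bsub>A\<^esub> Y n)"])
    (auto intro!: always_eventually diff simp: star_homD[OF hom])

lemma map_cls: assumes "X \<in> A.cs" shows "completion_map B q g (A.cls X) = B.cls (\<lambda>n. g (X n))"
  unfolding completion_map_def
  by (rule A.UN_cls[OF assms]) (use assms in \<open>auto simp: B.cls_eq_iff cs_map null_map\<close>)

lemma map_embed: "a \<in> carrier A \<Longrightarrow> completion_map B q g (embed A p a) = embed B q (g a)"
  by (simp add: embed_def map_cls A.cs_const)

lemma map_hom: "star_hom A.C B.C (completion_map B q g)"
  unfolding star_hom_def
  by (auto intro!: ring_hom_memI elim!: A.CE simp: map_cls cs_map A.cls_mult B.cls_mult A.cls_add B.cls_add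
      A.cls_smult B.cls_smult A.cls_star B.cls_star A.one_C B.one_C A.cs_const star_homD[OF hom])

lemma map_le: assumes "P \<in> carrier A.C" shows "nrm B.C (completion_map B q g P) \<le> nrm A.C P"
proof -
  obtain X where X: "X \<in> A.cs" "P = A.cls X" using assms by (rule A.CE)
  show ?thesis unfolding X(2) map_cls[OF X(1)]
    by (rule LIMSEQ_le[OF B.nrm_cls[OF cs_map[OF X(1)]] A.nrm_cls[OF X(1)]]) (use X le in auto)
qed

end

section \<open>Linear extensions and the free *-algebra\<close>

text \<open>Reduces statements about additive maps to monomials. The support bound \<open>S\<close>
  makes the rule usable relative to the carriers of free algebras and of formal tensors, where only
  monomials over \<open>S\<close> are well behaved.\<close>

lemma keys_induct_on [consumes 1, case_names zero single add]:
  fixes f :: "'m \<Rightarrow>\<^sub>0 'c::comm_monoid_add"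
  assumes "Poly_Mapping.keys f \<subseteq> S"
    and "P 0" and single: "\<And>w c. w \<in> S \<Longrightarrow> P (Poly_Mapping.single w c)"
    and add: "\<And>f g. \<lbrakk>Poly_Mapping.keys f \<subseteq> S; Poly_Mapping.keys g \<subseteq> S; P f; P g\<rbrakk> \<Longrightarrow> P (f + g)"
  shows "P f"
proof -
  have "P (\<Sum>w\<in>T. Poly_Mapping.single w (Poly_Mapping.lookup f w)) \<and>
      Poly_Mapping.keys (\<Sum>w\<in>T. Poly_Mapping.single w (Poly_Mapping.lookup f w)) \<subseteq> S"
    if "finite T" "T \<subseteq> S" for T
    using that
  proof (induction T)
    case (insert w T)
    let ?s = "Poly_Mapping.single w (Poly_Mapping.lookup f w)"
    have "Poly_Mapping.keys ?s \<subseteq> S" using insert.prems by simp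
    moreover from this have "Poly_Mapping.keys (?s + h) \<subseteq> S" if "Poly_Mapping.keys h \<subseteq> S" for h
      using that keys_add[of ?s h] by blast
    ultimately show ?case using insert single add by simp
  qed (use assms(2) in simp)
  moreover have "(\<Sum>w\<in>Poly_Mapping.keys f. Poly_Mapping.single w (Poly_Mapping.lookup f w)) = f"
    by (rule poly_mapping_eqI) (simp add: lookup_sum lookup_single when_def sum.delta in_keys_iff)
  ultimately show ?thesis using assms(1) finite_keys by metis
qed

lemma lookup_scale [simp]: "Poly_Mapping.lookup (scale c f) w = c * Poly_Mapping.lookup f w"
  by transfer (simp add: when_def)

lemma keys_scale: "Poly_Mapping.keys (scale c f) \<subseteq> Poly_Mapping.keys f"
  by (auto simp: in_keys_iff)

lemma scale_single [simp]: "scale c (Poly_Mapping.single w d) = Poly_Mapping.single w (c * d)"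
  by simp

lemma scale_add: "scale c (f + g) = scale c f + scale c g"
  by (rule poly_mapping_eqI) (simp add: lookup_add distrib_left)

lemma scale_diff: "scale c (f - g) = scale c f - scale c g"
  by (rule poly_mapping_eqI) (simp add: lookup_minus right_diff_distrib)

lemma scale_add_left: "scale (a + b) f = scale a f + scale b f"
  by (rule poly_mapping_eqI) (simp add: lookup_add distrib_right)

lemma scale_scale: "scale a (scale b f) = scale (a * b) f"
  by (rule poly_mapping_eqI) simp

lemma scale_1 [simp]: "scale 1 f = f"
  by (rule poly_mapping_eqI) simp

lemma scale_0 [simp]: "scale 0 f = 0"
  by (rule poly_mapping_eqI) simp

lemma scale_const_0 [simp]: "Poly_Mapping.map (\<lambda>a. 0) f = 0"
  by (simp add: map_eq_zero_iff)

lemma scale_zero [simp]: "scale c 0 = 0"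
  by (rule poly_mapping_eqI) simp

lemma scale_sum: "scale c (sum f I) = (\<Sum>i\<in>I. scale c (f i))"
  by (induction I rule: infinite_finite_induct) (auto simp: scale_add)

lemma scale_mult_left:
  fixes f :: "'m::monoid_add \<Rightarrow>\<^sub>0 complex" shows "scale c f * g = scale c (f * g)"
  by (simp add: mult_map_scale_conv_mult mult.assoc)

text \<open>Scaling is left multiplication by a constant monomial. Constants are central although
  the monoid of words is not commutative.\<close>

lemma scale_mult_right:
  fixes f :: "'m::monoid_add \<Rightarrow>\<^sub>0 complex" shows "f * scale c g = scale c (f * g)"
proof -
  have "f * Poly_Mapping.single 0 c = Poly_Mapping.single 0 c * f"
    by (induction f rule: keys_induct_on[OF subset_UNIV])
      (simp_all add: mult_single distrib_left distrib_right mult.commute[of c])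
  then show ?thesis by (metis mult_map_scale_conv_mult mult.assoc)
qed

lemma scale_minus_1: "scale (- 1) f = - f"
  by (rule poly_mapping_eqI) simp

lemma sum_keys_superset:
  assumes "\<And>w. g w 0 = 0" "finite S" "Poly_Mapping.keys f \<subseteq> S"
  shows "(\<Sum>w\<in>Poly_Mapping.keys f. g w (Poly_Mapping.lookup f w)) = (\<Sum>w\<in>S. g w (Poly_Mapping.lookup f w))"
  by (rule sum.mono_neutral_left) (use assms in \<open>auto simp: in_keys_iff\<close>)

lemma sum_keys_single:
  assumes "\<And>w. g w 0 = 0"
  shows "(\<Sum>w\<in>Poly_Mapping.keys (Poly_Mapping.single v c). g w (Poly_Mapping.lookup (Poly_Mapping.single v c) w)) = g v c"
  by (simp add: assms)

definition lin_ext :: "('m \<Rightarrow> 'n \<Rightarrow>\<^sub>0 complex) \<Rightarrow> ('m \<Rightarrow>\<^sub>0 complex) \<Rightarrow> 'n \<Rightarrow>\<^sub>0 complex" where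
  "lin_ext g f = (\<Sum>w\<in>Poly_Mapping.keys f. scale (Poly_Mapping.lookup f w) (g w))"

lemma lin_ext_single [simp]: "lin_ext g (Poly_Mapping.single w c) = scale c (g w)"
  unfolding lin_ext_def by (rule sum_keys_single) simp

lemma lin_ext_zero [simp]: "lin_ext g 0 = 0"
  by (simp add: lin_ext_def)

lemma lin_ext_add: "lin_ext g (f + h) = lin_ext g f + lin_ext g h"
  unfolding lin_ext_def by (rule setsum_keys_plus_distrib) (auto simp: scale_add_left)

lemma lin_ext_scale: "lin_ext g (scale c f) = scale c (lin_ext g f)"
  by (induction f rule: keys_induct_on[OF subset_UNIV])
    (simp_all add: scale_add lin_ext_add scale_scale)

lemma lin_ext_uminus: "lin_ext g (- f) = - lin_ext g f"
  using lin_ext_scale[of g "-1" f] by (simp only: scale_minus_1)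

lemma lin_ext_diff: "lin_ext g (f - h) = lin_ext g f - lin_ext g h"
  using lin_ext_add[of g f "- h"] by (simp add: lin_ext_uminus)

lemma lin_ext_sum: "lin_ext g (sum f I) = (\<Sum>i\<in>I. lin_ext g (f i))"
  by (induction I rule: infinite_finite_induct) (auto simp: lin_ext_add)

lemma conj_single [simp]: "conj_linear_ext \<sigma> (Poly_Mapping.single w c) = Poly_Mapping.single (\<sigma> w) (cnj c)"
  unfolding conj_linear_ext_def by (rule sum_keys_single) simp

lemma conj_zero [simp]: "conj_linear_ext \<sigma> 0 = 0"
  by (simp add: conj_linear_ext_def)

lemma conj_add: "conj_linear_ext \<sigma> (f + g) = conj_linear_ext \<sigma> f + conj_linear_ext \<sigma> g"
  unfolding conj_linear_ext_def by (rule setsum_keys_plus_distrib) (auto simp: single_add)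

lemma conj_scale: "conj_linear_ext \<sigma> (scale c f) = scale (cnj c) (conj_linear_ext \<sigma> f)"
  by (induction f rule: keys_induct_on[OF subset_UNIV]) (simp_all add: scale_add conj_add)

lemma conj_uminus: "conj_linear_ext \<sigma> (- f) = - conj_linear_ext \<sigma> f"
  using conj_scale[of \<sigma> "-1" f] by (simp only: scale_minus_1 complex_cnj_minus complex_cnj_one)

lemma conj_diff: "conj_linear_ext \<sigma> (f - g) = conj_linear_ext \<sigma> f - conj_linear_ext \<sigma> g"
  using conj_add[of \<sigma> f "- g"] by (simp add: conj_uminus)

lemma conj_sum: "conj_linear_ext \<sigma> (sum f I) = (\<Sum>i\<in>I. conj_linear_ext \<sigma> (f i))"
  by (induction I rule: infinite_finite_induct) (auto simp: conj_add)

lemma letter_star_star [simp]: "letter_star (letter_star l) = l"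
  by (cases l) auto

lemma word_star_star [simp]: "word_star (word_star w) = w"
  by (cases w) (simp add: word_star_def rev_map o_def)

lemma word_star_add: "word_star (v + w) = word_star w + word_star v"
  by (simp add: word_star_def plus_gen_word_def)

lemma word_star_zero [simp]: "word_star 0 = 0"
  by (simp add: word_star_def zero_gen_word_def)

lemma free_star_mult: "free_star (f * g) = free_star g * free_star f"
proof (induction f rule: keys_induct_on[OF subset_UNIV])
  case (2 w c)
  show ?case
    by (induction g rule: keys_induct_on[OF subset_UNIV])
      (simp_all add: mult_single word_star_add distrib_left distrib_right conj_add mult.commute)
qed (simp_all add: distrib_left distrib_right conj_add)

lemma free_star_star [simp]: "free_star (free_star f) = f"
  by (induction f rule: keys_induct_on[OF subset_UNIV]) (simp_all add: conj_add)

lemma free_star_one [simp]: "free_star 1 = 1"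
  by (metis complex_cnj_one conj_single single_one word_star_zero)

lemma set_gen_word_add [simp]: "set_gen_word (v + w) = set_gen_word v \<union> set_gen_word w"
  by (cases v; cases w) (auto simp: plus_gen_word_def)

lemma set_gen_word_zero [simp]: "set_gen_word 0 = {}"
  by (simp add: zero_gen_word_def)

lemma set_letter_star [simp]: "set_letter (letter_star l) = set_letter l"
  by (cases l) auto

lemma set_gen_word_star [simp]: "set_gen_word (word_star w) = set_gen_word w"
  by (cases w) (simp add: word_star_def)

abbreviation words_on :: "'x set \<Rightarrow> 'x gen_word set" where
  "words_on X \<equiv> {w. set_gen_word w \<subseteq> X}"

lemma free_carrier_iff: "f \<in> carrier (free_star_algebra X) \<longleftrightarrow> Poly_Mapping.keys f \<subseteq> words_on X"
  by (auto simp: free_star_algebra_def)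

lemma free_star_algebra_simps [simp]:
  "monoid.mult (free_star_algebra X) = (*)" "one (free_star_algebra X) = 1"
  "ring.zero (free_star_algebra X) = 0" "add (free_star_algebra X) = (+)"
  "smult (free_star_algebra X) = scale" "star (free_star_algebra X) = free_star"
  by (simp_all add: free_star_algebra_def)

lemma free_single [simp]: "set_gen_word w \<subseteq> X \<Longrightarrow> Poly_Mapping.single w c \<in> carrier (free_star_algebra X)"
  by (simp add: free_carrier_iff)

lemma free_add [simp]:
  "f \<in> carrier (free_star_algebra X) \<Longrightarrow> g \<in> carrier (free_star_algebra X) \<Longrightarrow> f + g \<in> carrier (free_star_algebra X)"
  using keys_add[of f g] unfolding free_carrier_iff by blast

lemma free_zero [simp]: "0 \<in> carrier (free_star_algebra X)"
  by (simp add: free_carrier_iff)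

lemma free_one [simp]: "1 \<in> carrier (free_star_algebra X)"
  by (simp add: free_carrier_iff)

lemma free_induct [consumes 1, case_names zero single add]:
  assumes "f \<in> carrier (free_star_algebra X)" "P 0"
    and "\<And>w c. set_gen_word w \<subseteq> X \<Longrightarrow> P (Poly_Mapping.single w c)"
    and "\<And>f g. \<lbrakk>f \<in> carrier (free_star_algebra X); g \<in> carrier (free_star_algebra X); P f; P g\<rbrakk> \<Longrightarrow> P (f + g)"
  shows "P f"
  by (rule keys_induct_on[of f "words_on X" P]) (use assms in \<open>auto simp: free_carrier_iff\<close>)

lemma free_scale [simp]: "f \<in> carrier (free_star_algebra X) \<Longrightarrow> scale c f \<in> carrier (free_star_algebra X)"
  unfolding free_carrier_iff by (rule order_trans[OF keys_scale])

lemma free_uminus [simp]: "f \<in> carrier (free_star_algebra X) \<Longrightarrow> - f \<in> carrier (free_star_algebra X)"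
  using free_scale[of f X "-1"] by (simp only: scale_minus_1)

lemma free_diff [simp]:
  "f \<in> carrier (free_star_algebra X) \<Longrightarrow> g \<in> carrier (free_star_algebra X) \<Longrightarrow> f - g \<in> carrier (free_star_algebra X)"
  using free_add[of f X "- g"] by simp

lemma free_sum [simp]:
  "(\<And>i. i \<in> I \<Longrightarrow> f i \<in> carrier (free_star_algebra X)) \<Longrightarrow> sum f I \<in> carrier (free_star_algebra X)"
  by (induction I rule: infinite_finite_induct) auto

lemma free_mult [simp]:
  "f \<in> carrier (free_star_algebra X) \<Longrightarrow> g \<in> carrier (free_star_algebra X) \<Longrightarrow> f * g \<in> carrier (free_star_algebra X)"
  using keys_mult[of f g] unfolding free_carrier_iff by fastforce

lemma free_star_in [simp]: "f \<in> carrier (free_star_algebra X) \<Longrightarrow> free_star f \<in> carrier (free_star_algebra X)"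
  by (induction rule: free_induct) (auto simp: conj_add)

lemma free_gen [simp]: "x \<in> X \<Longrightarrow> gen x \<in> carrier (free_star_algebra X)"
  by (simp add: gen_def)

lemma star_algebra_free: "star_algebra (free_star_algebra X)"
proof (rule star_algebraI)
  show "ring (free_star_algebra X)"
  proof (rule ringI)
    show "abelian_group (free_star_algebra X)"
    proof (rule abelian_groupI)
      fix x assume "x \<in> carrier (free_star_algebra X)"
      then show "\<exists>y\<in>carrier (free_star_algebra X). y \<oplus>\<^bsub>free_star_algebra X\<^esub> x = \<zero>\<^bsub>free_star_algebra X\<^esub>"
        by (intro bexI[of _ "- x"]) auto
    qed (auto simp: add.assoc add.commute)
    show "monoid (free_star_algebra X)"
      by (rule monoidI) (auto simp: mult.assoc)
  qed (auto simp: distrib_left distrib_right)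
qed (auto simp: scale_add scale_add_left scale_scale scale_mult_left scale_mult_right conj_add
    conj_scale free_star_mult)

lemma free_minus [simp]:
  "f \<in> carrier (free_star_algebra X) \<Longrightarrow> g \<in> carrier (free_star_algebra X) \<Longrightarrow> f \<ominus>\<^bsub>free_star_algebra X\<^esub> g = f - g"
  using star_algebra.minus_eq[OF star_algebra_free, where x=f and y=g]
    star_algebra.smult_minus_1[OF star_algebra_free, where x=g, symmetric]
  by (simp only: free_star_algebra_simps scale_minus_1 diff_conv_add_uminus)

section \<open>Substitution: the universal property of the free *-algebra\<close>

fun letter_val :: "('x \<Rightarrow> 'y free_algebra) \<Rightarrow> 'x letter \<Rightarrow> 'y free_algebra" where
  "letter_val \<sigma> (Gen x) = \<sigma> x"
| "letter_val \<sigma> (Adj x) = free_star (\<sigma> x)"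

definition word_val :: "('x \<Rightarrow> 'y free_algebra) \<Rightarrow> 'x gen_word \<Rightarrow> 'y free_algebra" where
  "word_val \<sigma> w = prod_list (map (letter_val \<sigma>) (letters w))"

definition subst :: "('x \<Rightarrow> 'y free_algebra) \<Rightarrow> 'x free_algebra \<Rightarrow> 'y free_algebra" where
  "subst \<sigma> = lin_ext (word_val \<sigma>)"

lemma word_val_add: "word_val \<sigma> (v + w) = word_val \<sigma> v * word_val \<sigma> w"
  by (simp add: word_val_def plus_gen_word_def)

lemma word_val_zero [simp]: "word_val \<sigma> 0 = 1"
  by (simp add: word_val_def zero_gen_word_def)

lemma letter_val_star: "letter_val \<sigma> (letter_star l) = free_star (letter_val \<sigma> l)"
  by (cases l) auto

lemma word_val_star: "word_val \<sigma> (word_star w) = free_star (word_val \<sigma> w)"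
proof -
  have "prod_list (map (letter_val \<sigma>) (rev (map letter_star ls))) = free_star (prod_list (map (letter_val \<sigma>) ls))" for ls
    by (induction ls) (auto simp: free_star_mult letter_val_star)
  then show ?thesis by (simp add: word_val_def word_star_def)
qed

lemma subst_simps [simp]:
  "subst \<sigma> (Poly_Mapping.single w c) = scale c (word_val \<sigma> w)"
  "subst \<sigma> 0 = 0" "subst \<sigma> (f + g) = subst \<sigma> f + subst \<sigma> g" "subst \<sigma> (f - g) = subst \<sigma> f - subst \<sigma> g"
  "subst \<sigma> (sum h I) = (\<Sum>i\<in>I. subst \<sigma> (h i))" "subst \<sigma> (scale c f) = scale c (subst \<sigma> f)"
  by (simp_all add: subst_def lin_ext_add lin_ext_diff lin_ext_sum lin_ext_scale del: map_eq_zero_iff)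

lemma subst_gen [simp]: "subst \<sigma> (gen x) = \<sigma> x"
  by (simp add: gen_def word_val_def)

lemma subst_one [simp]: "subst \<sigma> 1 = 1"
  by (metis scale_1 single_one subst_simps(1) word_val_zero)

lemma subst_mult [simp]: "subst \<sigma> (f * g) = subst \<sigma> f * subst \<sigma> g"
proof (induction f rule: keys_induct_on[OF subset_UNIV])
  case (2 w c)
  show ?case
    by (induction g rule: keys_induct_on[OF subset_UNIV])
      (simp_all add: mult_single word_val_add distrib_left scale_mult_left scale_mult_right scale_scale mult.commute)
qed (simp_all add: distrib_right)

lemma subst_star [simp]: "subst \<sigma> (free_star f) = free_star (subst \<sigma> f)"
  by (induction f rule: keys_induct_on[OF subset_UNIV]) (simp_all add: conj_add conj_scale word_val_star)

lemma word_val_in: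
  assumes "set_gen_word w \<subseteq> X" "\<And>x. x \<in> X \<Longrightarrow> \<sigma> x \<in> carrier (free_star_algebra Y)"
  shows "word_val \<sigma> w \<in> carrier (free_star_algebra Y)"
proof -
  have "prod_list (map (letter_val \<sigma>) ls) \<in> carrier (free_star_algebra Y)" if "(\<Union>l\<in>set ls. set_letter l) \<subseteq> X" for ls
    using that
  proof (induction ls)
    case (Cons l ls)
    have "letter_val \<sigma> l \<in> carrier (free_star_algebra Y)" using Cons.prems assms(2) by (cases l) auto
    then show ?case using Cons by simp
  qed simp
  then show ?thesis using assms(1) by (cases w) (simp add: word_val_def)
qed

lemma subst_in:
  assumes "f \<in> carrier (free_star_algebra X)" "\<And>x. x \<in> X \<Longrightarrow> \<sigma> x \<in> carrier (free_star_algebra Y)"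
  shows "subst \<sigma> f \<in> carrier (free_star_algebra Y)"
  using assms(1) by (induction rule: free_induct) (auto intro!: free_scale[OF word_val_in] assms(2))

lemma star_hom_subst:
  assumes "\<And>x. x \<in> X \<Longrightarrow> \<sigma> x \<in> carrier (free_star_algebra Y)"
  shows "star_hom (free_star_algebra X) (free_star_algebra Y) (subst \<sigma>)"
  by (rule star_homI) (auto intro: subst_in assms)

section \<open>The universal C*-seminorm\<close>

lemma cstar_seminorm_pullback:
  assumes "star_algebra A" and g: "star_hom A B g" and q: "cstar_seminorm B q"
  shows "cstar_seminorm A (\<lambda>x. q (g x))"
  using q star_homD[OF g] star_algebra.star_closed[OF assms(1)] unfolding cstar_seminorm_def by auto

text \<open>A bound on each generator, uniform over all seminorms that kill \<open>R\<close>, is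
  what makes the supremum in \<open>universal_norm\<close> finite on the whole carrier.\<close>

definition bounded_presentation :: "'x set \<Rightarrow> 'x free_algebra set \<Rightarrow> bool" where
  "bounded_presentation X R \<longleftrightarrow> R \<subseteq> carrier (free_star_algebra X) \<and>
    (\<forall>x\<in>X. \<exists>K. \<forall>p. cstar_seminorm (free_star_algebra X) p \<and> (\<forall>r\<in>R. p r = 0) \<longrightarrow> p (gen x) \<le> K)"

locale presentation =
  fixes X :: "'x set" and R :: "'x free_algebra set"
  assumes bdd: "bounded_presentation X R"
begin

abbreviation "F \<equiv> free_star_algebra X"

definition admissible :: "('x free_algebra \<Rightarrow> real) \<Rightarrow> bool" where
  "admissible p \<longleftrightarrow> cstar_seminorm F p \<and> (\<forall>r\<in>R. p r = 0)"

lemma admissible_locale: "admissible p \<Longrightarrow> cstar_seminormed_algebra F p"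
  by (intro cstar_seminormed_algebra.intro star_algebra_free cstar_seminormed_algebra_axioms.intro)
    (simp add: admissible_def)

text \<open>The bounds pass from generators to adjoints because the star is isometric, and to words
  by submultiplicativity; linear combinations follow by the triangle inequality.\<close>

lemma word_bounded:
  assumes "set_gen_word w \<subseteq> X" shows "\<exists>K. \<forall>p. admissible p \<longrightarrow> p (Poly_Mapping.single w 1) \<le> K"
proof -
  have letter: "\<exists>K. \<forall>p. admissible p \<longrightarrow> p (Poly_Mapping.single (Word [l]) 1) \<le> K" if "set_letter l \<subseteq> X" for l
  proof (cases l)
    case (Gen x)
    then show ?thesis using bdd that by (auto simp: bounded_presentation_def admissible_def gen_def)
  next
    case (Adj x)
    then have "x \<in> X" using that by simp
    then obtain K where K: "\<forall>p. admissible p \<longrightarrow> p (gen x) \<le> K"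
      using bdd unfolding bounded_presentation_def admissible_def by blast
    have "p (Poly_Mapping.single (Word [l]) 1) \<le> K" if "admissible p" for p
      using K[rule_format, OF that] cstar_seminormed_algebra.p_star[OF admissible_locale[OF that], of "gen x"] \<open>set_letter l \<subseteq> X\<close> Adj
      by (simp add: gen_def word_star_def)
    then show ?thesis by blast
  qed
  have "\<exists>K. \<forall>p. admissible p \<longrightarrow> p (Poly_Mapping.single (Word ls) 1) \<le> K" if "(\<Union>l\<in>set ls. set_letter l) \<subseteq> X" for ls
    using that
  proof (induction ls)
    case Nil
    \<comment> \<open>The empty word is the unit, and \<open>p 1\<close> equals its own square, so
      it is 0 or 1.\<close>
    have "p (Poly_Mapping.single (Word []) 1) \<le> 1" if "admissible p" for p
    proof -
      interpret cstar_seminormed_algebra F p by (rule admissible_locale[OF that])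
      have "(p 1)\<^sup>2 = p 1" using p_cstar[of 1] by simp
      then show ?thesis by (auto simp: power2_eq_square zero_gen_word_def[symmetric])
    qed
    then show ?case by blast
  next
    case (Cons l ls)
    obtain K1 where K1: "\<And>p. admissible p \<Longrightarrow> p (Poly_Mapping.single (Word [l]) 1) \<le> K1"
      using letter[of l] Cons.prems by auto
    obtain K2 where K2: "\<And>p. admissible p \<Longrightarrow> p (Poly_Mapping.single (Word ls) 1) \<le> K2"
      using Cons by auto
    have "p (Poly_Mapping.single (Word (l # ls)) 1) \<le> \<bar>K1\<bar> * \<bar>K2\<bar>" if ap: "admissible p" for p
    proof -
      interpret cstar_seminormed_algebra F p by (rule admissible_locale[OF ap])
      have c: "Poly_Mapping.single (Word [l]) 1 \<in> carrier F" "Poly_Mapping.single (Word ls) 1 \<in> carrier F"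
        using Cons.prems by auto
      have "p (Poly_Mapping.single (Word (l # ls)) 1) = p (Poly_Mapping.single (Word [l]) 1 * Poly_Mapping.single (Word ls) 1)"
        by (simp add: mult_single plus_gen_word_def)
      also have "\<dots> \<le> p (Poly_Mapping.single (Word [l]) 1) * p (Poly_Mapping.single (Word ls) 1)"
        using p_mult[OF c] by simp
      also have "\<dots> \<le> \<bar>K1\<bar> * \<bar>K2\<bar>"
        using K1[OF ap] K2[OF ap] p_nonneg[OF c(1)] p_nonneg[OF c(2)] by (intro mult_mono) auto
      finally show ?thesis .
    qed
    then show ?case by blast
  qed
  then show ?thesis using assms by (cases w) auto
qed

lemma bounded: "f \<in> carrier F \<Longrightarrow> \<exists>K. \<forall>p. admissible p \<longrightarrow> p f \<le> K"
proof (induction rule: free_induct)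
  case zero
  have "p 0 \<le> 0" if "admissible p" for p
    using cstar_seminormed_algebra.p_zero[OF admissible_locale[OF that]] by simp
  then show ?case by blast
next
  case (single w c)
  then obtain K where K: "\<And>p. admissible p \<Longrightarrow> p (Poly_Mapping.single w 1) \<le> K" using word_bounded by blast
  have "p (Poly_Mapping.single w c) \<le> cmod c * K" if "admissible p" for p
    using cstar_seminormed_algebra.p_smult[OF admissible_locale[OF that], of "Poly_Mapping.single w 1" c] single
      mult_left_mono[OF K[OF that], of "cmod c"] by simp
  then show ?case by blast
next
  case (add f g)
  then obtain K L where KL: "\<And>p. admissible p \<Longrightarrow> p f \<le> K" "\<And>p. admissible p \<Longrightarrow> p g \<le> L" by blast
  have "p (f + g) \<le> K + L" if "admissible p" for p
    using cstar_seminormed_algebra.p_add[OF admissible_locale[OF that], of f g] add KL[OF that] by simp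
  then show ?case by blast
qed

abbreviation "u \<equiv> universal_norm X R"

lemma u_def: "u f = (SUP p\<in>Collect admissible. p f)"
  unfolding universal_norm_def by (rule arg_cong[of _ _ Sup]) (auto simp: admissible_def)

text \<open>Keeps the set under the supremum nonempty, and gives nonnegativity of the universal
  norm.\<close>

lemma admissible_zero: "admissible (\<lambda>f. 0)"
  by (simp add: admissible_def cstar_seminorm_def)

lemma le_u: assumes "admissible p" "f \<in> carrier F" shows "p f \<le> u f"
proof -
  obtain K where "\<And>p. admissible p \<Longrightarrow> p f \<le> K" using bounded[OF assms(2)] by blast
  then have "bdd_above ((\<lambda>p. p f) ` Collect admissible)" by (intro bdd_aboveI2[of _ _ K]) simp
  then show ?thesis unfolding u_def using assms by (intro cSUP_upper) auto
qed

lemma u_le: "(\<And>p. admissible p \<Longrightarrow> p f \<le> K) \<Longrightarrow> u f \<le> K"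
  unfolding u_def using admissible_zero by (intro cSUP_least) auto

lemma u_nonneg: "f \<in> carrier F \<Longrightarrow> 0 \<le> u f"
  using le_u[OF admissible_zero] by simp

lemma u_relation: "r \<in> R \<Longrightarrow> u r = 0"
  using u_le[of r 0] u_nonneg[of r] bdd by (force simp: bounded_presentation_def admissible_def)

text \<open>Suprema preserve every clause. Homogeneity is shown as an inequality and reversed with
  the scalar \<open>1 / c\<close>; for the C*-identity each admissible \<open>p f\<close> is at most
  the square root of the supremum at \<open>f* f\<close>.\<close>

lemma u_seminorm: "cstar_seminorm F u"
  unfolding cstar_seminorm_def
proof (intro conjI ballI allI)
  fix f assume f: "f \<in> carrier F"
  show "0 \<le> u f" by (rule u_nonneg[OF f])
  have le: "u (c \<odot>\<^bsub>F\<^esub> f) \<le> cmod c * u f" if f: "f \<in> carrier F" for c f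
  proof (rule u_le)
    fix p assume p: "admissible p"
    show "p (c \<odot>\<^bsub>F\<^esub> f) \<le> cmod c * u f"
      using cstar_seminormed_algebra.p_smult[OF admissible_locale[OF p] f] le_u[OF p f]
      by (simp add: mult_left_mono)
  qed
  show "u (c \<odot>\<^bsub>F\<^esub> f) = cmod c * u f" for c
  proof (cases "c = 0")
    case True
    then show ?thesis using le[OF f, of 0] u_nonneg[of 0] by simp
  next
    case False
    have "cmod c * u f \<le> cmod c * (cmod (1 / c) * u (c \<odot>\<^bsub>F\<^esub> f))"
      using le[of "c \<odot>\<^bsub>F\<^esub> f" "1 / c"] f False by (intro mult_left_mono) (auto simp: scale_scale)
    then show ?thesis using le[OF f, of c] False by (simp add: norm_divide)
  qed
  show "u (star F f \<otimes>\<^bsub>F\<^esub> f) = (u f)\<^sup>2"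
  proof (rule antisym)
    show "u (star F f \<otimes>\<^bsub>F\<^esub> f) \<le> (u f)\<^sup>2"
    proof (rule u_le)
      fix p assume p: "admissible p"
      interpret cstar_seminormed_algebra F p by (rule admissible_locale[OF p])
      show "p (star F f \<otimes>\<^bsub>F\<^esub> f) \<le> (u f)\<^sup>2"
        using p_cstar[OF f] le_u[OF p f] p_nonneg[OF f] by (simp add: power_mono)
    qed
    have "u f \<le> sqrt (u (star F f \<otimes>\<^bsub>F\<^esub> f))"
    proof (rule u_le)
      fix p assume p: "admissible p"
      interpret cstar_seminormed_algebra F p by (rule admissible_locale[OF p])
      show "p f \<le> sqrt (u (star F f \<otimes>\<^bsub>F\<^esub> f))"
        using p_cstar[OF f] le_u[OF p, of "star F f \<otimes>\<^bsub>F\<^esub> f"] f by (intro real_le_rsqrt) simp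
    qed
    then show "(u f)\<^sup>2 \<le> u (star F f \<otimes>\<^bsub>F\<^esub> f)"
      using power_mono[OF _ u_nonneg[OF f], of _ 2] u_nonneg[of "star F f \<otimes>\<^bsub>F\<^esub> f"] f by force
  qed
  fix g assume g: "g \<in> carrier F"
  show "u (f \<oplus>\<^bsub>F\<^esub> g) \<le> u f + u g"
  proof (rule u_le)
    fix p assume p: "admissible p"
    show "p (f \<oplus>\<^bsub>F\<^esub> g) \<le> u f + u g"
      using cstar_seminormed_algebra.p_add[OF admissible_locale[OF p] f g] le_u[OF p f] le_u[OF p g] by simp
  qed
  show "u (f \<otimes>\<^bsub>F\<^esub> g) \<le> u f * u g"
  proof (rule u_le)
    fix p assume p: "admissible p"
    interpret cstar_seminormed_algebra F p by (rule admissible_locale[OF p])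
    show "p (f \<otimes>\<^bsub>F\<^esub> g) \<le> u f * u g"
      using order_trans[OF p_mult[OF f g] mult_mono[OF le_u[OF p f] le_u[OF p g]]] f g u_nonneg by auto
  qed
qed

sublocale cstar_seminormed_algebra F u
  by (intro cstar_seminormed_algebra.intro star_algebra_free cstar_seminormed_algebra_axioms.intro u_seminorm)

text \<open>The universal property: the pullback of \<open>q\<close> along \<open>g\<close> is an
  admissible seminorm, hence lies below the supremum.\<close>

lemma universal_contraction:
  assumes "star_hom F B g" "cstar_seminorm B q" "\<And>r. r \<in> R \<Longrightarrow> q (g r) = 0"
  shows "contraction F u B q g"
  unfolding contraction_def using assms cstar_seminorm_pullback[OF star_algebra_free assms(1,2)]
  by (auto intro!: le_u[of "\<lambda>x. q (g x)"] simp: admissible_def)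

end

section \<open>Positive functionals\<close>

lemma of_real_cmod_sq: "(complex_of_real (cmod z))\<^sup>2 = z * cnj z"
  by (metis complex_norm_square of_real_power)

text \<open>Iterating the square inequality bounds the power \<open>2 ^ n\<close> of
  \<open>a 0 / D\<close> by \<open>a n / D\<close>, hence by \<open>K / D\<close> times the same
  power of \<open>W\<close>. The fixed factor cannot compensate exponential growth, so
  \<open>a 0 / D\<close> does not exceed \<open>W\<close>.\<close>

lemma iterated_cauchy_schwarz_bound:
  fixes a :: "nat \<Rightarrow> real"
  assumes sq: "\<And>n. (a n)\<^sup>2 \<le> a (Suc n) * D" and le: "\<And>n. a n \<le> K * W ^ (2 ^ n)"
    and D: "D \<ge> 0" and W: "W \<ge> 0"
  shows "a 0 \<le> W * D"
proof (cases "a 0 \<le> 0 \<or> D = 0 \<or> W = 0")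
  case True
  then consider "a 0 \<le> 0" | "D = 0" | "W = 0" by blast
  then show ?thesis
  proof cases
    case 3
    then have "a (Suc 0) * D \<le> 0" using le[of "Suc 0"] D by (simp add: mult_nonpos_nonneg)
    then have "(a 0)\<^sup>2 \<le> 0" using sq[of 0] by linarith
    then show ?thesis using 3 by simp
  qed (use D W sq[of 0] in \<open>auto simp: order_trans[OF _ mult_nonneg_nonneg]\<close>)
next
  case False
  then have pos: "a 0 > 0" "D > 0" "W > 0" using D W by auto
  have iter: "(a 0 / D) ^ (2 ^ n) \<le> a n / D" for n
  proof (induction n)
    case (Suc n)
    have "(a 0 / D) ^ (2 ^ Suc n) = ((a 0 / D) ^ (2 ^ n))\<^sup>2" by (simp add: power_mult[symmetric] mult.commute)
    also have "\<dots> \<le> (a n / D)\<^sup>2" using Suc pos by (intro power_mono) auto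
    also have "\<dots> \<le> a (Suc n) / D" using sq[of n] pos by (simp add: field_simps power2_eq_square)
    finally show ?case .
  qed simp
  define r where "r = a 0 / (D * W)"
  have r: "r ^ (2 ^ n) \<le> K / D" for n
  proof -
    have "r ^ (2 ^ n) = (a 0 / D) ^ (2 ^ n) / W ^ (2 ^ n)" by (simp add: r_def power_divide power_mult_distrib)
    also have "\<dots> \<le> (K * W ^ (2 ^ n) / D) / W ^ (2 ^ n)"
      using order_trans[OF iter[of n] divide_right_mono[OF le[of n], of D]] pos by (intro divide_right_mono) auto
    finally show ?thesis using pos by simp
  qed
  have "r \<le> 1"
  proof (rule ccontr)
    assume "\<not> r \<le> 1"
    then obtain n where n: "K / D < r ^ n" using real_arch_pow[of r "K / D"] by auto
    have "r ^ n \<le> r ^ (2 ^ n)" using \<open>\<not> r \<le> 1\<close> by (intro power_increasing) (auto intro: less_imp_le)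
    with n r[of n] show False by linarith
  qed
  then show ?thesis using pos by (simp add: r_def field_simps)
qed

definition nonneg :: "complex \<Rightarrow> bool" where
  "nonneg z \<longleftrightarrow> z \<in> \<real> \<and> 0 \<le> Re z"

lemma nonneg_sum: "(\<And>i. i \<in> I \<Longrightarrow> nonneg (f i)) \<Longrightarrow> nonneg (sum f I)"
  unfolding nonneg_def by (auto intro!: sum_in_Reals sum_nonneg)

lemma nonneg_eq: "nonneg z \<Longrightarrow> z = of_real (Re z)"
  by (auto simp: nonneg_def elim: Reals_cases)

text \<open>The discriminant of a nonnegative real quadratic in a complex variable, with the
  degenerate leading coefficient included.\<close>

lemma quadratic_form_bound:
  fixes b :: complex
  assumes pos: "\<And>c. 0 \<le> A + 2 * Re (c * b) + (cmod c)\<^sup>2 * C" and "C \<ge> 0" "A \<ge> 0"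
  shows "(cmod b)\<^sup>2 \<le> A * C"
proof (cases "C = 0")
  case True
  have "b = 0"
  proof (rule ccontr)
    assume b: "b \<noteq> 0"
    \<comment> \<open>Chosen so that the remaining affine expression takes the value -1.\<close>
    define t where "t = (A + 1) / (2 * (cmod b)\<^sup>2)"
    have "0 \<le> A + 2 * Re (of_real (- t) * cnj b * b)"
      using pos[of "of_real (- t) * cnj b"] True by simp
    also have "of_real (- t) * cnj b * b = of_real (- t * (cmod b)\<^sup>2)"
      by (simp add: of_real_cmod_sq mult.assoc mult.commute)
    also have "A + 2 * Re (of_real (- t * (cmod b)\<^sup>2)) = -1" using b by (simp add: t_def field_simps)
    finally show False by simp
  qed
  then show ?thesis using True by simp
next
  case False
  then have C: "C > 0" using assms(2) by simp
  \<comment> \<open>The minimiser of the quadratic, \<open>c = - cnj b / C\<close>.\<close>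
  have "0 \<le> A + 2 * Re (of_real (- 1 / C) * cnj b * b) + (cmod (of_real (- 1 / C) * cnj b))\<^sup>2 * C"
    by (rule pos)
  also have "of_real (- 1 / C) * cnj b * b = of_real (- (cmod b)\<^sup>2 / C)"
    by (simp add: of_real_cmod_sq mult.commute)
  also have "(cmod (of_real (- 1 / C) * cnj b))\<^sup>2 * C = (cmod b)\<^sup>2 / C"
  proof -
    have "cmod (of_real (- 1 / C) * cnj b) = cmod b / C" using C by (simp add: norm_divide)
    then show ?thesis using C by (simp add: power_divide power2_eq_square)
  qed
  finally show ?thesis using C by (simp add: field_simps)
qed

text \<open>The algebraic half of \<open>state\<close>. It makes sense on
  \<open>formal_tensors\<close>, which carry no norm and on which a normalisation is only imposed on
  vectors.\<close>

definition pos_functional :: "('a, 'm) star_algebra_scheme \<Rightarrow> ('a \<Rightarrow> complex) \<Rightarrow> bool" where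
  "pos_functional A \<omega> \<longleftrightarrow>
    (\<forall>x \<in> carrier A. \<forall>y \<in> carrier A. \<omega> (x \<oplus>\<^bsub>A\<^esub> y) = \<omega> x + \<omega> y) \<and>
    (\<forall>c. \<forall>x \<in> carrier A. \<omega> (c \<odot>\<^bsub>A\<^esub> x) = c * \<omega> x) \<and>
    (\<forall>x \<in> carrier A. nonneg (\<omega> (star A x \<otimes>\<^bsub>A\<^esub> x)))"

locale positive_functional = star_algebra A for A (structure) +
  fixes \<omega>
  assumes functional: "pos_functional A \<omega>"
begin

lemma f_add: "x \<in> carrier A \<Longrightarrow> y \<in> carrier A \<Longrightarrow> \<omega> (x \<oplus> y) = \<omega> x + \<omega> y"
  and f_smult: "x \<in> carrier A \<Longrightarrow> \<omega> (c \<odot> x) = c * \<omega> x"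
  and f_nonneg: "x \<in> carrier A \<Longrightarrow> nonneg (\<omega> (star A x \<otimes> x))"
  using functional by (auto simp: pos_functional_def)

lemma f_zero [simp]: "\<omega> \<zero> = 0"
  using f_smult[of \<zero> 0] by simp

definition sq :: "'a \<Rightarrow> real" where
  "sq x = Re (\<omega> (star A x \<otimes> x))"

lemma sq_nonneg [simp]: "x \<in> carrier A \<Longrightarrow> 0 \<le> sq x"
  using f_nonneg by (simp add: sq_def nonneg_def)

lemma f_sq: "x \<in> carrier A \<Longrightarrow> \<omega> (star A x \<otimes> x) = of_real (sq x)"
  using nonneg_eq[OF f_nonneg] by (simp add: sq_def)

lemma f_polar:
  assumes [simp]: "x \<in> carrier A" "y \<in> carrier A"
  shows "of_real (sq (x \<oplus> c \<odot> y)) = of_real (sq x) + c * \<omega> (star A x \<otimes> y) + cnj c * \<omega> (star A y \<otimes> x)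
    + of_real ((cmod c)\<^sup>2 * sq y)"
proof -
  have "star A (x \<oplus> c \<odot> y) \<otimes> (x \<oplus> c \<odot> y) =
      (star A x \<otimes> x \<oplus> cnj c \<odot> (star A y \<otimes> x)) \<oplus> (c \<odot> (star A x \<otimes> y) \<oplus> (c * cnj c) \<odot> (star A y \<otimes> y))"
    by (simp add: star_add star_smult l_distr r_distr smult_mult_left smult_mult_right smult_smult smult_add_right)
  then have "\<omega> (star A (x \<oplus> c \<odot> y) \<otimes> (x \<oplus> c \<odot> y)) =
      (\<omega> (star A x \<otimes> x) + cnj c * \<omega> (star A y \<otimes> x)) + (c * \<omega> (star A x \<otimes> y) + (c * cnj c) * \<omega> (star A y \<otimes> y))"
    by (simp add: f_add f_smult)
  then show ?thesis by (simp add: f_sq of_real_cmod_sq)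
qed

text \<open>The left side of the polarisation identity is real, so its imaginary part vanishes:
  \<open>c = 1\<close> compares the imaginary parts, \<open>c = \<i>\<close> the real parts.\<close>

lemma f_swap:
  assumes "x \<in> carrier A" "y \<in> carrier A"
  shows "\<omega> (star A y \<otimes> x) = cnj (\<omega> (star A x \<otimes> y))"
proof (rule complex_eqI)
  from arg_cong[OF f_polar[OF assms, of 1], of Im]
  show "Im (\<omega> (star A y \<otimes> x)) = Im (cnj (\<omega> (star A x \<otimes> y)))" by simp
  from arg_cong[OF f_polar[OF assms, of \<i>], of Im]
  show "Re (\<omega> (star A y \<otimes> x)) = Re (cnj (\<omega> (star A x \<otimes> y)))" by simp
qed

lemma cauchy_schwarz:
  assumes x: "x \<in> carrier A" and y: "y \<in> carrier A"
  shows "(cmod (\<omega> (star A x \<otimes> y)))\<^sup>2 \<le> sq x * sq y"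
proof (rule quadratic_form_bound)
  fix c
  have "Re (cnj c * \<omega> (star A y \<otimes> x)) = Re (c * \<omega> (star A x \<otimes> y))" using f_swap[OF x y] by simp
  then have "sq (x \<oplus> c \<odot> y) = sq x + 2 * Re (c * \<omega> (star A x \<otimes> y)) + (cmod c)\<^sup>2 * sq y"
    using arg_cong[OF f_polar[OF x y, of c], of Re] by (simp del: times_complex.sel of_real_mult of_real_power)
  then show "0 \<le> sq x + 2 * Re (c * \<omega> (star A x \<otimes> y)) + (cmod c)\<^sup>2 * sq y"
    using sq_nonneg[of "x \<oplus> c \<odot> y"] x y by simp
qed (use x y in auto)

lemma cauchy_schwarz_sqrt:
  assumes x: "x \<in> carrier A" and y: "y \<in> carrier A"
  shows "cmod (\<omega> (star A x \<otimes> y)) \<le> sqrt (sq x) * sqrt (sq y)"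
  using real_le_rsqrt[OF cauchy_schwarz[OF x y]] by (simp add: real_sqrt_mult)

lemma sqrt_sq_triangle:
  assumes x: "x \<in> carrier A" and y: "y \<in> carrier A"
  shows "sqrt (sq (x \<oplus> y)) \<le> sqrt (sq x) + sqrt (sq y)"
proof -
  have "Re (\<omega> (star A y \<otimes> x)) = Re (\<omega> (star A x \<otimes> y))" using f_swap[OF x y] by simp
  then have "sq (x \<oplus> y) = sq x + 2 * Re (\<omega> (star A x \<otimes> y)) + sq y"
    using arg_cong[OF f_polar[OF x y, of 1], of Re] y by simp
  also have "\<dots> \<le> sq x + 2 * (sqrt (sq x) * sqrt (sq y)) + sq y"
    using order_trans[OF complex_Re_le_cmod cauchy_schwarz_sqrt[OF x y]] by simp
  also have "\<dots> = (sqrt (sq x) + sqrt (sq y))\<^sup>2" using x y by (simp add: power2_sum)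
  finally show ?thesis using x y by (intro real_le_lsqrt) auto
qed

lemma sq_smult: "x \<in> carrier A \<Longrightarrow> sq (c \<odot> x) = (cmod c)\<^sup>2 * sq x"
  using f_polar[of \<zero> x c] by (simp add: sq_def[of \<zero>] del: of_real_mult)

text \<open>Boundedness of the GNS operator of \<open>x\<close>, without completeness or order on
  \<open>A\<close>. The numbers \<omega>(y* h y), with \<open>h\<close> running through the iterated
  squares of \<open>x* x\<close>, satisfy the Cauchy-Schwarz recursion, and a submultiplicative
  weight bounds their growth; the constants depending on \<open>y\<close> disappear in the
  limit.\<close>

lemma sq_mult_le:
  assumes wt: "\<And>x. x \<in> carrier A \<Longrightarrow> cmod (\<omega> x) \<le> wt x" "\<And>x. x \<in> carrier A \<Longrightarrow> 0 \<le> wt x"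
      "\<And>x y. x \<in> carrier A \<Longrightarrow> y \<in> carrier A \<Longrightarrow> wt (x \<otimes> y) \<le> wt x * wt y"
    and x: "x \<in> carrier A" and y: "y \<in> carrier A"
  shows "sq (x \<otimes> y) \<le> wt (star A x \<otimes> x) * sq y"
proof -
  define h where "h = rec_nat (star A x \<otimes> x) (\<lambda>_ z. z \<otimes> z)"
  have h0: "h 0 = star A x \<otimes> x" and hSuc: "h (Suc n) = h n \<otimes> h n" for n by (simp_all add: h_def)
  have hc [simp]: "h n \<in> carrier A" for n by (induction n) (auto simp: h0 hSuc x)
  have hs: "star A (h n) = h n" for n by (induction n) (auto simp: h0 hSuc x star_mult star_star)
  have hw: "wt (h n) \<le> wt (star A x \<otimes> x) ^ (2 ^ n)" for n
  proof (induction n)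
    case (Suc n)
    have "wt (h (Suc n)) \<le> wt (h n) * wt (h n)" by (simp add: hSuc wt(3))
    also have "\<dots> \<le> wt (star A x \<otimes> x) ^ (2 ^ n) * wt (star A x \<otimes> x) ^ (2 ^ n)"
      using Suc wt(2) x by (intro mult_mono) auto
    finally show ?case by (simp add: power_add[symmetric] mult_2)
  qed (simp add: h0)
  have next_sq: "sq (h n \<otimes> y) = Re (\<omega> (star A y \<otimes> (h (Suc n) \<otimes> y)))" for n
    using y by (simp add: sq_def star_mult hs hSuc m_assoc)
  have "Re (\<omega> (star A y \<otimes> (h 0 \<otimes> y))) \<le> wt (star A x \<otimes> x) * sq y"
  proof (rule iterated_cauchy_schwarz_bound[where a = "\<lambda>n. Re (\<omega> (star A y \<otimes> (h n \<otimes> y)))"])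
    fix n
    have "(Re (\<omega> (star A y \<otimes> (h n \<otimes> y))))\<^sup>2 \<le> (cmod (\<omega> (star A y \<otimes> (h n \<otimes> y))))\<^sup>2"
      using abs_Re_le_cmod power2_le_iff_abs_le by (metis abs_norm_cancel power2_abs power_mono abs_ge_zero)
    also have "\<dots> \<le> sq y * sq (h n \<otimes> y)" by (rule cauchy_schwarz) (use y in auto)
    finally show "(Re (\<omega> (star A y \<otimes> (h n \<otimes> y))))\<^sup>2 \<le> Re (\<omega> (star A y \<otimes> (h (Suc n) \<otimes> y))) * sq y"
      by (simp add: next_sq mult.commute)
    have "Re (\<omega> (star A y \<otimes> (h n \<otimes> y))) \<le> wt (star A y \<otimes> (h n \<otimes> y))"
      using order_trans[OF complex_Re_le_cmod wt(1)] y by simp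
    also have "\<dots> \<le> wt (star A y) * (wt (h n) * wt y)"
      using y wt(2) by (intro order_trans[OF wt(3)] mult_left_mono wt(3)) auto
    also have "\<dots> \<le> wt (star A y) * (wt (star A x \<otimes> x) ^ (2 ^ n) * wt y)"
      using y wt(2) hw by (intro mult_left_mono mult_right_mono) auto
    finally show "Re (\<omega> (star A y \<otimes> (h n \<otimes> y))) \<le> (wt (star A y) * wt y) * wt (star A x \<otimes> x) ^ (2 ^ n)"
      by (simp add: algebra_simps)
  qed (use x y wt(2) in auto)
  then show ?thesis using x y by (simp add: sq_def star_mult h0 m_assoc)
qed

lemmas finsum_in = abelian_monoid.finsum_closed[OF abelian_group.axioms(1)[OF is_group]]
lemmas finsum_ins = abelian_monoid.finsum_insert[OF abelian_group.axioms(1)[OF is_group]]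
lemmas finsum_emp = abelian_monoid.finsum_empty[OF abelian_group.axioms(1)[OF is_group]]

lemma f_finsum:
  assumes "finite I" "\<And>i. i \<in> I \<Longrightarrow> f i \<in> carrier A" "y \<in> carrier A"
  shows "\<omega> (star A y \<otimes> (\<Oplus>i\<in>I. d i \<odot> f i)) = (\<Sum>i\<in>I. d i * \<omega> (star A y \<otimes> f i))"
  using assms
proof (induction I)
  case (insert i I)
  have "(\<Oplus>k\<in>I. d k \<odot> f k) \<in> carrier A" using insert by (intro finsum_in) auto
  with insert show ?case
    by (simp add: finsum_ins Pi_def r_distr smult_mult_right f_add f_smult)
qed (simp add: finsum_emp)

text \<open>Positivity at the linear combination of the \<open>f i\<close> with coefficients
  \<open>d i\<close>: the Gram kernel of a positive functional is positive semidefinite.\<close>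

lemma f_finsum_sq:
  assumes I: "finite I" and f: "\<And>i. i \<in> I \<Longrightarrow> f i \<in> carrier A"
  shows "nonneg (\<Sum>i\<in>I. \<Sum>j\<in>I. cnj (d i) * d j * \<omega> (star A (f i) \<otimes> f j))"
proof -
  let ?x = "\<Oplus>i\<in>I. d i \<odot> f i"
  have x: "?x \<in> carrier A" using f by (intro finsum_in) auto
  have "\<omega> (star A ?x \<otimes> ?x) = (\<Sum>j\<in>I. d j * \<omega> (star A ?x \<otimes> f j))" by (rule f_finsum[OF I f x])
  also have "\<dots> = (\<Sum>j\<in>I. d j * cnj (\<omega> (star A (f j) \<otimes> ?x)))"
    using f by (intro sum.cong refl) (simp add: f_swap[OF f x])
  also have "\<dots> = (\<Sum>j\<in>I. \<Sum>i\<in>I. cnj (d i) * d j * \<omega> (star A (f i) \<otimes> f j))"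
    using f by (intro sum.cong refl) (simp add: f_finsum[OF I f] sum_distrib_left algebra_simps flip: f_swap)
  also have "\<dots> = (\<Sum>i\<in>I. \<Sum>j\<in>I. cnj (d i) * d j * \<omega> (star A (f i) \<otimes> f j))" by (rule sum.swap)
  finally show ?thesis using f_nonneg[OF x] by simp
qed

end

section \<open>The Schur product of positive kernels\<close>

definition psd :: "'i set \<Rightarrow> ('i \<Rightarrow> 'i \<Rightarrow> complex) \<Rightarrow> bool" where
  "psd I K \<longleftrightarrow> (\<forall>i\<in>I. \<forall>j\<in>I. K j i = cnj (K i j)) \<and>
    (\<forall>c. nonneg (\<Sum>i\<in>I. \<Sum>j\<in>I. cnj (c i) * c j * K i j))"

lemma sum_insert_insert:
  assumes "finite I" "a \<notin> I"
  shows "(\<Sum>i\<in>insert a I. \<Sum>j\<in>insert a I. f i j) =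
    f a a + (\<Sum>j\<in>I. f a j) + (\<Sum>i\<in>I. f i a) + (\<Sum>i\<in>I. \<Sum>j\<in>I. (f i j :: complex))"
  using assms by (simp add: sum.distrib add_ac)

text \<open>The form on the enlarged set as a quadratic polynomial in the coefficient
  \<open>z\<close> at the new point. Different choices of \<open>z\<close> yield the vanishing of a
  row with zero pivot and the positivity of the Schur complement.\<close>

lemma psd_insert_sum:
  fixes K :: "'i \<Rightarrow> 'i \<Rightarrow> complex"
  assumes "finite I" "a \<notin> I" "psd (insert a I) K"
  shows "nonneg ((cmod z)\<^sup>2 * K a a + (cnj z * (\<Sum>j\<in>I. c j * K a j) + cnj (cnj z * (\<Sum>j\<in>I. c j * K a j))) +
    (\<Sum>i\<in>I. \<Sum>j\<in>I. cnj (c i) * c j * K i j))"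
proof -
  define c' where "c' = c(a := z)"
  have c': "c' a = z" "\<And>i. i \<in> I \<Longrightarrow> c' i = c i" using assms(2) by (auto simp: c'_def)
  have "(\<Sum>i\<in>I. cnj (c i) * z * K i a) = cnj (cnj z * (\<Sum>j\<in>I. c j * K a j))"
  proof -
    have "K i a = cnj (K a i)" if "i \<in> I" for i using assms(3) that unfolding psd_def by blast
    then show ?thesis by (simp add: sum_distrib_left algebra_simps)
  qed
  moreover have "(\<Sum>j\<in>I. cnj z * c j * K a j) = cnj z * (\<Sum>j\<in>I. c j * K a j)"
    by (simp add: sum_distrib_left mult.assoc)
  moreover have "cnj z * z * K a a = (cmod z)\<^sup>2 * K a a" by (simp add: of_real_cmod_sq mult.commute)
  ultimately have "(\<Sum>i\<in>insert a I. \<Sum>j\<in>insert a I. cnj (c' i) * c' j * K i j) =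
      (cmod z)\<^sup>2 * K a a + (cnj z * (\<Sum>j\<in>I. c j * K a j) + cnj (cnj z * (\<Sum>j\<in>I. c j * K a j))) +
    (\<Sum>i\<in>I. \<Sum>j\<in>I. cnj (c i) * c j * K i j)"
    unfolding sum_insert_insert[OF assms(1,2)] using c' by (simp cong: sum.cong)
  moreover have "nonneg (\<Sum>i\<in>insert a I. \<Sum>j\<in>insert a I. cnj (c' i) * c' j * K i j)"
    using assms(3) unfolding psd_def by blast
  ultimately show ?thesis by (simp only:)
qed

text \<open>Cholesky decomposition by induction: the rank one kernel of the pivot row
  \<open>w\<close> is split off, and what remains vanishes on the row and column of \<open>a\<close>
  and is again positive on \<open>I\<close>.\<close>

lemma psd_decomposition:
  fixes K :: "'i \<Rightarrow> 'i \<Rightarrow> complex"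
  assumes "finite I" "psd I K"
  shows "\<exists>n (v :: nat \<Rightarrow> 'i \<Rightarrow> complex). \<forall>i\<in>I. \<forall>j\<in>I. K i j = (\<Sum>k<n. cnj (v k i) * v k j)"
  using assms
proof (induction I arbitrary: K)
  case empty
  show ?case by simp
next
  case (insert a I)
  note ps = psd_insert_sum[OF insert.hyps insert.prems]
  have herm: "K j i = cnj (K i j)" if "i \<in> insert a I" "j \<in> insert a I" for i j
    using insert.prems that by (auto simp: psd_def)
  have "nonneg (K a a)" using ps[of 1 "\<lambda>_. 0"] by simp
  then have Kaa: "K a a = of_real (Re (K a a))" "Re (K a a) \<ge> 0" by (auto simp: nonneg_eq[symmetric] nonneg_def)
  define \<kappa> where "\<kappa> = Re (K a a)"
  \<comment> \<open>For a zero pivot the quotient is 0 by the convention on division, which agrees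
    with the vanishing of the row shown next.\<close>
  define w where "w j = K a j / of_real (sqrt \<kappa>)" for j
  have null: "K a j = 0" if "\<kappa> = 0" "j \<in> I" for j
  proof -
    have "(cmod (K a j))\<^sup>2 \<le> Re (K j j) * 0"
    proof (rule quadratic_form_bound)
      fix c
      have s: "(\<Sum>i\<in>I. (if i = j then 1 else 0) * K a i) = K a j"
        using that insert.hyps by (simp add: if_distrib[of "\<lambda>x. x * _"] cong: if_cong)
      have s2: "(\<Sum>i\<in>I. \<Sum>l\<in>I. cnj (if i = j then 1 else 0) * (if l = j then 1 else 0) * K i l) = K j j"
      proof -
        have "(\<Sum>i\<in>I. \<Sum>l\<in>I. cnj (if i = j then 1 else 0) * (if l = j then 1 else 0) * K i l) =
            (\<Sum>i\<in>I. if i = j then (\<Sum>l\<in>I. if l = j then K j j else 0) else 0)"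
          by (intro sum.cong refl) (auto simp: if_distrib[of "\<lambda>x. x * _"] intro!: sum.cong)
        then show ?thesis using that insert.hyps by simp
      qed
      have "nonneg ((cmod c)\<^sup>2 * K a a + (cnj (cnj c) * K a j + cnj (cnj (cnj c) * K a j)) + K j j)"
        using ps[of "cnj c" "\<lambda>i. if i = j then 1 else 0"] unfolding s s2 by simp
      then show "0 \<le> Re (K j j) + 2 * Re (c * K a j) + (cmod c)\<^sup>2 * 0"
        using that Kaa by (simp add: nonneg_def \<kappa>_def)
      have "nonneg (K j j)" using ps[of 0 "\<lambda>i. if i = j then 1 else 0"] unfolding s s2 by simp
      then show "0 \<le> Re (K j j)" by (simp add: nonneg_def)
    qed simp
    then show ?thesis by simp
  qed
  have ww: "cnj (w a) * w j = K a j" if "j \<in> insert a I" for j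
  proof (cases "\<kappa> = 0")
    case False
    have "cnj (w a) = of_real (sqrt \<kappa>)" using False Kaa
      by (simp add: w_def \<kappa>_def complex_eq_iff real_div_sqrt flip: of_real_divide)
    then show ?thesis using False Kaa(2) by (simp add: w_def \<kappa>_def)
  next
    case True
    then show ?thesis using null that Kaa by (auto simp: w_def \<kappa>_def)
  qed
  define K' where "K' i j = K i j - cnj (w i) * w j" for i j
  have K'a: "K' a j = 0" "K' j a = 0" if "j \<in> insert a I" for j
  proof -
    show "K' a j = 0" using ww[OF that] by (simp add: K'_def)
    have "K j a = cnj (cnj (w a) * w j)" using herm[of a j] that ww[OF that] by simp
    then show "K' j a = 0" by (simp add: K'_def mult.commute)
  qed
  have "psd I K'"
    unfolding psd_def
  proof (intro conjI ballI allI)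
    show "K' j i = cnj (K' i j)" if "i \<in> I" "j \<in> I" for i j
      using herm[of i j] that by (simp add: K'_def mult.commute)
    fix c
    define s where "s = (\<Sum>j\<in>I. c j * K a j)"
    define t where "t = (\<Sum>j\<in>I. c j * w j)"
    have st: "s = of_real (sqrt \<kappa>) * t"
    proof (cases "\<kappa> = 0")
      case True
      then show ?thesis using null by (simp add: s_def)
    qed (simp add: s_def t_def w_def sum_distrib_left)
    \<comment> \<open>The minimiser of the quadratic in the coefficient at \<open>a\<close>. Its
      value \<open>- (cnj t * t)\<close> is precisely the correction that turns \<open>K\<close>
      into \<open>K'\<close>; for a zero pivot both \<open>t\<close> and \<open>z\<close> are
      0.\<close>
    define z where "z = - t / of_real (sqrt \<kappa>)"
    have t0: "t = 0" if "\<kappa> = 0" using that by (simp add: t_def w_def)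
    have val: "(cmod z)\<^sup>2 * K a a + (cnj z * s + cnj (cnj z * s)) = - (cnj t * t)"
    proof (cases "\<kappa> = 0")
      case False
      then have k: "\<kappa> > 0" using Kaa by (simp add: \<kappa>_def)
      have "(cmod z)\<^sup>2 * K a a = cnj t * t"
        using k Kaa(1) by (simp add: z_def norm_divide power_divide complex_norm_square of_real_cmod_sq mult.commute flip: \<kappa>_def of_real_power)
      moreover have "cnj z * s = - (cnj t * t)" using k by (simp add: z_def st)
      ultimately show ?thesis by (simp add: mult.commute)
    qed (use t0 Kaa st in \<open>simp add: z_def\<close>)
    have "(\<Sum>i\<in>I. \<Sum>j\<in>I. cnj (c i) * c j * K' i j) =
        (\<Sum>i\<in>I. \<Sum>j\<in>I. cnj (c i) * c j * K i j) - (\<Sum>i\<in>I. \<Sum>j\<in>I. cnj (c i * w i) * (c j * w j))"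
      by (simp add: K'_def right_diff_distrib sum_subtractf algebra_simps)
    also have "(\<Sum>i\<in>I. \<Sum>j\<in>I. cnj (c i * w i) * (c j * w j)) = cnj t * t"
      by (simp add: t_def sum_product)
    finally show "nonneg (\<Sum>i\<in>I. \<Sum>j\<in>I. cnj (c i) * c j * K' i j)"
      using ps[of z c] unfolding s_def[symmetric] val by simp
  qed
  from insert.IH[OF this] obtain n and v :: "nat \<Rightarrow> 'i \<Rightarrow> complex" where nv: "\<forall>i\<in>I. \<forall>j\<in>I. K' i j = (\<Sum>k<n. cnj (v k i) * v k j)" by blast
  \<comment> \<open>The new vector \<open>w\<close> gets the index \<open>n\<close>; the old vectors
    are extended by 0 at \<open>a\<close>, where \<open>K'\<close> vanishes.\<close>
  define v' where "v' k i = (if k = n then w i else if i = a then 0 else v k i)" for k i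
  have "K i j = (\<Sum>k<Suc n. cnj (v' k i) * v' k j)" if ij: "i \<in> insert a I" "j \<in> insert a I" for i j
  proof -
    have "(\<Sum>k<n. cnj (v' k i) * v' k j) = K' i j"
      using ij nv K'a insert.hyps by (cases "i = a \<or> j = a") (auto simp: v'_def)
    then show ?thesis by (simp add: v'_def K'_def)
  qed
  then show ?case by blast
qed

text \<open>Writing \<open>L\<close> as a sum of rank one kernels makes the form a sum of forms of
  \<open>K\<close> with the coefficients \<open>c i * v k i\<close>.\<close>

lemma schur_product:
  fixes K L :: "'i \<Rightarrow> 'i \<Rightarrow> complex"
  assumes "finite I" "psd I K" "psd I L"
  shows "nonneg (\<Sum>i\<in>I. \<Sum>j\<in>I. cnj (c i) * c j * (K i j * L i j))"
proof -
  obtain n and v :: "nat \<Rightarrow> 'i \<Rightarrow> complex" where L: "\<forall>i\<in>I. \<forall>j\<in>I. L i j = (\<Sum>k<n. cnj (v k i) * v k j)"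
    using psd_decomposition[OF assms(1,3)] by blast
  have "(\<Sum>i\<in>I. \<Sum>j\<in>I. cnj (c i) * c j * (K i j * L i j)) =
      (\<Sum>i\<in>I. \<Sum>j\<in>I. \<Sum>k<n. cnj (c i * v k i) * (c j * v k j) * K i j)"
    using L by (intro sum.cong refl) (simp add: sum_distrib_left algebra_simps)
  also have "\<dots> = (\<Sum>i\<in>I. \<Sum>k<n. \<Sum>j\<in>I. cnj (c i * v k i) * (c j * v k j) * K i j)"
    by (intro sum.cong refl sum.swap)
  also have "\<dots> = (\<Sum>k<n. \<Sum>i\<in>I. \<Sum>j\<in>I. cnj (c i * v k i) * (c j * v k j) * K i j)"
    by (rule sum.swap)
  also have "nonneg \<dots>"
  proof (rule nonneg_sum)
    show "nonneg (\<Sum>i\<in>I. \<Sum>j\<in>I. cnj (c i * v k i) * (c j * v k j) * K i j)" for k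
      using assms(2) unfolding psd_def by (elim conjE allE[of _ "\<lambda>i. c i * v k i"])
  qed
  finally show ?thesis .
qed

section \<open>Operator seminorms from families of positive functionals\<close>

text \<open>The abstract situation behind the spatial norm: positive functionals on a *-algebra
  whose GNS operators are uniformly bounded by virtue of the weight \<open>wt\<close>.\<close>

locale functional_family = star_algebra A for A (structure) +
  fixes \<Omega> :: "('a \<Rightarrow> complex) set" and wt :: "'a \<Rightarrow> real"
  assumes pos: "\<omega> \<in> \<Omega> \<Longrightarrow> pos_functional A \<omega>"
    and wt_bound: "\<omega> \<in> \<Omega> \<Longrightarrow> x \<in> carrier A \<Longrightarrow> cmod (\<omega> x) \<le> wt x"
    and wt_nonneg: "x \<in> carrier A \<Longrightarrow> 0 \<le> wt x"
    and wt_mult: "x \<in> carrier A \<Longrightarrow> y \<in> carrier A \<Longrightarrow> wt (x \<otimes> y) \<le> wt x * wt y"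
begin

text \<open>The operator norm of left multiplication by \<open>x\<close>, taken over the pre-Hilbert
  spaces of all functionals in the family at once. The inserted 0 is the value when there is no unit
  vector.\<close>

definition opn :: "'a \<Rightarrow> real" where
  "opn x = Sup (insert 0 {sqrt (Re (\<omega> (star A (x \<otimes> y) \<otimes> (x \<otimes> y)))) | \<omega> y.
    \<omega> \<in> \<Omega> \<and> y \<in> carrier A \<and> \<omega> (star A y \<otimes> y) = 1})"

abbreviation "Sq \<equiv> positive_functional.sq A"

lemma pf: "\<omega> \<in> \<Omega> \<Longrightarrow> positive_functional A \<omega>"
  by (intro positive_functional.intro star_algebra_axioms positive_functional_axioms.intro pos)

lemma sq_def': "\<omega> \<in> \<Omega> \<Longrightarrow> Sq \<omega> x = Re (\<omega> (star A x \<otimes> x))"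
  by (rule positive_functional.sq_def[OF pf])

lemma opn_bdd:
  assumes x: "x \<in> carrier A"
  shows "bdd_above (insert 0 {sqrt (Re (\<omega> (star A (x \<otimes> y) \<otimes> (x \<otimes> y)))) | \<omega> y.
    \<omega> \<in> \<Omega> \<and> y \<in> carrier A \<and> \<omega> (star A y \<otimes> y) = 1})"
proof (rule bdd_aboveI[of _ "sqrt (wt (star A x \<otimes> x))"])
  fix r assume "r \<in> insert 0 {sqrt (Re (\<omega> (star A (x \<otimes> y) \<otimes> (x \<otimes> y)))) | \<omega> y.
    \<omega> \<in> \<Omega> \<and> y \<in> carrier A \<and> \<omega> (star A y \<otimes> y) = 1}"
  then consider "r = 0" | \<omega> y where "r = sqrt (Sq \<omega> (x \<otimes> y))" "\<omega> \<in> \<Omega>" "y \<in> carrier A" "Sq \<omega> y = 1"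
    by (auto simp: sq_def')
  then show "r \<le> sqrt (wt (star A x \<otimes> x))"
  proof cases
    case 2
    then show ?thesis
      using positive_functional.sq_mult_le[OF pf[OF 2(2)] wt_bound[OF 2(2)] wt_nonneg wt_mult x 2(3)] by simp
  qed (use x in \<open>simp add: wt_nonneg\<close>)
qed

lemma opn_nonneg: "x \<in> carrier A \<Longrightarrow> 0 \<le> opn x"
  unfolding opn_def by (rule cSup_upper[OF _ opn_bdd]) auto

lemma opn_upper: "\<lbrakk>x \<in> carrier A; \<omega> \<in> \<Omega>; y \<in> carrier A; \<omega> (star A y \<otimes> y) = 1\<rbrakk> \<Longrightarrow> sqrt (Sq \<omega> (x \<otimes> y)) \<le> opn x"
  unfolding opn_def by (rule cSup_upper[OF _ opn_bdd]) (auto simp: sq_def')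

text \<open>Scaling reduces to unit vectors, except when \<open>y\<close> is a null vector; in that
  case \<open>x y\<close> is null as well by \<open>sq_mult_le\<close>.\<close>

lemma opn_bound:
  assumes x: "x \<in> carrier A" and \<omega>: "\<omega> \<in> \<Omega>" and y: "y \<in> carrier A"
  shows "sqrt (Sq \<omega> (x \<otimes> y)) \<le> opn x * sqrt (Sq \<omega> y)"
proof -
  interpret positive_functional A \<omega> by (rule pf[OF \<omega>])
  show ?thesis
  proof (cases "sq y = 0")
    case True
    have "sq (x \<otimes> y) \<le> wt (star A x \<otimes> x) * sq y"
      by (rule sq_mult_le) (use \<omega> x y wt_bound wt_nonneg wt_mult in auto)
    then show ?thesis using True sq_nonneg[of "x \<otimes> y"] x y by simp
  next
    case False
    then have p: "sq y > 0" using sq_nonneg[OF y] by linarith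
    define c where "c = complex_of_real (1 / sqrt (sq y))"
    have c: "(cmod c)\<^sup>2 = 1 / sq y" using p by (simp add: c_def power_divide norm_divide)
    have "\<omega> (star A (c \<odot> y) \<otimes> (c \<odot> y)) = 1" using p y c by (simp add: f_sq sq_smult)
    then have "sqrt (sq (x \<otimes> (c \<odot> y))) \<le> opn x" using \<omega> x y by (intro opn_upper) auto
    then have "sqrt (sq (x \<otimes> y) / sq y) \<le> opn x"
      using x y c by (simp add: smult_mult_right sq_smult)
    then show ?thesis using p by (simp add: real_sqrt_divide field_simps)
  qed
qed

lemma opn_le:
  assumes "0 \<le> K" "\<And>\<omega> y. \<lbrakk>\<omega> \<in> \<Omega>; y \<in> carrier A\<rbrakk> \<Longrightarrow> sqrt (Sq \<omega> (x \<otimes> y)) \<le> K * sqrt (Sq \<omega> y)"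
  shows "opn x \<le> K"
  unfolding opn_def
proof (rule cSup_least)
  fix r assume "r \<in> insert 0 {sqrt (Re (\<omega> (star A (x \<otimes> y) \<otimes> (x \<otimes> y)))) | \<omega> y.
    \<omega> \<in> \<Omega> \<and> y \<in> carrier A \<and> \<omega> (star A y \<otimes> y) = 1}"
  then consider "r = 0" | \<omega> y where "r = sqrt (Sq \<omega> (x \<otimes> y))" "\<omega> \<in> \<Omega>" "y \<in> carrier A" "Sq \<omega> y = 1"
    by (auto simp: sq_def')
  then show "r \<le> K" by cases (use assms(1) assms(2) in force)+
qed simp

text \<open>The squared length of \<open>x y\<close> is the inner product of \<open>y\<close> with
  \<open>x* x y\<close>, so Cauchy-Schwarz applies.\<close>

lemma opn_star_le:
  assumes x: "x \<in> carrier A" shows "(opn x)\<^sup>2 \<le> opn (star A x \<otimes> x)"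
proof -
  have "opn x \<le> sqrt (opn (star A x \<otimes> x))"
  proof (rule opn_le)
    fix \<omega> y assume \<omega>: "\<omega> \<in> \<Omega>" and y: "y \<in> carrier A"
    interpret positive_functional A \<omega> by (rule pf[OF \<omega>])
    have "sq (x \<otimes> y) = Re (\<omega> (star A y \<otimes> ((star A x \<otimes> x) \<otimes> y)))"
      using x y by (simp add: sq_def star_mult m_assoc)
    also have "\<dots> \<le> sqrt (sq y) * sqrt (sq ((star A x \<otimes> x) \<otimes> y))"
      by (rule order_trans[OF complex_Re_le_cmod cauchy_schwarz_sqrt]) (use x y in auto)
    also have "\<dots> \<le> sqrt (sq y) * (opn (star A x \<otimes> x) * sqrt (sq y))"
      using x y \<omega> by (intro mult_left_mono opn_bound) auto
    also have "\<dots> = opn (star A x \<otimes> x) * sq y" using y by simp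
    finally show "sqrt (sq (x \<otimes> y)) \<le> sqrt (opn (star A x \<otimes> x)) * sqrt (sq y)"
      by (simp flip: real_sqrt_mult)
  qed (use x opn_nonneg in simp)
  then have "(opn x)\<^sup>2 \<le> (sqrt (opn (star A x \<otimes> x)))\<^sup>2" using opn_nonneg[OF x] by (intro power_mono)
  then show ?thesis using x opn_nonneg by simp
qed

lemma opn_mult:
  assumes x: "x \<in> carrier A" and x': "x' \<in> carrier A" shows "opn (x \<otimes> x') \<le> opn x * opn x'"
proof (rule opn_le)
  fix \<omega> y assume \<omega>: "\<omega> \<in> \<Omega>" and y: "y \<in> carrier A"
  have "sqrt (Sq \<omega> ((x \<otimes> x') \<otimes> y)) = sqrt (Sq \<omega> (x \<otimes> (x' \<otimes> y)))" using x x' y by (simp add: m_assoc)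
  also have "\<dots> \<le> opn x * sqrt (Sq \<omega> (x' \<otimes> y))" using x x' y \<omega> by (intro opn_bound) auto
  also have "\<dots> \<le> opn x * (opn x' * sqrt (Sq \<omega> y))"
    using x x' y \<omega> by (intro mult_left_mono opn_bound opn_nonneg) auto
  finally show "sqrt (Sq \<omega> ((x \<otimes> x') \<otimes> y)) \<le> opn x * opn x' * sqrt (Sq \<omega> y)" by (simp add: mult.assoc)
qed (use x x' opn_nonneg in simp)

theorem opn_seminorm: "cstar_seminorm A opn"
  unfolding cstar_seminorm_def
proof (intro conjI ballI allI)
  fix x assume x: "x \<in> carrier A"
  show "0 \<le> opn x" by (rule opn_nonneg[OF x])
  have smult_le: "opn (c \<odot> x) \<le> cmod c * opn x" if x: "x \<in> carrier A" for c x
  proof (rule opn_le)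
    fix \<omega> y assume \<omega>: "\<omega> \<in> \<Omega>" and y: "y \<in> carrier A"
    interpret positive_functional A \<omega> by (rule pf[OF \<omega>])
    show "sqrt (sq ((c \<odot> x) \<otimes> y)) \<le> cmod c * opn x * sqrt (sq y)"
      using mult_left_mono[OF opn_bound[OF x \<omega> y], of "cmod c"] x y
      by (simp add: smult_mult_left sq_smult real_sqrt_mult mult.assoc)
  qed (use x opn_nonneg in simp)
  show "opn (c \<odot> x) = cmod c * opn x" for c
  proof (cases "c = 0")
    case True
    then show ?thesis using smult_le[OF x, of 0] opn_nonneg[of \<zero>] x by simp
  next
    case False
    have "cmod c * opn x \<le> cmod c * (cmod (1 / c) * opn (c \<odot> x))"
      using smult_le[of "c \<odot> x" "1 / c"] x False by (intro mult_left_mono) (auto simp: smult_smult)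
    then show ?thesis using smult_le[OF x, of c] False by (simp add: norm_divide)
  qed
  \<comment> \<open>As for \<open>p_star\<close>, but with only one half of the C*-identity at hand;
    the isometry of the star then supplies the other half.\<close>
  have star_le: "opn x \<le> opn (star A x)" if x: "x \<in> carrier A" for x
  proof (cases "opn x = 0")
    case False
    have "opn x * opn x \<le> opn (star A x) * opn x"
      using order_trans[OF opn_star_le[OF x] opn_mult[of "star A x" x]] x by (simp add: power2_eq_square)
    with False opn_nonneg[OF x] show ?thesis by (simp add: order_less_le)
  qed (use x opn_nonneg in simp)
  have "opn (star A x \<otimes> x) \<le> opn (star A x) * opn x" using x by (intro opn_mult) auto
  moreover have "opn (star A x) = opn x" using star_le[OF x] star_le[of "star A x"] x by (simp add: star_star)
  ultimately show "opn (star A x \<otimes> x) = (opn x)\<^sup>2"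
    using opn_star_le[OF x] by (simp add: power2_eq_square)
  fix x' assume x': "x' \<in> carrier A"
  show "opn (x \<otimes> x') \<le> opn x * opn x'" by (rule opn_mult[OF x x'])
  show "opn (x \<oplus> x') \<le> opn x + opn x'"
  proof (rule opn_le)
    fix \<omega> y assume \<omega>: "\<omega> \<in> \<Omega>" and y: "y \<in> carrier A"
    interpret positive_functional A \<omega> by (rule pf[OF \<omega>])
    have "sqrt (sq ((x \<oplus> x') \<otimes> y)) \<le> sqrt (sq (x \<otimes> y)) + sqrt (sq (x' \<otimes> y))"
      using x x' y by (simp add: l_distr sqrt_sq_triangle)
    also have "\<dots> \<le> opn x * sqrt (sq y) + opn x' * sqrt (sq y)"
      using x x' y \<omega> by (intro add_mono opn_bound)
    finally show "sqrt (sq ((x \<oplus> x') \<otimes> y)) \<le> (opn x + opn x') * sqrt (sq y)" by (simp add: distrib_right)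
  qed (use x x' opn_nonneg in simp)
qed

text \<open>A test by matrix coefficients, linear in \<open>z\<close> and \<open>y\<close>, which
  the definition by squares is not.\<close>

lemma opn_eq_0I:
  assumes x: "x \<in> carrier A"
    and null: "\<And>\<omega> z y. \<lbrakk>\<omega> \<in> \<Omega>; z \<in> carrier A; y \<in> carrier A\<rbrakk> \<Longrightarrow> \<omega> (z \<otimes> (x \<otimes> y)) = 0"
  shows "opn x = 0"
proof -
  have "opn x \<le> 0"
  proof (rule opn_le)
    fix \<omega> y assume "\<omega> \<in> \<Omega>" "y \<in> carrier A"
    then show "sqrt (Sq \<omega> (x \<otimes> y)) \<le> 0 * sqrt (Sq \<omega> y)"
      using null[of \<omega> "star A (x \<otimes> y)" y] x by (simp add: sq_def')
  qed simp
  then show ?thesis using opn_nonneg[OF x] by simp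
qed

end

section \<open>Formal tensors and the spatial seminorm\<close>

sublocale unital_cstar_algebra \<subseteq> cstar_seminormed_algebra A "nrm A"
  by (intro cstar_seminormed_algebra.intro star_algebra_axioms cstar_seminormed_algebra_axioms.intro cstar_norm)

locale tensor_pair = A: unital_cstar_algebra A + B: unital_cstar_algebra B
  for A :: "('a, 'm) cstar_algebra_scheme" and B :: "('b, 'n) cstar_algebra_scheme"
begin

abbreviation "T \<equiv> formal_tensors A B"
abbreviation "KT \<equiv> carrier A \<times> carrier B"

definition pmul :: "'a \<times> 'b \<Rightarrow> 'a \<times> 'b \<Rightarrow> 'a \<times> 'b" where
  "pmul k l = (fst k \<otimes>\<^bsub>A\<^esub> fst l, snd k \<otimes>\<^bsub>B\<^esub> snd l)"

definition pstar :: "'a \<times> 'b \<Rightarrow> 'a \<times> 'b" where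
  "pstar k = (star A (fst k), star B (snd k))"

definition punit :: "'a \<times> 'b" where
  "punit = (\<one>\<^bsub>A\<^esub>, \<one>\<^bsub>B\<^esub>)"

lemma pmul_in [simp]: "k \<in> KT \<Longrightarrow> l \<in> KT \<Longrightarrow> pmul k l \<in> KT"
  and pstar_in [simp]: "k \<in> KT \<Longrightarrow> pstar k \<in> KT"
  and punit_in [simp]: "punit \<in> KT"
  by (auto simp: pmul_def pstar_def punit_def)

lemma pmul_assoc: "\<lbrakk>k \<in> KT; l \<in> KT; m \<in> KT\<rbrakk> \<Longrightarrow> pmul (pmul k l) m = pmul k (pmul l m)"
  and pmul_punit [simp]: "k \<in> KT \<Longrightarrow> pmul k punit = k"
  and punit_pmul [simp]: "k \<in> KT \<Longrightarrow> pmul punit k = k"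
  and pstar_pstar [simp]: "k \<in> KT \<Longrightarrow> pstar (pstar k) = k"
  and pstar_pmul: "k \<in> KT \<Longrightarrow> l \<in> KT \<Longrightarrow> pstar (pmul k l) = pmul (pstar l) (pstar k)"
  and pstar_punit [simp]: "pstar punit = punit"
  by (auto simp: pmul_def pstar_def punit_def A.m_assoc B.m_assoc A.star_star B.star_star A.star_mult B.star_mult)

definition tmul :: "('a \<times> 'b \<Rightarrow>\<^sub>0 complex) \<Rightarrow> ('a \<times> 'b \<Rightarrow>\<^sub>0 complex) \<Rightarrow> ('a \<times> 'b \<Rightarrow>\<^sub>0 complex)" where
  "tmul f g = (\<Sum>k\<in>Poly_Mapping.keys f. \<Sum>l\<in>Poly_Mapping.keys g.
    Poly_Mapping.single (pmul k l) (Poly_Mapping.lookup f k * Poly_Mapping.lookup g l))"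

lemma T_simps [simp]:
  "monoid.mult T = tmul" "one T = Poly_Mapping.single punit 1"
  "ring.zero T = 0" "add T = (+)" "smult T = scale" "star T = conj_linear_ext pstar"
  by (simp_all add: formal_tensors_def tmul_def[abs_def] case_prod_unfold punit_def pmul_def pstar_def[abs_def])

lemma T_carrier: "f \<in> carrier T \<longleftrightarrow> Poly_Mapping.keys f \<subseteq> KT"
  by (simp add: formal_tensors_def)

lemma tmul_add_left: "tmul (f + f') g = tmul f g + tmul f' g"
  unfolding tmul_def
  by (rule setsum_keys_plus_distrib) (auto simp: distrib_right single_add sum.distrib)

lemma tmul_add_right: "tmul f (g + g') = tmul f g + tmul f g'"
  unfolding tmul_def sum.distrib[symmetric]
  by (intro sum.cong refl setsum_keys_plus_distrib) (auto simp: distrib_left single_add)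

lemma tmul_single [simp]:
  "tmul (Poly_Mapping.single k c) (Poly_Mapping.single l d) = Poly_Mapping.single (pmul k l) (c * d)"
  by (simp add: tmul_def)

lemma tmul_zero [simp]: "tmul 0 g = 0" "tmul f 0 = 0"
  by (simp_all add: tmul_def)

lemma tmul_minus_left: "tmul (- f) g = - tmul f g"
  and tmul_minus_right: "tmul f (- g) = - tmul f g"
  using tmul_add_left[of f "- f" g] tmul_add_right[of f g "- g"] by (auto simp: eq_neg_iff_add_eq_0 add.commute)

lemma tmul_diff_left: "tmul (f - f') g = tmul f g - tmul f' g"
  and tmul_diff_right: "tmul f (g - g') = tmul f g - tmul f g'"
  using tmul_add_left[of f "- f'" g] tmul_add_right[of f g "- g'"] by (simp_all add: tmul_minus_left tmul_minus_right)

lemma tmul_scale_left: "tmul (scale c f) g = scale c (tmul f g)"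
proof (induction f rule: keys_induct_on[OF subset_UNIV])
  case (2 k d)
  show ?case
    by (induction g rule: keys_induct_on[OF subset_UNIV]) (simp_all add: tmul_add_right scale_add mult.assoc)
qed (simp_all add: tmul_add_left scale_add)

lemma tmul_scale_right: "tmul f (scale c g) = scale c (tmul f g)"
proof (induction f rule: keys_induct_on[OF subset_UNIV])
  case (2 k d)
  show ?case
    by (induction g rule: keys_induct_on[OF subset_UNIV])
      (simp_all add: tmul_add_right scale_add mult.left_commute)
qed (simp_all add: tmul_add_left scale_add)

lemma T_single [simp]: "k \<in> KT \<Longrightarrow> Poly_Mapping.single k c \<in> carrier T"
  by (simp add: T_carrier)

lemma T_zero [simp]: "0 \<in> carrier T"
  by (simp add: T_carrier)

lemma T_add [simp]: "f \<in> carrier T \<Longrightarrow> g \<in> carrier T \<Longrightarrow> f + g \<in> carrier T"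
  using keys_add[of f g] unfolding T_carrier by blast

lemma T_scale [simp]: "f \<in> carrier T \<Longrightarrow> scale c f \<in> carrier T"
  unfolding T_carrier by (rule order_trans[OF keys_scale])

lemma T_uminus [simp]: "f \<in> carrier T \<Longrightarrow> - f \<in> carrier T"
  using T_scale[of f "-1"] by (simp only: scale_minus_1)

lemma T_diff [simp]: "f \<in> carrier T \<Longrightarrow> g \<in> carrier T \<Longrightarrow> f - g \<in> carrier T"
  using T_add[of f "- g"] by simp

lemma T_sum [simp]: "(\<And>i. i \<in> I \<Longrightarrow> f i \<in> carrier T) \<Longrightarrow> sum f I \<in> carrier T"
  by (induction I rule: infinite_finite_induct) auto

lemma T_induct [consumes 1, case_names zero single add]:
  assumes "f \<in> carrier T" "P 0" "\<And>k c. k \<in> KT \<Longrightarrow> P (Poly_Mapping.single k c)"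
    and "\<And>f g. \<lbrakk>f \<in> carrier T; g \<in> carrier T; P f; P g\<rbrakk> \<Longrightarrow> P (f + g)"
  shows "P f"
  by (rule keys_induct_on[of f KT P]) (use assms in \<open>auto simp: T_carrier\<close>)

lemma tmul_in [simp]: "f \<in> carrier T \<Longrightarrow> g \<in> carrier T \<Longrightarrow> tmul f g \<in> carrier T"
  unfolding tmul_def T_carrier[of f] T_carrier[of g] by (intro T_sum T_single pmul_in) auto

lemma tstar_in [simp]: "f \<in> carrier T \<Longrightarrow> conj_linear_ext pstar f \<in> carrier T"
  by (induction rule: T_induct) (auto simp: conj_add simp del: mem_Times_iff)

lemma tmul_assoc: "\<lbrakk>f \<in> carrier T; g \<in> carrier T; h \<in> carrier T\<rbrakk> \<Longrightarrow> tmul (tmul f g) h = tmul f (tmul g h)"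
proof (induction f rule: T_induct)
  case (single k c)
  from single(2,3) show ?case
  proof (induction g rule: T_induct)
    case (single l d)
    from single(2) show ?case
      by (induction h rule: T_induct)
        (simp_all add: tmul_add_right pmul_assoc \<open>k \<in> KT\<close> \<open>l \<in> KT\<close> mult.assoc del: mem_Times_iff)
  qed (simp_all add: tmul_add_left tmul_add_right)
qed (simp_all add: tmul_add_left)

lemma tstar_mult:
  "\<lbrakk>f \<in> carrier T; g \<in> carrier T\<rbrakk> \<Longrightarrow>
    conj_linear_ext pstar (tmul f g) = tmul (conj_linear_ext pstar g) (conj_linear_ext pstar f)"
proof (induction f rule: T_induct)
  case (single k c)
  from single(2) show ?case
    by (induction g rule: T_induct)
      (simp_all add: tmul_add_left tmul_add_right conj_add pstar_pmul \<open>k \<in> KT\<close> mult.commute del: mem_Times_iff)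
qed (simp_all add: tmul_add_left tmul_add_right conj_add)

lemma star_algebra_T: "star_algebra T"
proof (rule star_algebraI)
  show "ring T"
  proof (rule ringI)
    show "abelian_group T"
    proof (rule abelian_groupI)
      fix x assume "x \<in> carrier T"
      then show "\<exists>y\<in>carrier T. y \<oplus>\<^bsub>T\<^esub> x = \<zero>\<^bsub>T\<^esub>" by (intro bexI[of _ "- x"]) auto
    qed (auto simp: add.assoc add.commute)
    have unit: "tmul (Poly_Mapping.single punit 1) f = f" "tmul f (Poly_Mapping.single punit 1) = f"
      if "f \<in> carrier T" for f
      using that by (induction rule: T_induct) (simp_all add: tmul_add_left tmul_add_right del: mem_Times_iff)
    show "monoid T"
      by (rule monoidI) (simp_all add: tmul_assoc unit)
  qed (simp_all add: tmul_add_left tmul_add_right)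
  show "star T (star T x) = x" if "x \<in> carrier T" for x
    using that by (induction rule: T_induct) (simp_all add: conj_add del: mem_Times_iff)
qed (simp_all add: scale_add scale_add_left scale_scale tmul_scale_left tmul_scale_right conj_add conj_scale tstar_mult)

sublocale T: star_algebra T by (rule star_algebra_T)

lemma T_minus [simp]: "f \<in> carrier T \<Longrightarrow> g \<in> carrier T \<Longrightarrow> f \<ominus>\<^bsub>T\<^esub> g = f - g"
  using T.minus_eq[where x=f and y=g] T.smult_minus_1[where x=g, symmetric]
  by (simp only: T_simps scale_minus_1 diff_conv_add_uminus)

text \<open>A weighted l1 norm on formal sums. It is submultiplicative and dominates every product
  of states.\<close>

definition wt :: "('a \<times> 'b \<Rightarrow>\<^sub>0 complex) \<Rightarrow> real" where
  "wt f = (\<Sum>k\<in>Poly_Mapping.keys f. cmod (Poly_Mapping.lookup f k) * (nrm A (fst k) * nrm B (snd k)))"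

lemma wt_nonneg: "f \<in> carrier T \<Longrightarrow> 0 \<le> wt f"
  unfolding wt_def T_carrier by (intro sum_nonneg mult_nonneg_nonneg) auto

lemma wt_single: "wt (Poly_Mapping.single k c) = cmod c * (nrm A (fst k) * nrm B (snd k))"
  by (simp add: wt_def)

lemma wt_add: assumes "f \<in> carrier T" "g \<in> carrier T" shows "wt (f + g) \<le> wt f + wt g"
proof -
  let ?S = "Poly_Mapping.keys f \<union> Poly_Mapping.keys g"
  let ?n = "\<lambda>k. nrm A (fst k) * nrm B (snd k)"
  have wt: "wt h = (\<Sum>k\<in>?S. cmod (Poly_Mapping.lookup h k) * ?n k)" if "Poly_Mapping.keys h \<subseteq> ?S" for h
    unfolding wt_def by (rule sum_keys_superset[where g="\<lambda>k c. cmod c * ?n k"]) (use that in auto)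
  have "wt (f + g) = (\<Sum>k\<in>?S. cmod (Poly_Mapping.lookup f k + Poly_Mapping.lookup g k) * ?n k)"
    using wt[OF keys_add] by (simp add: lookup_add)
  also have "\<dots> \<le> (\<Sum>k\<in>?S. cmod (Poly_Mapping.lookup f k) * ?n k + cmod (Poly_Mapping.lookup g k) * ?n k)"
    unfolding distrib_right[symmetric]
    by (intro sum_mono mult_right_mono norm_triangle_ineq) (use assms in \<open>auto simp: T_carrier\<close>)
  also have "\<dots> = wt f + wt g" by (simp add: wt sum.distrib)
  finally show ?thesis .
qed

lemma wt_sum: "(\<And>i. i \<in> I \<Longrightarrow> f i \<in> carrier T) \<Longrightarrow> wt (sum f I) \<le> (\<Sum>i\<in>I. wt (f i))"
proof (induction I rule: infinite_finite_induct)
  case (insert i I)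
  then show ?case using wt_add[of "f i" "sum f I"] by fastforce
qed (simp_all add: wt_def)

lemma wt_mult: assumes "f \<in> carrier T" "g \<in> carrier T" shows "wt (f \<otimes>\<^bsub>T\<^esub> g) \<le> wt f * wt g"
proof -
  let ?f = "Poly_Mapping.lookup f" and ?g = "Poly_Mapping.lookup g"
  let ?kf = "Poly_Mapping.keys f" and ?kg = "Poly_Mapping.keys g"
  have k: "k \<in> KT" "l \<in> KT" if "k \<in> ?kf" "l \<in> ?kg" for k l using assms that by (auto simp: T_carrier)
  have "wt (f \<otimes>\<^bsub>T\<^esub> g) \<le> (\<Sum>k\<in>?kf. wt (\<Sum>l\<in>?kg. Poly_Mapping.single (pmul k l) (?f k * ?g l)))"
    unfolding T_simps tmul_def using k by (intro wt_sum T_sum T_single pmul_in)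
  also have "\<dots> \<le> (\<Sum>k\<in>?kf. \<Sum>l\<in>?kg. wt (Poly_Mapping.single (pmul k l) (?f k * ?g l)))"
    using k by (intro sum_mono wt_sum T_single pmul_in)
  also have "\<dots> \<le> (\<Sum>k\<in>?kf. \<Sum>l\<in>?kg.
      (cmod (?f k) * (nrm A (fst k) * nrm B (snd k))) * (cmod (?g l) * (nrm A (fst l) * nrm B (snd l))))"
  proof (intro sum_mono)
    fix k l assume kl: "k \<in> ?kf" "l \<in> ?kg"
    have "nrm A (fst k \<otimes>\<^bsub>A\<^esub> fst l) * nrm B (snd k \<otimes>\<^bsub>B\<^esub> snd l) \<le>
        (nrm A (fst k) * nrm A (fst l)) * (nrm B (snd k) * nrm B (snd l))"
      using k[OF kl] by (intro mult_mono A.p_mult B.p_mult) (auto simp: mem_Times_iff)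
    from mult_left_mono[OF this, of "cmod (?f k * ?g l)"]
    show "wt (Poly_Mapping.single (pmul k l) (?f k * ?g l)) \<le>
      (cmod (?f k) * (nrm A (fst k) * nrm B (snd k))) * (cmod (?g l) * (nrm A (fst l) * nrm B (snd l)))"
      by (simp add: wt_single pmul_def norm_mult mult_ac)
  qed
  also have "\<dots> = wt f * wt g" by (simp add: wt_def sum_product)
  finally show ?thesis .
qed

abbreviation "pf \<equiv> product_functional"

lemma pf_alt: "pf \<phi> \<psi> f = (\<Sum>k\<in>Poly_Mapping.keys f. Poly_Mapping.lookup f k * (\<phi> (fst k) * \<psi> (snd k)))"
  by (simp add: product_functional_def case_prod_unfold mult.assoc)

lemma pf_single [simp]: "pf \<phi> \<psi> (Poly_Mapping.single k c) = c * (\<phi> (fst k) * \<psi> (snd k))"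
  by (simp add: pf_alt)

lemma pf_zero [simp]: "pf \<phi> \<psi> 0 = 0"
  by (simp add: pf_alt)

lemma pf_add: "pf \<phi> \<psi> (f + g) = pf \<phi> \<psi> f + pf \<phi> \<psi> g"
  unfolding pf_alt by (rule setsum_keys_plus_distrib) (auto simp: distrib_right)

lemma pf_scale: "pf \<phi> \<psi> (scale c f) = c * pf \<phi> \<psi> f"
  by (induction f rule: keys_induct_on[OF subset_UNIV]) (simp_all add: scale_add pf_add distrib_left mult.assoc)

lemma pf_diff: "pf \<phi> \<psi> (f - g) = pf \<phi> \<psi> f - pf \<phi> \<psi> g"
  using pf_add[of \<phi> \<psi> "f - g" g] by simp

lemma pf_sum: "pf \<phi> \<psi> (sum f I) = (\<Sum>i\<in>I. pf \<phi> \<psi> (f i))"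
  by (induction I rule: infinite_finite_induct) (auto simp: pf_add)

lemma poly_mapping_sum_singles: "f = (\<Sum>k\<in>Poly_Mapping.keys f. Poly_Mapping.single k (Poly_Mapping.lookup f k))"
  by (rule poly_mapping_eqI) (simp add: lookup_sum lookup_single when_def sum.delta in_keys_iff)

lemma tmul_sum_left: "tmul (sum f I) g = (\<Sum>i\<in>I. tmul (f i) g)"
  by (induction I rule: infinite_finite_induct) (auto simp: tmul_add_left)

lemma tmul_sum_right: "tmul g (sum f I) = (\<Sum>i\<in>I. tmul g (f i))"
  by (induction I rule: infinite_finite_induct) (auto simp: tmul_add_right)

text \<open>The value at \<open>f* f\<close> as the form of the entrywise product of two Gram
  kernels, one for each factor: the shape required by \<open>schur_product\<close>.\<close>

lemma pf_star_mult:
  "pf \<phi> \<psi> (tmul (conj_linear_ext pstar f) f) =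
    (\<Sum>k\<in>Poly_Mapping.keys f. \<Sum>l\<in>Poly_Mapping.keys f.
      cnj (Poly_Mapping.lookup f k) * Poly_Mapping.lookup f l *
      (\<phi> (star A (fst k) \<otimes>\<^bsub>A\<^esub> fst l) * \<psi> (star B (snd k) \<otimes>\<^bsub>B\<^esub> snd l)))"
proof -
  let ?s = "\<lambda>k. Poly_Mapping.single k (Poly_Mapping.lookup f k)"
  let ?k = "Poly_Mapping.keys f"
  have "tmul (conj_linear_ext pstar (sum ?s ?k)) (sum ?s ?k) =
      (\<Sum>k\<in>?k. \<Sum>l\<in>?k. tmul (conj_linear_ext pstar (?s k)) (?s l))"
    by (simp only: conj_sum tmul_sum_left tmul_sum_right) (rule sum.swap)
  then show ?thesis
    unfolding poly_mapping_sum_singles[symmetric]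
    by (simp add: pf_sum pmul_def pstar_def)
qed

end

lemma state_add: "state A \<phi> \<Longrightarrow> x \<in> carrier A \<Longrightarrow> y \<in> carrier A \<Longrightarrow> \<phi> (x \<oplus>\<^bsub>A\<^esub> y) = \<phi> x + \<phi> y"
  and state_smult: "state A \<phi> \<Longrightarrow> x \<in> carrier A \<Longrightarrow> \<phi> (c \<odot>\<^bsub>A\<^esub> x) = c * \<phi> x"
  by (auto simp: state_def)

lemma (in unital_cstar_algebra) state_pos: "state A \<phi> \<Longrightarrow> pos_functional A \<phi>"
  by (simp add: state_def pos_functional_def nonneg_def)

lemma (in positive_functional) psd_functional:
  assumes I: "finite I" and f: "\<And>i. i \<in> I \<Longrightarrow> f i \<in> carrier A"
  shows "psd I (\<lambda>i j. \<omega> (star A (f i) \<otimes> f j))"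
  unfolding psd_def by (intro conjI ballI allI f_finsum_sq f_swap I f)

context tensor_pair
begin

definition product_states :: "(('a \<times> 'b \<Rightarrow>\<^sub>0 complex) \<Rightarrow> complex) set" where
  "product_states = {pf \<phi> \<psi> | \<phi> \<psi>. state A \<phi> \<and> state B \<psi>}"

text \<open>Positivity of a product of states is the Schur product theorem for the Gram kernels of
  the two states; the weight bound is the norm clause of \<open>state\<close> on each
  factor.\<close>

sublocale functional_family T product_states wt
proof
  fix \<omega> assume "\<omega> \<in> product_states"
  then obtain \<phi> \<psi> where \<omega>: "\<omega> = pf \<phi> \<psi>" and \<phi>: "state A \<phi>" and \<psi>: "state B \<psi>"
    by (auto simp: product_states_def)
  interpret \<Phi>: positive_functional A \<phi>
    by (intro positive_functional.intro A.star_algebra_axioms positive_functional_axioms.intro A.state_pos \<phi>)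
  interpret \<Psi>: positive_functional B \<psi>
    by (intro positive_functional.intro B.star_algebra_axioms positive_functional_axioms.intro B.state_pos \<psi>)
  have "nonneg (\<omega> (tmul (conj_linear_ext pstar x) x))" if "x \<in> carrier T" for x
    unfolding \<omega> pf_star_mult
    by (rule schur_product) (use that in \<open>auto intro!: \<Phi>.psd_functional \<Psi>.psd_functional simp: T_carrier\<close>)
  then show "pos_functional T \<omega>"
    by (simp add: pos_functional_def \<omega> pf_add pf_scale)
  fix x assume x: "x \<in> carrier T"
  show "cmod (\<omega> x) \<le> wt x"
    unfolding \<omega> pf_alt wt_def
  proof (rule sum_norm_le)
    fix k assume "k \<in> Poly_Mapping.keys x"
    then have "fst k \<in> carrier A" "snd k \<in> carrier B" using x by (auto simp: T_carrier)
    then have "cmod (\<phi> (fst k)) \<le> nrm A (fst k)" "cmod (\<psi> (snd k)) \<le> nrm B (snd k)" "0 \<le> nrm A (fst k)"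
      using \<phi> \<psi> by (auto simp: state_def)
    then show "cmod (Poly_Mapping.lookup x k * (\<phi> (fst k) * \<psi> (snd k)))
        \<le> cmod (Poly_Mapping.lookup x k) * (nrm A (fst k) * nrm B (snd k))"
      by (auto simp: norm_mult intro!: mult_left_mono mult_mono)
  qed
qed (auto intro: wt_nonneg wt_mult simp del: T_simps)

abbreviation "sp \<equiv> spatial_norm A B"

lemma sp_eq: "sp = opn"
proof
  fix x
  show "sp x = opn x"
    unfolding spatial_norm_def opn_def gns_inner_def unfolding product_states_def
    by (intro arg_cong[of _ _ Sup] arg_cong[of _ _ "insert 0"]) blast
qed

lemma sp_seminorm: "cstar_seminorm T sp"
  unfolding sp_eq by (rule opn_seminorm)

sublocale Tn: cstar_seminormed_algebra T sp
  by (intro cstar_seminormed_algebra.intro star_algebra_T cstar_seminormed_algebra_axioms.intro sp_seminorm)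

text \<open>Because matrix coefficients are linear in both outer factors, elementary tensors suffice
  as test elements.\<close>

lemma sp_nullI:
  assumes x: "x \<in> carrier T"
    and null: "\<And>\<phi> \<psi> k l. \<lbrakk>state A \<phi>; state B \<psi>; k \<in> KT; l \<in> KT\<rbrakk> \<Longrightarrow>
      pf \<phi> \<psi> (tmul (Poly_Mapping.single k 1) (tmul x (Poly_Mapping.single l 1))) = 0"
  shows "sp x = 0"
  unfolding sp_eq
proof (rule opn_eq_0I[OF x])
  fix \<omega> z y assume "\<omega> \<in> product_states" and z: "z \<in> carrier T" and y: "y \<in> carrier T"
  then obtain \<phi> \<psi> where \<omega>: "\<omega> = pf \<phi> \<psi>" and st: "state A \<phi>" "state B \<psi>"
    by (auto simp: product_states_def)
  have sg: "Poly_Mapping.single k c = scale c (Poly_Mapping.single k 1)" for k :: "'a \<times> 'b" and c :: complex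
    by simp
  have "pf \<phi> \<psi> (tmul z (tmul x y)) = 0"
    using z
  proof (induction z rule: T_induct)
    case (single k c)
    from y show ?case
    proof (induction y rule: T_induct)
      case (single l d)
      show ?case
        unfolding sg[of k c] sg[of l d] tmul_scale_left tmul_scale_right pf_scale
        using null[OF st \<open>k \<in> KT\<close> \<open>l \<in> KT\<close>] by simp
    qed (simp_all add: tmul_add_right pf_add)
  qed (simp_all add: tmul_add_left pf_add)
  then show "\<omega> (z \<otimes>\<^bsub>T\<^esub> (x \<otimes>\<^bsub>T\<^esub> y)) = 0" by (simp add: \<omega>)
qed

text \<open>This and the next three lemmas are the bilinearity relations of the tensor product.
  Products of states evaluate to 0 on them, also after multiplication by elementary tensors from
  both sides.\<close>

lemma null_add_left:
  assumes "a \<in> carrier A" "a' \<in> carrier A" "b \<in> carrier B"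
  shows "sp (Poly_Mapping.single (a \<oplus>\<^bsub>A\<^esub> a', b) 1 - (Poly_Mapping.single (a, b) 1 + Poly_Mapping.single (a', b) 1)) = 0"
proof (rule sp_nullI)
  fix \<phi> \<psi> k l assume st: "state A \<phi>" "state B \<psi>" and "k \<in> KT" "l \<in> KT"
  then show "pf \<phi> \<psi> (tmul (Poly_Mapping.single k 1) (tmul (Poly_Mapping.single (a \<oplus>\<^bsub>A\<^esub> a', b) 1 -
    (Poly_Mapping.single (a, b) 1 + Poly_Mapping.single (a', b) 1)) (Poly_Mapping.single l 1))) = 0"
    using assms by (auto simp: tmul_diff_left tmul_diff_right tmul_add_left tmul_add_right pf_add pf_diff pmul_def
      A.l_distr A.r_distr state_add[OF st(1)] distrib_right)
qed (use assms in simp)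

lemma null_add_right:
  assumes "a \<in> carrier A" "b \<in> carrier B" "b' \<in> carrier B"
  shows "sp (Poly_Mapping.single (a, b \<oplus>\<^bsub>B\<^esub> b') 1 - (Poly_Mapping.single (a, b) 1 + Poly_Mapping.single (a, b') 1)) = 0"
proof (rule sp_nullI)
  fix \<phi> \<psi> k l assume st: "state A \<phi>" "state B \<psi>" and "k \<in> KT" "l \<in> KT"
  then show "pf \<phi> \<psi> (tmul (Poly_Mapping.single k 1) (tmul (Poly_Mapping.single (a, b \<oplus>\<^bsub>B\<^esub> b') 1 -
    (Poly_Mapping.single (a, b) 1 + Poly_Mapping.single (a, b') 1)) (Poly_Mapping.single l 1))) = 0"
    using assms by (auto simp: tmul_diff_left tmul_diff_right tmul_add_left tmul_add_right pf_add pf_diff pmul_def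
      B.l_distr B.r_distr state_add[OF st(2)] distrib_left)
qed (use assms in simp)

lemma null_smult_left:
  assumes "a \<in> carrier A" "b \<in> carrier B"
  shows "sp (Poly_Mapping.single (c \<odot>\<^bsub>A\<^esub> a, b) 1 - Poly_Mapping.single (a, b) c) = 0"
proof (rule sp_nullI)
  fix \<phi> \<psi> k l assume st: "state A \<phi>" "state B \<psi>" and "k \<in> KT" "l \<in> KT"
  then show "pf \<phi> \<psi> (tmul (Poly_Mapping.single k 1) (tmul (Poly_Mapping.single (c \<odot>\<^bsub>A\<^esub> a, b) 1 -
    Poly_Mapping.single (a, b) c) (Poly_Mapping.single l 1))) = 0"
    using assms by (auto simp: tmul_diff_left tmul_diff_right pf_diff pmul_def
      A.smult_mult_left A.smult_mult_right state_smult[OF st(1)])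
qed (use assms in simp)

lemma null_smult_right:
  assumes "a \<in> carrier A" "b \<in> carrier B"
  shows "sp (Poly_Mapping.single (a, c \<odot>\<^bsub>B\<^esub> b) 1 - Poly_Mapping.single (a, b) c) = 0"
proof (rule sp_nullI)
  fix \<phi> \<psi> k l assume st: "state A \<phi>" "state B \<psi>" and "k \<in> KT" "l \<in> KT"
  then show "pf \<phi> \<psi> (tmul (Poly_Mapping.single k 1) (tmul (Poly_Mapping.single (a, c \<odot>\<^bsub>B\<^esub> b) 1 -
    Poly_Mapping.single (a, b) c) (Poly_Mapping.single l 1))) = 0"
    using assms by (auto simp: tmul_diff_left tmul_diff_right pf_diff pmul_def
      B.smult_mult_left B.smult_mult_right state_smult[OF st(2)])
qed (use assms in simp)

end

section \<open>Functoriality of the minimal tensor product\<close>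

text \<open>Isometry is part of the data; it is supplied later by two mutually inverse
  contractions.\<close>

locale cstar_iso = A: unital_cstar_algebra A + B: unital_cstar_algebra B
  for A :: "('a, 'm) cstar_algebra_scheme" and B :: "('b, 'n) cstar_algebra_scheme" +
  fixes \<phi> assumes hom: "star_hom A B \<phi>" and bij: "bij_betw \<phi> (carrier A) (carrier B)"
    and isom: "a \<in> carrier A \<Longrightarrow> nrm B (\<phi> a) = nrm A a"
begin

sublocale A2: tensor_pair A A ..
sublocale B2: tensor_pair B B ..

definition tmap :: "('a \<times> 'a \<Rightarrow>\<^sub>0 complex) \<Rightarrow> ('b \<times> 'b \<Rightarrow>\<^sub>0 complex)" where
  "tmap = lin_ext (\<lambda>k. Poly_Mapping.single (map_prod \<phi> \<phi> k) 1)"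

lemma tmap_simps [simp]:
  "tmap (Poly_Mapping.single k c) = Poly_Mapping.single (map_prod \<phi> \<phi> k) c"
  "tmap 0 = 0" "tmap (f + g) = tmap f + tmap g" "tmap (scale c f) = scale c (tmap f)"
  by (simp_all add: tmap_def lin_ext_add lin_ext_scale)

lemma tmap_in: "f \<in> carrier A2.T \<Longrightarrow> tmap f \<in> carrier B2.T"
  by (induction rule: A2.T_induct) (auto simp: star_homD[OF hom] simp del: A2.T_simps B2.T_simps)

lemma tmap_mult: "f \<in> carrier A2.T \<Longrightarrow> g \<in> carrier A2.T \<Longrightarrow> tmap (A2.tmul f g) = B2.tmul (tmap f) (tmap g)"
proof (induction f rule: A2.T_induct)
  case (single k c)
  from single(2) show ?case
    by (induction g rule: A2.T_induct)
      (use single(1) in \<open>auto simp: A2.tmul_add_right B2.tmul_add_right A2.pmul_def B2.pmul_def star_homD[OF hom]\<close>)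
qed (simp_all add: A2.tmul_add_left B2.tmul_add_left)

lemma tmap_star: "f \<in> carrier A2.T \<Longrightarrow> tmap (conj_linear_ext A2.pstar f) = conj_linear_ext B2.pstar (tmap f)"
  by (induction rule: A2.T_induct) (auto simp: conj_add A2.pstar_def B2.pstar_def star_homD[OF hom])

lemma tmap_hom: "star_hom A2.T B2.T tmap"
  by (rule star_homI) (auto simp: tmap_in tmap_mult tmap_star A2.punit_def B2.punit_def star_homD[OF hom])

text \<open>Lets every test vector for the spatial norm over \<open>B\<close> be pulled back to
  \<open>A\<close>.\<close>

lemma tmap_surj: "g \<in> carrier B2.T \<Longrightarrow> \<exists>f \<in> carrier A2.T. tmap f = g"
proof (induction rule: B2.T_induct)
  case (single k c)
  then obtain a a' where "a \<in> carrier A" "a' \<in> carrier A" "k = (\<phi> a, \<phi> a')"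
  proof -
    have "fst k \<in> \<phi> ` carrier A" "snd k \<in> \<phi> ` carrier A" using single bij by (auto simp: bij_betw_def)
    then obtain a a' where "a \<in> carrier A" "a' \<in> carrier A" "fst k = \<phi> a" "snd k = \<phi> a'" by auto
    then show ?thesis using that by (metis prod.collapse)
  qed
  then show ?case by (intro bexI[of _ "Poly_Mapping.single (a, a') c"]) auto
next
  case (add f g)
  then obtain f' g' where "f' \<in> carrier A2.T" "g' \<in> carrier A2.T" "tmap f' = f" "tmap g' = g" by auto
  then show ?case by (intro bexI[of _ "f' + g'"]) auto
qed (use tmap_simps(2) A2.T_zero in blast)

text \<open>Isometry enters in the norm clause of \<open>state\<close>.\<close>

lemma state_pullback: "state B \<psi> \<Longrightarrow> state A (\<lambda>a. \<psi> (\<phi> a))"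
  unfolding state_def by (auto simp: star_homD[OF hom] simp flip: isom)

lemma pf_pullback: "B2.pf \<psi> \<psi>' (tmap f) = A2.pf (\<lambda>a. \<psi> (\<phi> a)) (\<lambda>a. \<psi>' (\<phi> a)) f"
  by (induction f rule: keys_induct_on[OF subset_UNIV]) (auto simp: A2.pf_add B2.pf_add)

text \<open>States and test vectors over \<open>B\<close> both pull back to \<open>A\<close>, so
  each quotient in the supremum for \<open>tmap f\<close> already occurs for
  \<open>f\<close>.\<close>

lemma tmap_contraction: "contraction A2.T A2.sp B2.T B2.sp tmap"
  unfolding contraction_def A2.sp_eq B2.sp_eq
proof (intro conjI ballI tmap_hom)
  fix f assume f: "f \<in> carrier A2.T"
  show "B2.opn (tmap f) \<le> A2.opn f"
  proof (rule B2.opn_le)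
    fix \<omega> y assume w: "\<omega> \<in> B2.product_states" and y: "y \<in> carrier B2.T"
    then obtain \<psi> \<psi>' where \<omega>: "\<omega> = B2.pf \<psi> \<psi>'" "state B \<psi>" "state B \<psi>'" by (auto simp: B2.product_states_def)
    obtain g where g: "g \<in> carrier A2.T" "y = tmap g" using tmap_surj[OF y] by blast
    define \<omega>' where "\<omega>' = A2.pf (\<lambda>a. \<psi> (\<phi> a)) (\<lambda>a. \<psi>' (\<phi> a))"
    have w': "\<omega>' \<in> A2.product_states"
      unfolding \<omega>'_def A2.product_states_def using \<omega> state_pullback by blast
    have Sq: "B2.Sq \<omega> (tmap h) = A2.Sq \<omega>' h" if "h \<in> carrier A2.T" for h
      unfolding B2.sq_def'[OF w] A2.sq_def'[OF w'] unfolding \<omega>(1) \<omega>'_def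
      using that by (simp add: pf_pullback flip: tmap_mult tmap_star)
    show "sqrt (B2.Sq \<omega> (tmap f \<otimes>\<^bsub>B2.T\<^esub> y)) \<le> A2.opn f * sqrt (B2.Sq \<omega> y)"
      using A2.opn_bound[OF f w' g(1)] f g by (simp add: Sq flip: tmap_mult)
  qed (rule A2.opn_nonneg[OF f])
qed

end

section \<open>Congruence modulo a C*-seminorm\<close>

lemma carrier_free_UNIV [simp]: "carrier (free_star_algebra UNIV) = UNIV"
  by (auto simp: free_star_algebra_def)

text \<open>Congruence on the free algebra over all generators of the type, so that no carrier
  conditions arise. Seminorms on fewer generators enter through \<open>restrict_gens\<close>, the
  spatial seminorm through \<open>push\<close>.\<close>

locale cstar_cong = cstar_seminormed_algebra "free_star_algebra UNIV" q
  for q :: "'y free_algebra \<Rightarrow> real"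
begin

lemma q_nonneg [simp]: "0 \<le> q x"
  and q_add: "q (x + y) \<le> q x + q y"
  and q_scale: "q (scale c x) = cmod c * q x"
  and q_mult: "q (x * y) \<le> q x * q y"
  and q_cstar: "q (free_star x * x) = (q x)\<^sup>2"
  and q_star [simp]: "q (free_star x) = q x"
  and q_zero [simp]: "q 0 = 0"
  and q_minus_commute: "q (x - y) = q (y - x)"
  using p_nonneg[of x] p_add[of x y] p_smult[of x c] p_mult[of x y] p_cstar[of x] p_star[of x] p_zero
    p_minus_commute[of x y] by simp_all

lemma q_sum: "q (sum f I) \<le> (\<Sum>i\<in>I. q (f i))"
proof (induction I rule: infinite_finite_induct)
  case (insert i I)
  then show ?case using q_add[of "f i" "sum f I"] by simp
qed auto

definition eqv :: "'y free_algebra \<Rightarrow> 'y free_algebra \<Rightarrow> bool"  (infix \<open>\<approx>\<close> 50) where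
  "x \<approx> y \<longleftrightarrow> q (x - y) = 0"

lemma eqv_refl [simp, intro]: "x \<approx> x"
  by (simp add: eqv_def)

lemma eqv_sym [sym]: "x \<approx> y \<Longrightarrow> y \<approx> x"
  by (simp add: eqv_def q_minus_commute)

lemma null_add: "q x = 0 \<Longrightarrow> q y = 0 \<Longrightarrow> q (x + y) = 0"
  using q_add[of x y] q_nonneg[of "x + y"] by linarith

lemma eqv_trans [trans]: "x \<approx> y \<Longrightarrow> y \<approx> z \<Longrightarrow> x \<approx> z"
  using null_add[of "x - y" "y - z"] by (simp add: eqv_def)

lemma eqv_add: "x \<approx> x' \<Longrightarrow> y \<approx> y' \<Longrightarrow> x + y \<approx> x' + y'"
  using null_add[of "x - x'" "y - y'"] by (simp add: eqv_def add_diff_add)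

lemma eqv_scale: "x \<approx> y \<Longrightarrow> scale c x \<approx> scale c y"
  by (simp add: eqv_def q_scale flip: scale_diff)

lemma eqv_uminus: "x \<approx> y \<Longrightarrow> - x \<approx> - y"
  using eqv_scale[of x y "-1"] by (simp only: scale_minus_1)

lemma eqv_diff: "x \<approx> x' \<Longrightarrow> y \<approx> y' \<Longrightarrow> x - y \<approx> x' - y'"
  using eqv_add[of x x' "- y" "- y'"] eqv_uminus[of y y'] by simp

lemma eqv_star: "x \<approx> y \<Longrightarrow> free_star x \<approx> free_star y"
  by (simp add: eqv_def flip: conj_diff)

lemma eqv_mult_left: assumes "x \<approx> y" shows "z * x \<approx> z * y"
proof -
  have "q (z * (x - y)) \<le> 0" using q_mult[of z "x - y"] assms by (simp add: eqv_def)
  then show ?thesis using q_nonneg[of "z * (x - y)"] unfolding eqv_def right_diff_distrib by linarith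
qed

lemma eqv_mult_right: assumes "x \<approx> y" shows "x * z \<approx> y * z"
proof -
  have "q ((x - y) * z) \<le> 0" using q_mult[of "x - y" z] assms by (simp add: eqv_def)
  then show ?thesis using q_nonneg[of "(x - y) * z"] unfolding eqv_def left_diff_distrib by linarith
qed

lemma eqv_mult: "x \<approx> x' \<Longrightarrow> y \<approx> y' \<Longrightarrow> x * y \<approx> x' * y'"
  using eqv_mult_left eqv_mult_right eqv_trans by blast

lemma eqv_sum: "(\<And>i. i \<in> I \<Longrightarrow> f i \<approx> g i) \<Longrightarrow> sum f I \<approx> sum g I"
  by (induction I rule: infinite_finite_induct) (auto intro: eqv_add)

lemma eqv_sum_zero: "(\<And>i. i \<in> I \<Longrightarrow> f i \<approx> 0) \<Longrightarrow> sum f I \<approx> 0"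
  using eqv_sum[of I f "\<lambda>_. 0"] by simp

lemma eqv_q: "x \<approx> y \<Longrightarrow> q x = q y"
  using q_add[of "x - y" y] q_add[of "y - x" x] by (simp add: eqv_def q_minus_commute)

lemma eqv_0_iff: "x \<approx> 0 \<longleftrightarrow> q x = 0"
  by (simp add: eqv_def)

lemma eqv_mult_0: "x \<approx> 0 \<Longrightarrow> z * x \<approx> 0" "x \<approx> 0 \<Longrightarrow> x * z \<approx> 0"
  using eqv_mult_left[of x 0 z] eqv_mult_right[of x 0 z] by simp_all

lemma cstar_zero: "free_star x * x \<approx> 0 \<Longrightarrow> x \<approx> 0"
  using q_cstar[of x] by (simp add: eqv_0_iff)

definition proj :: "'y free_algebra \<Rightarrow> bool" where
  "proj x \<longleftrightarrow> x * x \<approx> x \<and> free_star x \<approx> x"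

text \<open>For a projection the C*-identity reads \<open>q x = (q x)^2\<close>, so
  \<open>q x\<close> is 0 or 1.\<close>

lemma q_proj: assumes "proj x" shows "q x \<le> 1"
proof -
  have "free_star x * x \<approx> x"
    using assms eqv_mult_right[of "free_star x" x x] eqv_trans by (auto simp: proj_def)
  then have "(q x)\<^sup>2 = q x" using eqv_q q_cstar[of x] by simp
  then show ?thesis by (auto simp: power2_eq_square)
qed

lemma proj_one: "proj 1"
  by (simp add: proj_def)

lemma proj_compl: assumes "proj x" shows "proj (1 - x)"
proof -
  have "(1 - x) * (1 - x) = 1 - x - x + x * x" by (simp add: algebra_simps)
  also have "\<dots> \<approx> 1 - x - x + x" by (intro eqv_add eqv_refl) (use assms in \<open>simp add: proj_def\<close>)
  finally have "(1 - x) * (1 - x) \<approx> 1 - x" by simp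
  moreover have "free_star (1 - x) \<approx> 1 - x"
    unfolding conj_diff using assms by (intro eqv_diff) (auto simp: proj_def)
  ultimately show ?thesis by (simp add: proj_def)
qed

lemma proj_cong: assumes "proj x" "x \<approx> y" shows "proj y"
proof -
  have "y * y \<approx> x * x" using eqv_mult[OF eqv_sym eqv_sym, OF assms(2,2)] .
  also have "\<dots> \<approx> x" using assms(1) by (simp add: proj_def)
  also note assms(2)
  finally have 1: "y * y \<approx> y" .
  have "free_star y \<approx> free_star x" using eqv_star[OF eqv_sym[OF assms(2)]] .
  also have "\<dots> \<approx> x" using assms(1) by (simp add: proj_def)
  also note assms(2)
  finally show ?thesis using 1 by (simp add: proj_def)
qed

text \<open>The unit \<open>p\<close> of a corner is an extreme point of its unit ball. The set of \<open>z\<close> with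
  \<open>\<parallel>p + z k\<parallel> \<le> 1\<close> contains \<open>1, -1\<close> by assumption, and \<open>\<i>, -\<i>\<close> because \<open>k\<close> is self-adjoint; it is then stable under
  multiplication by \<open>1 + \<i>\<close>, since \<open>(p + z k)\<^sup>2 + (p + \<i> z k)\<^sup>2 = 2 (p + (1 + \<i>) z k)\<close>.\<close>

lemma corner_unit_extreme:
  assumes p: "proj p" and k: "free_star k \<approx> k" "p * k \<approx> k" "k * p \<approx> k"
    and le: "q (p + k) \<le> 1" "q (p - k) \<le> 1"
  shows "k \<approx> 0"
proof -
  define f where "f z = p + scale z k" for z
  have prod: "f z * f w \<approx> p + scale (z + w) k + scale (z * w) (k * k)" for z w
  proof -
    have "f z * f w = p * p + scale w (p * k) + scale z (k * p) + scale (z * w) (k * k)"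
      by (simp add: f_def distrib_left distrib_right scale_mult_left scale_mult_right scale_scale scale_add add_ac mult.commute)
    also have "\<dots> \<approx> p + scale w k + scale z k + scale (z * w) (k * k)"
      using p k by (intro eqv_add eqv_scale eqv_refl) (auto simp: proj_def)
    also have "\<dots> = p + scale (z + w) k + scale (z * w) (k * k)"
      by (simp add: scale_add_left add_ac)
    finally show ?thesis .
  qed
  \<comment> \<open>An average of two squares of contractions is a contraction.\<close>
  have half: "q x \<le> 1" if "scale 2 x \<approx> f z * f z + f w * f w" "q (f z) \<le> 1" "q (f w) \<le> 1" for x z w
  proof -
    have "2 * q x \<le> q (f z * f z) + q (f w * f w)"
      using eqv_q[OF that(1)] q_add[of "f z * f z" "f w * f w"] by (simp add: q_scale)
    also have "\<dots> \<le> q (f z) * q (f z) + q (f w) * q (f w)" by (intro add_mono q_mult)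
    also have "\<dots> \<le> 1 * 1 + 1 * 1" using that by (intro add_mono mult_mono) auto
    finally show ?thesis by simp
  qed
  have step: "q (f ((1 + \<i>) * z)) \<le> 1" if "q (f z) \<le> 1" "q (f (\<i> * z)) \<le> 1" for z
  proof (rule half[OF _ that])
    have "f z * f z + f (\<i> * z) * f (\<i> * z) \<approx>
        (p + scale (z + z) k + scale (z * z) (k * k)) +
        (p + scale (\<i> * z + \<i> * z) k + scale (\<i> * z * (\<i> * z)) (k * k))"
      by (intro eqv_add prod)
    also have "\<dots> = scale 2 (f ((1 + \<i>) * z))"
      by (rule poly_mapping_eqI) (simp add: f_def lookup_add algebra_simps)
    finally show "scale 2 (f ((1 + \<i>) * z)) \<approx> f z * f z + f (\<i> * z) * f (\<i> * z)" by (rule eqv_sym)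
  qed
  have f1: "q (f 1) \<le> 1" and fm1: "q (f (- 1)) \<le> 1"
    using le by (simp_all add: f_def scale_minus_1 del: map_eq_zero_iff)
  \<comment> \<open>Averaging the squares at 1 and -1 cancels the linear term. The outcome is also
    f(z)* f(z) for \<open>z = \<i>\<close> and \<open>z = - \<i>\<close>, so the C*-identity makes
    those two values contractions.\<close>
  have "q (p + k * k) \<le> 1"
  proof (rule half[OF _ f1 fm1])
    have "f 1 * f 1 + f (-1) * f (-1) \<approx>
        (p + scale (1 + 1) k + scale (1 * 1) (k * k)) + (p + scale (-1 + -1) k + scale (-1 * -1) (k * k))"
      by (intro eqv_add prod)
    also have "\<dots> = scale 2 (p + k * k)"
      by (rule poly_mapping_eqI) (simp add: lookup_add algebra_simps)
    finally show "scale 2 (p + k * k) \<approx> f 1 * f 1 + f (-1) * f (-1)" by (rule eqv_sym)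
  qed
  moreover have "(q (f z))\<^sup>2 = q (p + k * k)" if z: "z = \<i> \<or> z = - \<i>" for z
  proof -
    have "free_star (f z) \<approx> f (cnj z)"
      unfolding f_def conj_add conj_scale using p k by (intro eqv_add eqv_scale) (auto simp: proj_def)
    then have "free_star (f z) * f z \<approx> f (cnj z) * f z" by (rule eqv_mult_right)
    also have "\<dots> \<approx> p + scale (cnj z + z) k + scale (cnj z * z) (k * k)" by (rule prod)
    also have "\<dots> = p + k * k" using z by auto
    finally show ?thesis using eqv_q q_cstar by metis
  qed
  ultimately have fi: "q (f z) \<le> 1" if "z = \<i> \<or> z = - \<i>" for z
    using that by (metis abs_square_le_1 abs_of_nonneg q_nonneg)
  have all: "q (f z) \<le> 1 \<and> q (f (\<i> * z)) \<le> 1 \<and> q (f (- z)) \<le> 1 \<and> q (f (- \<i> * z)) \<le> 1"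
    if "z = (1 + \<i>) ^ n" for n z
    using that
  proof (induction n arbitrary: z)
    case 0
    then show ?case using f1 fm1 fi by simp
  next
    case (Suc n)
    define y where "y = (1 + \<i>) ^ n"
    have z: "z = (1 + \<i>) * y" using Suc.prems by (simp add: y_def)
    note IH = Suc.IH[OF y_def]
    have e: "(1 + \<i>) * (\<i> * y) = \<i> * z" "(1 + \<i>) * (- y) = - z" "(1 + \<i>) * (- \<i> * y) = - \<i> * z"
      by (simp_all add: z algebra_simps)
    show ?case
      using step[of y] step[of "\<i> * y"] step[of "- y"] step[of "- \<i> * y"] IH
      unfolding e z[symmetric] by simp
  qed
  \<comment> \<open>The numbers \<open>(1 + \<i>)^n\<close> have modulus \<open>sqrt 2 ^ n\<close>,
    while \<open>z k\<close> stays within distance 1 of \<open>- p\<close>, which has norm at most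
    1; only a null \<open>k\<close> survives this.\<close>
  have bound: "sqrt 2 ^ n * q k \<le> 2" for n
  proof -
    define z where "z = (1 + \<i>) ^ n"
    have "cmod (1 + \<i>) = sqrt 2" by (simp add: cmod_def)
    then have c: "cmod z = sqrt 2 ^ n" by (simp add: z_def norm_power)
    have "scale z k = f z + scale (-1) p" by (rule poly_mapping_eqI) (simp add: f_def lookup_add)
    then have "cmod z * q k \<le> q (f z) + q p"
      using q_add[of "f z" "scale (-1) p"] by (simp add: q_scale[of _ p] flip: q_scale[of z])
    then show ?thesis using all[OF z_def] q_proj[OF p] by (simp add: c)
  qed
  have "q k = 0"
  proof (rule ccontr)
    assume "q k \<noteq> 0"
    then have "q k > 0" using q_nonneg[of k] by linarith
    moreover obtain n where "2 / q k < sqrt 2 ^ n" using real_arch_pow[of "sqrt 2" "2 / q k"] by auto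
    ultimately show False using bound[of n] by (simp add: field_simps)
  qed
  then show ?thesis by (simp add: eqv_0_iff)
qed

text \<open>Substitutes norm estimates for positivity: small multiples of the corner
  \<open>h = p r p\<close> can be both added to and subtracted from \<open>p\<close> inside the unit
  ball, so \<open>h\<close> is null, and \<open>h\<close> is congruent to the C*-square of
  \<open>r p\<close>.\<close>

lemma partition_of_unity_orthogonal:
  assumes fin: "finite I" and pr: "\<And>i. i \<in> I \<Longrightarrow> proj (P i)" and one: "sum P I \<approx> 1"
    and ab: "a \<in> I" "b \<in> I" "a \<noteq> b"
  shows "P a * P b \<approx> 0"
proof -
  define p r where "p = P a" and "r = P b"
  have p: "p * p \<approx> p" "free_star p \<approx> p" "q p \<le> 1" and r: "r * r \<approx> r" "free_star r \<approx> r"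
    and pp: "proj p" and rp: "proj r"
    using pr ab q_proj by (auto simp: proj_def p_def r_def)
  define h where "h = p * r * p"
  define J where "J = I - {a, b}"
  define m where "m = real (card J)"
  have J: "sum P I = sum P J + p + r" "finite J"
    using fin ab by (simp_all add: J_def p_def r_def sum.remove[of I a] sum.remove[of "I - {a}" b] Diff_insert2[symmetric] insert_commute add_ac)
  have sand: "q (p * x * p) \<le> q x" for x
  proof -
    have "q (p * x * p) \<le> q p * q x * q p" by (intro order_trans[OF q_mult] mult_right_mono q_mult) auto
    also have "\<dots> \<le> 1 * q x * 1" using p(3) by (intro mult_mono) auto
    finally show ?thesis by simp
  qed
  have php: "p * h \<approx> h" "h * p \<approx> h"
  proof -
    have "p * h = (p * p) * (r * p)" by (simp add: h_def mult.assoc)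
    also have "\<dots> \<approx> p * (r * p)" by (rule eqv_mult_right[OF p(1)])
    finally show "p * h \<approx> h" by (simp add: h_def mult.assoc)
    have "h * p = (p * r) * (p * p)" by (simp add: h_def mult.assoc)
    also have "\<dots> \<approx> (p * r) * p" by (rule eqv_mult_left[OF p(1)])
    finally show "h * p \<approx> h" by (simp add: h_def)
  qed
  have hs: "free_star h \<approx> h"
  proof -
    have "free_star h = free_star p * free_star r * free_star p" by (simp add: h_def free_star_mult mult.assoc)
    also have "\<dots> \<approx> p * r * p" by (intro eqv_mult p r)
    finally show ?thesis by (simp add: h_def)
  qed
  \<comment> \<open>A sum of \<open>m\<close> projections, so of norm at most \<open>m\<close>. Its
    compression by \<open>p\<close> is \<open>m p + h\<close>, because the members outside
    \<open>J\<close> are exactly \<open>p\<close> and \<open>r\<close>.\<close>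
  define S where "S = (\<Sum>l\<in>J. 1 - P l)"
  have "q S \<le> (\<Sum>l\<in>J. 1)"
    unfolding S_def by (intro order_trans[OF q_sum] sum_mono q_proj proj_compl pr) (auto simp: J_def)
  then have qS: "q S \<le> m" by (simp add: m_def)
  have "p * S * p \<approx> scale (of_real m) p + h"
  proof -
    have "S = scale (of_real m) 1 - sum P J"
      using J(2) by (simp add: S_def sum_subtractf m_def mult_map_scale_conv_mult)
    moreover have "sum P J \<approx> 1 - p - r"
      using eqv_diff[OF eqv_diff[OF one eqv_refl[of p]] eqv_refl[of r]] J(1) by simp
    ultimately have "S \<approx> scale (of_real m) 1 - (1 - p - r)" by (auto intro: eqv_diff)
    then have "p * S * p \<approx> p * (scale (of_real m) 1 - (1 - p - r)) * p"
      by (intro eqv_mult_right eqv_mult_left)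
    also have "\<dots> = scale (of_real m) (p * p) - (p * p - p * p * p) + h"
      by (simp add: h_def algebra_simps scale_mult_left scale_mult_right)
    also have "\<dots> \<approx> scale (of_real m) p - (p - p) + h"
    proof (intro eqv_add eqv_diff eqv_scale p(1) eqv_refl)
      show "p * p * p \<approx> p" using eqv_trans[OF eqv_mult_right[OF p(1)] p(1)] .
    qed
    finally show ?thesis by simp
  qed
  then have qm: "q (scale (of_real m) p + h) \<le> m" using eqv_q sand[of S] qS by (metis order_trans)
  \<comment> \<open>With this \<open>t\<close>, the element \<open>p + t h\<close> is
    \<open>t\<close> times the sum of \<open>m p + h\<close> and \<open>p\<close>, whose norms are
    at most \<open>m\<close> and 1.\<close>
  define t where "t = 1 / (m + 1)"
  have t: "0 < t" "t \<le> 1" "t * (m + 1) = 1" by (auto simp: t_def m_def field_simps)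
  define k where "k = scale (of_real t) h"
  have "q (p + k) \<le> 1"
  proof -
    have "p + k = scale (of_real t) ((scale (of_real m) p + h) + p)"
    proof (rule poly_mapping_eqI)
      fix w
      have "complex_of_real t * (of_real m + 1) = 1" using t(3) by (metis of_real_1 of_real_add of_real_mult)
      then have "complex_of_real t * of_real m + of_real t = 1" by (simp add: distrib_left)
      then have "Poly_Mapping.lookup p w = (complex_of_real t * of_real m + of_real t) * Poly_Mapping.lookup p w" by simp
      then show "Poly_Mapping.lookup (p + k) w = Poly_Mapping.lookup (scale (of_real t) ((scale (of_real m) p + h) + p)) w"
        by (simp add: k_def lookup_add algebra_simps)
    qed
    then have "q (p + k) = t * q ((scale (of_real m) p + h) + p)" using t by (simp add: q_scale)
    also have "\<dots> \<le> t * (m + 1)" using q_add[of "scale (of_real m) p + h" p] qm p(3) t by (intro mult_left_mono) auto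
    finally show ?thesis using t by simp
  qed
  moreover have "q (p - k) \<le> 1"
  proof -
    \<comment> \<open>A compressed projection, hence a contraction; \<open>p - t h\<close> is a
      convex combination of it and \<open>p\<close>.\<close>
    have "p - h \<approx> p * (1 - r) * p"
      using eqv_diff[OF p(1)[THEN eqv_sym] eqv_refl[of h]] by (simp add: h_def algebra_simps)
    then have ph: "q (p - h) \<le> 1"
      using eqv_q[of "p - h" "p * (1 - r) * p"] order_trans[OF sand[of "1 - r"] q_proj[OF proj_compl[OF rp]]] by simp
    have "p - k = scale (of_real (1 - t)) p + scale (of_real t) (p - h)"
      by (rule poly_mapping_eqI) (simp add: k_def lookup_add lookup_minus algebra_simps)
    then have "q (p - k) \<le> (1 - t) * q p + t * q (p - h)"
      using q_add[of "scale (of_real (1 - t)) p" "scale (of_real t) (p - h)"] t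
      unfolding q_scale norm_of_real by simp
    also have "\<dots> \<le> (1 - t) * 1 + t * 1" using p(3) ph t by (intro add_mono mult_left_mono) auto
    finally show ?thesis by simp
  qed
  moreover have "free_star k \<approx> k" "p * k \<approx> k" "k * p \<approx> k"
    using hs php by (simp_all add: k_def conj_scale scale_mult_left scale_mult_right eqv_scale)
  ultimately have "k \<approx> 0" using corner_unit_extreme[OF pp] by blast
  then have h0: "h \<approx> 0" using t by (simp add: k_def eqv_0_iff q_scale)
  have "free_star (r * p) * (r * p) = free_star p * (free_star r * r) * p" by (simp add: free_star_mult mult.assoc)
  also have "\<dots> \<approx> p * (r * r) * p" by (intro eqv_mult p r eqv_refl)
  also have "\<dots> \<approx> h" unfolding h_def by (intro eqv_mult_right eqv_mult_left r)
  also note h0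
  finally have "r * p \<approx> 0" by (rule cstar_zero)
  then have "free_star (r * p) \<approx> 0" using eqv_star[of "r * p" 0] by simp
  then have "free_star p * free_star r \<approx> 0" by (simp add: free_star_mult)
  moreover have "p * r \<approx> free_star p * free_star r" using eqv_mult[OF eqv_sym eqv_sym, OF p(2) r(2)] .
  ultimately show ?thesis unfolding p_def r_def by (metis eqv_trans)
qed

text \<open>Adding the unit to the family turns a vanishing sum of projections into a partition of unity.\<close>

lemma sum_projections_zero:
  assumes fin: "finite I" and pr: "\<And>i. i \<in> I \<Longrightarrow> proj (P i)" and zero: "sum P I \<approx> 0" and a: "a \<in> I"
  shows "P a \<approx> 0"
proof -
  define P' where "P' = case_option 1 P"
  have "sum P' (insert None (Some ` I)) = 1 + sum P I"
    using fin by (simp add: P'_def sum.reindex)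
  then have "sum P' (insert None (Some ` I)) \<approx> 1" using eqv_add[OF eqv_refl[of 1] zero] by simp
  then have "P' (Some a) * P' None \<approx> 0"
    by (rule partition_of_unity_orthogonal[rotated 2])
      (use fin a pr proj_one in \<open>auto simp: P'_def\<close>)
  then show ?thesis by (simp add: P'_def)
qed

lemma sum_orthogonal_projections:
  assumes "finite I" and pr: "\<And>i. i \<in> I \<Longrightarrow> proj (P i)"
    and orth: "\<And>i j. i \<in> I \<Longrightarrow> j \<in> I \<Longrightarrow> i \<noteq> j \<Longrightarrow> P i * P j \<approx> 0"
  shows "proj (sum P I)"
proof -
  have "sum P I * sum P I = (\<Sum>i\<in>I. \<Sum>j\<in>I. P i * P j)" by (rule sum_product)
  also have "\<dots> \<approx> (\<Sum>i\<in>I. \<Sum>j\<in>I. if i = j then P i else 0)"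
    using pr orth by (intro eqv_sum) (auto simp: proj_def)
  also have "\<dots> = sum P I" using assms(1) by simp
  finally show ?thesis using pr by (auto simp: proj_def conj_sum intro: eqv_sum)
qed

section \<open>Magic unitaries\<close>

definition magic :: "'i set \<Rightarrow> ('i \<Rightarrow> 'i \<Rightarrow> 'y free_algebra) \<Rightarrow> bool" where
  "magic I u \<longleftrightarrow> (\<forall>i\<in>I. \<forall>j\<in>I. proj (u i j)) \<and>
    (\<forall>i\<in>I. (\<Sum>j\<in>I. u i j) \<approx> 1) \<and> (\<forall>i\<in>I. (\<Sum>j\<in>I. u j i) \<approx> 1)"

lemma magic_relations: "(\<forall>r \<in> magic_unitary_relations I u. q r = 0) \<longleftrightarrow> magic I u"
  unfolding magic_unitary_relations_def magic_def proj_def eqv_def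
  by (auto simp: ball_Un; metis)

lemma magic_row:
  assumes "finite I" "magic I u" "i \<in> I" "j \<in> I" "k \<in> I"
  shows "u i j * u i k \<approx> (if j = k then u i j else 0)"
  using assms partition_of_unity_orthogonal[of I "u i" j k] by (auto simp: magic_def proj_def)

lemma magic_col:
  assumes "finite I" "magic I u" "i \<in> I" "j \<in> I" "k \<in> I"
  shows "u j i * u k i \<approx> (if j = k then u j i else 0)"
  using assms partition_of_unity_orthogonal[of I "\<lambda>l. u l i" j k] by (auto simp: magic_def proj_def)

end

section \<open>Substitution and presentations\<close>

lemma subst_subst: "subst \<tau> (subst \<sigma> f) = subst (\<lambda>x. subst \<tau> (\<sigma> x)) f"
proof (induction f rule: keys_induct_on[OF subset_UNIV])
  case (2 w c)
  have "subst \<tau> (prod_list (map (letter_val \<sigma>) ls)) = prod_list (map (letter_val (\<lambda>x. subst \<tau> (\<sigma> x))) ls)" for ls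
  proof (induction ls)
    case (Cons l ls)
    then show ?case by (cases l) auto
  qed simp
  then show ?case by (simp add: word_val_def)
qed simp_all

context cstar_cong
begin

lemma subst_cong:
  assumes "f \<in> carrier (free_star_algebra X)" and st: "\<And>x. x \<in> X \<Longrightarrow> \<sigma> x \<approx> \<tau> x"
  shows "subst \<sigma> f \<approx> subst \<tau> f"
  using assms(1)
proof (induction rule: free_induct)
  case (single w c)
  have "prod_list (map (letter_val \<sigma>) ls) \<approx> prod_list (map (letter_val \<tau>) ls)" if "(\<Union>l\<in>set ls. set_letter l) \<subseteq> X" for ls
    using that
  proof (induction ls)
    case (Cons l ls)
    have "letter_val \<sigma> l \<approx> letter_val \<tau> l" using Cons.prems st by (cases l) (auto intro: eqv_star)
    then show ?case using Cons by (auto intro: eqv_mult)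
  qed simp
  then show ?case using single by (cases w) (auto simp: word_val_def intro: eqv_scale)
qed (auto intro: eqv_add)

end

lemma subst_gen_id [simp]: fixes f :: "'x free_algebra" shows "subst gen f = f"
proof (induction f rule: keys_induct_on[OF subset_UNIV])
  case (2 w c)
  have "prod_list (map (letter_val gen) ls) = Poly_Mapping.single (Word ls) 1" for ls :: "'x letter list"
  proof (induction ls)
    case Nil
    show ?case by (simp flip: zero_gen_word_def)
  next
    case (Cons l ls)
    have "letter_val gen l = Poly_Mapping.single (Word [l]) 1"
      by (cases l) (simp_all add: gen_def word_star_def)
    then show ?case using Cons by (simp add: mult_single plus_gen_word_def)
  qed
  then show ?case by (cases w) (simp add: word_val_def)
qed simp_all

text \<open>A retraction onto the free subalgebra over \<open>X\<close>. Composing with it extends a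
  seminorm to all generators without changing it on that subalgebra.\<close>

definition restrict_gens :: "'x set \<Rightarrow> 'x free_algebra \<Rightarrow> 'x free_algebra" where
  "restrict_gens X = subst (\<lambda>x. if x \<in> X then gen x else 0)"

lemma subst_agree:
  assumes "f \<in> carrier (free_star_algebra X)" and st: "\<And>x. x \<in> X \<Longrightarrow> \<sigma> x = \<tau> x"
  shows "subst \<sigma> f = subst \<tau> f"
  using assms(1)
proof (induction rule: free_induct)
  case (single w c)
  have "map (letter_val \<sigma>) (letters w) = map (letter_val \<tau>) (letters w)"
  proof (rule map_cong[OF refl])
    fix l assume l: "l \<in> set (letters w)"
    then have "set_letter l \<subseteq> X" using single by (cases w) auto
    then show "letter_val \<sigma> l = letter_val \<tau> l" using st by (cases l) auto
  qed
  then show ?case by (simp add: word_val_def del: map_eq_conv)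
qed simp_all

lemma restrict_gens_id: "f \<in> carrier (free_star_algebra X) \<Longrightarrow> restrict_gens X f = f"
  unfolding restrict_gens_def by (subst subst_agree[where \<tau>=gen]) auto

lemma star_hom_restrict_gens: "star_hom (free_star_algebra UNIV) (free_star_algebra X) (restrict_gens X)"
  unfolding restrict_gens_def by (rule star_hom_subst) auto

lemma restrict_gens_in: "restrict_gens X f \<in> carrier (free_star_algebra X)"
  using star_homD(1)[OF star_hom_restrict_gens, of f] by simp

lemma image_magic_relations:
  "subst \<sigma> ` magic_unitary_relations I u = magic_unitary_relations I (\<lambda>i j. subst \<sigma> (u i j))"
  unfolding magic_unitary_relations_def image_Un
  by (intro arg_cong2[of _ _ _ _ "(\<union>)"]; force simp: image_iff)

lemma image_intertwiner_relations:
  "subst \<sigma> ` intertwiner_relations I J M u w = intertwiner_relations I J M (\<lambda>i j. subst \<sigma> (u i j)) (\<lambda>i j. subst \<sigma> (w i j))"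
  unfolding intertwiner_relations_def by (force simp: image_iff)

lemma free_finsum:
  assumes "finite I" "\<And>i. i \<in> I \<Longrightarrow> f i \<in> carrier (free_star_algebra X)"
  shows "finsum (free_star_algebra X) f I = sum f I"
proof -
  interpret abelian_group "free_star_algebra X" by (rule star_algebra.is_group[OF star_algebra_free])
  show ?thesis using assms by (induction I) (auto simp: Pi_def)
qed

context cstar_cong
begin

definition intertw :: "'i set \<Rightarrow> 'j set \<Rightarrow> ('i \<Rightarrow> 'j \<Rightarrow> complex) \<Rightarrow> ('i \<Rightarrow> 'i \<Rightarrow> 'y free_algebra) \<Rightarrow>
    ('j \<Rightarrow> 'j \<Rightarrow> 'y free_algebra) \<Rightarrow> bool" where
  "intertw I J M u w \<longleftrightarrow> (\<forall>i\<in>I. \<forall>j\<in>J. (\<Sum>k\<in>J. scale (M i k) (w k j)) \<approx> (\<Sum>k\<in>I. scale (M k j) (u i k)))"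

lemma intertwiner_relations: "(\<forall>r \<in> intertwiner_relations I J M u w. q r = 0) \<longleftrightarrow> intertw I J M u w"
  unfolding intertwiner_relations_def intertw_def eqv_def by blast

text \<open>For self-adjoint entries the adjoint matrix is the transpose and the entrywise conjugate
  is the matrix itself, so this one property yields both unitarity and invertibility of the
  conjugate. It is preserved by block sums.\<close>

definition orthogonal_matrix :: "'i set \<Rightarrow> ('i \<Rightarrow> 'i \<Rightarrow> 'y free_algebra) \<Rightarrow> bool" where
  "orthogonal_matrix I u \<longleftrightarrow> (\<forall>i\<in>I. \<forall>j\<in>I. free_star (u i j) \<approx> u i j \<and>
    (\<Sum>k\<in>I. u i k * u j k) \<approx> (if i = j then 1 else 0) \<and> (\<Sum>k\<in>I. u k i * u k j) \<approx> (if i = j then 1 else 0))"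

text \<open>Mixed terms vanish by the orthogonality of projections within a row or a column; the
  diagonal terms are idempotent and sum to 1.\<close>

lemma magic_orthogonal_matrix:
  assumes "finite I" and u: "magic I u" shows "orthogonal_matrix I u"
  unfolding orthogonal_matrix_def
proof (intro ballI conjI)
  fix i j assume ij: "i \<in> I" "j \<in> I"
  show "free_star (u i j) \<approx> u i j" using u ij by (auto simp: magic_def proj_def)
  have "(\<Sum>k\<in>I. u i k * u j k) \<approx> (\<Sum>k\<in>I. if i = j then u i k else 0)"
    using ij magic_col[OF assms] by (intro eqv_sum) auto
  also have "\<dots> \<approx> (if i = j then 1 else 0)" using u ij by (auto simp: magic_def)
  finally show "(\<Sum>k\<in>I. u i k * u j k) \<approx> (if i = j then 1 else 0)" .
  have "(\<Sum>k\<in>I. u k i * u k j) \<approx> (\<Sum>k\<in>I. if i = j then u k i else 0)"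
    using ij magic_row[OF assms] by (intro eqv_sum) auto
  also have "\<dots> \<approx> (if i = j then 1 else 0)" using u ij by (auto simp: magic_def)
  finally show "(\<Sum>k\<in>I. u k i * u k j) \<approx> (if i = j then 1 else 0)" .
qed

lemma block_sum_orthogonal_matrix:
  assumes "finite I" "finite J" and u: "orthogonal_matrix I u" and w: "orthogonal_matrix J w"
  shows "orthogonal_matrix (I <+> J) (block_sum u w)"
  unfolding orthogonal_matrix_def
proof (intro ballI)
  fix p r assume pr: "p \<in> I <+> J" "r \<in> I <+> J"
  note uD = u[unfolded orthogonal_matrix_def, rule_format] and wD = w[unfolded orthogonal_matrix_def, rule_format]
  from pr consider i i' where "p = Inl i" "r = Inl i'" "i \<in> I" "i' \<in> I"
    | j j' where "p = Inr j" "r = Inr j'" "j \<in> J" "j' \<in> J"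
    | i j where "p = Inl i" "r = Inr j" | i j where "p = Inr j" "r = Inl i" by auto
  then show "free_star (block_sum u w p r) \<approx> block_sum u w p r \<and>
      (\<Sum>k\<in>I <+> J. block_sum u w p k * block_sum u w r k) \<approx> (if p = r then 1 else 0) \<and>
      (\<Sum>k\<in>I <+> J. block_sum u w k p * block_sum u w k r) \<approx> (if p = r then 1 else 0)"
  proof cases
    case 1
    then show ?thesis using uD[of i i'] by (simp add: sum.Plus assms(1,2) block_sum_def)
  next
    case 2
    then show ?thesis using wD[of j j'] by (simp add: sum.Plus assms(1,2) block_sum_def)
  qed (simp_all add: sum.Plus assms(1,2) block_sum_def)
qed

end

section \<open>From congruences to equations in the universal C*-algebra\<close>

context presentation
begin

lemma restricted_seminorm: "cstar_seminorm (free_star_algebra UNIV) (\<lambda>f. u (restrict_gens X f))"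
  by (rule cstar_seminorm_pullback[OF star_algebra_free star_hom_restrict_gens u_seminorm])

sublocale cong: cstar_cong "\<lambda>f. u (restrict_gens X f)"
  by (intro cstar_cong.intro cstar_seminormed_algebra.intro star_algebra_free
      cstar_seminormed_algebra_axioms.intro restricted_seminorm)

lemma eqv_iff: "f \<in> carrier F \<Longrightarrow> g \<in> carrier F \<Longrightarrow> cong.eqv f g \<longleftrightarrow> u (f - g) = 0"
  by (simp add: cong.eqv_def restrict_gens_id)

lemma relation_null: "r \<in> R \<Longrightarrow> u (restrict_gens X r) = 0"
  using u_relation[of r] bdd restrict_gens_id[of r X] by (auto simp: bounded_presentation_def)

lemma eqv_embed:
  assumes "f \<in> carrier F" "g \<in> carrier F" "cong.eqv f g" shows "embed F u f = embed F u g"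
  unfolding embed_def using assms by (subst cls_eq_iff) (auto simp: cs_const null_eq_def eqv_iff)

lemma embed_simps:
  "\<lbrakk>f \<in> carrier F; g \<in> carrier F\<rbrakk> \<Longrightarrow> embed F u (f + g) = embed F u f \<oplus>\<^bsub>C\<^esub> embed F u g"
  "\<lbrakk>f \<in> carrier F; g \<in> carrier F\<rbrakk> \<Longrightarrow> embed F u (f * g) = embed F u f \<otimes>\<^bsub>C\<^esub> embed F u g"
  "f \<in> carrier F \<Longrightarrow> embed F u (scale c f) = c \<odot>\<^bsub>C\<^esub> embed F u f"
  "f \<in> carrier F \<Longrightarrow> embed F u (free_star f) = star C (embed F u f)"
  using star_homD[OF star_hom_embed] by simp_all

lemma embed_one: "embed F u 1 = \<one>\<^bsub>C\<^esub>"
  using star_homD(4)[OF star_hom_embed] by simp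

lemma embed_zero: "embed F u 0 = \<zero>\<^bsub>C\<^esub>"
  by (simp add: embed_def zero_C)

lemma embed_sum:
  assumes "finite I" "\<And>i. i \<in> I \<Longrightarrow> f i \<in> carrier F"
  shows "embed F u (sum f I) = (\<Oplus>\<^bsub>C\<^esub>i\<in>I. embed F u (f i))"
  using star_hom_finsum[OF star_algebra_free star_algebra_completion star_hom_embed assms]
  by (simp add: free_finsum assms)

lemma universal_cstar_eq: "universal_cstar X R = C"
  by (simp add: universal_cstar_def)

text \<open>Words in the generators and their adjoints span the free algebra, and its image is
  dense.\<close>

lemma cstar_subalgebra_generated:
  assumes S: "cstar_subalgebra S C" and gens: "\<And>x. x \<in> X \<Longrightarrow> embed F u (gen x) \<in> S"
  shows "S = carrier C"
proof (rule cstar_subalgebra_completion[OF S])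
  note S' = S[unfolded cstar_subalgebra_def]
  have one: "embed F u 1 \<in> S" using S' by (simp add: embed_one)
  have letter: "embed F u (Poly_Mapping.single (Word [l]) 1) \<in> S" if "set_letter l \<subseteq> X" for l
  proof (cases l)
    case (Gen x)
    then show ?thesis using gens that by (simp add: gen_def)
  next
    case (Adj x)
    then have "Poly_Mapping.single (Word [l]) 1 = free_star (gen x)" by (simp add: gen_def word_star_def)
    then show ?thesis using gens[of x] that Adj S' by (simp add: embed_simps)
  qed
  have word: "embed F u (Poly_Mapping.single (Word ls) 1) \<in> S" if "(\<Union>l\<in>set ls. set_letter l) \<subseteq> X" for ls
    using that
  proof (induction ls)
    case Nil
    show ?case using one by (simp flip: zero_gen_word_def)
  next
    case (Cons l ls)
    have "Poly_Mapping.single (Word (l # ls)) 1 = Poly_Mapping.single (Word [l]) 1 * Poly_Mapping.single (Word ls) (1::complex)"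
      by (simp add: mult_single plus_gen_word_def)
    then show ?case using Cons letter[of l] S' by (simp add: embed_simps)
  qed
  fix f assume "f \<in> carrier F"
  then show "embed F u f \<in> S"
  proof (induction rule: free_induct)
    case zero
    have "embed F u (scale 0 1) \<in> S" using one S' by (simp add: embed_simps del: scale_0)
    then show ?case by simp
  next
    case (single w c)
    have "Poly_Mapping.single w c = scale c (Poly_Mapping.single w 1)" by simp
    moreover have "embed F u (Poly_Mapping.single w 1) \<in> S" using word single by (cases w) auto
    ultimately show ?case using S' single by (simp add: embed_simps del: scale_single map_single)
  qed (use S' in \<open>simp add: embed_simps\<close>)
qed

lemma compact_matrix_quantum_groupI:
  assumes fin: "finite I" and uc: "\<And>i j. i \<in> I \<Longrightarrow> j \<in> I \<Longrightarrow> w i j \<in> carrier F"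
    and orth: "cong.orthogonal_matrix I w"
    and gens: "\<And>x. x \<in> X \<Longrightarrow> \<exists>i\<in>I. \<exists>j\<in>I. w i j = gen x"
    and \<Delta>: "comultiplication (universal_quantum_group X R I w) \<Delta>"
  shows "compact_matrix_quantum_group (universal_quantum_group X R I w)"
proof -
  let ?e = "embed F u"
  note O = orth[unfolded cong.orthogonal_matrix_def, rule_format]
  have star_eq: "star C (?e (w i j)) = ?e (w i j)" if "i \<in> I" "j \<in> I" for i j
    using O[OF that] uc[OF that] eqv_embed[of "free_star (w i j)" "w i j"] by (simp add: embed_simps)
  have ec: "?e (w i j) \<in> carrier C" if "i \<in> I" "j \<in> I" for i j using uc[OF that] by simp
  have mc: "?e (w i j) \<otimes>\<^bsub>C\<^esub> ?e (w k l) \<in> carrier C" if "i \<in> I" "j \<in> I" "k \<in> I" "l \<in> I" for i j k l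
    using embed_in[of "w i j * w k l"] that uc by (simp add: embed_simps(2))
  have row: "(\<Oplus>\<^bsub>C\<^esub>k\<in>I. ?e (w i k) \<otimes>\<^bsub>C\<^esub> ?e (w j k)) = delta C i j"
    and col: "(\<Oplus>\<^bsub>C\<^esub>k\<in>I. ?e (w k i) \<otimes>\<^bsub>C\<^esub> ?e (w k j)) = delta C i j" if ij: "i \<in> I" "j \<in> I" for i j
  proof -
    interpret G: abelian_group C by (rule star_algebra.is_group[OF star_algebra_completion])
    have d: "?e (if i = j then 1 else 0) = delta C i j" by (simp add: delta_def embed_one embed_zero)
    have "?e (\<Sum>k\<in>I. w i k * w j k) = delta C i j" "?e (\<Sum>k\<in>I. w k i * w k j) = delta C i j"
      unfolding d[symmetric] using O[OF ij] ij uc by (intro eqv_embed; simp)+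
    moreover have "?e (\<Sum>k\<in>I. w i k * w j k) = (\<Oplus>\<^bsub>C\<^esub>k\<in>I. ?e (w i k * w j k))"
      "?e (\<Sum>k\<in>I. w k i * w k j) = (\<Oplus>\<^bsub>C\<^esub>k\<in>I. ?e (w k i * w k j))"
      using ij uc by (intro embed_sum fin; simp)+
    moreover have "(\<Oplus>\<^bsub>C\<^esub>k\<in>I. ?e (w i k * w j k)) = (\<Oplus>\<^bsub>C\<^esub>k\<in>I. ?e (w i k) \<otimes>\<^bsub>C\<^esub> ?e (w j k))"
      "(\<Oplus>\<^bsub>C\<^esub>k\<in>I. ?e (w k i * w k j)) = (\<Oplus>\<^bsub>C\<^esub>k\<in>I. ?e (w k i) \<otimes>\<^bsub>C\<^esub> ?e (w k j))"
      using ij uc by (intro G.finsum_cong'; simp add: embed_simps(2) mc)+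
    ultimately show "(\<Oplus>\<^bsub>C\<^esub>k\<in>I. ?e (w i k) \<otimes>\<^bsub>C\<^esub> ?e (w j k)) = delta C i j"
      "(\<Oplus>\<^bsub>C\<^esub>k\<in>I. ?e (w k i) \<otimes>\<^bsub>C\<^esub> ?e (w k j)) = delta C i j" by simp_all
  qed
  interpret G: abelian_group C by (rule star_algebra.is_group[OF star_algebra_completion])
  have inv1: "inverse_matrices C I (\<lambda>i j. ?e (w i j)) (\<lambda>i j. star C (?e (w j i)))"
    unfolding inverse_matrices_def
  proof (intro ballI conjI)
    fix i j assume ij: "i \<in> I" "j \<in> I"
    have "(\<Oplus>\<^bsub>C\<^esub>k\<in>I. ?e (w i k) \<otimes>\<^bsub>C\<^esub> star C (?e (w j k))) = (\<Oplus>\<^bsub>C\<^esub>k\<in>I. ?e (w i k) \<otimes>\<^bsub>C\<^esub> ?e (w j k))"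
      using ij by (intro G.finsum_cong') (auto simp: star_eq mc)
    then show "(\<Oplus>\<^bsub>C\<^esub>k\<in>I. ?e (w i k) \<otimes>\<^bsub>C\<^esub> star C (?e (w j k))) = delta C i j" using row[OF ij] by simp
    have "(\<Oplus>\<^bsub>C\<^esub>k\<in>I. star C (?e (w k i)) \<otimes>\<^bsub>C\<^esub> ?e (w k j)) = (\<Oplus>\<^bsub>C\<^esub>k\<in>I. ?e (w k i) \<otimes>\<^bsub>C\<^esub> ?e (w k j))"
      using ij by (intro G.finsum_cong') (auto simp: star_eq mc)
    then show "(\<Oplus>\<^bsub>C\<^esub>k\<in>I. star C (?e (w k i)) \<otimes>\<^bsub>C\<^esub> ?e (w k j)) = delta C i j" using col[OF ij] by simp
  qed
  have inv2: "inverse_matrices C I (\<lambda>i j. star C (?e (w i j))) (\<lambda>i j. ?e (w j i))"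
    unfolding inverse_matrices_def
  proof (intro ballI conjI)
    fix i j assume ij: "i \<in> I" "j \<in> I"
    have "(\<Oplus>\<^bsub>C\<^esub>k\<in>I. star C (?e (w i k)) \<otimes>\<^bsub>C\<^esub> ?e (w j k)) = (\<Oplus>\<^bsub>C\<^esub>k\<in>I. ?e (w i k) \<otimes>\<^bsub>C\<^esub> ?e (w j k))"
      using ij by (intro G.finsum_cong') (auto simp: star_eq mc)
    then show "(\<Oplus>\<^bsub>C\<^esub>k\<in>I. star C (?e (w i k)) \<otimes>\<^bsub>C\<^esub> ?e (w j k)) = delta C i j" using row[OF ij] by simp
    have "(\<Oplus>\<^bsub>C\<^esub>k\<in>I. ?e (w k i) \<otimes>\<^bsub>C\<^esub> star C (?e (w k j))) = (\<Oplus>\<^bsub>C\<^esub>k\<in>I. ?e (w k i) \<otimes>\<^bsub>C\<^esub> ?e (w k j))"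
      using ij by (intro G.finsum_cong') (auto simp: star_eq mc)
    then show "(\<Oplus>\<^bsub>C\<^esub>k\<in>I. ?e (w k i) \<otimes>\<^bsub>C\<^esub> star C (?e (w k j))) = delta C i j" using col[OF ij] by simp
  qed
  have gen: "S = carrier C" if "cstar_subalgebra S C" "\<forall>i\<in>I. \<forall>j\<in>I. ?e (w i j) \<in> S" for S
    using cstar_subalgebra_generated[OF that(1)] gens that(2) by metis
  show ?thesis
    unfolding compact_matrix_quantum_group_def
  proof (intro conjI)
    show "\<exists>w'. (\<forall>i\<in>index (universal_quantum_group X R I w). \<forall>j\<in>index (universal_quantum_group X R I w).
        w' i j \<in> carrier (algebra (universal_quantum_group X R I w))) \<and>
      inverse_matrices (algebra (universal_quantum_group X R I w)) (index (universal_quantum_group X R I w))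
       (\<lambda>i j. star (algebra (universal_quantum_group X R I w)) (fund (universal_quantum_group X R I w) i j)) w'"
      using inv2 ec by (intro exI[of _ "\<lambda>i j. ?e (w j i)"]) (simp add: universal_quantum_group_def universal_cstar_eq)
  qed (use \<Delta> unital_cstar_completion fin ec gen inv1 in \<open>auto simp: universal_quantum_group_def universal_cstar_eq\<close>)
qed

end

section \<open>Isomorphic presentations\<close>

text \<open>The two substitutions are inverse to each other only modulo the relations, and this is
  asked on generators alone; in the applications one of the two composites is not the identity as a
  substitution.\<close>

locale presentation_iso = P: presentation X R + Q: presentation X' R'
  for X :: "'x set" and R and X' :: "'y set" and R' +
  fixes \<sigma> \<sigma>'
  assumes \<sigma>_in: "x \<in> X \<Longrightarrow> \<sigma> x \<in> carrier (free_star_algebra X')"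
    and \<sigma>'_in: "y \<in> X' \<Longrightarrow> \<sigma>' y \<in> carrier (free_star_algebra X)"
    and \<sigma>_rel: "r \<in> R \<Longrightarrow> Q.cong.eqv (subst \<sigma> r) 0"
    and \<sigma>'_rel: "r' \<in> R' \<Longrightarrow> P.cong.eqv (subst \<sigma>' r') 0"
    and \<sigma>_inv: "x \<in> X \<Longrightarrow> P.cong.eqv (subst \<sigma>' (\<sigma> x)) (gen x)"
    and \<sigma>'_inv: "y \<in> X' \<Longrightarrow> Q.cong.eqv (subst \<sigma> (\<sigma>' y)) (gen y)"
begin

lemma contr: "contraction P.F P.u Q.F Q.u (subst \<sigma>)"
proof (rule P.universal_contraction[OF star_hom_subst Q.u_seminorm])
  fix r assume r: "r \<in> R"
  then have "subst \<sigma> r \<in> carrier Q.F" using P.bdd \<sigma>_in by (auto simp: bounded_presentation_def intro: subst_in)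
  then show "Q.u (subst \<sigma> r) = 0" using \<sigma>_rel[OF r] by (simp add: Q.eqv_iff)
qed (rule \<sigma>_in)

lemma contr': "contraction Q.F Q.u P.F P.u (subst \<sigma>')"
proof (rule Q.universal_contraction[OF star_hom_subst P.u_seminorm])
  fix r assume r: "r \<in> R'"
  then have "subst \<sigma>' r \<in> carrier P.F" using Q.bdd \<sigma>'_in by (auto simp: bounded_presentation_def intro: subst_in)
  then show "P.u (subst \<sigma>' r) = 0" using \<sigma>'_rel[OF r] by (simp add: P.eqv_iff)
qed (rule \<sigma>'_in)

sublocale PQ: contraction_pair P.F P.u Q.F Q.u "subst \<sigma>"
  by (intro contraction_pair.intro P.cstar_seminormed_algebra_axioms Q.cstar_seminormed_algebra_axioms
      contraction_pair_axioms.intro contr)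

sublocale QP: contraction_pair Q.F Q.u P.F P.u "subst \<sigma>'"
  by (intro contraction_pair.intro P.cstar_seminormed_algebra_axioms Q.cstar_seminormed_algebra_axioms
      contraction_pair_axioms.intro contr')

definition "\<phi> = completion_map Q.F Q.u (subst \<sigma>)"
definition "\<psi> = completion_map P.F P.u (subst \<sigma>')"

text \<open>Congruence on generators spreads to all polynomials by \<open>subst_cong\<close>, so the
  composite changes each term of a Cauchy sequence by a null element only.\<close>

lemma \<psi>\<phi>: assumes "a \<in> carrier P.C" shows "\<psi> (\<phi> a) = a"
proof -
  obtain Y where Y: "Y \<in> P.cs" "a = P.cls Y" using assms by (rule P.CE)
  have c: "subst \<sigma>' (subst \<sigma> (Y n)) \<in> carrier P.F" for n
    using Y \<sigma>_in \<sigma>'_in by (intro subst_in[of _ X'] subst_in[of _ X]) auto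
  have "P.u (subst \<sigma>' (subst \<sigma> (Y n)) - Y n) = 0" for n
    using P.cong.subst_cong[of "Y n" X "\<lambda>x. subst \<sigma>' (\<sigma> x)" gen] \<sigma>_inv Y c
    by (simp add: subst_subst P.eqv_iff[symmetric])
  then have "P.null_eq (\<lambda>n. subst \<sigma>' (subst \<sigma> (Y n))) Y"
    using Y c by (simp add: P.null_eq_def)
  then show ?thesis
    using Y QP.cs_map[OF PQ.cs_map[OF Y(1)]]
    by (simp add: \<phi>_def \<psi>_def PQ.map_cls QP.map_cls PQ.cs_map P.cls_eq_iff)
qed

lemma \<phi>\<psi>: assumes "a \<in> carrier Q.C" shows "\<phi> (\<psi> a) = a"
proof -
  obtain Y where Y: "Y \<in> Q.cs" "a = Q.cls Y" using assms by (rule Q.CE)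
  have c: "subst \<sigma> (subst \<sigma>' (Y n)) \<in> carrier Q.F" for n
    using Y \<sigma>_in \<sigma>'_in by (intro subst_in[of _ X] subst_in[of _ X']) auto
  have "Q.u (subst \<sigma> (subst \<sigma>' (Y n)) - Y n) = 0" for n
    using Q.cong.subst_cong[of "Y n" X' "\<lambda>x. subst \<sigma> (\<sigma>' x)" gen] \<sigma>'_inv Y c
    by (simp add: subst_subst Q.eqv_iff[symmetric])
  then have "Q.null_eq (\<lambda>n. subst \<sigma> (subst \<sigma>' (Y n))) Y"
    using Y c by (simp add: Q.null_eq_def)
  then show ?thesis
    using Y PQ.cs_map[OF QP.cs_map[OF Y(1)]]
    by (simp add: \<phi>_def \<psi>_def PQ.map_cls QP.map_cls QP.cs_map Q.cls_eq_iff)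
qed

lemma \<phi>_hom: "star_hom P.C Q.C \<phi>" and \<psi>_hom: "star_hom Q.C P.C \<psi>"
  using PQ.map_hom QP.map_hom by (simp_all add: \<phi>_def \<psi>_def)

lemma \<phi>_embed: "f \<in> carrier P.F \<Longrightarrow> \<phi> (embed P.F P.u f) = embed Q.F Q.u (subst \<sigma> f)"
  by (simp add: \<phi>_def PQ.map_embed)

text \<open>The norm cannot grow under \<phi> nor under its inverse \<psi>, hence it is
  preserved.\<close>

sublocale iso: cstar_iso P.C Q.C \<phi>
proof (intro cstar_iso.intro P.unital_cstar_completion Q.unital_cstar_completion cstar_iso_axioms.intro \<phi>_hom)
  show "bij_betw \<phi> (carrier P.C) (carrier Q.C)"
    by (rule bij_betw_byWitness[where f'=\<psi>])
      (use \<psi>\<phi> \<phi>\<psi> star_homD(1)[OF \<phi>_hom] star_homD(1)[OF \<psi>_hom] in auto)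
  fix a assume a: "a \<in> carrier P.C"
  have "nrm Q.C (\<phi> a) \<le> nrm P.C a" using PQ.map_le[OF a] by (simp add: \<phi>_def)
  moreover have "nrm P.C (\<psi> (\<phi> a)) \<le> nrm Q.C (\<phi> a)"
    using QP.map_le[OF star_homD(1)[OF \<phi>_hom a]] by (simp add: \<psi>_def)
  ultimately show "nrm Q.C (\<phi> a) = nrm P.C a" using \<psi>\<phi>[OF a] by simp
qed

text \<open>Only the comultiplication of the first quantum group is needed: that of the second one is transported
  along the isomorphism, so the relations \<open>R'\<close> need not be checked on a tensor product.\<close>

lemma quantum_group_eqI:
  assumes G: "compact_matrix_quantum_group (universal_quantum_group X R I u)"
    and \<Delta>: "comultiplication (universal_quantum_group X R I u) \<Delta>"
    and J: "finite J" "\<And>i j. i \<in> J \<Longrightarrow> j \<in> J \<Longrightarrow> w i j \<in> carrier Q.F"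
    and orth: "Q.cong.orthogonal_matrix J w"
    and gens: "\<And>x. x \<in> X' \<Longrightarrow> \<exists>i\<in>J. \<exists>j\<in>J. w i j = gen x"
    and wv: "\<And>i j. i \<in> J \<Longrightarrow> j \<in> J \<Longrightarrow> v i j \<in> carrier P.F \<and> subst \<sigma> (v i j) = w i j"
    and \<Delta>v: "\<And>i j. i \<in> J \<Longrightarrow> j \<in> J \<Longrightarrow> \<Delta> (embed P.F P.u (v i j)) =
      (\<Oplus>\<^bsub>min_tensor P.C P.C\<^esub>k\<in>J. elem_tensor P.C P.C (embed P.F P.u (v i k)) (embed P.F P.u (v k j)))"
  shows "quantum_group_eq (universal_quantum_group X R I u) (universal_quantum_group X' R' J w)"
proof -
  let ?G = "universal_quantum_group X R I u" and ?H = "universal_quantum_group X' R' J w"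
  have alg: "algebra ?G = P.C" "algebra ?H = Q.C"
    by (simp_all add: universal_quantum_group_def P.universal_cstar_eq Q.universal_cstar_eq)
  have H: "index ?H = J" "fund ?H = (\<lambda>i j. embed Q.F Q.u (w i j))"
    by (simp_all add: universal_quantum_group_def)
  interpret TP: contraction_pair iso.A2.T iso.A2.sp iso.B2.T iso.B2.sp iso.tmap
    by (intro contraction_pair.intro iso.A2.Tn.cstar_seminormed_algebra_axioms
      iso.B2.Tn.cstar_seminormed_algebra_axioms contraction_pair_axioms.intro iso.tmap_contraction)
  define \<theta> where "\<theta> = completion_map iso.B2.T iso.B2.sp iso.tmap"
  have \<theta>_hom: "star_hom (min_tensor P.C P.C) (min_tensor Q.C Q.C) \<theta>"
    using TP.map_hom by (simp add: \<theta>_def min_tensor_def)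
  have \<theta>_elem: "\<theta> (elem_tensor P.C P.C a b) = elem_tensor Q.C Q.C (\<phi> a) (\<phi> b)"
    if "a \<in> carrier P.C" "b \<in> carrier P.C" for a b
    using that TP.map_embed[of "Poly_Mapping.single (a, b) 1"] by (simp add: \<theta>_def elem_tensor_def)
  have tensor: "tensor_hom P.C Q.C \<phi> \<theta>"
    unfolding tensor_hom_def using \<theta>_hom \<theta>_elem by blast
  \<comment> \<open>This choice makes compatibility with \<phi> immediate from
    \<open>\<psi> (\<phi> a) = a\<close>. What remains is the formula on the entries of
    \<open>w\<close>, which come from the matrix \<open>v\<close> over the other algebra.\<close>
  define \<Delta>' where "\<Delta>' = \<theta> \<circ> \<Delta> \<circ> \<psi>"
  have \<Delta>_hom: "star_hom P.C (min_tensor P.C P.C) \<Delta>"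
    using \<Delta> by (simp add: comultiplication_def alg)
  have st: "star_algebra (min_tensor P.C P.C)" "star_algebra (min_tensor Q.C Q.C)"
    unfolding min_tensor_def by (rule iso.A2.Tn.star_algebra_completion iso.B2.Tn.star_algebra_completion)+
  have elem_in: "elem_tensor P.C P.C a b \<in> carrier (min_tensor P.C P.C)" if "a \<in> carrier P.C" "b \<in> carrier P.C" for a b
    using that unfolding elem_tensor_def min_tensor_def by (intro iso.A2.Tn.embed_in) simp
  have elem_in': "elem_tensor Q.C Q.C a b \<in> carrier (min_tensor Q.C Q.C)" if "a \<in> carrier Q.C" "b \<in> carrier Q.C" for a b
    using that unfolding elem_tensor_def min_tensor_def by (intro iso.B2.Tn.embed_in) simp
  have \<phi>v: "\<phi> (embed P.F P.u (v i j)) = embed Q.F Q.u (w i j)" if "i \<in> J" "j \<in> J" for i j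
    using wv[OF that] by (simp add: \<phi>_embed)
  have \<psi>w: "\<psi> (embed Q.F Q.u (w i j)) = embed P.F P.u (v i j)" if "i \<in> J" "j \<in> J" for i j
    using \<phi>v[OF that] \<psi>\<phi>[of "embed P.F P.u (v i j)"] wv[OF that] by simp
  have co: "comultiplication ?H \<Delta>'"
    unfolding comultiplication_def alg H
  proof (intro conjI ballI)
    show "star_hom Q.C (min_tensor Q.C Q.C) \<Delta>'"
      unfolding \<Delta>'_def by (intro star_hom_comp[OF \<psi>_hom] star_hom_comp[OF \<Delta>_hom] \<theta>_hom)
    fix i j assume ij: "i \<in> J" "j \<in> J"
    have "\<Delta>' (embed Q.F Q.u (w i j)) = \<theta> (\<Oplus>\<^bsub>min_tensor P.C P.C\<^esub>k\<in>J.
        elem_tensor P.C P.C (embed P.F P.u (v i k)) (embed P.F P.u (v k j)))"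
      by (simp add: \<Delta>'_def \<psi>w[OF ij] \<Delta>v[OF ij])
    also have "\<dots> = (\<Oplus>\<^bsub>min_tensor Q.C Q.C\<^esub>k\<in>J.
        \<theta> (elem_tensor P.C P.C (embed P.F P.u (v i k)) (embed P.F P.u (v k j))))"
      using ij wv by (intro star_hom_finsum[OF st \<theta>_hom J(1)] elem_in) auto
    also have "\<dots> = (\<Oplus>\<^bsub>min_tensor Q.C Q.C\<^esub>k\<in>J.
        elem_tensor Q.C Q.C (embed Q.F Q.u (w i k)) (embed Q.F Q.u (w k j)))"
      using ij wv J(2) \<phi>v
      by (intro abelian_monoid.finsum_cong'[OF abelian_group.axioms(1)[OF star_algebra.is_group[OF st(2)]]])
        (auto simp: \<theta>_elem intro!: elem_in')
    finally show "\<Delta>' (embed Q.F Q.u (w i j)) = (\<Oplus>\<^bsub>min_tensor Q.C Q.C\<^esub>k\<in>J.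
        elem_tensor Q.C Q.C (embed Q.F Q.u (w i k)) (embed Q.F Q.u (w k j)))" .
  qed
  have "compact_matrix_quantum_group ?H"
    by (rule Q.compact_matrix_quantum_groupI[OF J orth gens co])
  then show ?thesis
    unfolding quantum_group_eq_def alg
    using G \<Delta> co \<phi>_hom iso.bij tensor \<psi>\<phi>
    by (intro conjI exI[of _ \<Delta>] exI[of _ \<Delta>'] exI[of _ \<phi>] exI[of _ \<theta>]) (auto simp: \<Delta>'_def)
qed

end

section \<open>The comultiplication of a universal quantum group\<close>

context cstar_cong
begin

text \<open>Commutation of the two copies rearranges \<open>a b a b\<close> into
  \<open>a a b b\<close>; row orthogonality of \<open>a\<close> leaves the diagonal terms, which are
  idempotent.\<close>

lemma convolution_magic:
  assumes fin: "finite I" and a: "magic I a" and b: "magic I b"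
    and comm: "\<And>i j k l. a i j * b k l \<approx> b k l * a i j"
  shows "magic I (\<lambda>i j. \<Sum>k\<in>I. a i k * b k j)"
  unfolding magic_def
proof (intro conjI ballI)
  fix i assume i: "i \<in> I"
  show "proj (\<Sum>k\<in>I. a i k * b k j)" if j: "j \<in> I" for j
    unfolding proj_def
  proof
    have "(\<Sum>k\<in>I. a i k * b k j) * (\<Sum>k\<in>I. a i k * b k j) = (\<Sum>k\<in>I. \<Sum>l\<in>I. a i k * (b k j * a i l) * b l j)"
      by (simp add: sum_product mult.assoc)
    also have "\<dots> \<approx> (\<Sum>k\<in>I. \<Sum>l\<in>I. a i k * (a i l * b k j) * b l j)"
      by (intro eqv_sum eqv_mult_right eqv_mult_left eqv_sym[OF comm])
    also have "\<dots> = (\<Sum>k\<in>I. \<Sum>l\<in>I. (a i k * a i l) * (b k j * b l j))"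
      by (simp add: mult.assoc)
    also have "\<dots> \<approx> (\<Sum>k\<in>I. \<Sum>l\<in>I. (if k = l then a i k else 0) * (b k j * b l j))"
      using i by (intro eqv_sum eqv_mult_right magic_row[OF fin a])
    also have "\<dots> = (\<Sum>k\<in>I. a i k * (b k j * b k j))"
      using fin by (simp add: if_distrib[of "\<lambda>x. x * _"] cong: if_cong)
    also have "\<dots> \<approx> (\<Sum>k\<in>I. a i k * b k j)"
      using b j by (intro eqv_sum eqv_mult_left) (auto simp: magic_def proj_def)
    finally show "(\<Sum>k\<in>I. a i k * b k j) * (\<Sum>k\<in>I. a i k * b k j) \<approx> (\<Sum>k\<in>I. a i k * b k j)" .
    have "free_star (\<Sum>k\<in>I. a i k * b k j) = (\<Sum>k\<in>I. free_star (b k j) * free_star (a i k))"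
      by (simp add: conj_sum free_star_mult)
    also have "\<dots> \<approx> (\<Sum>k\<in>I. b k j * a i k)"
      using a b i j by (intro eqv_sum eqv_mult) (auto simp: magic_def proj_def)
    also have "\<dots> \<approx> (\<Sum>k\<in>I. a i k * b k j)"
      by (intro eqv_sum eqv_sym[OF comm])
    finally show "free_star (\<Sum>k\<in>I. a i k * b k j) \<approx> (\<Sum>k\<in>I. a i k * b k j)" .
  qed
  have "(\<Sum>j\<in>I. \<Sum>k\<in>I. a i k * b k j) = (\<Sum>k\<in>I. a i k * (\<Sum>j\<in>I. b k j))"
    by (subst sum.swap) (simp add: sum_distrib_left)
  also have "\<dots> \<approx> (\<Sum>k\<in>I. a i k * 1)"
    using b by (intro eqv_sum eqv_mult_left) (auto simp: magic_def)
  also have "\<dots> \<approx> 1" using a i by (auto simp: magic_def)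
  finally show "(\<Sum>j\<in>I. \<Sum>k\<in>I. a i k * b k j) \<approx> 1" .
  have "(\<Sum>j\<in>I. \<Sum>k\<in>I. a j k * b k i) = (\<Sum>k\<in>I. (\<Sum>j\<in>I. a j k) * b k i)"
    by (subst sum.swap) (simp add: sum_distrib_right)
  also have "\<dots> \<approx> (\<Sum>k\<in>I. 1 * b k i)"
    using a by (intro eqv_sum eqv_mult_right) (auto simp: magic_def)
  also have "\<dots> \<approx> 1" using b i by (auto simp: magic_def)
  finally show "(\<Sum>j\<in>I. \<Sum>k\<in>I. a j k * b k i) \<approx> 1" .
qed

text \<open>In matrix form \<open>M (c d) = (M c) d = (a M) d = a (M d) = a (b M)\<close>.\<close>

lemma convolution_intertw:
  assumes ac: "intertw I J M a c" and bd: "intertw I J M b d"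
  shows "intertw I J M (\<lambda>i j. \<Sum>k\<in>I. a i k * b k j) (\<lambda>i j. \<Sum>k\<in>J. c i k * d k j)"
  unfolding intertw_def
proof (intro ballI)
  fix i j assume i: "i \<in> I" and j: "j \<in> J"
  have "(\<Sum>k\<in>J. scale (M i k) (\<Sum>l\<in>J. c k l * d l j)) = (\<Sum>k\<in>J. \<Sum>l\<in>J. scale (M i k) (c k l) * d l j)"
    by (simp add: scale_sum scale_mult_left)
  also have "\<dots> = (\<Sum>l\<in>J. (\<Sum>k\<in>J. scale (M i k) (c k l)) * d l j)"
    by (subst sum.swap) (simp add: sum_distrib_right)
  also have "\<dots> \<approx> (\<Sum>l\<in>J. (\<Sum>m\<in>I. scale (M m l) (a i m)) * d l j)"
    using ac i by (intro eqv_sum eqv_mult_right) (auto simp: intertw_def)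
  also have "\<dots> = (\<Sum>l\<in>J. \<Sum>m\<in>I. a i m * scale (M m l) (d l j))"
    by (simp add: sum_distrib_right scale_mult_left scale_mult_right)
  also have "\<dots> = (\<Sum>m\<in>I. a i m * (\<Sum>l\<in>J. scale (M m l) (d l j)))"
    by (subst sum.swap) (simp add: sum_distrib_left)
  also have "\<dots> \<approx> (\<Sum>m\<in>I. a i m * (\<Sum>n\<in>I. scale (M n j) (b m n)))"
    using bd j by (intro eqv_sum eqv_mult_left) (auto simp: intertw_def)
  also have "\<dots> = (\<Sum>m\<in>I. \<Sum>n\<in>I. scale (M n j) (a i m * b m n))"
    by (simp add: sum_distrib_left scale_mult_right)
  also have "\<dots> = (\<Sum>n\<in>I. scale (M n j) (\<Sum>m\<in>I. a i m * b m n))"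
    by (subst sum.swap) (simp add: scale_sum)
  finally show "(\<Sum>k\<in>J. scale (M i k) (\<Sum>l\<in>J. c k l * d l j)) \<approx>
    (\<Sum>n\<in>I. scale (M n j) (\<Sum>m\<in>I. a i m * b m n))" .
qed

end

section \<open>Two commuting copies inside the minimal tensor product\<close>

context presentation
begin

sublocale tp: tensor_pair C C
  by (intro tensor_pair.intro unital_cstar_completion)

definition ev :: "'x free_algebra \<Rightarrow> (nat \<Rightarrow> 'x free_algebra) set" where
  "ev f = embed F u (restrict_gens X f)"

lemma ev_hom: "star_hom (free_star_algebra UNIV) C ev"
proof -
  have "ev = embed F u \<circ> restrict_gens X" by (auto simp: ev_def)
  then show ?thesis using star_hom_comp[OF star_hom_restrict_gens star_hom_embed] by simp
qed

lemma ev_in [simp]: "ev f \<in> carrier C"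
  using star_homD(1)[OF ev_hom] by simp

lemma ev_simps:
  "ev (f + g) = ev f \<oplus>\<^bsub>C\<^esub> ev g" "ev (f * g) = ev f \<otimes>\<^bsub>C\<^esub> ev g" "ev 1 = \<one>\<^bsub>C\<^esub>"
  "ev (scale c f) = c \<odot>\<^bsub>C\<^esub> ev f" "ev (free_star f) = star C (ev f)"
  using star_homD[OF ev_hom] by simp_all

text \<open>The generators \<open>Inl x\<close> and \<open>Inr x\<close> of the doubled free algebra stand for \<open>x \<otimes> 1\<close> and \<open>1 \<otimes> x\<close>.\<close>

fun pgen :: "'x + 'x \<Rightarrow> (nat \<Rightarrow> 'x free_algebra) set \<times> (nat \<Rightarrow> 'x free_algebra) set" where
  "pgen (Inl x) = (ev (gen x), \<one>\<^bsub>C\<^esub>)"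
| "pgen (Inr x) = (\<one>\<^bsub>C\<^esub>, ev (gen x))"

fun plet :: "('x + 'x) letter \<Rightarrow> (nat \<Rightarrow> 'x free_algebra) set \<times> (nat \<Rightarrow> 'x free_algebra) set" where
  "plet (Gen y) = pgen y"
| "plet (Adj y) = tp.pstar (pgen y)"

definition pval :: "('x + 'x) gen_word \<Rightarrow> (nat \<Rightarrow> 'x free_algebra) set \<times> (nat \<Rightarrow> 'x free_algebra) set" where
  "pval w = foldr (\<lambda>l. tp.pmul (plet l)) (letters w) tp.punit"

lemma one_in: "\<one>\<^bsub>C\<^esub> \<in> carrier C"
  using ring.ring_simprules(6)[OF ring_completion] .

lemma pgen_in: "pgen y \<in> tp.KT"
  using one_in by (cases y) auto

lemma plet_in: "plet l \<in> tp.KT"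
  using tp.pstar_in pgen_in by (cases l) (auto simp del: mem_Times_iff)

lemma foldr_in: "foldr (\<lambda>l. tp.pmul (plet l)) ls tp.punit \<in> tp.KT"
  by (induction ls) (auto simp: plet_in simp del: mem_Times_iff)

lemma pval_in: "pval w \<in> tp.KT"
  unfolding pval_def by (rule foldr_in)

lemma pval_add: "pval (v + w) = tp.pmul (pval v) (pval w)"
proof -
  have "foldr (\<lambda>l. tp.pmul (plet l)) ls (foldr (\<lambda>l. tp.pmul (plet l)) ms tp.punit) =
      tp.pmul (foldr (\<lambda>l. tp.pmul (plet l)) ls tp.punit) (foldr (\<lambda>l. tp.pmul (plet l)) ms tp.punit)" for ls ms
    by (induction ls) (simp_all add: foldr_in tp.pmul_assoc plet_in del: mem_Times_iff)
  then show ?thesis by (simp add: pval_def plus_gen_word_def)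
qed

lemma pval_single: "pval (Word [l]) = plet l"
  using tp.pmul_punit[OF plet_in] by (simp add: pval_def)

lemma pval_zero: "pval 0 = tp.punit"
  by (simp add: pval_def zero_gen_word_def)

lemma plet_star: "plet (letter_star l) = tp.pstar (plet l)"
  using tp.pstar_pstar[OF pgen_in] by (cases l) auto

lemma pval_star: "pval (word_star w) = tp.pstar (pval w)"
proof -
  have "pval (Word (rev (map letter_star ls))) = tp.pstar (pval (Word ls))" for ls
  proof (induction ls)
    case Nil
    show ?case by (simp add: pval_def)
  next
    case (Cons l ls)
    have "pval (Word (rev (map letter_star (l # ls)))) = tp.pmul (pval (Word (rev (map letter_star ls)))) (plet (letter_star l))"
      using pval_add[of "Word (rev (map letter_star ls))" "Word [letter_star l]"] by (simp add: plus_gen_word_def pval_single)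
    also have "\<dots> = tp.pstar (tp.pmul (plet l) (pval (Word ls)))"
      using Cons tp.pstar_pmul[OF plet_in pval_in] by (simp add: plet_star)
    also have "tp.pmul (plet l) (pval (Word ls)) = pval (Word (l # ls))"
      using pval_add[of "Word [l]" "Word ls"] by (simp add: plus_gen_word_def pval_single)
    finally show ?case .
  qed
  then show ?thesis by (cases w) (simp add: word_star_def)
qed

text \<open>Every word becomes a single pair, so this is a *-homomorphism into formal sums on the
  nose, before null vectors are divided out.\<close>

definition push :: "('x + 'x) free_algebra \<Rightarrow> (nat \<Rightarrow> 'x free_algebra) set \<times> (nat \<Rightarrow> 'x free_algebra) set \<Rightarrow>\<^sub>0 complex" where
  "push = lin_ext (\<lambda>w. Poly_Mapping.single (pval w) 1)"

lemma push_simps [simp]: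
  "push (Poly_Mapping.single w c) = Poly_Mapping.single (pval w) c"
  "push 0 = 0" "push (f + g) = push f + push g" "push (scale c f) = scale c (push f)"
  "push (sum h I) = (\<Sum>i\<in>I. push (h i))" "push (f - g) = push f - push g"
  by (simp_all add: push_def lin_ext_add lin_ext_scale lin_ext_sum lin_ext_diff)

lemma push_in: "push f \<in> carrier tp.T"
  by (induction f rule: keys_induct_on[OF subset_UNIV]) (auto simp: tp.T_single[OF pval_in] simp del: mem_Times_iff)

lemma push_mult: "push (f * g) = tp.tmul (push f) (push g)"
proof (induction f rule: keys_induct_on[OF subset_UNIV])
  case (2 w c)
  show ?case
    by (induction g rule: keys_induct_on[OF subset_UNIV])
      (simp_all add: mult_single pval_add distrib_left tp.tmul_add_right)
qed (simp_all add: distrib_right tp.tmul_add_left)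

lemma push_one: "push 1 = Poly_Mapping.single tp.punit 1"
  using push_simps(1)[of 0 1] by (simp add: pval_zero)

lemma push_star: "push (free_star f) = conj_linear_ext tp.pstar (push f)"
  by (induction f rule: keys_induct_on[OF subset_UNIV]) (simp_all add: conj_add pval_star)

lemma push_hom: "star_hom (free_star_algebra UNIV) tp.T push"
  by (rule star_homI) (simp_all add: push_in push_mult push_one push_star)

text \<open>The spatial seminorm pulled back to the free algebra on two copies of the generators;
  relations in the tensor product can now be checked by the congruence calculus.\<close>

sublocale cong2: cstar_cong "\<lambda>f. tp.sp (push f)"
  by (intro cstar_cong.intro cstar_seminormed_algebra.intro star_algebra_free
      cstar_seminormed_algebra_axioms.intro cstar_seminorm_pullback[OF star_algebra_free push_hom tp.sp_seminorm])

lemma push_gen: "push (gen y) = Poly_Mapping.single (pgen y) 1"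
  by (simp add: gen_def pval_single)

lemma C_unit: "a \<in> carrier C \<Longrightarrow> \<one>\<^bsub>C\<^esub> \<otimes>\<^bsub>C\<^esub> a = a" "a \<in> carrier C \<Longrightarrow> a \<otimes>\<^bsub>C\<^esub> \<one>\<^bsub>C\<^esub> = a"
  using monoid.l_one[OF ring.is_monoid[OF ring_completion]] monoid.r_one[OF ring.is_monoid[OF ring_completion]]
  by simp_all

lemma push_gen_gen: "push (gen (Inl x) * gen (Inr y)) = Poly_Mapping.single (ev (gen x), ev (gen y)) 1"
  by (simp add: push_mult push_gen tp.pmul_def C_unit)

lemma copies_commute: "cong2.eqv (gen (Inl x) * gen (Inr y)) (gen (Inr y) * gen (Inl x))"
proof -
  have "push (gen (Inr y) * gen (Inl x)) = Poly_Mapping.single (ev (gen x), ev (gen y)) 1"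
    by (simp add: push_mult push_gen tp.pmul_def C_unit)
  then have "push (gen (Inl x) * gen (Inr y) - gen (Inr y) * gen (Inl x)) = 0"
    by (simp add: push_gen_gen)
  then show ?thesis using tp.Tn.p_zero by (simp add: cong2.eqv_def)
qed

abbreviation "inL \<equiv> subst (\<lambda>x. gen (Inl x))"
abbreviation "inR \<equiv> subst (\<lambda>x. gen (Inr x))"

lemma C_star_one: "star C \<one>\<^bsub>C\<^esub> = \<one>\<^bsub>C\<^esub>"
  by (rule star_algebra.star_one[OF star_algebra_completion])

lemma single_letter: "Poly_Mapping.single (Word [Gen x]) 1 = gen x" "Poly_Mapping.single (Word [Adj x]) 1 = free_star (gen x)"
  by (simp_all add: gen_def word_star_def)

lemma single_cons: "Poly_Mapping.single (Word (l # ls)) (1 :: complex) = Poly_Mapping.single (Word [l]) 1 * Poly_Mapping.single (Word ls) 1"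
  by (simp add: mult_single plus_gen_word_def)

lemma push_copies_word:
  "push (inL (Poly_Mapping.single w 1)) = Poly_Mapping.single (ev (Poly_Mapping.single w 1), \<one>\<^bsub>C\<^esub>) 1"
  "push (inR (Poly_Mapping.single w 1)) = Poly_Mapping.single (\<one>\<^bsub>C\<^esub>, ev (Poly_Mapping.single w 1)) 1"
proof -
  have "push (inL (Poly_Mapping.single (Word ls) 1)) = Poly_Mapping.single (ev (Poly_Mapping.single (Word ls) 1), \<one>\<^bsub>C\<^esub>) 1 \<and>
      push (inR (Poly_Mapping.single (Word ls) 1)) = Poly_Mapping.single (\<one>\<^bsub>C\<^esub>, ev (Poly_Mapping.single (Word ls) 1)) 1" for ls
  proof (induction ls)
    case Nil
    have "Poly_Mapping.single (Word []) 1 = (1 :: 'x free_algebra)" by (simp flip: zero_gen_word_def)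
    then show ?case by (simp add: push_one ev_simps tp.punit_def del: subst_simps(1))
  next
    case (Cons l ls)
    have "push (inL (Poly_Mapping.single (Word [l]) 1)) = Poly_Mapping.single (ev (Poly_Mapping.single (Word [l]) 1), \<one>\<^bsub>C\<^esub>) 1 \<and>
      push (inR (Poly_Mapping.single (Word [l]) 1)) = Poly_Mapping.single (\<one>\<^bsub>C\<^esub>, ev (Poly_Mapping.single (Word [l]) 1)) 1"
      by (cases l) (simp_all add: single_letter push_gen push_star ev_simps tp.pstar_def C_star_one del: subst_simps(1))
    with Cons show ?case
      by (simp add: single_cons[of l ls] push_mult ev_simps tp.pmul_def C_unit one_in del: subst_simps(1))
  qed
  then show "push (inL (Poly_Mapping.single w 1)) = Poly_Mapping.single (ev (Poly_Mapping.single w 1), \<one>\<^bsub>C\<^esub>) 1"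
    "push (inR (Poly_Mapping.single w 1)) = Poly_Mapping.single (\<one>\<^bsub>C\<^esub>, ev (Poly_Mapping.single w 1)) 1"
    by (cases w; simp del: subst_simps(1))+
qed

lemma sp_null_trans:
  assumes "f \<in> carrier tp.T" "g \<in> carrier tp.T" "h \<in> carrier tp.T" "tp.sp (f - g) = 0" "tp.sp (g - h) = 0"
  shows "tp.sp (f - h) = 0"
  using tp.Tn.p_triangle[of f g h] assms by (intro antisym) simp_all

text \<open>The two sides differ as formal sums: a polynomial is pushed to a sum of pairs, while the
  elementary tensor is one pair with a sum in a leg. The bilinearity relations bridge the gap modulo
  null vectors.\<close>

lemma push_copies:
  "tp.sp (push (inL f) - Poly_Mapping.single (ev f, \<one>\<^bsub>C\<^esub>) 1) = 0 \<and>
   tp.sp (push (inR f) - Poly_Mapping.single (\<one>\<^bsub>C\<^esub>, ev f) 1) = 0"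
proof (induction f rule: keys_induct_on[OF subset_UNIV])
  case 1
  have "ev 0 = 0 \<odot>\<^bsub>C\<^esub> ev 0" by (simp flip: ev_simps(4))
  then show ?case
    using tp.null_smult_left[of "ev 0" "\<one>\<^bsub>C\<^esub>" 0] tp.null_smult_right[of "\<one>\<^bsub>C\<^esub>" "ev 0" 0] one_in
      tp.Tn.p_minus_commute[of 0 "Poly_Mapping.single (ev 0, \<one>\<^bsub>C\<^esub>) 1"]
      tp.Tn.p_minus_commute[of 0 "Poly_Mapping.single (\<one>\<^bsub>C\<^esub>, ev 0) 1"]
    by simp
next
  case (2 w c)
  have s: "Poly_Mapping.single w c = scale c (Poly_Mapping.single w 1)" by simp
  have L: "push (inL (Poly_Mapping.single w c)) = Poly_Mapping.single (ev (Poly_Mapping.single w 1), \<one>\<^bsub>C\<^esub>) c"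
    "push (inR (Poly_Mapping.single w c)) = Poly_Mapping.single (\<one>\<^bsub>C\<^esub>, ev (Poly_Mapping.single w 1)) c"
    unfolding s subst_simps(6) push_simps push_copies_word by simp_all
  show ?case
    unfolding L unfolding s ev_simps
    using tp.null_smult_left[of "ev (Poly_Mapping.single w 1)" "\<one>\<^bsub>C\<^esub>" c]
      tp.null_smult_right[of "\<one>\<^bsub>C\<^esub>" "ev (Poly_Mapping.single w 1)" c] one_in
      tp.Tn.p_minus_commute[of "Poly_Mapping.single (ev (Poly_Mapping.single w 1), \<one>\<^bsub>C\<^esub>) c"
        "Poly_Mapping.single (c \<odot>\<^bsub>C\<^esub> ev (Poly_Mapping.single w 1), \<one>\<^bsub>C\<^esub>) 1"]
      tp.Tn.p_minus_commute[of "Poly_Mapping.single (\<one>\<^bsub>C\<^esub>, ev (Poly_Mapping.single w 1)) c"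
        "Poly_Mapping.single (\<one>\<^bsub>C\<^esub>, c \<odot>\<^bsub>C\<^esub> ev (Poly_Mapping.single w 1)) 1"]
    by (simp flip: ev_simps(4))
next
  case (3 f g)
  have add0: "tp.sp ((a + b) - c) = 0"
    if "tp.sp (a - a') = 0" "tp.sp (b - b') = 0" "tp.sp (c - (a' + b')) = 0"
      "a \<in> carrier tp.T" "b \<in> carrier tp.T" "a' \<in> carrier tp.T" "b' \<in> carrier tp.T" "c \<in> carrier tp.T" for a b a' b' c
  proof -
    have "tp.sp ((a + b) - (a' + b')) = 0"
      using tp.Tn.p_add_diff[of a b a' b'] that by (intro antisym) simp_all
    then show ?thesis using sp_null_trans[of "a + b" "a' + b'" c] tp.Tn.p_minus_commute[of c "a' + b'"] that by simp
  qed
  show ?case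
    using 3 tp.null_add_left[of "ev f" "ev g" "\<one>\<^bsub>C\<^esub>"] tp.null_add_right[of "\<one>\<^bsub>C\<^esub>" "ev f" "ev g"] one_in push_in
    unfolding subst_simps push_simps ev_simps
    by (intro conjI add0) (auto simp flip: ev_simps(1))
qed

text \<open>A null \<open>f\<close> has image 0 in the universal algebra; written as 0 times the
  unit, this makes its elementary tensors null, so the defining relations hold in each leg.\<close>

lemma copies_null:
  assumes "u (restrict_gens X f) = 0"
  shows "cong2.eqv (inL f) 0" "cong2.eqv (inR f) 0"
proof -
  have "ev f = \<zero>\<^bsub>C\<^esub>"
    using eqv_embed[of "restrict_gens X f" 0] assms
    by (simp add: ev_def eqv_iff embed_zero restrict_gens_in)
  then have z: "ev f = 0 \<odot>\<^bsub>C\<^esub> \<one>\<^bsub>C\<^esub>"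
    using star_algebra.smult_0[OF star_algebra_completion one_in] by simp
  have "tp.sp (Poly_Mapping.single (ev f, \<one>\<^bsub>C\<^esub>) 1 - 0) = 0" "tp.sp (Poly_Mapping.single (\<one>\<^bsub>C\<^esub>, ev f) 1 - 0) = 0"
    using tp.null_smult_left[of "\<one>\<^bsub>C\<^esub>" "\<one>\<^bsub>C\<^esub>" 0] tp.null_smult_right[of "\<one>\<^bsub>C\<^esub>" "\<one>\<^bsub>C\<^esub>" 0] one_in
    unfolding z by simp_all
  then have "tp.sp (push (inL f) - 0) = 0" "tp.sp (push (inR f) - 0) = 0"
    using push_copies[of f] one_in
    by (intro sp_null_trans[of "push (inL f)" "Poly_Mapping.single (ev f, \<one>\<^bsub>C\<^esub>) 1" 0]
        sp_null_trans[of "push (inR f)" "Poly_Mapping.single (\<one>\<^bsub>C\<^esub>, ev f) 1" 0]; simp add: push_in)+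
  then show "cong2.eqv (inL f) 0" "cong2.eqv (inR f) 0" by (simp_all add: cong2.eqv_def)
qed

definition comult :: "('x \<Rightarrow> ('x + 'x) free_algebra) \<Rightarrow> (nat \<Rightarrow> 'x free_algebra) set \<Rightarrow>
    (nat \<Rightarrow> ((nat \<Rightarrow> 'x free_algebra) set \<times> (nat \<Rightarrow> 'x free_algebra) set \<Rightarrow>\<^sub>0 complex)) set" where
  "comult W = completion_map tp.T tp.sp (push \<circ> subst W)"

lemma comult:
  assumes rel: "\<And>r. r \<in> R \<Longrightarrow> cong2.eqv (subst W r) 0"
  shows "star_hom C (min_tensor C C) (comult W)"
    and "f \<in> carrier F \<Longrightarrow> comult W (embed F u f) = embed tp.T tp.sp (push (subst W f))"
proof -
  have "contraction F u tp.T tp.sp (push \<circ> subst W)"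
  proof (rule universal_contraction[OF _ tp.sp_seminorm])
    show "star_hom F tp.T (push \<circ> subst W)"
      by (rule star_hom_comp[OF star_hom_subst push_hom]) simp
    fix r assume "r \<in> R"
    then show "tp.sp ((push \<circ> subst W) r) = 0" using rel by (simp add: cong2.eqv_def)
  qed
  then interpret TP: contraction_pair F u tp.T tp.sp "push \<circ> subst W"
    by (intro contraction_pair.intro cstar_seminormed_algebra_axioms
      tp.Tn.cstar_seminormed_algebra_axioms contraction_pair_axioms.intro)
  show "star_hom C (min_tensor C C) (comult W)" using TP.map_hom by (simp add: comult_def min_tensor_def)
  show "f \<in> carrier F \<Longrightarrow> comult W (embed F u f) = embed tp.T tp.sp (push (subst W f))"
    using TP.map_embed[of f] by (simp add: comult_def)
qed

lemma star_algebra_min_tensor: "star_algebra (min_tensor C C)"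
  unfolding min_tensor_def by (rule tp.Tn.star_algebra_completion)

lemma elem_tensor_in: "a \<in> carrier C \<Longrightarrow> b \<in> carrier C \<Longrightarrow> elem_tensor C C a b \<in> carrier (min_tensor C C)"
  unfolding elem_tensor_def min_tensor_def by (intro tp.Tn.embed_in) simp

lemma T_finsum:
  assumes "finite I" "\<And>i. i \<in> I \<Longrightarrow> f i \<in> carrier tp.T"
  shows "finsum tp.T f I = sum f I"
proof -
  interpret abelian_group tp.T by (rule star_algebra.is_group[OF tp.star_algebra_T])
  show ?thesis using assms by (induction I) (auto simp: Pi_def)
qed

lemma ev_gen: "x \<in> X \<Longrightarrow> ev (gen x) = embed F u (gen x)"
  by (simp add: ev_def restrict_gens_id)

lemma comult_gen:
  assumes rel: "\<And>r. r \<in> R \<Longrightarrow> cong2.eqv (subst W r) 0"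
    and K: "finite K" "\<And>k. k \<in> K \<Longrightarrow> a k \<in> X \<and> b k \<in> X" and x: "x \<in> X"
    and W: "W x = (\<Sum>k\<in>K. gen (Inl (a k)) * gen (Inr (b k)))"
  shows "comult W (embed F u (gen x)) =
    (\<Oplus>\<^bsub>min_tensor C C\<^esub>k\<in>K. elem_tensor C C (embed F u (gen (a k))) (embed F u (gen (b k))))"
proof -
  have "comult W (embed F u (gen x)) = embed tp.T tp.sp (\<Sum>k\<in>K. Poly_Mapping.single (embed F u (gen (a k)), embed F u (gen (b k))) 1)"
    using x K(2) by (simp add: comult(2)[OF rel] W push_gen_gen ev_gen cong: sum.cong)
  also have "\<dots> = embed tp.T tp.sp (finsum tp.T (\<lambda>k. Poly_Mapping.single (embed F u (gen (a k)), embed F u (gen (b k))) 1) K)"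
    using K by (subst T_finsum) auto
  also have "\<dots> = (\<Oplus>\<^bsub>min_tensor C C\<^esub>k\<in>K. elem_tensor C C (embed F u (gen (a k))) (embed F u (gen (b k))))"
    unfolding elem_tensor_def min_tensor_def
    using K by (intro star_hom_finsum[OF tp.star_algebra_T tp.Tn.star_algebra_completion tp.Tn.star_hom_embed]) auto
  finally show ?thesis .
qed

text \<open>Disposes of the off-diagonal blocks of a block sum in the formula for the
  comultiplication.\<close>

lemma elem_tensor_zero:
  assumes "a \<in> carrier C"
  shows "elem_tensor C C (embed F u 0) a = \<zero>\<^bsub>min_tensor C C\<^esub>" "elem_tensor C C a (embed F u 0) = \<zero>\<^bsub>min_tensor C C\<^esub>"
proof -
  have z: "embed F u 0 = 0 \<odot>\<^bsub>C\<^esub> \<one>\<^bsub>C\<^esub>"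
    using star_algebra.smult_0[OF star_algebra_completion one_in] by (simp add: embed_zero)
  have e: "embed tp.T tp.sp f = \<zero>\<^bsub>min_tensor C C\<^esub>" if "f \<in> carrier tp.T" "tp.sp f = 0" for f
    using that unfolding min_tensor_def embed_def tp.Tn.zero_C
    by (subst tp.Tn.cls_eq_iff) (auto simp: tp.Tn.cs_const tp.Tn.null_eq_def)
  show "elem_tensor C C (embed F u 0) a = \<zero>\<^bsub>min_tensor C C\<^esub>" "elem_tensor C C a (embed F u 0) = \<zero>\<^bsub>min_tensor C C\<^esub>"
    unfolding elem_tensor_def z
    using tp.null_smult_left[of "\<one>\<^bsub>C\<^esub>" a 0] tp.null_smult_right[of a "\<one>\<^bsub>C\<^esub>" 0] one_in assms
    by (intro e; simp)+
qed

end

section \<open>The quantum automorphism group of a hypergraph\<close>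

lemma (in abelian_group) finsum_Plus:
  assumes "finite I" "finite J" "\<And>i. i \<in> I \<Longrightarrow> f (Inl i) \<in> carrier G" "\<And>j. j \<in> J \<Longrightarrow> f (Inr j) \<in> carrier G"
  shows "finsum G f (I <+> J) = finsum G (\<lambda>i. f (Inl i)) I \<oplus> finsum G (\<lambda>j. f (Inr j)) J"
proof -
  have "finsum G f (I <+> J) = finsum G f (Inl ` I) \<oplus> finsum G f (Inr ` J)"
    unfolding Plus_def using assms by (intro finsum_Un_disjoint) auto
  also have "finsum G f (Inl ` I) = finsum G (\<lambda>i. f (Inl i)) I"
    using assms by (intro finsum_reindex) auto
  also have "finsum G f (Inr ` J) = finsum G (\<lambda>j. f (Inr j)) J"
    using assms by (intro finsum_reindex) auto
  finally show ?thesis .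
qed

text \<open>Relations that make the generators projections bound them by 1 in every
  seminorm.\<close>

lemma bounded_presentationI:
  assumes R: "R \<subseteq> carrier (free_star_algebra X)"
    and gens: "\<And>x. x \<in> X \<Longrightarrow> gen x * gen x - gen x \<in> R \<and> free_star (gen x) - gen x \<in> R"
  shows "bounded_presentation X R"
  unfolding bounded_presentation_def
proof (intro conjI R ballI exI allI impI)
  fix x p assume x: "x \<in> X" and p: "cstar_seminorm (free_star_algebra X) p \<and> (\<forall>r\<in>R. p r = 0)"
  interpret cstar_cong "\<lambda>f. p (restrict_gens X f)"
    by (intro cstar_cong.intro cstar_seminormed_algebra.intro star_algebra_free cstar_seminormed_algebra_axioms.intro
        cstar_seminorm_pullback[OF star_algebra_free star_hom_restrict_gens]) (use p in blast)
  have "proj (gen x)" using gens[OF x] p x by (auto simp: proj_def eqv_def restrict_gens_id)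
  from q_proj[OF this] show "p (gen x) \<le> 1" using x by (simp add: restrict_gens_id)
qed

lemma magic_unitary_relations_in:
  assumes "\<And>i j. i \<in> I \<Longrightarrow> j \<in> I \<Longrightarrow> u i j \<in> carrier (free_star_algebra X)"
  shows "magic_unitary_relations I u \<subseteq> carrier (free_star_algebra X)"
  unfolding magic_unitary_relations_def using assms by auto

lemma intertwiner_relations_in:
  assumes "\<And>i j. i \<in> I \<Longrightarrow> j \<in> I \<Longrightarrow> u i j \<in> carrier (free_star_algebra X)"
    and "\<And>i j. i \<in> J \<Longrightarrow> j \<in> J \<Longrightarrow> w i j \<in> carrier (free_star_algebra X)"
  shows "intertwiner_relations I J M u w \<subseteq> carrier (free_star_algebra X)"
  unfolding intertwiner_relations_def using assms by auto

lemma magic_relations_gens: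
  assumes "i \<in> I" "j \<in> I"
  shows "u i j * u i j - u i j \<in> magic_unitary_relations I u" "free_star (u i j) - u i j \<in> magic_unitary_relations I u"
  using assms unfolding magic_unitary_relations_def by blast+

definition hyp_gens :: "'v set \<Rightarrow> 'e set \<Rightarrow> ('v \<times> 'v + 'e \<times> 'e) set" where
  "hyp_gens V E = V \<times> V <+> E \<times> E"

definition hyp_rels :: "'v set \<Rightarrow> 'e set \<Rightarrow> ('e \<Rightarrow> 'v set) \<Rightarrow> ('e \<Rightarrow> 'v set) \<Rightarrow> ('v \<times> 'v + 'e \<times> 'e) free_algebra set" where
  "hyp_rels V E s r = magic_unitary_relations V vertex_gen \<union> magic_unitary_relations E edge_gen \<union>
     intertwiner_relations V E (incidence s) vertex_gen edge_gen \<union>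
     intertwiner_relations V E (incidence r) vertex_gen edge_gen"

lemma qaut_eq: "qaut V E s r = universal_quantum_group (hyp_gens V E) (hyp_rels V E s r) (V <+> E) (block_sum vertex_gen edge_gen)"
  by (simp add: qaut_def hyp_gens_def hyp_rels_def)

definition (in cstar_cong) hyp_matrices ::
    "'v set \<Rightarrow> 'e set \<Rightarrow> ('e \<Rightarrow> 'v set) \<Rightarrow> ('e \<Rightarrow> 'v set) \<Rightarrow> ('v \<Rightarrow> 'v \<Rightarrow> 'y free_algebra) \<Rightarrow>
      ('e \<Rightarrow> 'e \<Rightarrow> 'y free_algebra) \<Rightarrow> bool" where
  "hyp_matrices V E s r u w \<longleftrightarrow> magic V u \<and> magic E w \<and> intertw V E (incidence s) u w \<and> intertw V E (incidence r) u w"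

text \<open>The dictionary between formal relations and matrix conditions, for an arbitrary
  substitution. It is read in both directions: for the generators, for the two legs, for their
  convolution and for the comparison maps.\<close>

lemma (in cstar_cong) hyp_rels_iff:
  "(\<forall>\<rho>\<in>hyp_rels V E s r. subst \<tau> \<rho> \<approx> 0) \<longleftrightarrow>
    hyp_matrices V E s r (\<lambda>v w. \<tau> (Inl (v, w))) (\<lambda>e f. \<tau> (Inr (e, f)))"
proof -
  have "(\<forall>\<rho>\<in>hyp_rels V E s r. subst \<tau> \<rho> \<approx> 0) \<longleftrightarrow> (\<forall>\<rho> \<in> subst \<tau> ` hyp_rels V E s r. q \<rho> = 0)"
    by (simp add: eqv_0_iff)
  also have "\<dots> \<longleftrightarrow> hyp_matrices V E s r (\<lambda>v w. \<tau> (Inl (v, w))) (\<lambda>e f. \<tau> (Inr (e, f)))"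
    unfolding hyp_rels_def image_Un image_magic_relations image_intertwiner_relations ball_Un
      magic_relations intertwiner_relations hyp_matrices_def vertex_gen_def edge_gen_def subst_gen conj_assoc ..
  finally show ?thesis .
qed

locale finite_hypergraph =
  fixes V :: "'v set" and E :: "'e set" and s r :: "'e \<Rightarrow> 'v set"
  assumes fin: "finite V" "finite E"
begin

abbreviation "X \<equiv> hyp_gens V E"
abbreviation "R \<equiv> hyp_rels V E s r"

lemma gens_in [simp]:
  "v \<in> V \<Longrightarrow> w \<in> V \<Longrightarrow> vertex_gen v w \<in> carrier (free_star_algebra X)"
  "e \<in> E \<Longrightarrow> f \<in> E \<Longrightarrow> edge_gen e f \<in> carrier (free_star_algebra X)"
  by (auto simp: vertex_gen_def edge_gen_def hyp_gens_def intro!: free_gen)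

lemma presentation: "presentation X R"
proof (intro presentation.intro bounded_presentationI)
  show "R \<subseteq> carrier (free_star_algebra X)"
    unfolding hyp_rels_def
    by (intro Un_least magic_unitary_relations_in intertwiner_relations_in gens_in)
  fix x assume "x \<in> X"
  then consider v w where "x = Inl (v, w)" "v \<in> V" "w \<in> V" | e f where "x = Inr (e, f)" "e \<in> E" "f \<in> E"
    by (auto simp: hyp_gens_def)
  then show "gen x * gen x - gen x \<in> R \<and> free_star (gen x) - gen x \<in> R"
  proof cases
    case 1
    then show ?thesis using magic_relations_gens[of v V w "vertex_gen :: 'v \<Rightarrow> 'v \<Rightarrow> ('v \<times> 'v + 'e \<times> 'e) free_algebra"] by (simp add: vertex_gen_def hyp_rels_def)
  next
    case 2
    then show ?thesis using magic_relations_gens[of e E f "edge_gen :: 'e \<Rightarrow> 'e \<Rightarrow> ('v \<times> 'v + 'e \<times> 'e) free_algebra"] by (simp add: edge_gen_def hyp_rels_def)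
  qed
qed

sublocale P: presentation X R by (rule presentation)

lemma generators: "P.cong.hyp_matrices V E s r vertex_gen edge_gen"
proof -
  have "\<forall>\<rho>\<in>R. P.cong.eqv (subst gen \<rho>) 0" by (simp add: P.cong.eqv_0_iff P.relation_null)
  then show ?thesis unfolding P.cong.hyp_rels_iff by (simp add: vertex_gen_def[abs_def] edge_gen_def[abs_def])
qed

fun W :: "'v \<times> 'v + 'e \<times> 'e \<Rightarrow> (('v \<times> 'v + 'e \<times> 'e) + ('v \<times> 'v + 'e \<times> 'e)) free_algebra" where
  "W (Inl (v, w)) = (\<Sum>k\<in>V. gen (Inl (Inl (v, k))) * gen (Inr (Inl (k, w))))"
| "W (Inr (e, f)) = (\<Sum>k\<in>E. gen (Inl (Inr (e, k))) * gen (Inr (Inr (k, f))))"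

text \<open>Each leg satisfies the relations by \<open>copies_null\<close>, and the generators of
  the two legs commute, so the convolution lemmas apply to both blocks.\<close>

lemma W_rel: "\<rho> \<in> R \<Longrightarrow> P.cong2.eqv (subst W \<rho>) 0"
proof -
  have L: "\<forall>\<rho>\<in>R. P.cong2.eqv (P.inL \<rho>) 0" and R: "\<forall>\<rho>\<in>R. P.cong2.eqv (P.inR \<rho>) 0"
    using P.copies_null P.relation_null by blast+
  have "P.cong2.hyp_matrices V E s r (\<lambda>v w. W (Inl (v, w))) (\<lambda>e f. W (Inr (e, f)))"
    using L R unfolding P.cong2.hyp_rels_iff P.cong2.hyp_matrices_def W.simps
    by (intro conjI P.cong2.convolution_magic P.cong2.convolution_intertw fin P.copies_commute; blast)
  then show "\<rho> \<in> R \<Longrightarrow> P.cong2.eqv (subst W \<rho>) 0" unfolding P.cong2.hyp_rels_iff[symmetric] by blast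
qed

abbreviation "C \<equiv> P.C"
abbreviation "vg v w \<equiv> embed P.F P.u (vertex_gen v w)"
abbreviation "eg e f \<equiv> embed P.F P.u (edge_gen e f)"

lemma comult_vertex:
  assumes "v \<in> V" "w \<in> V"
  shows "P.comult W (vg v w) = (\<Oplus>\<^bsub>min_tensor C C\<^esub>k\<in>V. elem_tensor C C (vg v k) (vg k w))"
  unfolding vertex_gen_def
  by (rule P.comult_gen[OF W_rel fin(1)]) (use assms in \<open>auto simp: hyp_gens_def\<close>)

lemma comult_edge:
  assumes "e \<in> E" "f \<in> E"
  shows "P.comult W (eg e f) = (\<Oplus>\<^bsub>min_tensor C C\<^esub>k\<in>E. elem_tensor C C (eg e k) (eg k f))"
  unfolding edge_gen_def
  by (rule P.comult_gen[OF W_rel fin(2)]) (use assms in \<open>auto simp: hyp_gens_def\<close>)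

lemma comultiplication: "comultiplication (qaut V E s r) (P.comult W)"
proof -
  let ?M = "min_tensor C C"
  let ?b = "\<lambda>i j. embed P.F P.u (block_sum vertex_gen edge_gen i j)"
  interpret M: abelian_group ?M by (rule star_algebra.is_group[OF P.star_algebra_min_tensor])
  have b_in: "?b i j \<in> carrier C" if "i \<in> V <+> E" "j \<in> V <+> E" for i j
    using that by (auto simp: block_sum_def)
  have b: "?b (Inl v) (Inl w) = vg v w" "?b (Inr e) (Inr f) = eg e f"
    "?b (Inl v) (Inr f) = embed P.F P.u 0" "?b (Inr e) (Inl w) = embed P.F P.u 0" for v w e f
    by (simp_all add: block_sum_def)
  have in': "elem_tensor C C (?b i k) (?b k j) \<in> carrier ?M" if "i \<in> V <+> E" "j \<in> V <+> E" "k \<in> V <+> E" for i j k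
    using that b_in by (intro P.elem_tensor_in) auto
  have split: "(\<Oplus>\<^bsub>?M\<^esub>k\<in>V <+> E. elem_tensor C C (?b i k) (?b k j)) =
      (\<Oplus>\<^bsub>?M\<^esub>k\<in>V. elem_tensor C C (?b i (Inl k)) (?b (Inl k) j)) \<oplus>\<^bsub>?M\<^esub>
      (\<Oplus>\<^bsub>?M\<^esub>k\<in>E. elem_tensor C C (?b i (Inr k)) (?b (Inr k) j))" if "i \<in> V <+> E" "j \<in> V <+> E" for i j
    using in'[OF that] by (intro M.finsum_Plus fin) auto
  have zero: "(\<Oplus>\<^bsub>?M\<^esub>k\<in>K. h k) = \<zero>\<^bsub>?M\<^esub>" if "\<And>k. k \<in> K \<Longrightarrow> h k = \<zero>\<^bsub>?M\<^esub>" for K :: "'z set" and h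
    using M.finsum_cong'[of K K "\<lambda>_. \<zero>\<^bsub>?M\<^esub>" h] that by simp
  have vg_in: "vg v w \<in> carrier C" if "v \<in> V" "w \<in> V" for v w using that by simp
  have eg_in: "eg e f \<in> carrier C" if "e \<in> E" "f \<in> E" for e f using that by simp
  have z_in: "embed P.F P.u 0 \<in> carrier C" by simp
  have sum: "P.comult W (?b i j) = (\<Oplus>\<^bsub>?M\<^esub>k\<in>V <+> E. elem_tensor C C (?b i k) (?b k j))"
    if ij: "i \<in> V <+> E" "j \<in> V <+> E" for i j
  proof -
    have c0: "P.comult W (embed P.F P.u 0) = \<zero>\<^bsub>?M\<^esub>"
      using star_hom_zero[OF P.star_algebra_completion P.star_algebra_min_tensor P.comult(1)[OF W_rel]]
      by (simp add: P.embed_zero)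
    from ij consider v w where "i = Inl v" "j = Inl w" "v \<in> V" "w \<in> V" | e f where "i = Inr e" "j = Inr f" "e \<in> E" "f \<in> E"
      | v f where "i = Inl v" "j = Inr f" "v \<in> V" "f \<in> E" | e w where "i = Inr e" "j = Inl w" "e \<in> E" "w \<in> V" by blast
    then show ?thesis
    proof cases
      case 1
      have "(\<Oplus>\<^bsub>?M\<^esub>k\<in>V. elem_tensor C C (vg v k) (vg k w)) \<in> carrier ?M"
        using 1 by (intro M.finsum_closed) (auto intro: P.elem_tensor_in)
      then show ?thesis unfolding split[OF ij] unfolding 1(1,2) b
        using 1 zero[of E] P.elem_tensor_zero[OF z_in] by (simp add: comult_vertex)
    next
      case 2
      have "(\<Oplus>\<^bsub>?M\<^esub>k\<in>E. elem_tensor C C (eg e k) (eg k f)) \<in> carrier ?M"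
        using 2 by (intro M.finsum_closed) (auto intro: P.elem_tensor_in)
      then show ?thesis unfolding split[OF ij] unfolding 2(1,2) b
        using 2 zero[of V] P.elem_tensor_zero[OF z_in] by (simp add: comult_edge)
    next
      \<comment> \<open>A mixed entry is 0, and every summand of its coproduct has an off-diagonal 0
        in one leg.\<close>
      case 3
      then show ?thesis unfolding split[OF ij] unfolding 3(1,2) b
        using zero[of V] zero[of E] P.elem_tensor_zero(2)[OF vg_in] P.elem_tensor_zero(1)[OF eg_in] c0 by simp
    next
      case 4
      then show ?thesis unfolding split[OF ij] unfolding 4(1,2) b
        using zero[of V] zero[of E] P.elem_tensor_zero(2)[OF eg_in] P.elem_tensor_zero(1)[OF vg_in] c0 by simp
    qed
  qed
  show ?thesis
    unfolding comultiplication_def qaut_eq using P.comult(1)[OF W_rel] sum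
    by (simp add: universal_quantum_group_def P.universal_cstar_eq)
qed

lemma orthogonal: "P.cong.orthogonal_matrix (V <+> E) (block_sum vertex_gen edge_gen)"
  using generators unfolding P.cong.hyp_matrices_def
  by (intro P.cong.block_sum_orthogonal_matrix P.cong.magic_orthogonal_matrix fin) auto

lemma cmqg: "compact_matrix_quantum_group (qaut V E s r)"
  unfolding qaut_eq
proof (rule P.compact_matrix_quantum_groupI[OF _ _ orthogonal])
  show "\<exists>i\<in>V <+> E. \<exists>j\<in>V <+> E. block_sum vertex_gen edge_gen i j = gen x" if "x \<in> X" for x
  proof -
    from that consider v w where "x = Inl (v, w)" "v \<in> V" "w \<in> V" | e f where "x = Inr (e, f)" "e \<in> E" "f \<in> E"
      by (auto simp: hyp_gens_def)
    then show ?thesis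
    proof cases
      case 1
      then show ?thesis by (intro bexI[of _ "Inl v"] bexI[of _ "Inl w"]) (auto simp: block_sum_def vertex_gen_def)
    next
      case 2
      then show ?thesis by (intro bexI[of _ "Inr e"] bexI[of _ "Inr f"]) (auto simp: block_sum_def edge_gen_def)
    qed
  qed
  show "comultiplication (universal_quantum_group X R (V <+> E) (block_sum vertex_gen edge_gen)) (P.comult W)"
    using comultiplication by (simp add: qaut_eq)
qed (use fin in \<open>auto simp: block_sum_def\<close>)

end

section \<open>Edges with a single endpoint\<close>

context cstar_cong
begin

lemma eqv_if: "(c \<Longrightarrow> x \<approx> y) \<Longrightarrow> (\<not> c \<Longrightarrow> x' \<approx> y') \<Longrightarrow> (if c then x else x') \<approx> (if c then y else y')"
  by simp

lemma magicD:
  assumes "magic I u"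
  shows "i \<in> I \<Longrightarrow> j \<in> I \<Longrightarrow> proj (u i j)"
    and "i \<in> I \<Longrightarrow> (\<Sum>j\<in>I. u i j) \<approx> 1" and "i \<in> I \<Longrightarrow> (\<Sum>j\<in>I. u j i) \<approx> 1"
  using assms by (auto simp: magic_def)

lemma proj_mult:
  assumes p: "proj p" and r: "proj r" and comm: "p * r \<approx> r * p" shows "proj (p * r)"
  unfolding proj_def
proof
  have "(p * r) * (p * r) = p * (r * p) * r" by (simp add: mult.assoc)
  also have "\<dots> \<approx> p * (p * r) * r" by (intro eqv_mult_right eqv_mult_left eqv_sym[OF comm])
  also have "\<dots> = (p * p) * (r * r)" by (simp add: mult.assoc)
  also have "\<dots> \<approx> p * r" using p r by (intro eqv_mult) (auto simp: proj_def)
  finally show "(p * r) * (p * r) \<approx> p * r" .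
  have "free_star (p * r) = free_star r * free_star p" by (rule free_star_mult)
  also have "\<dots> \<approx> r * p" using p r by (intro eqv_mult) (auto simp: proj_def)
  also have "\<dots> \<approx> p * r" by (rule eqv_sym[OF comm])
  finally show "free_star (p * r) \<approx> p * r" .
qed

lemma proj_diff:
  assumes p: "proj p" and r: "proj r" and pr: "p * r \<approx> r" and rp: "r * p \<approx> r" shows "proj (p - r)"
  unfolding proj_def
proof
  have "(p - r) * (p - r) = p * p - p * r - r * p + r * r" by (simp add: algebra_simps)
  also have "\<dots> \<approx> p - r - r + r"
    using p r pr rp by (intro eqv_add eqv_diff) (auto simp: proj_def)
  finally show "(p - r) * (p - r) \<approx> p - r" by simp
  show "free_star (p - r) \<approx> p - r"
    unfolding conj_diff using p r by (intro eqv_diff) (auto simp: proj_def)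
qed

lemma proj_add:
  assumes p: "proj p" and r: "proj r" and pr: "p * r \<approx> 0" and rp: "r * p \<approx> 0" shows "proj (p + r)"
  unfolding proj_def
proof
  have "(p + r) * (p + r) = p * p + p * r + (r * p + r * r)" by (simp add: algebra_simps)
  also have "\<dots> \<approx> p + 0 + (0 + r)"
    using p r pr rp by (intro eqv_add) (auto simp: proj_def)
  finally show "(p + r) * (p + r) \<approx> p + r" by simp
  show "free_star (p + r) \<approx> p + r"
    unfolding conj_add using p r by (intro eqv_add) (auto simp: proj_def)
qed

lemma intertw_incidence:
  assumes "finite V" "finite E" "\<And>f. f \<in> E \<Longrightarrow> t f \<subseteq> V"
  shows "intertw V E (incidence t) u w \<longleftrightarrow> (\<forall>v\<in>V. \<forall>f\<in>E. (\<Sum>e | e \<in> E \<and> v \<in> t e. w e f) \<approx> (\<Sum>x\<in>t f. u v x))"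
proof -
  have "(\<Sum>k\<in>E. scale (incidence t v k) (w k f)) = (\<Sum>e | e \<in> E \<and> v \<in> t e. w e f)" for v f
    by (rule sum.mono_neutral_cong_right) (use assms in \<open>auto simp: incidence_def\<close>)
  moreover have "(\<Sum>k\<in>V. scale (incidence t k f) (u v k)) = (\<Sum>x\<in>t f. u v x)" if "f \<in> E" for v f
    by (rule sum.mono_neutral_cong_right) (use assms that in \<open>auto simp: incidence_def\<close>)
  ultimately show ?thesis by (simp add: intertw_def)
qed

text \<open>A map \<open>f \<mapsto> t f\<close> from edges to sets of vertices; the hypothesis is the relation \<open>A\<^sub>t u\<^sub>E = u\<^sub>V A\<^sub>t\<close>.\<close>

lemma incidence_absorb:
  assumes fin: "finite E" and w: "magic E w" and inc: "(\<Sum>e | e \<in> E \<and> v \<in> t e. w e f) \<approx> y" and ef: "e \<in> E" "f \<in> E"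
  shows "y * w e f \<approx> (if v \<in> t e then w e f else 0)" "w e f * y \<approx> (if v \<in> t e then w e f else 0)"
proof -
  have "y * w e f \<approx> (\<Sum>e | e \<in> E \<and> v \<in> t e. w e f) * w e f"
    by (rule eqv_mult_right[OF eqv_sym[OF inc]])
  also have "\<dots> = (\<Sum>e' | e' \<in> E \<and> v \<in> t e'. w e' f * w e f)" by (simp add: sum_distrib_right)
  also have "\<dots> \<approx> (\<Sum>e' | e' \<in> E \<and> v \<in> t e'. if e' = e then w e' f else 0)"
    using ef by (intro eqv_sum magic_col[OF fin w]) auto
  also have "\<dots> = (if v \<in> t e then w e f else 0)" using fin ef by (simp add: sum.delta)
  finally show "y * w e f \<approx> (if v \<in> t e then w e f else 0)" .
  have "w e f * y \<approx> w e f * (\<Sum>e | e \<in> E \<and> v \<in> t e. w e f)"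
    by (rule eqv_mult_left[OF eqv_sym[OF inc]])
  also have "\<dots> = (\<Sum>e' | e' \<in> E \<and> v \<in> t e'. w e f * w e' f)" by (simp add: sum_distrib_left)
  also have "\<dots> \<approx> (\<Sum>e' | e' \<in> E \<and> v \<in> t e'. if e = e' then w e f else 0)"
    using ef by (intro eqv_sum magic_col[OF fin w]) auto
  also have "\<dots> = (if v \<in> t e then w e f else 0)" using fin ef by (simp add: sum.delta')
  finally show "w e f * y \<approx> (if v \<in> t e then w e f else 0)" .
qed

text \<open>Both factors are partial sums of the same column of a magic unitary, whose entries are
  orthogonal, so the product keeps the edges common to both.\<close>

lemma incidence_product:
  assumes fin: "finite E" and w: "magic E w" and f: "f \<in> E"
    and v: "(\<Sum>e | e \<in> E \<and> v \<in> t e. w e f) \<approx> y" and v': "(\<Sum>e | e \<in> E \<and> v' \<in> t' e. w e f) \<approx> y'"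
  shows "y * y' \<approx> (\<Sum>e | e \<in> E \<and> v \<in> t e \<and> v' \<in> t' e. w e f)"
proof -
  have "y * y' \<approx> y * y' * (\<Sum>e\<in>E. w e f)"
    using eqv_mult_left[OF eqv_sym[OF magicD(3)[OF w f]], of "y * y'"] by simp
  also have "\<dots> = (\<Sum>e\<in>E. y * (y' * w e f))" by (simp add: sum_distrib_left mult.assoc)
  also have "\<dots> \<approx> (\<Sum>e\<in>E. y * (if v' \<in> t' e then w e f else 0))"
    using f by (intro eqv_sum eqv_mult_left incidence_absorb(1)[OF fin w v'])
  also have "\<dots> = (\<Sum>e\<in>E. if v' \<in> t' e then y * w e f else 0)" by (intro sum.cong) auto
  also have "\<dots> \<approx> (\<Sum>e\<in>E. if v' \<in> t' e then (if v \<in> t e then w e f else 0) else 0)"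
    using f by (intro eqv_sum eqv_if incidence_absorb(1)[OF fin w v]) auto
  also have "\<dots> = (\<Sum>e | e \<in> E \<and> v \<in> t e \<and> v' \<in> t' e. w e f)"
    by (rule sum.mono_neutral_cong_right) (use fin in auto)
  finally show ?thesis .
qed

definition endpoint :: "'v set \<Rightarrow> 'e set \<Rightarrow> ('e \<Rightarrow> 'v) \<Rightarrow> ('v \<Rightarrow> 'v \<Rightarrow> 'y free_algebra) \<Rightarrow> ('e \<Rightarrow> 'e \<Rightarrow> 'y free_algebra) \<Rightarrow> bool" where
  "endpoint V E t u w \<longleftrightarrow> (\<forall>v\<in>V. \<forall>f\<in>E. (\<Sum>e | e \<in> E \<and> t e = v. w e f) \<approx> u v (t f))"

lemma intertw_endpoint:
  assumes "finite V" "finite E" "\<And>f. f \<in> E \<Longrightarrow> t f \<in> V"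
  shows "intertw V E (incidence (\<lambda>e. {t e})) u w \<longleftrightarrow> endpoint V E t u w"
proof -
  have eq: "{e. e \<in> E \<and> v = t e} = {e. e \<in> E \<and> t e = v}" for v by auto
  show ?thesis using assms by (subst intertw_incidence) (auto simp: endpoint_def eq)
qed

text \<open>Passes from columns to rows. Multiplying \<open>w e f\<close> by
  \<open>u (t e) x\<close> keeps it or kills it according to whether \<open>t f = x\<close>, by row
  orthogonality of \<open>u\<close>; summing over \<open>f\<close> replaces the row of
  \<open>w\<close> by 1.\<close>

lemma endpoint_row:
  assumes fin: "finite V" "finite E" and u: "magic V u" and w: "magic E w" and t: "\<And>f. f \<in> E \<Longrightarrow> t f \<in> V"
    and ep: "endpoint V E t u w" and e: "e \<in> E" and x: "x \<in> V"
  shows "(\<Sum>f | f \<in> E \<and> t f = x. w e f) \<approx> u (t e) x"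
proof -
  have inc: "(\<Sum>e' | e' \<in> E \<and> t e \<in> {t e'}. w e' f) \<approx> u (t e) (t f)" if "f \<in> E" for f
    using ep t[OF e] that by (simp add: endpoint_def eq_commute[of "t e"])
  have absorb: "u (t e) x * w e f \<approx> (if t f = x then w e f else 0)" if f: "f \<in> E" for f
  proof -
    have a: "u (t e) (t f) * w e f \<approx> w e f" using incidence_absorb(1)[OF fin(2) w inc[OF f] e f] by simp
    have "u (t e) x * w e f \<approx> u (t e) x * (u (t e) (t f) * w e f)" by (rule eqv_mult_left[OF eqv_sym[OF a]])
    also have "\<dots> = (u (t e) x * u (t e) (t f)) * w e f" by (simp add: mult.assoc)
    also have "\<dots> \<approx> (if x = t f then u (t e) x else 0) * w e f"
      by (intro eqv_mult_right magic_row[OF fin(1) u] t x e f)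
    also have "\<dots> \<approx> (if t f = x then w e f else 0)" using a by auto
    finally show ?thesis .
  qed
  have "u (t e) x \<approx> u (t e) x * (\<Sum>f\<in>E. w e f)"
    using eqv_mult_left[OF eqv_sym[OF magicD(2)[OF w e]], of "u (t e) x"] by simp
  also have "\<dots> = (\<Sum>f\<in>E. u (t e) x * w e f)" by (simp add: sum_distrib_left)
  also have "\<dots> \<approx> (\<Sum>f\<in>E. if t f = x then w e f else 0)" by (intro eqv_sum absorb)
  also have "\<dots> = (\<Sum>f | f \<in> E \<and> t f = x. w e f)"
    by (rule sum.mono_neutral_cong_right) (use fin in auto)
  finally show ?thesis by (rule eqv_sym)
qed

end

section \<open>Bichon's relations\<close>

context cstar_cong
begin

abbreviation adj_intertw :: "'v set \<Rightarrow> ('v \<Rightarrow> 'v \<Rightarrow> bool) \<Rightarrow> ('v \<Rightarrow> 'v \<Rightarrow> 'y free_algebra) \<Rightarrow> bool" where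
  "adj_intertw V adj u \<equiv> intertw V V (adjacency adj) u u"

text \<open>The entrywise form of commutation with the adjacency matrix; for a magic unitary the two
  are equivalent.\<close>

definition adj_null :: "'v set \<Rightarrow> ('v \<Rightarrow> 'v \<Rightarrow> bool) \<Rightarrow> ('v \<Rightarrow> 'v \<Rightarrow> 'y free_algebra) \<Rightarrow> bool" where
  "adj_null V adj u \<longleftrightarrow> (\<forall>v\<in>V. \<forall>w\<in>V. \<forall>k\<in>V. \<forall>l\<in>V. adj v w \<noteq> adj k l \<longrightarrow> u v k * u w l \<approx> 0)"

lemma adjacency_scale: "scale (adjacency adj v w) x = (if adj v w then x else 0)"
  by (simp add: adjacency_def)

lemma adj_intertw_of_null:
  assumes fin: "finite V" and u: "magic V u" and null: "adj_null V adj u"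
  shows "adj_intertw V adj u"
  unfolding intertw_def adjacency_scale
proof (intro ballI)
  fix v w assume v: "v \<in> V" and w: "w \<in> V"
  have n: "u v y * u x w \<approx> 0" if "x \<in> V" "y \<in> V" "adj v x \<noteq> adj y w" for x y
    using null v w that unfolding adj_null_def by blast
  have "(\<Sum>x\<in>V. if adj v x then u x w else 0) \<approx> (\<Sum>x\<in>V. if adj v x then (\<Sum>y\<in>V. u v y) * u x w else 0)"
    using eqv_mult_right[OF eqv_sym[OF magicD(2)[OF u v]]] by (intro eqv_sum eqv_if) auto
  also have "\<dots> = (\<Sum>x\<in>V. \<Sum>y\<in>V. if adj v x then u v y * u x w else 0)"
    by (intro sum.cong) (auto simp: sum_distrib_right)
  also have "\<dots> \<approx> (\<Sum>x\<in>V. \<Sum>y\<in>V. if adj y w then u v y * u x w else 0)"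
    using n by (intro eqv_sum) (auto intro: eqv_sym)
  also have "\<dots> = (\<Sum>y\<in>V. if adj y w then u v y * (\<Sum>x\<in>V. u x w) else 0)"
    by (subst sum.swap, intro sum.cong) (auto simp: sum_distrib_left)
  also have "\<dots> \<approx> (\<Sum>y\<in>V. if adj y w then u v y else 0)"
    using eqv_mult_left[OF magicD(3)[OF u w]] by (intro eqv_sum eqv_if) auto
  finally show "(\<Sum>x\<in>V. if adj v x then u x w else 0) \<approx> (\<Sum>y\<in>V. if adj y w then u v y else 0)" .
qed

text \<open>The entry of the commutation relation at \<open>(i, l)\<close> is multiplied by
  \<open>u i k\<close> on the left and by \<open>u j l\<close> on the right; orthogonality leaves
  one term on each side, and exactly one of them is switched off.\<close>

lemma null_of_adj_intertw:
  assumes fin: "finite V" and u: "magic V u" and A: "adj_intertw V adj u"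
  shows "adj_null V adj u"
  unfolding adj_null_def
proof (intro ballI impI)
  fix i j k l assume V: "i \<in> V" "j \<in> V" "k \<in> V" "l \<in> V" and ne: "adj i j \<noteq> adj k l"
  define L where "L = (\<Sum>x\<in>V. if adj i x then u x l else 0)"
  define M where "M = (\<Sum>y\<in>V. if adj y l then u i y else 0)"
  have LM: "L \<approx> M" using A V unfolding intertw_def adjacency_scale L_def M_def by blast
  have "L * u j l = (\<Sum>x\<in>V. if adj i x then u x l * u j l else 0)"
    unfolding L_def sum_distrib_right by (intro sum.cong) auto
  also have "\<dots> \<approx> (\<Sum>x\<in>V. if adj i x then (if x = j then u x l else 0) else 0)"
    using V by (intro eqv_sum eqv_if magic_col[OF fin u]) auto
  also have "\<dots> = (\<Sum>x\<in>V. if x = j then (if adj i j then u j l else 0) else 0)" by (intro sum.cong) auto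
  also have "\<dots> = (if adj i j then u j l else 0)" using fin V by simp
  finally have L: "L * u j l \<approx> (if adj i j then u j l else 0)" .
  have "u i k * M = (\<Sum>y\<in>V. if adj y l then u i k * u i y else 0)"
    unfolding M_def sum_distrib_left by (intro sum.cong) auto
  also have "\<dots> \<approx> (\<Sum>y\<in>V. if adj y l then (if k = y then u i k else 0) else 0)"
    using V by (intro eqv_sum eqv_if magic_row[OF fin u]) auto
  also have "\<dots> = (\<Sum>y\<in>V. if k = y then (if adj k l then u i k else 0) else 0)" by (intro sum.cong) auto
  also have "\<dots> = (if adj k l then u i k else 0)" using fin V by simp
  finally have M: "u i k * M \<approx> (if adj k l then u i k else 0)" .
  have "(if adj i j then u i k * u j l else 0) \<approx> u i k * (L * u j l)"
    using eqv_sym[OF eqv_mult_left[OF L, of "u i k"]] by auto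
  also have "\<dots> \<approx> u i k * (M * u j l)" by (intro eqv_mult_left eqv_mult_right LM)
  also have "\<dots> = (u i k * M) * u j l" by (simp add: mult.assoc)
  also have "\<dots> \<approx> (if adj k l then u i k else 0) * u j l" by (intro eqv_mult_right M)
  finally show "u i k * u j l \<approx> 0" using ne by (auto split: if_splits intro: eqv_sym)
qed

text \<open>Summing \<open>u\<^sub>v\<^sub>k u\<^sub>w\<^sub>l\<close> over the pairs \<open>k \<sim> l\<close> only yields \<open>1\<close>, so the remaining products vanish.\<close>

lemma adj_null_of_sum:
  assumes fin: "finite V" and u: "magic V u"
    and null: "\<And>v w k l. \<lbrakk>v \<in> V; w \<in> V; k \<in> V; l \<in> V; adj k l; \<not> adj v w\<rbrakk> \<Longrightarrow> u v k * u w l \<approx> 0"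
    and sum: "\<And>v w. \<lbrakk>v \<in> V; w \<in> V; adj v w\<rbrakk> \<Longrightarrow> (\<Sum>k\<in>V. \<Sum>l\<in>V. if adj k l then u v k * u w l else 0) \<approx> 1"
  shows "adj_null V adj u"
proof -
  have "u v k * u w l \<approx> 0" if V: "v \<in> V" "w \<in> V" "k \<in> V" "l \<in> V" "adj v w" "\<not> adj k l" for v w k l
  proof -
    \<comment> \<open>The sum congruent to 1 is inserted between the two factors. Each of its terms
      with \<open>k' \<sim> l'\<close> differs from \<open>(k, l)\<close> in some coordinate and is
      killed by row orthogonality on that side.\<close>
    have "u v k * u w l \<approx> u v k * (\<Sum>k'\<in>V. \<Sum>l'\<in>V. if adj k' l' then u v k' * u w l' else 0) * u w l"
      using eqv_mult_right[OF eqv_mult_left[OF eqv_sym[OF sum[OF V(1,2,5)]]], of "u v k" "u w l"] by simp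
    also have "\<dots> = (\<Sum>k'\<in>V. \<Sum>l'\<in>V. if adj k' l' then (u v k * u v k') * (u w l' * u w l) else 0)"
      unfolding sum_distrib_left sum_distrib_right by (intro sum.cong) (auto simp: mult.assoc)
    also have "\<dots> \<approx> 0"
    proof (intro eqv_sum_zero)
      fix k' l' assume kl: "k' \<in> V" "l' \<in> V"
      have "u v k * u v k' \<approx> 0 \<or> u w l' * u w l \<approx> 0" if "adj k' l'"
        using magic_row[OF fin u V(1,3) kl(1)] magic_row[OF fin u V(2) kl(2) V(4)] that V(6) by (auto split: if_splits)
      then show "(if adj k' l' then (u v k * u v k') * (u w l' * u w l) else 0) \<approx> 0"
        using eqv_mult_0 by auto
    qed
    finally show ?thesis .
  qed
  then show ?thesis unfolding adj_null_def using null by blast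
qed

text \<open>Where the other pair is adjacent, \<open>adj_null\<close> makes the terms excluded by
  the condition null; dropping it leaves full row or column sums.\<close>

lemma adj_sums:
  assumes fin: "finite V" and u: "magic V u" and null: "adj_null V adj u"
  shows "\<lbrakk>v \<in> V; w \<in> V; adj v w\<rbrakk> \<Longrightarrow> (\<Sum>k\<in>V. \<Sum>l\<in>V. if adj k l then u v k * u w l else 0) \<approx> 1"
    and "\<lbrakk>k \<in> V; l \<in> V; adj k l\<rbrakk> \<Longrightarrow> (\<Sum>v\<in>V. \<Sum>w\<in>V. if adj v w then u v k * u w l else 0) \<approx> 1"
    and "\<lbrakk>v \<in> V; k \<in> V; l \<in> V; adj k l\<rbrakk> \<Longrightarrow> (\<Sum>w\<in>V. if adj v w then u v k * u w l else 0) \<approx> u v k"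
    and "\<lbrakk>w \<in> V; k \<in> V; l \<in> V; adj k l\<rbrakk> \<Longrightarrow> (\<Sum>v\<in>V. if adj v w then u v k * u w l else 0) \<approx> u w l"
proof -
  have n: "u v k * u w l \<approx> 0" if "v \<in> V" "w \<in> V" "k \<in> V" "l \<in> V" "adj v w \<noteq> adj k l" for v w k l
    using null that unfolding adj_null_def by blast
  show part1: "(\<Sum>w\<in>V. if adj v w then u v k * u w l else 0) \<approx> u v k" if V: "v \<in> V" "k \<in> V" "l \<in> V" "adj k l" for v k l
  proof -
    have "(\<Sum>w\<in>V. if adj v w then u v k * u w l else 0) \<approx> (\<Sum>w\<in>V. u v k * u w l)"
      using V n by (intro eqv_sum) (auto intro: eqv_sym)
    also have "\<dots> \<approx> u v k"
      using eqv_mult_left[OF magicD(3)[OF u V(3)], of "u v k"] by (simp add: sum_distrib_left)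
    finally show ?thesis .
  qed
  show "(\<Sum>v\<in>V. if adj v w then u v k * u w l else 0) \<approx> u w l" if V: "w \<in> V" "k \<in> V" "l \<in> V" "adj k l" for w k l
  proof -
    have "(\<Sum>v\<in>V. if adj v w then u v k * u w l else 0) \<approx> (\<Sum>v\<in>V. u v k * u w l)"
      using V n by (intro eqv_sum) (auto intro: eqv_sym)
    also have "\<dots> \<approx> u w l"
      using eqv_mult_right[OF magicD(3)[OF u V(2)], of "u w l"] by (simp add: sum_distrib_right)
    finally show ?thesis .
  qed
  show "(\<Sum>v\<in>V. \<Sum>w\<in>V. if adj v w then u v k * u w l else 0) \<approx> 1" if V: "k \<in> V" "l \<in> V" "adj k l" for k l
  proof -
    have "(\<Sum>v\<in>V. \<Sum>w\<in>V. if adj v w then u v k * u w l else 0) \<approx> (\<Sum>v\<in>V. u v k)"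
      by (intro eqv_sum part1 V)
    also have "\<dots> \<approx> 1" by (rule magicD(3)[OF u V(1)])
    finally show ?thesis .
  qed
  show "(\<Sum>k\<in>V. \<Sum>l\<in>V. if adj k l then u v k * u w l else 0) \<approx> 1" if V: "v \<in> V" "w \<in> V" "adj v w" for v w
  proof -
    have "(\<Sum>k\<in>V. \<Sum>l\<in>V. if adj k l then u v k * u w l else 0) \<approx> (\<Sum>k\<in>V. \<Sum>l\<in>V. u v k * u w l)"
      using V n by (intro eqv_sum) (auto intro: eqv_sym)
    also have "\<dots> = (\<Sum>k\<in>V. u v k) * (\<Sum>l\<in>V. u w l)" by (simp add: sum_product)
    also have "\<dots> \<approx> 1 * 1" by (intro eqv_mult magicD(2)[OF u] V)
    finally show ?thesis by simp
  qed
qed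

definition bichon :: "'v set \<Rightarrow> ('v \<Rightarrow> 'v \<Rightarrow> bool) \<Rightarrow> ('v \<Rightarrow> 'v \<Rightarrow> 'y free_algebra) \<Rightarrow> bool" where
  "bichon V adj u \<longleftrightarrow> magic V u \<and> adj_intertw V adj u \<and>
    (\<forall>i\<in>V. \<forall>j\<in>V. \<forall>k\<in>V. \<forall>l\<in>V. adj i j \<and> adj k l \<longrightarrow> u i k * u j l \<approx> u j l * u i k)"

section \<open>Directed graphs\<close>

text \<open>At most one edge runs from \<open>v\<close> to \<open>v'\<close>, so the product of the
  two incidence sums is a single entry of \<open>w\<close>, in either order of the factors.\<close>

lemma digraph_edge_product:
  assumes fin: "finite V" and E: "E \<subseteq> V \<times> V" and w: "magic E w"
    and ep: "endpoint V E fst u w" "endpoint V E snd u w" and V: "v \<in> V" "v' \<in> V" and f: "f \<in> E"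
  shows "u v (fst f) * u v' (snd f) \<approx> (if (v, v') \<in> E then w (v, v') f else 0)"
    and "u v' (snd f) * u v (fst f) \<approx> (if (v, v') \<in> E then w (v, v') f else 0)"
proof -
  have finE: "finite E" using fin E finite_subset by blast
  have inc: "(\<Sum>e | e \<in> E \<and> v \<in> {fst e}. w e f) \<approx> u v (fst f)" "(\<Sum>e | e \<in> E \<and> v' \<in> {snd e}. w e f) \<approx> u v' (snd f)"
    using ep V f by (simp_all add: endpoint_def eq_commute[of v] eq_commute[of v'])
  have "{e. e \<in> E \<and> v \<in> {fst e} \<and> v' \<in> {snd e}} = (if (v, v') \<in> E then {(v, v')} else {})"
    "{e. e \<in> E \<and> v' \<in> {snd e} \<and> v \<in> {fst e}} = (if (v, v') \<in> E then {(v, v')} else {})" by auto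
  then show "u v (fst f) * u v' (snd f) \<approx> (if (v, v') \<in> E then w (v, v') f else 0)"
    "u v' (snd f) * u v (fst f) \<approx> (if (v, v') \<in> E then w (v, v') f else 0)"
    using incidence_product[OF finE w f inc(1) inc(2)] incidence_product[OF finE w f inc(2) inc(1)] by (auto split: if_splits)
qed

lemma sum_over_edges:
  assumes "finite V" "E \<subseteq> V \<times> V"
  shows "(\<Sum>f\<in>E. g (fst f) (snd f)) = (\<Sum>k\<in>V. \<Sum>l\<in>V. if (k, l) \<in> E then (g k l :: 'y free_algebra) else 0)"
proof -
  have "(\<Sum>k\<in>V. \<Sum>l\<in>V. if (k, l) \<in> E then g k l else 0) = (\<Sum>f\<in>V \<times> V. if f \<in> E then g (fst f) (snd f) else 0)"
    by (simp add: sum.cartesian_product case_prod_unfold)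
  also have "\<dots> = (\<Sum>f\<in>E. g (fst f) (snd f))"
    by (rule sum.mono_neutral_cong_right) (use assms in auto)
  finally show ?thesis by simp
qed

text \<open>Commutation holds because both orders yield the same edge entry or 0; the sum over
  adjacent pairs is a row sum of \<open>w\<close>.\<close>

lemma digraph_bichon:
  assumes fin: "finite V" and E: "E \<subseteq> V \<times> V" and u: "magic V u" and w: "magic E w"
    and ep: "endpoint V E fst u w" "endpoint V E snd u w"
  shows "bichon V (\<lambda>v w. (v, w) \<in> E) u"
proof -
  note prod = digraph_edge_product[OF fin E w ep]
  have null: "adj_null V (\<lambda>v w. (v, w) \<in> E) u"
  proof (rule adj_null_of_sum[OF fin u])
    show "u v k * u v' l \<approx> 0" if "v \<in> V" "v' \<in> V" "k \<in> V" "l \<in> V" "(k, l) \<in> E" "(v, v') \<notin> E" for v v' k l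
      using prod(1)[of v v' "(k, l)"] that by simp
    fix v v' assume V: "v \<in> V" "v' \<in> V" "(v, v') \<in> E"
    have "(\<Sum>k\<in>V. \<Sum>l\<in>V. if (k, l) \<in> E then u v k * u v' l else 0) = (\<Sum>f\<in>E. u v (fst f) * u v' (snd f))"
      by (rule sum_over_edges[OF fin E, symmetric])
    also have "\<dots> \<approx> (\<Sum>f\<in>E. w (v, v') f)" using prod(1)[OF V(1,2)] V(3) by (intro eqv_sum) simp
    also have "\<dots> \<approx> 1" by (rule magicD(2)[OF w V(3)])
    finally show "(\<Sum>k\<in>V. \<Sum>l\<in>V. if (k, l) \<in> E then u v k * u v' l else 0) \<approx> 1" .
  qed
  moreover have "u i k * u j l \<approx> u j l * u i k" if "i \<in> V" "j \<in> V" "(k, l) \<in> E" for i j k l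
    using eqv_trans[OF prod(1) eqv_sym[OF prod(2)], OF that that] by simp
  ultimately show ?thesis unfolding bichon_def using u adj_intertw_of_null[OF fin u] by blast
qed

text \<open>Commutation makes the products projections; the sums required of \<open>w\<close> are
  those of \<open>adj_sums\<close>.\<close>

lemma bichon_digraph:
  assumes fin: "finite V" and E: "E \<subseteq> V \<times> V" and b: "bichon V (\<lambda>v w. (v, w) \<in> E) u"
  defines "w \<equiv> \<lambda>e f. u (fst e) (fst f) * u (snd e) (snd f)"
  shows "magic E w" "endpoint V E fst u w" "endpoint V E snd u w"
proof -
  have u: "magic V u" and comm: "\<And>i j k l. (i, j) \<in> E \<Longrightarrow> (k, l) \<in> E \<Longrightarrow> u i k * u j l \<approx> u j l * u i k"
    using b E unfolding bichon_def by blast+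
  have null: "adj_null V (\<lambda>v w. (v, w) \<in> E) u" using null_of_adj_intertw[OF fin u] b by (auto simp: bichon_def)
  note sums = adj_sums[OF fin u null]
  have inV: "fst e \<in> V" "snd e \<in> V" "(fst e, snd e) \<in> E" if "e \<in> E" for e using that E by auto
  show "magic E w"
    unfolding magic_def
  proof (intro conjI ballI)
    fix e assume e: "e \<in> E"
    show "proj (w e f)" if f: "f \<in> E" for f
      unfolding w_def by (intro proj_mult magicD(1)[OF u] comm inV e f)
    show "(\<Sum>f\<in>E. w e f) \<approx> 1"
      unfolding w_def sum_over_edges[OF fin E, of "\<lambda>k l. u (fst e) k * u (snd e) l"] by (intro sums(1) inV e)
    show "(\<Sum>f\<in>E. w f e) \<approx> 1"
      unfolding w_def sum_over_edges[OF fin E, of "\<lambda>k l. u k (fst e) * u l (snd e)"] by (intro sums(2) inV e)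
  qed
  show "endpoint V E fst u w"
    unfolding endpoint_def
  proof (intro ballI)
    fix v f assume v: "v \<in> V" and f: "f \<in> E"
    have "(\<Sum>e | e \<in> E \<and> fst e = v. w e f) = (\<Sum>x | x \<in> V \<and> (v, x) \<in> E. u v (fst f) * u x (snd f))"
      by (rule sum.reindex_bij_witness[of _ "\<lambda>x. (v, x)" snd]) (use E in \<open>auto simp: w_def\<close>)
    also have "\<dots> = (\<Sum>x\<in>V. if (v, x) \<in> E then u v (fst f) * u x (snd f) else 0)"
      by (rule sum.mono_neutral_cong_left) (use fin in auto)
    also have "\<dots> \<approx> u v (fst f)" by (intro sums(3) inV f v)
    finally show "(\<Sum>e | e \<in> E \<and> fst e = v. w e f) \<approx> u v (fst f)" .
  qed
  show "endpoint V E snd u w"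
    unfolding endpoint_def
  proof (intro ballI)
    fix v f assume v: "v \<in> V" and f: "f \<in> E"
    have "(\<Sum>e | e \<in> E \<and> snd e = v. w e f) = (\<Sum>x | x \<in> V \<and> (x, v) \<in> E. u x (fst f) * u v (snd f))"
      by (rule sum.reindex_bij_witness[of _ "\<lambda>x. (x, v)" fst]) (use E in \<open>auto simp: w_def\<close>)
    also have "\<dots> = (\<Sum>x\<in>V. if (x, v) \<in> E then u x (fst f) * u v (snd f) else 0)"
      by (rule sum.mono_neutral_cong_left) (use fin in auto)
    also have "\<dots> \<approx> u v (snd f)" by (intro sums(4) inV f v)
    finally show "(\<Sum>e | e \<in> E \<and> snd e = v. w e f) \<approx> u v (snd f)" .
  qed
qed

end

section \<open>Simple graphs\<close>

context cstar_cong
begin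

text \<open>With \<open>P = u\<^sub>v\<^sub>k, Q = u\<^sub>v\<^sub>'\<^sub>l, R = u\<^sub>v\<^sub>l, S = u\<^sub>v\<^sub>'\<^sub>k\<close>, the edge entry is
  \<open>P Q + R S = Q P + S R\<close>; multiplying by \<open>P\<close> on either side gives \<open>P Q = P Q P = Q P\<close>.\<close>

lemma two_point_commute:
  assumes x: "(P + R) * (Q + S) \<approx> x" "(Q + S) * (P + R) \<approx> x"
    and idem: "P * P \<approx> P" and z: "P * R \<approx> 0" "R * P \<approx> 0" "P * S \<approx> 0" "S * P \<approx> 0" "R * Q \<approx> 0" "Q * R \<approx> 0"
  shows "x \<approx> P * Q + R * S" "P * Q \<approx> P * x" "P * Q \<approx> Q * P"
proof -
  have "(P + R) * (Q + S) = P * Q + R * S + (P * S + R * Q)" by (simp add: algebra_simps)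
  also have "\<dots> \<approx> P * Q + R * S + (0 + 0)" by (intro eqv_add eqv_refl z)
  finally have "(P + R) * (Q + S) \<approx> P * Q + R * S" by simp
  then show x1: "x \<approx> P * Q + R * S" using x(1) eqv_trans eqv_sym by blast
  have "(Q + S) * (P + R) = Q * P + S * R + (S * P + Q * R)" by (simp add: algebra_simps)
  also have "\<dots> \<approx> Q * P + S * R + (0 + 0)" by (intro eqv_add eqv_refl z)
  finally have "(Q + S) * (P + R) \<approx> Q * P + S * R" by simp
  then have x2: "x \<approx> Q * P + S * R" using x(2) eqv_trans eqv_sym by blast
  have "P * x \<approx> P * (P * Q + R * S)" by (rule eqv_mult_left[OF x1])
  also have "\<dots> = (P * P) * Q + (P * R) * S" by (simp add: algebra_simps)
  also have "\<dots> \<approx> P * Q + 0" by (intro eqv_add eqv_mult_right idem eqv_mult_0 z)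
  finally have Px1: "P * x \<approx> P * Q" by simp
  then show "P * Q \<approx> P * x" by (rule eqv_sym)
  have "P * x \<approx> P * (Q * P + S * R)" by (rule eqv_mult_left[OF x2])
  also have "\<dots> = P * Q * P + (P * S) * R" by (simp add: algebra_simps)
  also have "\<dots> \<approx> P * Q * P + 0" by (intro eqv_add eqv_refl eqv_mult_0 z)
  finally have Px2: "P * x \<approx> P * Q * P" by simp
  have "x * P \<approx> (P * Q + R * S) * P" by (rule eqv_mult_right[OF x1])
  also have "\<dots> = P * Q * P + R * (S * P)" by (simp add: algebra_simps)
  also have "\<dots> \<approx> P * Q * P + 0" by (intro eqv_add eqv_refl eqv_mult_0 z)
  finally have xP1: "x * P \<approx> P * Q * P" by simp
  have "x * P \<approx> (Q * P + S * R) * P" by (rule eqv_mult_right[OF x2])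
  also have "\<dots> = Q * (P * P) + S * (R * P)" by (simp add: algebra_simps)
  also have "\<dots> \<approx> Q * P + 0" by (intro eqv_add eqv_mult_left idem eqv_mult_0 z)
  finally have xP2: "x * P \<approx> Q * P" by simp
  show "P * Q \<approx> Q * P"
    using eqv_trans[OF eqv_trans[OF eqv_sym[OF Px1] Px2] eqv_trans[OF eqv_sym[OF xP1] xP2]] .
qed

end

text \<open>The functions \<open>a\<close> and \<open>b\<close> choose an arbitrary orientation of
  each edge. The formula for the edge entries uses it, but the entries are independent of it modulo
  the relations.\<close>

locale simple_graph_edges =
  fixes V :: "'v set" and E :: "'v set set" and a b :: "'v set \<Rightarrow> 'v"
  assumes fin: "finite V" and EV: "E \<subseteq> Pow V" and ab: "\<And>e. e \<in> E \<Longrightarrow> e = {a e, b e} \<and> a e \<noteq> b e"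
begin

lemma ab_set: "e \<in> E \<Longrightarrow> {a e, b e} = e" "e \<in> E \<Longrightarrow> {b e, a e} = e"
  and ab_ne: "e \<in> E \<Longrightarrow> a e \<noteq> b e"
  using ab by (blast, metis insert_commute, blast)

lemma finE: "finite E"
  using fin EV by (meson finite_Pow_iff finite_subset)

lemma ab_in: "e \<in> E \<Longrightarrow> a e \<in> V" "e \<in> E \<Longrightarrow> b e \<in> V"
  using ab EV by blast+

lemma edge_distinct: "{v, w} \<in> E \<Longrightarrow> v \<noteq> w"
  using ab_set(1)[of "{v, w}"] ab_ne[of "{v, w}"] by (auto simp: doubleton_eq_iff)

lemma edge_eq_iff: assumes "e \<in> E" "v \<noteq> w" shows "v \<in> e \<and> w \<in> e \<longleftrightarrow> e = {v, w}"
proof -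
  obtain x y where "e = {x, y}" using ab[OF assms(1)] by blast
  then show ?thesis using assms(2) by auto
qed

text \<open>Every edge accounts for exactly two ordered pairs of adjacent vertices.\<close>

lemma sum_over_edge_pairs:
  fixes g :: "'v \<Rightarrow> 'v \<Rightarrow> 'g::comm_monoid_add"
  shows "(\<Sum>f\<in>E. g (a f) (b f) + g (b f) (a f)) = (\<Sum>k\<in>V. \<Sum>l\<in>V. if {k, l} \<in> E then g k l else 0)"
proof -
  let ?P = "{x \<in> V \<times> V. {fst x, snd x} \<in> E}"
  have "(\<Sum>k\<in>V. \<Sum>l\<in>V. if {k, l} \<in> E then g k l else 0) =
      (\<Sum>x\<in>V \<times> V. if {fst x, snd x} \<in> E then g (fst x) (snd x) else 0)"
    by (simp add: sum.cartesian_product case_prod_unfold)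
  also have "\<dots> = (\<Sum>x\<in>?P. g (fst x) (snd x))"
    by (rule sum.mono_neutral_cong_right) (use fin in auto)
  also have "\<dots> = (\<Sum>f\<in>E. sum (\<lambda>x. g (fst x) (snd x)) {x. x \<in> ?P \<and> {fst x, snd x} = f})"
    by (rule sum.group[symmetric]) (use fin finE in auto)
  also have "\<dots> = (\<Sum>f\<in>E. g (a f) (b f) + g (b f) (a f))"
  proof (rule sum.cong[OF refl])
    fix f assume f: "f \<in> E"
    have "x \<in> ?P \<and> {fst x, snd x} = f \<longleftrightarrow> x = (a f, b f) \<or> x = (b f, a f)" for x
    proof
      assume "x \<in> ?P \<and> {fst x, snd x} = f"
      then have "{fst x, snd x} = {a f, b f}" by (simp add: ab_set f)
      then show "x = (a f, b f) \<or> x = (b f, a f)" by (cases x) (auto simp: doubleton_eq_iff)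
    qed (elim disjE; simp add: ab_set ab_in f)
    then have "{x. x \<in> ?P \<and> {fst x, snd x} = f} = {(a f, b f), (b f, a f)}" by blast
    then show "sum (\<lambda>x. g (fst x) (snd x)) {x. x \<in> ?P \<and> {fst x, snd x} = f} = g (a f) (b f) + g (b f) (a f)"
      using ab_ne[OF f] by simp
  qed
  finally show ?thesis by simp
qed

lemma sum_edge: "e \<in> E \<Longrightarrow> (\<Sum>x\<in>e. g x) = g (a e) + (g (b e) :: 'g::comm_monoid_add)"
  using sum.insert[of "{b e}" "a e" g] ab_ne[of e] by (simp add: ab_set)

abbreviation "adj \<equiv> \<lambda>v w. {v, w} \<in> E"

end

locale simple_graph_cong = simple_graph_edges V E a b + cstar_cong q
  for V :: "'v set" and E a b and q :: "'y free_algebra \<Rightarrow> real"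
begin

definition edge_entry :: "('v \<Rightarrow> 'v \<Rightarrow> 'y free_algebra) \<Rightarrow> 'v set \<Rightarrow> 'v set \<Rightarrow> 'y free_algebra" where
  "edge_entry u e f = u (a e) (a f) * u (b e) (b f) + u (a e) (b f) * u (b e) (a f)"

lemma intertw_edges:
  "intertw V E (incidence (\<lambda>e. e)) u w \<longleftrightarrow> (\<forall>v\<in>V. \<forall>f\<in>E. (\<Sum>e | e \<in> E \<and> v \<in> e. w e f) \<approx> (\<Sum>x\<in>f. u v x))"
  by (rule intertw_incidence[OF fin finE]) (use EV in auto)

text \<open>The incidence sums at \<open>v\<close> and \<open>v'\<close> have at most one edge in
  common, so their product in either order is the edge entry, or 0 for a non-edge. This is the input
  of \<open>two_point_commute\<close>.\<close>

lemma graph_edge_product: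
  assumes u: "magic V u" and w: "magic E w" and inc: "intertw V E (incidence (\<lambda>e. e)) u w"
    and V: "v \<in> V" "v' \<in> V" "v \<noteq> v'" and f: "f \<in> E" "f = {k, l}"
  shows "(if {v, v'} \<in> E then w {v, v'} f else 0) \<approx> u v k * u v' l + u v l * u v' k"
    and "{v, v'} \<notin> E \<Longrightarrow> u v k * u v' l \<approx> 0"
    and "u v k * u v' l \<approx> u v' l * u v k"
proof -
  have kl: "k \<noteq> l" "k \<in> V" "l \<in> V" using f edge_distinct[of k l] EV by auto
  have E1: "(\<Sum>e | e \<in> E \<and> y \<in> e. w e f) \<approx> u y k + u y l" if "y \<in> V" for y
    using inc[unfolded intertw_edges, rule_format, OF that f(1)] kl f(2)
    by simp
  have set: "{e. e \<in> E \<and> v \<in> e \<and> v' \<in> e} = (if {v, v'} \<in> E then {{v, v'}} else {})"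
    "{e. e \<in> E \<and> v' \<in> e \<and> v \<in> e} = (if {v, v'} \<in> E then {{v, v'}} else {})"
    using edge_eq_iff[OF _ V(3)] by auto
  let ?x = "if {v, v'} \<in> E then w {v, v'} f else 0"
  have x: "(u v k + u v l) * (u v' l + u v' k) \<approx> ?x" "(u v' l + u v' k) * (u v k + u v l) \<approx> ?x"
    using incidence_product[OF finE w f(1) E1[OF V(1)] E1[OF V(2)]]
      incidence_product[OF finE w f(1) E1[OF V(2)] E1[OF V(1)]]
    by (simp_all add: set add.commute[of "u v' l"] split: if_splits)
  \<comment> \<open>In the notation of \<open>two_point_commute\<close>, \<open>P\<close> and
    \<open>R\<close> are orthogonal in row \<open>v\<close>, while \<open>P\<close>,
    \<open>S\<close> and \<open>R\<close>, \<open>Q\<close> are orthogonal in columns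
    \<open>k\<close> and \<open>l\<close> because \<open>v\<close> and \<open>v'\<close>
    differ.\<close>
  have z: "u v k * u v k \<approx> u v k" "u v k * u v l \<approx> 0" "u v l * u v k \<approx> 0" "u v k * u v' k \<approx> 0" "u v' k * u v k \<approx> 0"
    "u v l * u v' l \<approx> 0" "u v' l * u v l \<approx> 0"
    using magic_row[OF fin u V(1) kl(2) kl(2)] magic_row[OF fin u V(1) kl(2) kl(3)] magic_row[OF fin u V(1) kl(3) kl(2)]
      magic_col[OF fin u kl(2) V(1) V(2)] magic_col[OF fin u kl(2) V(2) V(1)]
      magic_col[OF fin u kl(3) V(1) V(2)] magic_col[OF fin u kl(3) V(2) V(1)] kl V by auto
  note t = two_point_commute[OF x z]
  show "?x \<approx> u v k * u v' l + u v l * u v' k" by (rule t(1))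
  show "u v k * u v' l \<approx> u v' l * u v k" by (rule t(3))
  show "u v k * u v' l \<approx> 0" if "{v, v'} \<notin> E" using t(2) that by simp
qed

lemma graph_bichon:
  assumes u: "magic V u" and w: "magic E w" and inc: "intertw V E (incidence (\<lambda>e. e)) u w"
  shows "bichon V adj u" and "\<lbrakk>e \<in> E; f \<in> E\<rbrakk> \<Longrightarrow> w e f \<approx> edge_entry u e f"
proof -
  note prod = graph_edge_product[OF u w inc]
  show entry: "w e f \<approx> edge_entry u e f" if ef: "e \<in> E" "f \<in> E" for e f
    using prod(1)[of "a e" "b e" f "a f" "b f"] ab_ne[OF ef(1)] ab_in[OF ef(1)] ef
    by (simp add: edge_entry_def ab_set)
  have null: "adj_null V adj u"
  proof (rule adj_null_of_sum[OF fin u])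
    \<comment> \<open>The product lemma needs distinct vertices; for \<open>v = v'\<close> the claim
      is row orthogonality, since \<open>k\<close> and \<open>l\<close> differ.\<close>
    show "u v k * u v' l \<approx> 0" if "v \<in> V" "v' \<in> V" "k \<in> V" "l \<in> V" "{k, l} \<in> E" "{v, v'} \<notin> E" for v v' k l
      using prod(2)[of v v' "{k, l}" k l] magic_row[OF fin u that(1,3,4)] edge_distinct[of k l] that
      by (cases "v = v'") auto
    fix v v' assume V: "v \<in> V" "v' \<in> V" "{v, v'} \<in> E"
    have "(\<Sum>k\<in>V. \<Sum>l\<in>V. if {k, l} \<in> E then u v k * u v' l else 0) =
        (\<Sum>f\<in>E. u v (a f) * u v' (b f) + u v (b f) * u v' (a f))"
      by (rule sum_over_edge_pairs[symmetric])
    also have "\<dots> \<approx> (\<Sum>f\<in>E. w {v, v'} f)"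
    proof (intro eqv_sum)
      fix f assume f: "f \<in> E"
      show "u v (a f) * u v' (b f) + u v (b f) * u v' (a f) \<approx> w {v, v'} f"
        using eqv_sym[OF prod(1)[of v v' f "a f" "b f"]] edge_distinct[OF V(3)] f V by (simp add: ab_set)
    qed
    also have "\<dots> \<approx> 1" by (rule magicD(2)[OF w V(3)])
    finally show "(\<Sum>k\<in>V. \<Sum>l\<in>V. if {k, l} \<in> E then u v k * u v' l else 0) \<approx> 1" .
  qed
  have "u i k * u j l \<approx> u j l * u i k" if "i \<in> V" "j \<in> V" "{i, j} \<in> E" "{k, l} \<in> E" for i j k l
    using prod(3)[of i j "{k, l}" k l] edge_distinct[of i j] that by blast
  then show "bichon V adj u" unfolding bichon_def using u adj_intertw_of_null[OF fin u null] by blast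
qed

lemma bichon_graph:
  assumes b: "bichon V adj u"
  shows "magic E (edge_entry u)" "intertw V E (incidence (\<lambda>e. e)) u (edge_entry u)"
proof -
  have u: "magic V u" and A: "adj_intertw V adj u"
    and comm0: "\<And>i j k l. \<lbrakk>i \<in> V; j \<in> V; k \<in> V; l \<in> V; {i, j} \<in> E; {k, l} \<in> E\<rbrakk> \<Longrightarrow> u i k * u j l \<approx> u j l * u i k"
    using b unfolding bichon_def by blast+
  have EVd: "v \<in> V" "w \<in> V" if "{v, w} \<in> E" for v w using that EV by auto
  have comm: "u i k * u j l \<approx> u j l * u i k" if "{i, j} \<in> E" "{k, l} \<in> E" for i j k l
    using comm0 EVd that by blast
  note sums = adj_sums[OF fin u null_of_adj_intertw[OF fin u A]]
  have abE: "{a e, b e} \<in> E" "{b e, a e} \<in> E" "a e \<noteq> b e" if "e \<in> E" for e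
    using that by (simp_all add: ab_set ab_ne)
  \<comment> \<open>Exchanging the endpoints of \<open>e\<close> reverses the factors of both
    products, so independence of the orientation is an instance of Bichon's commutation.\<close>
  have entry_swap: "edge_entry u e f \<approx> u v (a f) * u x (b f) + u v (b f) * u x (a f)"
    if e: "e \<in> E" "e = {v, x}" and f: "f \<in> E" for e f v x
  proof -
    from e(2) ab_set(1)[OF e(1)] consider "v = a e" "x = b e" | "v = b e" "x = a e" by (metis doubleton_eq_iff)
    then show ?thesis
    proof cases
      case 2
      have "edge_entry u e f \<approx> u (b e) (b f) * u (a e) (a f) + u (b e) (a f) * u (a e) (b f)"
        unfolding edge_entry_def using abE[OF e(1)] abE[OF f] by (intro eqv_add comm)
      then show ?thesis using 2 by (simp add: add.commute)
    qed (simp add: edge_entry_def)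
  qed
  show "magic E (edge_entry u)"
    unfolding magic_def
  proof (intro conjI ballI)
    fix e assume e: "e \<in> E"
    show "proj (edge_entry u e f)" if f: "f \<in> E" for f
      unfolding edge_entry_def
    proof (rule proj_add)
      let ?P = "u (a e) (a f)" and ?Q = "u (b e) (b f)" and ?R = "u (a e) (b f)" and ?S = "u (b e) (a f)"
      show "proj (?P * ?Q)" "proj (?R * ?S)"
        using abE[OF e] abE[OF f] ab_in[OF e] ab_in[OF f] by (auto intro!: proj_mult magicD(1)[OF u] comm)
      have PR: "?P * ?R \<approx> 0" "?R * ?P \<approx> 0"
        using magic_row[OF fin u ab_in(1)[OF e] ab_in(1)[OF f] ab_in(2)[OF f]]
          magic_row[OF fin u ab_in(1)[OF e] ab_in(2)[OF f] ab_in(1)[OF f]] abE(3)[OF f] by auto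
      have "(?P * ?Q) * (?R * ?S) \<approx> (?Q * ?P) * (?R * ?S)"
        by (intro eqv_mult_right comm abE e f)
      also have "\<dots> = ?Q * (?P * ?R) * ?S" by (simp add: mult.assoc)
      also have "\<dots> \<approx> 0" by (intro eqv_mult_0 PR)
      finally show "(?P * ?Q) * (?R * ?S) \<approx> 0" .
      have "(?R * ?S) * (?P * ?Q) \<approx> (?S * ?R) * (?P * ?Q)"
        by (intro eqv_mult_right comm abE e f)
      also have "\<dots> = ?S * (?R * ?P) * ?Q" by (simp add: mult.assoc)
      also have "\<dots> \<approx> 0" by (intro eqv_mult_0 PR)
      finally show "(?R * ?S) * (?P * ?Q) \<approx> 0" .
    qed
    have "(\<Sum>f\<in>E. edge_entry u e f) = (\<Sum>k\<in>V. \<Sum>l\<in>V. if {k, l} \<in> E then u (a e) k * u (b e) l else 0)"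
      unfolding edge_entry_def by (rule sum_over_edge_pairs)
    also have "\<dots> \<approx> 1" by (intro sums(1) ab_in abE e)
    finally show "(\<Sum>f\<in>E. edge_entry u e f) \<approx> 1" .
    have "(\<Sum>f\<in>E. edge_entry u f e) \<approx> (\<Sum>f\<in>E. u (a f) (a e) * u (b f) (b e) + u (b f) (a e) * u (a f) (b e))"
      unfolding edge_entry_def using abE abE[OF e] by (intro eqv_sum eqv_add eqv_refl comm) auto
    also have "\<dots> = (\<Sum>v\<in>V. \<Sum>w\<in>V. if {v, w} \<in> E then u v (a e) * u w (b e) else 0)"
      by (rule sum_over_edge_pairs)
    also have "\<dots> \<approx> 1" by (intro sums(2) ab_in abE e)
    finally show "(\<Sum>f\<in>E. edge_entry u f e) \<approx> 1" .
  qed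
  show "intertw V E (incidence (\<lambda>e. e)) u (edge_entry u)"
    unfolding intertw_edges
  proof (intro ballI)
    fix v f assume v: "v \<in> V" and f: "f \<in> E"
    have "(\<Sum>e | e \<in> E \<and> v \<in> e. edge_entry u e f) = (\<Sum>x | x \<in> V \<and> {v, x} \<in> E. edge_entry u {v, x} f)"
    \<comment> \<open>Edges at \<open>v\<close> correspond to neighbours of \<open>v\<close>, each
      edge being sent to its other endpoint.\<close>
    proof (rule sum.reindex_bij_witness[of _ "\<lambda>x. {v, x}" "\<lambda>e. if v = a e then b e else a e"])
      fix e assume "e \<in> {e. e \<in> E \<and> v \<in> e}"
      then have e: "e \<in> E" "v \<in> e" by auto
      have "v = a e \<or> v = b e" using e ab_set(1)[OF e(1)] by blast
      then show "{v, if v = a e then b e else a e} = e" using e(1) ab_ne[OF e(1)] by (elim disjE) (simp_all add: ab_set)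
      then show "(if v = a e then b e else a e) \<in> {x. x \<in> V \<and> {v, x} \<in> E}" "edge_entry u {v, if v = a e then b e else a e} f = edge_entry u e f"
        using e ab_in[OF e(1)] by auto
    next
      fix x assume "x \<in> {x. x \<in> V \<and> {v, x} \<in> E}"
      then have x: "{v, x} \<in> E" by simp
      then show "(if v = a {v, x} then b {v, x} else a {v, x}) = x"
        using ab_set(1)[OF x] ab_ne[OF x] unfolding doubleton_eq_iff by metis
      show "{v, x} \<in> {e. e \<in> E \<and> v \<in> e}" using x by simp
    qed
    also have "\<dots> \<approx> (\<Sum>x | x \<in> V \<and> {v, x} \<in> E. u v (a f) * u x (b f) + u v (b f) * u x (a f))"
      using f by (intro eqv_sum entry_swap) auto
    also have "\<dots> = (\<Sum>x\<in>V. if {v, x} \<in> E then u v (a f) * u x (b f) else 0) + (\<Sum>x\<in>V. if {v, x} \<in> E then u v (b f) * u x (a f) else 0)"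
      unfolding sum.distrib by (intro arg_cong2[of _ _ _ _ "(+)"] sum.mono_neutral_cong_left) (use fin in auto)
    also have "\<dots> \<approx> u v (a f) + u v (b f)"
      by (intro eqv_add sums(3) v ab_in abE f)
    also have "\<dots> = (\<Sum>x\<in>f. u v x)" by (rule sum_edge[OF f, symmetric])
    finally show "(\<Sum>e | e \<in> E \<and> v \<in> e. edge_entry u e f) \<approx> (\<Sum>x\<in>f. u v x)" .
  qed
qed

end

section \<open>Multigraphs\<close>

definition esum :: "'e set \<Rightarrow> ('e \<Rightarrow> 'v) \<Rightarrow> ('e \<Rightarrow> 'e \<Rightarrow> 'y free_algebra) \<Rightarrow> 'v \<Rightarrow> 'e \<Rightarrow> 'y free_algebra" where
  "esum E t w v e = (\<Sum>f | f \<in> E \<and> t f = v. w e f)"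

context cstar_cong
begin

lemma magic_orth:
  assumes "finite I" "magic I u" "i \<in> I" "j \<in> I" "k \<in> I" "j \<noteq> k"
  shows "u i j * u i k \<approx> 0" "u j i * u k i \<approx> 0"
  using magic_row[OF assms(1-5)] magic_col[OF assms(1-5)] assms(6) by simp_all

lemma sum_by_endpoint:
  assumes "finite E" "finite V" "\<And>f. f \<in> E \<Longrightarrow> t f \<in> V"
  shows "(\<Sum>v\<in>V. \<Sum>f | f \<in> E \<and> t f = v. g f) = (\<Sum>f\<in>E. (g f :: 'y free_algebra))"
  by (rule sum.group) (use assms in auto)

lemma esum_proj:
  assumes "finite E" "magic E w" "e \<in> E" shows "proj (esum E t w v e)"
  unfolding esum_def
  using assms magicD(1)[OF assms(2)] by (intro sum_orthogonal_projections magic_orth(1)[OF assms]) auto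

text \<open>Row sums \<open>S\<^sub>e\<^sub>f\<close> over the block of \<open>f\<close> that only depend on the block of \<open>e\<close> dominate the column
  sums \<open>L\<^sub>e\<^sub>f\<close> over the block of \<open>e\<close>. Both matrices have the same total sum, so the projections
  \<open>S\<^sub>e\<^sub>f - L\<^sub>e\<^sub>f\<close> vanish.\<close>

lemma esum_column:
  assumes fin: "finite E" and w: "magic E w"
    and const: "\<And>e e' f. \<lbrakk>e \<in> E; e' \<in> E; f \<in> E; t e = t e'\<rbrakk> \<Longrightarrow> esum E t w (t f) e \<approx> esum E t w (t f) e'"
    and ef: "e \<in> E" "f \<in> E"
  shows "(\<Sum>e' | e' \<in> E \<and> t e' = t e. w e' f) \<approx> esum E t w (t f) e"
proof -
  define S where "S e f = esum E t w (t f) e" for e f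
  define L where "L e f = (\<Sum>e' | e' \<in> E \<and> t e' = t e. w e' f)" for e f
  have SL: "S e f * L e f \<approx> L e f" "L e f * S e f \<approx> L e f" if e: "e \<in> E" and f: "f \<in> E" for e f
  proof -
    have S: "S e f * w e' f \<approx> w e' f" "w e' f * S e f \<approx> w e' f" if e': "e' \<in> E" "t e' = t e" for e'
    proof -
      have c: "S e f \<approx> esum E t w (t f) e'" unfolding S_def using const[OF e e'(1) f] e' by simp
      have "esum E t w (t f) e' * w e' f \<approx> (\<Sum>f' | f' \<in> E \<and> t f' = t f. if f' = f then w e' f' else 0)"
        unfolding esum_def sum_distrib_right using f e' by (intro eqv_sum magic_row[OF fin w]) auto
      also have "\<dots> = w e' f" using fin f by (simp add: sum.delta)
      finally show "S e f * w e' f \<approx> w e' f" using eqv_trans[OF eqv_mult_right[OF c]] by blast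
      have "w e' f * esum E t w (t f) e' \<approx> (\<Sum>f' | f' \<in> E \<and> t f' = t f. if f = f' then w e' f else 0)"
        unfolding esum_def sum_distrib_left using f e' by (intro eqv_sum magic_row[OF fin w]) auto
      also have "\<dots> = w e' f" using fin f by (simp add: sum.delta')
      finally show "w e' f * S e f \<approx> w e' f" using eqv_trans[OF eqv_mult_left[OF c]] by blast
    qed
    show "S e f * L e f \<approx> L e f" unfolding L_def sum_distrib_left by (intro eqv_sum S) auto
    show "L e f * S e f \<approx> L e f" unfolding L_def sum_distrib_right by (intro eqv_sum S) auto
  qed
  have "proj (L e f)" if "f \<in> E" for e f
    unfolding L_def using that magicD(1)[OF w] fin
    by (intro sum_orthogonal_projections magic_orth(2)[OF fin w that]) auto
  then have D: "proj (S e f - L e f)" if "e \<in> E" "f \<in> E" for e f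
    using that SL[OF that] esum_proj[OF fin w] by (intro proj_diff) (auto simp: S_def)
  \<comment> \<open>Both totals reduce to the number of ordered pairs of edges with equal endpoint:
    for \<open>S\<close> by the column sums of \<open>w\<close>, for \<open>L\<close> by the row
    sums.\<close>
  have "(\<Sum>e\<in>E. \<Sum>f\<in>E. S e f) = (\<Sum>f\<in>E. \<Sum>f' | f' \<in> E \<and> t f' = t f. \<Sum>e\<in>E. w e f')"
    unfolding S_def esum_def by (subst sum.swap) (intro sum.cong refl sum.swap)
  also have "\<dots> \<approx> (\<Sum>f\<in>E. \<Sum>f' | f' \<in> E \<and> t f' = t f. 1)"
    by (intro eqv_sum magicD(3)[OF w]) auto
  finally have sS: "(\<Sum>e\<in>E. \<Sum>f\<in>E. S e f) \<approx> (\<Sum>f\<in>E. \<Sum>f' | f' \<in> E \<and> t f' = t f. 1)" .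
  have "(\<Sum>e\<in>E. \<Sum>f\<in>E. L e f) = (\<Sum>e\<in>E. \<Sum>e' | e' \<in> E \<and> t e' = t e. \<Sum>f\<in>E. w e' f)"
    unfolding L_def by (intro sum.cong refl sum.swap)
  also have "\<dots> \<approx> (\<Sum>e\<in>E. \<Sum>e' | e' \<in> E \<and> t e' = t e. 1)"
    by (intro eqv_sum magicD(2)[OF w]) auto
  finally have sL: "(\<Sum>e\<in>E. \<Sum>f\<in>E. L e f) \<approx> (\<Sum>f\<in>E. \<Sum>f' | f' \<in> E \<and> t f' = t f. 1)" .
  have "(\<Sum>x\<in>E \<times> E. S (fst x) (snd x) - L (fst x) (snd x)) = (\<Sum>e\<in>E. \<Sum>f\<in>E. S e f) - (\<Sum>e\<in>E. \<Sum>f\<in>E. L e f)"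
    by (simp add: sum_subtractf sum.cartesian_product case_prod_unfold)
  also have "\<dots> \<approx> 0" using eqv_diff[OF sS sL] by simp
  finally have "(\<Sum>x\<in>E \<times> E. S (fst x) (snd x) - L (fst x) (snd x)) \<approx> 0" .
  then have "S (fst (e, f)) (snd (e, f)) - L (fst (e, f)) (snd (e, f)) \<approx> 0"
    by (rule sum_projections_zero[rotated 2]) (use fin ef D in auto)
  then have "S e f \<approx> L e f" by (simp add: eqv_def)
  then show ?thesis unfolding S_def L_def by (rule eqv_sym)
qed

text \<open>If the blocks in \<open>I\<close> only map to blocks in \<open>I\<close>, then counting shows that no other block maps to
  them either.\<close>

lemma esum_outside:
  assumes fin: "finite E" and w: "magic E w"
    and col: "\<And>e f. \<lbrakk>e \<in> E; f \<in> E\<rbrakk> \<Longrightarrow> (\<Sum>e' | e' \<in> E \<and> t e' = t e. w e' f) \<approx> esum E t w (t f) e"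
    and I: "I \<subseteq> t ` E" and out: "\<And>e f. \<lbrakk>e \<in> E; f \<in> E; t e \<in> I; t f \<notin> I\<rbrakk> \<Longrightarrow> w e f \<approx> 0"
    and e: "e \<in> E" "t e \<notin> I" and x: "x \<in> I"
  shows "esum E t w x e \<approx> 0"
proof -
  obtain c where c: "\<And>v. v \<in> t ` E \<Longrightarrow> c v \<in> E \<and> t (c v) = v"
    by (metis f_inv_into_f inv_into_into)
  have c1: "c v \<in> E" "t (c v) = v" if "v \<in> t ` E" for v using c[OF that] by auto
  \<comment> \<open>The matrix on blocks, with one representative edge for each row. By the column
    property its entries are at the same time column sums of \<open>w\<close>.\<close>
  define M where "M v y = esum E t w y (c v)" for v y
  have finE: "finite (t ` E)" "finite I" using fin I finite_subset by auto
  have Mcol: "M v y \<approx> (\<Sum>e' | e' \<in> E \<and> t e' = v. w e' (c y))" if v: "v \<in> t ` E" and y: "y \<in> t ` E" for v y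
    using eqv_sym[OF col[OF c1(1)[OF v] c1(1)[OF y]]] c1(2)[OF v] c1(2)[OF y] by (simp add: M_def)
  have colsum: "(\<Sum>v\<in>t ` E. M v y) \<approx> 1" if y: "y \<in> t ` E" for y
  proof -
    have "(\<Sum>v\<in>t ` E. M v y) \<approx> (\<Sum>v\<in>t ` E. \<Sum>e' | e' \<in> E \<and> t e' = v. w e' (c y))"
      by (intro eqv_sum Mcol y)
    also have "\<dots> = (\<Sum>e'\<in>E. w e' (c y))" by (rule sum_by_endpoint[OF fin finE(1)]) auto
    also have "\<dots> \<approx> 1" by (rule magicD(3)[OF w c1(1)[OF y]])
    finally show ?thesis .
  qed
  have rowsum: "(\<Sum>y\<in>I. M v y) \<approx> 1" if v: "v \<in> I" for v
  proof -
    have vE: "v \<in> t ` E" using v I by auto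
    have "M v y \<approx> 0" if y: "y \<in> t ` E - I" for y
      unfolding M_def esum_def using y v c1[OF vE] by (intro eqv_sum_zero out) auto
    then have "(\<Sum>y\<in>I. M v y) + (\<Sum>y\<in>t ` E - I. M v y) \<approx> (\<Sum>y\<in>I. M v y) + 0"
      by (intro eqv_add eqv_refl eqv_sum_zero)
    moreover have "(\<Sum>y\<in>I. M v y) + (\<Sum>y\<in>t ` E - I. M v y) = (\<Sum>f\<in>E. w (c v) f)"
    proof -
      have "(\<Sum>y\<in>t ` E. M v y) = (\<Sum>f\<in>E. w (c v) f)"
        unfolding M_def esum_def by (rule sum_by_endpoint[OF fin finE(1)]) auto
      then show ?thesis using sum.subset_diff[OF I finE(1), of "M v"] by (simp add: add.commute)
    qed
    ultimately have "(\<Sum>f\<in>E. w (c v) f) \<approx> (\<Sum>y\<in>I. M v y)" by simp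
    then show ?thesis using magicD(2)[OF w c1(1)[OF vE]] eqv_trans eqv_sym by blast
  qed
  \<comment> \<open>The columns in \<open>I\<close> have total \<open>card I\<close>, which the rows
    in \<open>I\<close> already exhaust; the other entries of these columns are projections with
    null sum.\<close>
  have "(\<Sum>y\<in>I. \<Sum>v\<in>t ` E. M v y) \<approx> (\<Sum>y\<in>I. 1)" using I by (intro eqv_sum colsum) auto
  moreover have "(\<Sum>y\<in>I. \<Sum>v\<in>t ` E. M v y) = (\<Sum>y\<in>I. \<Sum>v\<in>t ` E - I. M v y) + (\<Sum>v\<in>I. \<Sum>y\<in>I. M v y)"
    unfolding sum.subset_diff[OF I finE(1)] sum.distrib by (subst (2) sum.swap) simp
  moreover have "(\<Sum>v\<in>I. \<Sum>y\<in>I. M v y) \<approx> (\<Sum>y\<in>I. 1)" by (intro eqv_sum rowsum)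
  ultimately have "((\<Sum>y\<in>I. \<Sum>v\<in>t ` E - I. M v y) + (\<Sum>v\<in>I. \<Sum>y\<in>I. M v y)) - (\<Sum>v\<in>I. \<Sum>y\<in>I. M v y) \<approx> (\<Sum>y\<in>I. 1) - (\<Sum>y\<in>I. 1)"
    by (intro eqv_diff) auto
  then have "(\<Sum>z\<in>I \<times> (t ` E - I). M (snd z) (fst z)) \<approx> 0"
    by (simp add: sum.cartesian_product case_prod_unfold)
  then have "M (snd (x, t e)) (fst (x, t e)) \<approx> 0"
    by (rule sum_projections_zero[rotated 2]) (use finE e x c1 in \<open>auto simp: M_def intro!: esum_proj[OF fin w]\<close>)
  then have M0: "M (t e) x \<approx> 0" by simp
  obtain f where f: "f \<in> E" "t f = x" using x I by auto
  have te: "t e \<in> t ` E" using e by simp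
  have "esum E t w x e \<approx> (\<Sum>e' | e' \<in> E \<and> t e' = t e. w e' f)"
    using eqv_sym[OF col[OF e(1) f(1)]] f(2) by simp
  also have "\<dots> \<approx> M (t e) x"
    using col[OF c1(1)[OF te] f(1)] c1(2)[OF te] f(2) by (simp add: M_def)
  also note M0
  finally show ?thesis .
qed

end

text \<open>A vertex that is both a start and an end uses a starting edge; the relations at inner
  vertices make the other choice congruent. Absence of isolated vertices ensures that the chosen
  edge exists.\<close>

definition vertex_entry :: "'e set \<Rightarrow> ('e \<Rightarrow> 'v) \<Rightarrow> ('e \<Rightarrow> 'v) \<Rightarrow> ('e \<Rightarrow> 'e \<Rightarrow> 'y free_algebra) \<Rightarrow> 'v \<Rightarrow> 'v \<Rightarrow> 'y free_algebra" where
  "vertex_entry E s r w v x =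
    (if v \<in> s ` E then esum E s w x (SOME e. e \<in> E \<and> s e = v) else esum E r w x (SOME e. e \<in> E \<and> r e = v))"

context cstar_cong
begin

definition goswami_hossain :: "'v set \<Rightarrow> 'e set \<Rightarrow> ('e \<Rightarrow> 'v) \<Rightarrow> ('e \<Rightarrow> 'v) \<Rightarrow> ('e \<Rightarrow> 'e \<Rightarrow> 'y free_algebra) \<Rightarrow> bool" where
  "goswami_hossain V E s r w \<longleftrightarrow> magic E w \<and>
    (\<forall>v\<in>V. \<forall>e\<in>E. \<forall>e'\<in>E. s e = s e' \<longrightarrow> esum E s w v e \<approx> esum E s w v e') \<and>
    (\<forall>v\<in>V. \<forall>e\<in>E. \<forall>e'\<in>E. r e = r e' \<longrightarrow> esum E r w v e \<approx> esum E r w v e') \<and>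
    (\<forall>e\<in>E. \<forall>f\<in>E. inner_vertex E s r (s e) \<and> is_source E r (s f) \<longrightarrow> w e f \<approx> 0) \<and>
    (\<forall>e\<in>E. \<forall>f\<in>E. inner_vertex E s r (r e) \<and> is_sink E s (r f) \<longrightarrow> w e f \<approx> 0) \<and>
    (\<forall>v\<in>V. \<forall>e\<in>E. \<forall>e'\<in>E. inner_vertex E s r v \<and> s e = r e' \<and> inner_vertex E s r (s e) \<longrightarrow>
      esum E s w v e \<approx> esum E r w v e')"

end

lemma is_source_iff: "is_source E r v \<longleftrightarrow> v \<notin> r ` E"
  by (auto simp: is_source_def)

lemma is_sink_iff: "is_sink E s v \<longleftrightarrow> v \<notin> s ` E"
  by (auto simp: is_sink_def)

lemma inner_vertex_iff: "inner_vertex E s r v \<longleftrightarrow> v \<in> s ` E \<inter> r ` E"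
  by (auto simp: inner_vertex_def is_source_iff is_sink_iff)

lemmas vertex_kind_iffs = is_source_iff is_sink_iff inner_vertex_iff

locale multigraph_cong = cstar_cong q
  for q :: "'y free_algebra \<Rightarrow> real" +
  fixes V :: "'v set" and E :: "'e set" and s r :: "'e \<Rightarrow> 'v"
  assumes fin: "finite V" "finite E" and sV: "e \<in> E \<Longrightarrow> s e \<in> V" and rV: "e \<in> E \<Longrightarrow> r e \<in> V"
    and noniso: "v \<in> V \<Longrightarrow> v \<in> s ` E \<or> v \<in> r ` E"
begin

lemma pick:
  assumes "v \<in> t ` E" shows "(SOME e. e \<in> E \<and> t e = v) \<in> E" "t (SOME e. e \<in> E \<and> t e = v) = v"
  using someI_ex[of "\<lambda>e. e \<in> E \<and> t e = v"] assms by auto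

lemma esum_empty: "x \<notin> t ` E \<Longrightarrow> esum E t w x e = 0"
  unfolding esum_def by (rule sum.neutral) auto

text \<open>By \<open>endpoint_row\<close> every row sum is an entry of \<open>u\<close> that
  depends on the endpoint of the edge alone, which contains all the comparison relations.\<close>

lemma endpoint_goswami_hossain:
  assumes u: "magic V u" and w: "magic E w" and eps: "endpoint V E s u w" and epr: "endpoint V E r u w"
  shows "goswami_hossain V E s r w"
    and "\<lbrakk>v \<in> V; x \<in> V\<rbrakk> \<Longrightarrow> vertex_entry E s r w v x \<approx> u v x"
proof -
  have es: "esum E s w x e \<approx> u (s e) x" and er: "esum E r w x e \<approx> u (r e) x" if "e \<in> E" "x \<in> V" for e x
    unfolding esum_def
    using endpoint_row[OF fin u w sV eps that] endpoint_row[OF fin u w rV epr that] by auto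
  show "vertex_entry E s r w v x \<approx> u v x" if "v \<in> V" "x \<in> V" for v x
    using es[OF pick(1)[of v s] that(2)] pick(2)[of v s] er[OF pick(1)[of v r] that(2)] pick(2)[of v r] noniso[OF that(1)]
    by (auto simp: vertex_entry_def)
  have absorb: "u (t e) (t f) * w e f \<approx> w e f" if "endpoint V E t u w" "t e \<in> V" "e \<in> E" "f \<in> E" for t e f
  proof -
    have "(\<Sum>e' | e' \<in> E \<and> t e \<in> {t e'}. w e' f) \<approx> u (t e) (t f)"
      using that by (simp add: endpoint_def eq_commute[of "t e"])
    then show ?thesis using incidence_absorb(1)[OF fin(2) w _ that(3,4), of "t e" "\<lambda>e. {t e}"] by simp
  qed
  show "goswami_hossain V E s r w"
    unfolding goswami_hossain_def vertex_kind_iffs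
  proof (intro conjI ballI impI w)
    fix v e e' assume v: "v \<in> V" and e: "e \<in> E" "e' \<in> E"
    show "esum E s w v e \<approx> esum E s w v e'" if "s e = s e'"
      using eqv_trans[OF es[OF e(1) v] eqv_sym[OF es[OF e(2) v, folded that]]] .
    show "esum E r w v e \<approx> esum E r w v e'" if "r e = r e'"
      using eqv_trans[OF er[OF e(1) v] eqv_sym[OF er[OF e(2) v, folded that]]] .
    show "esum E s w v e \<approx> esum E r w v e'" if "v \<in> s ` E \<inter> r ` E \<and> s e = r e' \<and> s e \<in> s ` E \<inter> r ` E"
    proof -
      have "s e = r e'" using that by blast
      then show ?thesis using eqv_trans[OF es[OF e(1) v]] eqv_sym[OF er[OF e(2) v]] by simp
    qed
  next
    fix e f assume e: "e \<in> E" and f: "f \<in> E" and c: "s e \<in> s ` E \<inter> r ` E \<and> s f \<notin> r ` E"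
    \<comment> \<open>The inner vertex \<open>s e\<close> is also the range of \<open>g\<close>, so
      \<open>u (s e) (s f)\<close> is a row sum over the edges ending in the source
      \<open>s f\<close>, of which there are none.\<close>
    then obtain g where g: "g \<in> E" "s e = r g" by auto
    have "u (s e) (s f) \<approx> 0" using eqv_sym[OF er[OF g(1) sV[OF f]]] c g(2) by (simp add: esum_empty)
    then show "w e f \<approx> 0" using eqv_sym[OF absorb[OF eps sV[OF e] e f]] eqv_mult_0(2) eqv_trans by blast
  next
    fix e f assume e: "e \<in> E" and f: "f \<in> E" and c: "r e \<in> s ` E \<inter> r ` E \<and> r f \<notin> s ` E"
    then obtain g where g: "g \<in> E" "r e = s g" by auto
    have "u (r e) (r f) \<approx> 0" using eqv_sym[OF es[OF g(1) rV[OF f]]] c g(2) by (simp add: esum_empty)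
    then show "w e f \<approx> 0" using eqv_sym[OF absorb[OF epr rV[OF e] e f]] eqv_mult_0(2) eqv_trans by blast
  qed
qed

text \<open>The comparison relations give column sums through \<open>esum_column\<close>. The
  vanishing relations make the block matrix triangular with respect to inner vertices, and
  \<open>esum_outside\<close> makes it diagonal; the mixed relation makes the two definitions of
  \<open>u\<close> at inner vertices agree.\<close>

lemma goswami_hossain_endpoint:
  assumes gh: "goswami_hossain V E s r w"
  defines "u \<equiv> vertex_entry E s r w"
  shows "magic V u" "endpoint V E s u w" "endpoint V E r u w"
proof -
  let ?I = "s ` E \<inter> r ` E"
  note gh' = gh[unfolded goswami_hossain_def vertex_kind_iffs]
  have w: "magic E w" by (rule gh'[THEN conjunct1])
  note gh2 = gh'[THEN conjunct2, THEN conjunct1, rule_format]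
    and gh3 = gh'[THEN conjunct2, THEN conjunct2, THEN conjunct1, rule_format]
    and gh4 = gh'[THEN conjunct2, THEN conjunct2, THEN conjunct2, THEN conjunct1, rule_format]
    and gh5 = gh'[THEN conjunct2, THEN conjunct2, THEN conjunct2, THEN conjunct2, THEN conjunct1, rule_format]
    and gh6 = gh'[THEN conjunct2, THEN conjunct2, THEN conjunct2, THEN conjunct2, THEN conjunct2, rule_format]
  have cs: "esum E s w x e \<approx> esum E s w x e'" if "x \<in> V" "e \<in> E" "e' \<in> E" "s e = s e'" for x e e'
    by (rule gh2[OF that])
  have cr: "esum E r w x e \<approx> esum E r w x e'" if "x \<in> V" "e \<in> E" "e' \<in> E" "r e = r e'" for x e e'
    by (rule gh3[OF that])
  \<comment> \<open>The edge \<open>f\<close> leaves \<open>s f\<close>, so \<open>s f\<close> fails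
    to be inner exactly when it is a source; for ranges and sinks likewise.\<close>
  have z1: "w e f \<approx> 0" if "e \<in> E" "f \<in> E" "s e \<in> ?I" "s f \<notin> ?I" for e f
    by (rule gh4[OF that(1,2)]) (use that in auto)
  have z2: "w e f \<approx> 0" if "e \<in> E" "f \<in> E" "r e \<in> ?I" "r f \<notin> ?I" for e f
    by (rule gh5[OF that(1,2)]) (use that in auto)
  have sr: "esum E s w x e \<approx> esum E r w x e'" if x: "x \<in> ?I" and e: "e \<in> E" "e' \<in> E" "s e = r e'" for x e e'
  proof (rule gh6[OF _ e(1,2)])
    show "x \<in> V" using x sV by auto
    show "x \<in> ?I \<and> s e = r e' \<and> s e \<in> ?I" using x imageI[OF e(1), of s] imageI[OF e(2), of r] e(3) by auto
  qed
  have cols: "(\<Sum>e' | e' \<in> E \<and> s e' = s e. w e' f) \<approx> esum E s w (s f) e" if "e \<in> E" "f \<in> E" for e f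
    by (rule esum_column[OF fin(2) w _ that]) (use cs sV in auto)
  have colr: "(\<Sum>e' | e' \<in> E \<and> r e' = r e. w e' f) \<approx> esum E r w (r f) e" if "e \<in> E" "f \<in> E" for e f
    by (rule esum_column[OF fin(2) w _ that]) (use cr rV in auto)
  have outs: "esum E s w x e \<approx> 0" if "e \<in> E" "s e \<notin> ?I" "x \<in> ?I" for e x
    by (rule esum_outside[OF fin(2) w cols Int_lower1 z1 that])
  have outr: "esum E r w x e \<approx> 0" if "e \<in> E" "r e \<notin> ?I" "x \<in> ?I" for e x
    by (rule esum_outside[OF fin(2) w colr Int_lower2 z2 that])
  have us: "u (s e) x \<approx> esum E s w x e" if "e \<in> E" "x \<in> V" for e x
    using cs[OF that(2) pick(1)[of "s e" s] that(1)] pick(2)[of "s e" s] that by (simp add: u_def vertex_entry_def)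
  \<comment> \<open>The mixed relation covers inner \<open>x\<close> only; for all other
    \<open>x\<close> both sides vanish because \<open>s e = r e'\<close> is inner.\<close>
  have srx: "esum E s w x e \<approx> esum E r w x e'" if e: "e \<in> E" "e' \<in> E" "s e = r e'" and x: "x \<in> V" for e e' x
  proof (cases "x \<in> ?I")
    case True
    then show ?thesis using sr e by blast
  next
    case False
    have sI: "s e \<in> ?I" "r e' \<in> ?I" using imageI[OF e(1), of s] imageI[OF e(2), of r] e(3) by auto
    have "esum E s w x e \<approx> 0" unfolding esum_def using z1[OF e(1) _ sI(1)] False by (intro eqv_sum_zero) auto
    moreover have "esum E r w x e' \<approx> 0" unfolding esum_def using z2[OF e(2) _ sI(2)] False by (intro eqv_sum_zero) auto
    ultimately show ?thesis using eqv_trans eqv_sym by blast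
  qed
  have ur: "u (r e) x \<approx> esum E r w x e" if e: "e \<in> E" and x: "x \<in> V" for e x
  proof (cases "r e \<in> s ` E")
    case True
    then obtain e' where e': "e' \<in> E" "s e' = r e" by (metis imageE)
    then show ?thesis using eqv_trans[OF us[OF e'(1) x] srx[OF e'(1) e e'(2) x]] by simp
  next
    case False
    then show ?thesis using cr[OF x pick(1)[of "r e" r] e] pick(2)[of "r e" r] e by (simp add: u_def vertex_entry_def)
  qed
  show eps: "endpoint V E s u w"
    unfolding endpoint_def
  proof (intro ballI)
    fix v f assume v: "v \<in> V" and f: "f \<in> E"
    show "(\<Sum>e | e \<in> E \<and> s e = v. w e f) \<approx> u v (s f)"
    proof (cases "v \<in> s ` E")
      case True
      then obtain e where e: "e \<in> E" "v = s e" by auto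
      show ?thesis using eqv_trans[OF cols[OF e(1) f] eqv_sym[OF us[OF e(1) sV[OF f]]]] e(2) by simp
    next
      case False
      then obtain e where e: "e \<in> E" "v = r e" using noniso[OF v] by auto
      \<comment> \<open>No edge starts in \<open>v = r e\<close>, so \<open>u v (s f)\<close> has to
        vanish. Either no edge ends in \<open>s f\<close>, or \<open>s f\<close> is inner whereas
        \<open>v\<close> is not, and \<open>outr\<close> applies.\<close>
      have "esum E r w (s f) e \<approx> 0"
      proof (cases "s f \<in> r ` E")
        case True
        then show ?thesis using outr[OF e(1)] False e(2) f by blast
      qed (simp add: esum_empty)
      then have "u v (s f) \<approx> 0" using eqv_trans[OF ur[OF e(1) sV[OF f]]] e(2) by blast
      moreover have "(\<Sum>e | e \<in> E \<and> s e = v. w e f) = 0" by (rule sum.neutral) (use False in auto)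
      ultimately show ?thesis by (simp add: eqv_sym)
    qed
  qed
  show epr: "endpoint V E r u w"
    unfolding endpoint_def
  proof (intro ballI)
    fix v f assume v: "v \<in> V" and f: "f \<in> E"
    show "(\<Sum>e | e \<in> E \<and> r e = v. w e f) \<approx> u v (r f)"
    proof (cases "v \<in> r ` E")
      case True
      then obtain e where e: "e \<in> E" "v = r e" by auto
      show ?thesis using eqv_trans[OF colr[OF e(1) f] eqv_sym[OF ur[OF e(1) rV[OF f]]]] e(2) by simp
    next
      case False
      then obtain e where e: "e \<in> E" "v = s e" using noniso[OF v] by auto
      have "esum E s w (r f) e \<approx> 0"
      proof (cases "r f \<in> s ` E")
        case True
        then show ?thesis using outs[OF e(1)] False e(2) f by blast
      qed (simp add: esum_empty)
      then have "u v (r f) \<approx> 0" using eqv_trans[OF us[OF e(1) rV[OF f]]] e(2) by blast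
      moreover have "(\<Sum>e | e \<in> E \<and> r e = v. w e f) = 0" by (rule sum.neutral) (use False in auto)
      ultimately show ?thesis by (simp add: eqv_sym)
    qed
  qed
  \<comment> \<open>Grouping a row or column of \<open>w\<close> by endpoints gives one of
    \<open>u\<close>. Every vertex is the start or end of some edge, so all rows and columns of
    \<open>u\<close> are reached.\<close>
  have col: "(\<Sum>v\<in>V. u v (t f)) \<approx> 1" if "endpoint V E t u w" "\<And>e. e \<in> E \<Longrightarrow> t e \<in> V" "f \<in> E" for t f
  proof -
    have "(\<Sum>v\<in>V. u v (t f)) \<approx> (\<Sum>v\<in>V. \<Sum>e | e \<in> E \<and> t e = v. w e f)"
      using that unfolding endpoint_def by (intro eqv_sum) (blast intro: eqv_sym)
    also have "\<dots> = (\<Sum>e\<in>E. w e f)" by (rule sum_by_endpoint[OF fin(2,1) that(2)])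
    also have "\<dots> \<approx> 1" by (rule magicD(3)[OF w that(3)])
    finally show ?thesis .
  qed
  have row: "(\<Sum>x\<in>V. u (t e) x) \<approx> 1"
    if "\<And>x. x \<in> V \<Longrightarrow> u (t e) x \<approx> esum E t w x e" "\<And>e. e \<in> E \<Longrightarrow> t e \<in> V" "e \<in> E" for t e
  proof -
    have "(\<Sum>x\<in>V. u (t e) x) \<approx> (\<Sum>x\<in>V. esum E t w x e)" by (intro eqv_sum that)
    also have "\<dots> = (\<Sum>f\<in>E. w e f)" unfolding esum_def by (rule sum_by_endpoint[OF fin(2,1) that(2)])
    also have "\<dots> \<approx> 1" by (rule magicD(2)[OF w that(3)])
    finally show ?thesis .
  qed
  show "magic V u"
    unfolding magic_def
  proof (intro conjI ballI)
    fix v assume v: "v \<in> V"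
    then consider e where "e \<in> E" "v = s e" | e where "e \<in> E" "v = r e" using noniso[OF v] by blast
    note v_cases = this
    show "proj (u v x)" if x: "x \<in> V" for x
      using v_cases
    proof cases
      case 1
      then show ?thesis using proj_cong[OF esum_proj[OF fin(2) w] eqv_sym[OF us]] x by blast
    next
      case 2
      then show ?thesis using proj_cong[OF esum_proj[OF fin(2) w] eqv_sym[OF ur]] x by blast
    qed
    show "(\<Sum>x\<in>V. u v x) \<approx> 1"
      using v_cases by cases (use row[of s] row[of r] us ur sV rV in auto)
    show "(\<Sum>x\<in>V. u x v) \<approx> 1"
      using v_cases by cases (use col[OF eps sV] col[OF epr rV] in auto)
  qed
qed

end

section \<open>The presentations of Bichon and of Goswami and Hossain\<close>

definition bic_rels :: "'v set \<Rightarrow> ('v \<Rightarrow> 'v \<Rightarrow> bool) \<Rightarrow> ('v \<times> 'v) free_algebra set" where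
  "bic_rels V adj = magic_unitary_relations V pair_gen \<union>
     intertwiner_relations V V (adjacency adj) pair_gen pair_gen \<union>
     {pair_gen i k * pair_gen j l - pair_gen j l * pair_gen i k | i j k l.
       i \<in> V \<and> j \<in> V \<and> k \<in> V \<and> l \<in> V \<and> adj i j \<and> adj k l}"

definition gh_rels :: "'v set \<Rightarrow> 'e set \<Rightarrow> ('e \<Rightarrow> 'v) \<Rightarrow> ('e \<Rightarrow> 'v) \<Rightarrow> ('e \<times> 'e) free_algebra set" where
  "gh_rels V E s r = magic_unitary_relations E pair_gen \<union>
     {endpoint_sum E s v e\<^sub>1 - endpoint_sum E s v e\<^sub>2 | v e\<^sub>1 e\<^sub>2.
       v \<in> V \<and> e\<^sub>1 \<in> E \<and> e\<^sub>2 \<in> E \<and> s e\<^sub>1 = s e\<^sub>2} \<union>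
     {endpoint_sum E r v e\<^sub>1 - endpoint_sum E r v e\<^sub>2 | v e\<^sub>1 e\<^sub>2.
       v \<in> V \<and> e\<^sub>1 \<in> E \<and> e\<^sub>2 \<in> E \<and> r e\<^sub>1 = r e\<^sub>2} \<union>
     {pair_gen e f | e f. e \<in> E \<and> f \<in> E \<and> inner_vertex E s r (s e) \<and> is_source E r (s f)} \<union>
     {pair_gen e f | e f. e \<in> E \<and> f \<in> E \<and> inner_vertex E s r (r e) \<and> is_sink E s (r f)} \<union>
     {endpoint_sum E s v e\<^sub>1 - endpoint_sum E r v e\<^sub>2 | v e\<^sub>1 e\<^sub>2.
       v \<in> V \<and> inner_vertex E s r v \<and> e\<^sub>1 \<in> E \<and> e\<^sub>2 \<in> E \<and>
       s e\<^sub>1 = r e\<^sub>2 \<and> inner_vertex E s r (s e\<^sub>1)}"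

lemma qaut_bic_eq: "qaut_bic V adj = universal_quantum_group (V \<times> V) (bic_rels V adj) V pair_gen"
  by (simp add: qaut_bic_def bic_rels_def)

lemma qaut_gh_bic_eq: "qaut_gh_bic V E s r = universal_quantum_group (E \<times> E) (gh_rels V E s r) E pair_gen"
  by (simp add: qaut_gh_bic_def gh_rels_def)

lemma pair_gen_in [simp]: "x \<in> I \<Longrightarrow> y \<in> I \<Longrightarrow> pair_gen x y \<in> carrier (free_star_algebra (I \<times> I))"
  by (simp add: pair_gen_def)

lemma subst_pair_gen [simp]: "subst \<tau> (pair_gen x y) = \<tau> (x, y)"
  by (simp add: pair_gen_def)

lemma presentation_pairsI:
  assumes "R \<subseteq> carrier (free_star_algebra (I \<times> I))" "magic_unitary_relations I pair_gen \<subseteq> R"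
  shows "presentation (I \<times> I) R"
proof (intro presentation.intro bounded_presentationI assms(1))
  fix x assume "x \<in> I \<times> I"
  then show "gen x * gen x - gen x \<in> R \<and> free_star (gen x) - gen x \<in> R"
    using magic_relations_gens[of "fst x" I "snd x" "pair_gen :: 'a \<Rightarrow> 'a \<Rightarrow> ('a \<times> 'a) free_algebra"] assms(2)
    by (auto simp: pair_gen_def)
qed

lemma presentation_bic: "presentation (V \<times> V) (bic_rels V adj)"
proof (rule presentation_pairsI)
  show "bic_rels V adj \<subseteq> carrier (free_star_algebra (V \<times> V))"
    unfolding bic_rels_def by (intro Un_least magic_unitary_relations_in intertwiner_relations_in) auto
qed (auto simp: bic_rels_def)

lemma endpoint_sum_in: "e \<in> E \<Longrightarrow> endpoint_sum E t v e \<in> carrier (free_star_algebra (E \<times> E))"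
  unfolding endpoint_sum_def by (intro free_sum) auto

lemma presentation_gh: "presentation (E \<times> E) (gh_rels V E s r)"
proof (rule presentation_pairsI)
  show "gh_rels V E s r \<subseteq> carrier (free_star_algebra (E \<times> E))"
    unfolding gh_rels_def by (intro Un_least magic_unitary_relations_in) (auto simp: endpoint_sum_in)
qed (auto simp: gh_rels_def)

lemma subst_endpoint_sum: "subst \<tau> (endpoint_sum E t v e) = esum E t (\<lambda>e f. \<tau> (e, f)) v e"
  by (simp add: endpoint_sum_def esum_def)

lemma subst_vertex_entry: "subst \<tau> (vertex_entry E s r pair_gen v w) = vertex_entry E s r (\<lambda>e f. \<tau> (e, f)) v w"
  by (simp add: vertex_entry_def esum_def)

context cstar_cong
begin

lemma eqv_minus_0: "x - y \<approx> 0 \<longleftrightarrow> x \<approx> y"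
  by (simp add: eqv_def)

lemma magic_rels_iff: "(\<forall>\<rho>\<in>magic_unitary_relations I pair_gen. subst \<tau> \<rho> \<approx> 0) \<longleftrightarrow> magic I (\<lambda>x y. \<tau> (x, y))"
proof -
  have "(\<forall>\<rho>\<in>magic_unitary_relations I pair_gen. subst \<tau> \<rho> \<approx> 0) \<longleftrightarrow>
      (\<forall>\<rho> \<in> subst \<tau> ` magic_unitary_relations I pair_gen. q \<rho> = 0)"
    by (simp add: eqv_0_iff)
  then show ?thesis unfolding image_magic_relations magic_relations by simp
qed

lemma bic_rels_iff: "(\<forall>\<rho>\<in>bic_rels V adj. subst \<tau> \<rho> \<approx> 0) \<longleftrightarrow> bichon V adj (\<lambda>v w. \<tau> (v, w))"
proof -
  have "(\<forall>\<rho>\<in>intertwiner_relations V V (adjacency adj) pair_gen pair_gen. subst \<tau> \<rho> \<approx> 0) \<longleftrightarrow>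
      (\<forall>\<rho> \<in> subst \<tau> ` intertwiner_relations V V (adjacency adj) pair_gen pair_gen. q \<rho> = 0)"
    by (simp add: eqv_0_iff)
  also have "\<dots> \<longleftrightarrow> adj_intertw V adj (\<lambda>v w. \<tau> (v, w))"
    unfolding image_intertwiner_relations intertwiner_relations by simp
  finally have i: "(\<forall>\<rho>\<in>intertwiner_relations V V (adjacency adj) pair_gen pair_gen. subst \<tau> \<rho> \<approx> 0) \<longleftrightarrow>
    adj_intertw V adj (\<lambda>v w. \<tau> (v, w))" .
  have c: "(\<forall>\<rho>\<in>{pair_gen i k * pair_gen j l - pair_gen j l * pair_gen i k | i j k l.
       i \<in> V \<and> j \<in> V \<and> k \<in> V \<and> l \<in> V \<and> adj i j \<and> adj k l}. subst \<tau> \<rho> \<approx> 0) \<longleftrightarrow>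
    (\<forall>i\<in>V. \<forall>j\<in>V. \<forall>k\<in>V. \<forall>l\<in>V. adj i j \<and> adj k l \<longrightarrow> \<tau> (i, k) * \<tau> (j, l) \<approx> \<tau> (j, l) * \<tau> (i, k))"
    by (auto simp: eqv_minus_0) (metis (no_types, lifting) eqv_minus_0 subst_mult subst_pair_gen subst_simps(4))
  show ?thesis unfolding bic_rels_def ball_Un magic_rels_iff i c bichon_def by blast
qed

lemma gh_rels_iff:
  fixes V :: "'v set" and E :: "'e set"
  shows "(\<forall>\<rho>\<in>gh_rels V E s r. subst \<tau> \<rho> \<approx> 0) \<longleftrightarrow> goswami_hossain V E s r (\<lambda>e f. \<tau> (e, f))"
proof -
  let ?w = "\<lambda>e f. \<tau> (e, f)"
  have d: "(\<forall>\<rho>\<in>{endpoint_sum E t v e\<^sub>1 - endpoint_sum E t' v e\<^sub>2 | v e\<^sub>1 e\<^sub>2. P v e\<^sub>1 e\<^sub>2}. subst \<tau> \<rho> \<approx> 0) \<longleftrightarrow>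
      (\<forall>v e\<^sub>1 e\<^sub>2. P v e\<^sub>1 e\<^sub>2 \<longrightarrow> esum E t ?w v e\<^sub>1 \<approx> esum E t' ?w v e\<^sub>2)" for t t' and P :: "'v \<Rightarrow> 'e \<Rightarrow> 'e \<Rightarrow> bool"
  proof -
    have "(\<forall>\<rho>\<in>{endpoint_sum E t v e\<^sub>1 - endpoint_sum E t' v e\<^sub>2 | v e\<^sub>1 e\<^sub>2. P v e\<^sub>1 e\<^sub>2}. subst \<tau> \<rho> \<approx> 0) \<longleftrightarrow>
      (\<forall>v e\<^sub>1 e\<^sub>2. P v e\<^sub>1 e\<^sub>2 \<longrightarrow> subst \<tau> (endpoint_sum E t v e\<^sub>1 - endpoint_sum E t' v e\<^sub>2) \<approx> 0)" by blast
    then show ?thesis by (simp add: subst_endpoint_sum eqv_minus_0)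
  qed
  have z: "(\<forall>\<rho>\<in>{pair_gen e f | e f. P e f}. subst \<tau> \<rho> \<approx> 0) \<longleftrightarrow> (\<forall>e f. P e f \<longrightarrow> ?w e f \<approx> 0)" for P
  proof -
    have "(\<forall>\<rho>\<in>{pair_gen e f | e f. P e f}. subst \<tau> \<rho> \<approx> 0) \<longleftrightarrow> (\<forall>e f. P e f \<longrightarrow> subst \<tau> (pair_gen e f) \<approx> 0)" by blast
    then show ?thesis by simp
  qed
  show ?thesis unfolding gh_rels_def ball_Un magic_rels_iff d z goswami_hossain_def by blast
qed

end

section \<open>Comparison with the quantum automorphism group of the hypergraph\<close>

context finite_hypergraph
begin

lemma sigma_rel:
  assumes "cstar_cong q" "cstar_cong.hyp_matrices q V E s r (\<lambda>v w. \<sigma> (Inl (v, w))) (\<lambda>e f. \<sigma> (Inr (e, f)))" "\<rho> \<in> R"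
  shows "cstar_cong.eqv q (subst \<sigma> \<rho>) 0"
  using cstar_cong.hyp_rels_iff[OF assms(1), of V E s r \<sigma>] assms(2,3) by blast

text \<open>The comparison when the other quantum group lives on vertices: edge generators go to
  \<open>entry\<close>, vertex generators to themselves. The vertex block is closed under the
  comultiplication, which gives the formula needed for the transport.\<close>

lemma quantum_group_eq_vertices:
  fixes R' :: "('v \<times> 'v) free_algebra set"
  defines "q' \<equiv> \<lambda>f. universal_norm (V \<times> V) R' (restrict_gens (V \<times> V) f)"
  assumes pres: "presentation (V \<times> V) R'"
    and entry_in: "\<And>e f. e \<in> E \<Longrightarrow> f \<in> E \<Longrightarrow> entry e f \<in> carrier (free_star_algebra (V \<times> V))"
    and hyp: "cstar_cong.hyp_matrices q' V E s r pair_gen entry"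
    and rel: "\<And>\<rho>. \<rho> \<in> R' \<Longrightarrow> P.cong.eqv (subst (\<lambda>(v, w). vertex_gen v w) \<rho>) 0"
    and inv: "\<And>e f. e \<in> E \<Longrightarrow> f \<in> E \<Longrightarrow> P.cong.eqv (subst (\<lambda>(v, w). vertex_gen v w) (entry e f)) (edge_gen e f)"
  shows "quantum_group_eq (qaut V E s r) (universal_quantum_group (V \<times> V) R' V pair_gen)"
proof -
  interpret Q: presentation "V \<times> V" R' by (rule pres)
  define \<sigma> where "\<sigma> = case_sum (\<lambda>(v, w). pair_gen v w) (\<lambda>(e, f). entry e f)"
  have \<sigma>: "\<sigma> (Inl (v, w)) = pair_gen v w" "\<sigma> (Inr (e, f)) = entry e f" for v w e f by (simp_all add: \<sigma>_def)
  interpret I: presentation_iso X R "V \<times> V" R' \<sigma> "\<lambda>(v, w). vertex_gen v w"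
  proof
    show "\<sigma> x \<in> carrier (free_star_algebra (V \<times> V))" if "x \<in> X" for x
      using that entry_in by (auto simp: hyp_gens_def \<sigma>)
    show "(case y of (v, w) \<Rightarrow> vertex_gen v w) \<in> carrier (free_star_algebra X)" if "y \<in> V \<times> V" for y
      using that by auto
    show "Q.cong.eqv (subst \<sigma> \<rho>) 0" if "\<rho> \<in> R" for \<rho>
      by (rule sigma_rel[OF Q.cong.cstar_cong_axioms _ that]) (use hyp in \<open>simp add: \<sigma> q'_def\<close>)
    show "P.cong.eqv (subst (\<lambda>(v, w). vertex_gen v w) (\<sigma> x)) (gen x)" if "x \<in> X" for x
    proof -
      from that consider v w where "x = Inl (v, w)" "v \<in> V" "w \<in> V" | e f where "x = Inr (e, f)" "e \<in> E" "f \<in> E"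
        by (auto simp: hyp_gens_def)
      then show ?thesis by cases (use inv in \<open>simp_all add: \<sigma> vertex_gen_def edge_gen_def\<close>)
    qed
    show "Q.cong.eqv (subst \<sigma> (case y of (v, w) \<Rightarrow> vertex_gen v w)) (gen y)" if "y \<in> V \<times> V" for y
      using that by (cases y) (simp add: vertex_gen_def \<sigma> pair_gen_def)
  qed (rule rel)
  have "Q.cong.magic V pair_gen" using hyp unfolding q'_def Q.cong.hyp_matrices_def by blast
  then have orth: "Q.cong.orthogonal_matrix V pair_gen" by (rule Q.cong.magic_orthogonal_matrix[OF fin(1)])
  show ?thesis
    unfolding qaut_eq
  proof (rule I.quantum_group_eqI[OF cmqg[unfolded qaut_eq] comultiplication[unfolded qaut_eq] fin(1) _ orth _ _ comult_vertex])
    show "vertex_gen v w \<in> carrier P.F \<and> subst \<sigma> (vertex_gen v w) = pair_gen v w" if "v \<in> V" "w \<in> V" for v w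
      using gens_in(1)[OF that] by (simp add: \<sigma> vertex_gen_def)
  qed (auto simp: pair_gen_def)
qed

text \<open>The mirror image, with the edge block kept and the vertex generators expressed by
  \<open>entry\<close>.\<close>

lemma quantum_group_eq_edges:
  fixes R' :: "('e \<times> 'e) free_algebra set"
  defines "q' \<equiv> \<lambda>f. universal_norm (E \<times> E) R' (restrict_gens (E \<times> E) f)"
  assumes pres: "presentation (E \<times> E) R'"
    and entry_in: "\<And>v w. v \<in> V \<Longrightarrow> w \<in> V \<Longrightarrow> entry v w \<in> carrier (free_star_algebra (E \<times> E))"
    and hyp: "cstar_cong.hyp_matrices q' V E s r entry pair_gen"
    and rel: "\<And>\<rho>. \<rho> \<in> R' \<Longrightarrow> P.cong.eqv (subst (\<lambda>(e, f). edge_gen e f) \<rho>) 0"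
    and inv: "\<And>v w. v \<in> V \<Longrightarrow> w \<in> V \<Longrightarrow> P.cong.eqv (subst (\<lambda>(e, f). edge_gen e f) (entry v w)) (vertex_gen v w)"
  shows "quantum_group_eq (qaut V E s r) (universal_quantum_group (E \<times> E) R' E pair_gen)"
proof -
  interpret Q: presentation "E \<times> E" R' by (rule pres)
  define \<sigma> where "\<sigma> = case_sum (\<lambda>(v, w). entry v w) (\<lambda>(e, f). pair_gen e f)"
  have \<sigma>: "\<sigma> (Inl (v, w)) = entry v w" "\<sigma> (Inr (e, f)) = pair_gen e f" for v w e f by (simp_all add: \<sigma>_def)
  interpret I: presentation_iso X R "E \<times> E" R' \<sigma> "\<lambda>(e, f). edge_gen e f"
  proof
    show "\<sigma> x \<in> carrier (free_star_algebra (E \<times> E))" if "x \<in> X" for x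
      using that entry_in by (auto simp: hyp_gens_def \<sigma>)
    show "(case y of (e, f) \<Rightarrow> edge_gen e f) \<in> carrier (free_star_algebra X)" if "y \<in> E \<times> E" for y
      using that by auto
    show "Q.cong.eqv (subst \<sigma> \<rho>) 0" if "\<rho> \<in> R" for \<rho>
      by (rule sigma_rel[OF Q.cong.cstar_cong_axioms _ that]) (use hyp in \<open>simp add: \<sigma> q'_def\<close>)
    show "P.cong.eqv (subst (\<lambda>(e, f). edge_gen e f) (\<sigma> x)) (gen x)" if "x \<in> X" for x
    proof -
      from that consider v w where "x = Inl (v, w)" "v \<in> V" "w \<in> V" | e f where "x = Inr (e, f)" "e \<in> E" "f \<in> E"
        by (auto simp: hyp_gens_def)
      then show ?thesis by cases (use inv in \<open>simp_all add: \<sigma> vertex_gen_def edge_gen_def\<close>)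
    qed
    show "Q.cong.eqv (subst \<sigma> (case y of (e, f) \<Rightarrow> edge_gen e f)) (gen y)" if "y \<in> E \<times> E" for y
      using that by (cases y) (simp add: edge_gen_def \<sigma> pair_gen_def)
  qed (rule rel)
  have "Q.cong.magic E pair_gen" using hyp unfolding q'_def Q.cong.hyp_matrices_def by blast
  then have orth: "Q.cong.orthogonal_matrix E pair_gen" by (rule Q.cong.magic_orthogonal_matrix[OF fin(2)])
  show ?thesis
    unfolding qaut_eq
  proof (rule I.quantum_group_eqI[OF cmqg[unfolded qaut_eq] comultiplication[unfolded qaut_eq] fin(2) _ orth _ _ comult_edge])
    show "edge_gen e f \<in> carrier P.F \<and> subst \<sigma> (edge_gen e f) = pair_gen e f" if "e \<in> E" "f \<in> E" for e f
      using gens_in(2)[OF that] by (simp add: \<sigma> edge_gen_def)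
  qed (auto simp: pair_gen_def)
qed

end

section \<open>The three classes of graphs\<close>

lemma digraph_case:
  assumes "directed_graph V E"
  shows "hypergraph V E (\<lambda>(v, w). {v}) (\<lambda>(v, w). {w})"
    and "quantum_group_eq (qaut V E (\<lambda>(v, w). {v}) (\<lambda>(v, w). {w})) (qaut_bic V (\<lambda>v w. (v, w) \<in> E))"
proof -
  have V: "finite V" and E: "E \<subseteq> V \<times> V" using assms by (auto simp: directed_graph_def)
  have finE: "finite E" using V E finite_subset by blast
  show "hypergraph V E (\<lambda>(v, w). {v}) (\<lambda>(v, w). {w})"
    using V E finE by (auto simp: hypergraph_def)
  have proj: "(\<lambda>(v, w). {v}) = (\<lambda>e. {fst e})" "(\<lambda>(v, w). {w}) = (\<lambda>e. {snd e})" by auto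
  have inV: "fst f \<in> V" "snd f \<in> V" if "f \<in> E" for f using E that by auto
  interpret H: finite_hypergraph V E "\<lambda>e. {fst e}" "\<lambda>e. {snd e}" by standard (use V finE in auto)
  interpret Q: presentation "V \<times> V" "bic_rels V (\<lambda>v w. (v, w) \<in> E)" by (rule presentation_bic)
  have vg: "(\<lambda>(v, w). vertex_gen v w) = (\<lambda>x. vertex_gen (fst x) (snd x))" by auto
  have Hg: "H.P.cong.magic V vertex_gen" "H.P.cong.magic E edge_gen"
    "H.P.cong.endpoint V E fst vertex_gen edge_gen" "H.P.cong.endpoint V E snd vertex_gen edge_gen"
    using H.generators unfolding H.P.cong.hyp_matrices_def
    by (auto simp: H.P.cong.intertw_endpoint[OF V finE] inV)
  have "Q.cong.bichon V (\<lambda>v w. (v, w) \<in> E) pair_gen"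
    using Q.cong.bic_rels_iff[of V "\<lambda>v w. (v, w) \<in> E" gen] Q.relation_null
    by (simp add: Q.cong.eqv_0_iff pair_gen_def[abs_def])
  note Qg = Q.cong.bichon_digraph[OF V E this] this
  show "quantum_group_eq (qaut V E (\<lambda>(v, w). {v}) (\<lambda>(v, w). {w})) (qaut_bic V (\<lambda>v w. (v, w) \<in> E))"
    unfolding proj qaut_bic_eq
  proof (rule H.quantum_group_eq_vertices[where entry="\<lambda>e f. pair_gen (fst e) (fst f) * pair_gen (snd e) (snd f)", OF presentation_bic])
    show "pair_gen (fst e) (fst f) * pair_gen (snd e) (snd f) \<in> carrier (free_star_algebra (V \<times> V))"
      if "e \<in> E" "f \<in> E" for e f using that inV by simp
    show "Q.cong.hyp_matrices V E (\<lambda>e. {fst e}) (\<lambda>e. {snd e}) pair_gen (\<lambda>e f. pair_gen (fst e) (fst f) * pair_gen (snd e) (snd f))"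
      unfolding Q.cong.hyp_matrices_def using Qg by (auto simp: Q.cong.intertw_endpoint[OF V finE] inV Q.cong.bichon_def)
    show "H.P.cong.eqv (subst (\<lambda>(v, w). vertex_gen v w) \<rho>) 0" if "\<rho> \<in> bic_rels V (\<lambda>v w. (v, w) \<in> E)" for \<rho>
      using H.P.cong.bic_rels_iff[of V "\<lambda>v w. (v, w) \<in> E" "\<lambda>(v, w). vertex_gen v w"]
        H.P.cong.digraph_bichon[OF V E Hg] that by simp
    show "H.P.cong.eqv (subst (\<lambda>(v, w). vertex_gen v w) (pair_gen (fst e) (fst f) * pair_gen (snd e) (snd f))) (edge_gen e f)"
      if "e \<in> E" "f \<in> E" for e f
      using H.P.cong.digraph_edge_product(1)[OF V E Hg(2-4) inV(1)[OF that(1)] inV(2)[OF that(1)] that(2)] that by simp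
  qed
qed

lemma simple_graph_case:
  assumes "simple_graph V E"
  shows "hypergraph V E (\<lambda>e. e) (\<lambda>e. e)"
    and "quantum_group_eq (qaut V E (\<lambda>e. e) (\<lambda>e. e)) (qaut_bic V (\<lambda>v w. {v, w} \<in> E))"
proof -
  have V: "finite V" and E: "E \<subseteq> Pow V" and card: "\<And>e. e \<in> E \<Longrightarrow> card e = 2" using assms by (auto simp: simple_graph_def)
  have finE: "finite E" using V E by (meson finite_Pow_iff finite_subset)
  show "hypergraph V E (\<lambda>e. e) (\<lambda>e. e)"
    using V E finE by (auto simp: hypergraph_def)
  have "\<forall>e\<in>E. \<exists>x y. e = {x, y} \<and> x \<noteq> y" using card by (simp add: card_2_iff)
  then obtain a b where ab: "\<And>e. e \<in> E \<Longrightarrow> e = {a e, b e} \<and> a e \<noteq> b e" by metis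
  let ?adj = "\<lambda>v w. {v, w} \<in> E"
  interpret H: finite_hypergraph V E "\<lambda>e. e" "\<lambda>e. e" by standard (use V finE in auto)
  interpret Q: presentation "V \<times> V" "bic_rels V ?adj" by (rule presentation_bic)
  interpret Gr: simple_graph_edges V E a b by standard (use V E ab in auto)
  \<comment> \<open>The same graph is studied modulo two seminorms: \<open>HG\<close> for the
    hypergraph relations, where Bichon's relations are derived, and \<open>QG\<close> for Bichon's
    relations, where the edge matrix is constructed.\<close>
  interpret HG: simple_graph_cong V E a b "\<lambda>f. universal_norm H.X H.R (restrict_gens H.X f)" ..
  interpret QG: simple_graph_cong V E a b "\<lambda>f. universal_norm (V \<times> V) (bic_rels V ?adj) (restrict_gens (V \<times> V) f)" ..
  have Hg: "H.P.cong.magic V vertex_gen" "H.P.cong.magic E edge_gen"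
    "H.P.cong.intertw V E (incidence (\<lambda>e. e)) vertex_gen edge_gen"
    using H.generators unfolding H.P.cong.hyp_matrices_def by auto
  have Qb: "Q.cong.bichon V ?adj pair_gen"
    using Q.cong.bic_rels_iff[of V ?adj gen] Q.relation_null
    by (simp add: Q.cong.eqv_0_iff pair_gen_def[abs_def])
  show "quantum_group_eq (qaut V E (\<lambda>e. e) (\<lambda>e. e)) (qaut_bic V ?adj)"
    unfolding qaut_bic_eq
  proof (rule H.quantum_group_eq_vertices[where entry="QG.edge_entry pair_gen", OF presentation_bic])
    show "QG.edge_entry pair_gen e f \<in> carrier (free_star_algebra (V \<times> V))" if "e \<in> E" "f \<in> E" for e f
      using that Gr.ab_in by (simp add: QG.edge_entry_def)
    show "Q.cong.hyp_matrices V E (\<lambda>e. e) (\<lambda>e. e) pair_gen (QG.edge_entry pair_gen)"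
      unfolding Q.cong.hyp_matrices_def using QG.bichon_graph[OF Qb] Qb by (auto simp: Q.cong.bichon_def)
    show "H.P.cong.eqv (subst (\<lambda>(v, w). vertex_gen v w) \<rho>) 0" if "\<rho> \<in> bic_rels V ?adj" for \<rho>
      using H.P.cong.bic_rels_iff[of V ?adj "\<lambda>(v, w). vertex_gen v w"]
        HG.graph_bichon(1)[OF Hg] that by simp
    show "H.P.cong.eqv (subst (\<lambda>(v, w). vertex_gen v w) (QG.edge_entry pair_gen e f)) (edge_gen e f)"
      if "e \<in> E" "f \<in> E" for e f
      using H.P.cong.eqv_sym[OF HG.graph_bichon(2)[OF Hg that]] by (simp add: HG.edge_entry_def QG.edge_entry_def)
  qed
qed

lemma multigraph_case:
  assumes "multigraph V E s r" and noniso: "\<And>v. v \<in> V \<Longrightarrow> \<not> isolated E s r v"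
  shows "hypergraph V E (\<lambda>e. {s e}) (\<lambda>e. {r e})"
    and "quantum_group_eq (qaut V E (\<lambda>e. {s e}) (\<lambda>e. {r e})) (qaut_gh_bic V E s r)"
proof -
  have fin: "finite V" "finite E" and inV: "\<And>e. e \<in> E \<Longrightarrow> s e \<in> V" "\<And>e. e \<in> E \<Longrightarrow> r e \<in> V"
    using assms(1) by (auto simp: multigraph_def)
  show "hypergraph V E (\<lambda>e. {s e}) (\<lambda>e. {r e})"
    using fin inV by (auto simp: hypergraph_def)
  have ni: "v \<in> s ` E \<or> v \<in> r ` E" if "v \<in> V" for v
    using noniso[OF that] by (auto simp: isolated_def is_source_iff is_sink_iff)
  interpret H: finite_hypergraph V E "\<lambda>e. {s e}" "\<lambda>e. {r e}" by standard (use fin in auto)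
  interpret Q: presentation "E \<times> E" "gh_rels V E s r" by (rule presentation_gh)
  interpret HM: multigraph_cong "\<lambda>f. universal_norm H.X H.R (restrict_gens H.X f)" V E s r
    by (intro multigraph_cong.intro H.P.cong.cstar_cong_axioms multigraph_cong_axioms.intro fin inV ni)
  interpret QM: multigraph_cong "\<lambda>f. universal_norm (E \<times> E) (gh_rels V E s r) (restrict_gens (E \<times> E) f)" V E s r
    by (intro multigraph_cong.intro Q.cong.cstar_cong_axioms multigraph_cong_axioms.intro fin inV ni)
  have Hg: "H.P.cong.magic V vertex_gen" "H.P.cong.magic E edge_gen"
    "H.P.cong.endpoint V E s vertex_gen edge_gen" "H.P.cong.endpoint V E r vertex_gen edge_gen"
    using H.generators unfolding H.P.cong.hyp_matrices_def
    by (auto simp: H.P.cong.intertw_endpoint[OF fin] inV)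
  have Qg: "Q.cong.goswami_hossain V E s r pair_gen"
    using Q.cong.gh_rels_iff[of V E s r gen] Q.relation_null
    by (simp add: Q.cong.eqv_0_iff pair_gen_def[abs_def])
  show "quantum_group_eq (qaut V E (\<lambda>e. {s e}) (\<lambda>e. {r e})) (qaut_gh_bic V E s r)"
    unfolding qaut_gh_bic_eq
  proof (rule H.quantum_group_eq_edges[where entry="vertex_entry E s r pair_gen", OF presentation_gh])
    show "vertex_entry E s r pair_gen v w \<in> carrier (free_star_algebra (E \<times> E))" if "v \<in> V" "w \<in> V" for v w
      unfolding vertex_entry_def esum_def
      using ni[OF that(1)] QM.pick(1)[of v s] QM.pick(1)[of v r] by (auto intro!: free_sum pair_gen_in)
    show "Q.cong.hyp_matrices V E (\<lambda>e. {s e}) (\<lambda>e. {r e}) (vertex_entry E s r pair_gen) pair_gen"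
      unfolding Q.cong.hyp_matrices_def using QM.goswami_hossain_endpoint[OF Qg] Qg
      by (auto simp: Q.cong.intertw_endpoint[OF fin] inV Q.cong.goswami_hossain_def)
    show "H.P.cong.eqv (subst (\<lambda>(e, f). edge_gen e f) \<rho>) 0" if "\<rho> \<in> gh_rels V E s r" for \<rho>
      using H.P.cong.gh_rels_iff[of V E s r "\<lambda>(e, f). edge_gen e f"]
        HM.endpoint_goswami_hossain(1)[OF Hg] that by simp
    show "H.P.cong.eqv (subst (\<lambda>(e, f). edge_gen e f) (vertex_entry E s r pair_gen v w)) (vertex_gen v w)"
      if "v \<in> V" "w \<in> V" for v w
      using HM.endpoint_goswami_hossain(2)[OF Hg that]
      by (simp add: subst_vertex_entry)
  qed
qed

theorem theorem2:
  shows "(\<forall>(V :: 'a set) E. directed_graph V E \<longrightarrow>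
            hypergraph V E (\<lambda>(v, w). {v}) (\<lambda>(v, w). {w}) \<and>
            quantum_group_eq (qaut V E (\<lambda>(v, w). {v}) (\<lambda>(v, w). {w}))
              (qaut_bic V (\<lambda>v w. (v, w) \<in> E)))
       \<and> (\<forall>(V :: 'b set) E. simple_graph V E \<longrightarrow>
            hypergraph V E (\<lambda>e. e) (\<lambda>e. e) \<and>
            quantum_group_eq (qaut V E (\<lambda>e. e) (\<lambda>e. e))
              (qaut_bic V (\<lambda>v w. {v, w} \<in> E)))
       \<and> (\<forall>(V :: 'c set) (E :: 'd set) s' r'.
            multigraph V E s' r' \<and> (\<forall>v \<in> V. \<not> isolated E s' r' v) \<longrightarrow>
            hypergraph V E (\<lambda>e. {s' e}) (\<lambda>e. {r' e}) \<and>
            quantum_group_eq (qaut V E (\<lambda>e. {s' e}) (\<lambda>e. {r' e}))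
              (qaut_gh_bic V E s' r'))"
  using digraph_case simple_graph_case multigraph_case by blast

end
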